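(* Let $K_0(\mathbf W^\infty)'$ be the subalgebra of $K_0(\mathbf W^\infty)$ (scalars extended to $\mathbb C(q)$) generated by the classes $[Q_+]$, $[Q_-]$ and $[C_k]$ for $k\ge0$. Then the algebra homomorphism $\mathcal K\to K_0(\mathbf W^\infty)'$ determined by $$x\mapsto[Q_+],\qquad y\mapsto[Q_-],\qquad c_k\mapsto[C_k]\quad(k\ge0)$$ is well-defined. Here $\mathcal K$ is the algebra given by generators and relations, and $\mathbf W^\infty$ the asymptotic Weyl category, both defined in the context.
   Context: **The algebra $\mathcal K$.** The unital associative $\mathbb C(q)$-algebra with generators $x,y$ and $c_k$ ($k\ge0$; $c_{j}:=0$ for $j<0$) and relations, for all $k,\ell\ge0$: - $yx=xy+c_0$; $c_kc_\ell=\delta_{k\ell}c_k$; - $c_kx=c_kx(c_k+c_{k-1})$; $xc_k=(c_k+c_{k+1})xc_k$; $c_ky=c_ky(c_k+c_{k+1})$; $yc_k=(c_k+c_{k-1})yc_k$; - $c_{k+1}xc_kxc_k=c_{k+1}xc_{k+1}xc_k$; $c_kyc_{k+1}yc_{k+1}=c_kyc_kyc_{k+1}$; - $c_kyc_kxc_k=c_k$; $c_{k-1}yc_kxc_{k-1}=c_{k-1}$; $c_kxc_kyc_k=c_k$; $c_kxc_{k-1}yc_k=c_k$ for $k\ge1$; - $yc_kx=c_k+c_{k-1}+c_kxyc_{k-1}+c_{k-1}xyc_k$; $xc_ky=c_k+c_{k+1}+c_kxyc_{k+1}+c_{k+1}xyc_k$; $yc_0x=c_0$. **The category $\mathbf W'$.**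 Ground field $\mathbb C(q)$; $[n]=\frac{q^n-q^{-n}}{q-q^{-1}}$. $\mathbf W'$ is the additive $\mathbb C(q)$-linear strict monoidal category, with unit object $\mathbb 1$, whose objects are finite direct sums of tensor words in two objects $Q_+,Q_-$. Write $1_\pm$ for the identity of $Q_\pm$. Morphisms are generated, under composition, tensor product and linear combination, by - $\eta:\mathbb 1\to Q_-\otimes Q_+$, $\varepsilon: Q_-\otimes Q_+\to\mathbb 1$, $\eta':\mathbb 1\to Q_+\otimes Q_-$, $\varepsilon':Q_+\otimes Q_-\to\mathbb 1$; - $E:Q_+\otimes Q_+\to Q_+\otimes Q_+$; - $b_k\in\mathrm{End}(\mathbb 1)$ for $k\in\mathbb Z$. An element $z\in\mathrm{End}(\mathbb 1)$ may be tensored on the left or on the right of, or inserted between, other morphisms. Planar isotopy relations: $(\varepsilon'\otimes 1_+)(1_+\otimes\eta)=1_+=(1_+\otimes\varepsilon)(\eta'\otimes1_+)$, $(1_-\otimes\varepsilon')(\eta\otimes1_-)=1_-=(\varepsilon\otimes1_-)(1_-\otimes\eta')$, and the left and right mates of $E$ (its rotations by $\pm180^\circ$ using the cups and caps) coincide; call the common mate $E^*:Q_-\otimes Q_-\to Q_-\otimes Q_-$. Notation (here $c_k$ denotes an endomorphism of $\mathbb 1$, not the generator of $\mathcal K$). - $b_k^\dagger:=\varepsilon\eta-b_{k-1}$ for $k\in\mathbb Z$. - $P:=1_+-[2]\,(1_+\otimes\varepsilon')(E\otimes1_-)(1_+\otimes\eta')$. - $c_0:=\varepsilon\circ\big(1_-\otimes[\varepsilon'(P\otimes1_-)\eta']\otimes1_+\big)\circ\eta$;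 $c_{k+1}:=\varepsilon'(1_+\otimes\varepsilon'\otimes1_-)(E\otimes c_k\otimes1_-\otimes1_-)(1_+\otimes\eta'\otimes1_-)\eta'$ for $k\ge0$; $c_k:=0$ for $k<0$. Relations (for all integers $k,j\ge0$ unless said otherwise): 1. $[2]^3(E\otimes1_+)(1_+\otimes E)(E\otimes1_+)=[2]\,E\otimes1_+$ and $[2]^3(1_+\otimes E)(E\otimes1_+)(1_+\otimes E)=[2]\,1_+\otimes E$. 2. $[2]^2(E\otimes1_-)(1_+\otimes\eta'\varepsilon')(E\otimes1_-)=[2]\,E\otimes1_-$ and $[2]^2(1_-\otimes E)(\eta\varepsilon\otimes1_+)(1_-\otimes E)=[2]\,1_-\otimes E$. 3. $[2](\varepsilon\otimes1_+)(1_-\otimes E)(\eta\otimes1_+)=1_+$ and $[2](1_+\otimes\varepsilon')(E\otimes1_-)(1_+\otimes\eta')=(1-c_0)\otimes1_+$. 4. $\varepsilon\eta=[2]$; $\ \varepsilon(1_-\otimes c_k\otimes1_+)\eta=b_{-2k+1}c_{k-1}+b_{-2k}^\dagger c_k$. 5. $\varepsilon'\eta'=[2]-c_0b_0^\dagger$; $\ \varepsilon'(1_+\otimes c_k\otimes1_-)\eta'=b_{-2k-1}c_k+b_{-2k-2}^\dagger c_{k+1}$. 6. $c_k\otimes1_+=c_k\otimes1_+\otimes(c_k+c_{k-1})$; $\ 1_+\otimes c_k=(c_k+c_{k+1})\otimes1_+\otimes c_k$. 7. $\big[(1_-\otimes1_-\otimes E)(1_-\otimes\eta\otimes1_+)\eta\big]\circ\big[\varepsilon(1_-\otimes\varepsilon\otimes1_+)(1_-\otimes1_-\otimes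 E)\big]=E^*\otimes E$; $\ c_0\otimes E=0$. 8. $c_kc_j=\delta_{kj}c_k$; $\ b_k\otimes1_+=1_+\otimes b_{k+1}$ for all $k\in\mathbb Z$. 9. $b_k^\dagger b_k=1$ for $k\ge0$. 10. $c_k\otimes1_-\otimes c_k\otimes1_+\otimes c_k=(1_-\otimes c_k\otimes1_+)\,\eta\,(c_kb_{-2k})\,\varepsilon\,(1_-\otimes c_k\otimes1_+)$; $c_{k-1}\otimes1_-\otimes c_k\otimes1_+\otimes c_{k-1}=(1_-\otimes c_k\otimes1_+)\,\eta\,(c_{k-1}b_{-2k+1}^\dagger)\,\varepsilon\,(1_-\otimes c_k\otimes1_+)$. 11. Writing juxtaposition for $\otimes$ and $1$ for $1_+$: $[2]\,E\circ(1\,c_k\,1)=[2]\,\big((1\,c_{k+1}\,1)\circ E\big)\,c_k+[2]\,c_k\,\big((1\,c_{k-1}\,1)\circ E\big)+c_{k+1}1c_k1c_k\,b_{-2k}^\dagger+c_k1c_k1c_{k-1}\,b_{-2k+1}-c_{k+1}1c_{k+1}1c_k\,b_{-2k-1}-c_k1c_{k-1}1c_{k-1}\,b_{-2k+2}^\dagger$. **The asymptotic Weyl category $\mathbf W^\infty$.** Let $\mathbf W$ be the Karoubi envelope of $\mathbf W'$, and $C_k$ the image of the idempotent $c_k\in\mathrm{End}(\mathbb 1)$. $\mathbf W^\infty$ is the quotient of $\mathbf W$ by the additional relations $b_k^\dagger b_k=1$ for all $k\in\mathbb Z$. **Grothendieck ring.** $K_0$ of an additive monoidal category is the abelian group generated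 by classes $[X]$ of objects with $[Z]=[X]+[Y]$ whenever $Z\cong X\oplus Y$, with product $[X][Y]=[X\otimes Y]$. *)

theory Defs
  imports
    "HOL-Computational_Algebra.Computational_Algebra"
    "HOL-Library.FuncSet"
    "HOL-Library.Poly_Mapping"
    "HOL-Algebra.QuotRing"
    "HOL-Algebra.Module"
    "HOL-Algebra.Generated_Groups"
    "Jordan_Normal_Form.Matrix"
begin

section \<open>The ground field\<close>

type_synonym cq = "complex poly fract"

definition qq :: cq where
  "qq = Fract (monom 1 1) 1"

definition qint :: "int \<Rightarrow> cq" where
  "qint n = (qq powi n - qq powi (- n)) / (qq - inverse qq)"


section \<open>Associative algebras\<close>

text \<open>
  Associative algebras are records of type \<^typ>\<open>('r, 'a) module\<close>, which extend rings by a scalar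
  multiplication.  The monoid algebra of \<open>M\<close>: finitely supported functions on the carrier of \<open>M\<close>
  with convolution; \<open>single m 1\<close> is the basis vector of \<open>m\<close>.
\<close>

definition monoid_algebra ::
  "('a, 'b) monoid_scheme \<Rightarrow> ('r::comm_ring_1, 'a \<Rightarrow>\<^sub>0 'r) module" where
  "monoid_algebra M =
     \<lparr>carrier = {p. Poly_Mapping.keys p \<subseteq> carrier M},
      mult = (\<lambda>p p'. \<Sum>a\<in>Poly_Mapping.keys p. \<Sum>b\<in>Poly_Mapping.keys p'.
        Poly_Mapping.single (a \<otimes>\<^bsub>M\<^esub> b) (Poly_Mapping.lookup p a * Poly_Mapping.lookup p' b)),
      one = Poly_Mapping.single \<one>\<^bsub>M\<^esub> 1,
      zero = 0,
      add = (+),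
      smult = (\<lambda>r. Poly_Mapping.map ((*) r))\<rparr>"

text \<open>The quotient of an algebra by a two-sided ideal that is closed under scalars.\<close>

definition alg_quot :: "('r, 'a) module \<Rightarrow> 'a set \<Rightarrow> ('r, 'a set) module" where
  "alg_quot A I =
     \<lparr>carrier = carrier (A Quot I),
      mult = mult (A Quot I),
      one = one (A Quot I),
      zero = zero (A Quot I),
      add = add (A Quot I),
      smult = (\<lambda>r X. \<Union>x\<in>X. I +>\<^bsub>A\<^esub> (r \<odot>\<^bsub>A\<^esub> x))\<rparr>"

definition alg_hom :: "('r, 'a) module \<Rightarrow> ('r, 'b) module \<Rightarrow> ('a \<Rightarrow> 'b) set" where
  "alg_hom A B =
     {\<phi> \<in> Ring.ring_hom A B. \<forall>r. \<forall>a\<in>carrier A. \<phi> (r \<odot>\<^bsub>A\<^esub> a) = r \<odot>\<^bsub>B\<^esub> \<phi> a}"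

inductive_set alg_span :: "('r, 'a) module \<Rightarrow> 'a set \<Rightarrow> 'a set" for A S where
  incl: "a \<in> S \<Longrightarrow> a \<in> alg_span A S"
| zero: "\<zero>\<^bsub>A\<^esub> \<in> alg_span A S"
| one: "\<one>\<^bsub>A\<^esub> \<in> alg_span A S"
| add: "a \<in> alg_span A S \<Longrightarrow> b \<in> alg_span A S \<Longrightarrow> a \<oplus>\<^bsub>A\<^esub> b \<in> alg_span A S"
| mult: "a \<in> alg_span A S \<Longrightarrow> b \<in> alg_span A S \<Longrightarrow> a \<otimes>\<^bsub>A\<^esub> b \<in> alg_span A S"
| smult: "a \<in> alg_span A S \<Longrightarrow> r \<odot>\<^bsub>A\<^esub> a \<in> alg_span A S"

definition subalg_generated :: "('r, 'a) module \<Rightarrow> 'a set \<Rightarrow> ('r, 'a) module" where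
  "subalg_generated A S = A\<lparr>carrier := alg_span A S\<rparr>"

text \<open>
  Extension of scalars \<open>\<complex>(q) \<otimes>\<^sub>\<int> A\<close> of a ring \<open>A\<close>: the free \<open>\<complex>(q)\<close>-module on the symbols
  \<open>r \<otimes> a\<close> (linear in \<open>r\<close>), modulo additivity in \<open>a\<close>, with
  \<open>(r \<otimes> a) (s \<otimes> b) = r s \<otimes> a b\<close>.
\<close>

definition ext_relations :: "'a ring \<Rightarrow> ('a \<Rightarrow>\<^sub>0 cq) set" where
  "ext_relations A = generate (add_monoid (monoid_algebra A :: (cq, 'a \<Rightarrow>\<^sub>0 cq) module))
     {Poly_Mapping.single (a \<oplus>\<^bsub>A\<^esub> b) r - Poly_Mapping.single a r - Poly_Mapping.single b r
      | a b r. a \<in> carrier A \<and> b \<in> carrier A}"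

definition ext_scalars :: "'a ring \<Rightarrow> (cq, ('a \<Rightarrow>\<^sub>0 cq) set) module" where
  "ext_scalars A = alg_quot (monoid_algebra A) (ext_relations A)"

definition ext_incl :: "'a ring \<Rightarrow> 'a \<Rightarrow> ('a \<Rightarrow>\<^sub>0 cq) set" where
  "ext_incl A a =
     ext_relations A +>\<^bsub>(monoid_algebra A :: (cq, 'a \<Rightarrow>\<^sub>0 cq) module)\<^esub> Poly_Mapping.single a 1"


section \<open>The algebra \<open>\<K>\<close>\<close>

datatype kgen = GX | GY | GC nat

definition free_alg :: "(cq, 'g list \<Rightarrow>\<^sub>0 cq) module" where
  "free_alg = monoid_algebra \<lparr>carrier = UNIV, mult = (@), one = []\<rparr>"

abbreviation kmul ::
  "(kgen list \<Rightarrow>\<^sub>0 cq) \<Rightarrow> (kgen list \<Rightarrow>\<^sub>0 cq) \<Rightarrow> (kgen list \<Rightarrow>\<^sub>0 cq)"  (infixl \<open>\<cdot>\<close> 70) where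
  "a \<cdot> b \<equiv> mult free_alg a b"

definition fx :: "kgen list \<Rightarrow>\<^sub>0 cq" where "fx = Poly_Mapping.single [GX] 1"
definition fy :: "kgen list \<Rightarrow>\<^sub>0 cq" where "fy = Poly_Mapping.single [GY] 1"
definition fc :: "int \<Rightarrow> kgen list \<Rightarrow>\<^sub>0 cq" where
  "fc k = (if k < 0 then 0 else Poly_Mapping.single [GC (nat k)] 1)"

inductive k_rel :: "(kgen list \<Rightarrow>\<^sub>0 cq) \<Rightarrow> (kgen list \<Rightarrow>\<^sub>0 cq) \<Rightarrow> bool" where
  "k_rel (fy \<cdot> fx) (fx \<cdot> fy + fc 0)"
| "0 \<le> k \<Longrightarrow> 0 \<le> l \<Longrightarrow> k_rel (fc k \<cdot> fc l) (if k = l then fc k else 0)"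
| "0 \<le> k \<Longrightarrow> k_rel (fc k \<cdot> fx) (fc k \<cdot> fx \<cdot> (fc k + fc (k - 1)))"
| "0 \<le> k \<Longrightarrow> k_rel (fx \<cdot> fc k) ((fc k + fc (k + 1)) \<cdot> fx \<cdot> fc k)"
| "0 \<le> k \<Longrightarrow> k_rel (fc k \<cdot> fy) (fc k \<cdot> fy \<cdot> (fc k + fc (k + 1)))"
| "0 \<le> k \<Longrightarrow> k_rel (fy \<cdot> fc k) ((fc k + fc (k - 1)) \<cdot> fy \<cdot> fc k)"
| "0 \<le> k \<Longrightarrow> k_rel (fc (k + 1) \<cdot> fx \<cdot> fc k \<cdot> fx \<cdot> fc k) (fc (k + 1) \<cdot> fx \<cdot> fc (k + 1) \<cdot> fx \<cdot> fc k)"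
| "0 \<le> k \<Longrightarrow> k_rel (fc k \<cdot> fy \<cdot> fc (k + 1) \<cdot> fy \<cdot> fc (k + 1)) (fc k \<cdot> fy \<cdot> fc k \<cdot> fy \<cdot> fc (k + 1))"
| "0 \<le> k \<Longrightarrow> k_rel (fc k \<cdot> fy \<cdot> fc k \<cdot> fx \<cdot> fc k) (fc k)"
| "0 \<le> k \<Longrightarrow> k_rel (fc (k - 1) \<cdot> fy \<cdot> fc k \<cdot> fx \<cdot> fc (k - 1)) (fc (k - 1))"
| "0 \<le> k \<Longrightarrow> k_rel (fc k \<cdot> fx \<cdot> fc k \<cdot> fy \<cdot> fc k) (fc k)"
| "1 \<le> k \<Longrightarrow> k_rel (fc k \<cdot> fx \<cdot> fc (k - 1) \<cdot> fy \<cdot> fc k) (fc k)"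
| "0 \<le> k \<Longrightarrow> k_rel (fy \<cdot> fc k \<cdot> fx)
     (fc k + fc (k - 1) + fc k \<cdot> fx \<cdot> fy \<cdot> fc (k - 1) + fc (k - 1) \<cdot> fx \<cdot> fy \<cdot> fc k)"
| "0 \<le> k \<Longrightarrow> k_rel (fx \<cdot> fc k \<cdot> fy)
     (fc k + fc (k + 1) + fc k \<cdot> fx \<cdot> fy \<cdot> fc (k + 1) + fc (k + 1) \<cdot> fx \<cdot> fy \<cdot> fc k)"
| "k_rel (fy \<cdot> fc 0 \<cdot> fx) (fc 0)"

definition k_ideal :: "(kgen list \<Rightarrow>\<^sub>0 cq) set" where
  "k_ideal = Idl\<^bsub>free_alg\<^esub> {a - b | a b. k_rel a b}"

definition K_alg :: "(cq, (kgen list \<Rightarrow>\<^sub>0 cq) set) module" where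
  "K_alg = alg_quot free_alg k_ideal"

definition K_x :: "(kgen list \<Rightarrow>\<^sub>0 cq) set" where "K_x = k_ideal +>\<^bsub>free_alg\<^esub> fx"
definition K_y :: "(kgen list \<Rightarrow>\<^sub>0 cq) set" where "K_y = k_ideal +>\<^bsub>free_alg\<^esub> fy"
definition K_c :: "nat \<Rightarrow> (kgen list \<Rightarrow>\<^sub>0 cq) set" where
  "K_c k = k_ideal +>\<^bsub>free_alg\<^esub> fc (int k)"


section \<open>Linear strict monoidal categories\<close>

text \<open>
  \<open>cmp C g f\<close> is \<open>g \<circ> f\<close>, \<open>nul C X Y\<close> the zero morphism \<open>X \<rightarrow> Y\<close>.  The operations are only
  meaningful on the arrows, composition and sums only for matching sources and targets.
\<close>

record ('o, 'm) lmcat =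
  objs :: "'o set"
  arrs :: "'m set"
  src :: "'m \<Rightarrow> 'o"
  tgt :: "'m \<Rightarrow> 'o"
  idn :: "'o \<Rightarrow> 'm"
  cmp :: "'m \<Rightarrow> 'm \<Rightarrow> 'm"
  nul :: "'o \<Rightarrow> 'o \<Rightarrow> 'm"
  padd :: "'m \<Rightarrow> 'm \<Rightarrow> 'm"
  scal :: "cq \<Rightarrow> 'm \<Rightarrow> 'm"
  unit_ob :: 'o
  tens_ob :: "'o \<Rightarrow> 'o \<Rightarrow> 'o"
  tens :: "'m \<Rightarrow> 'm \<Rightarrow> 'm"

definition Hom :: "('o, 'm) lmcat \<Rightarrow> 'o \<Rightarrow> 'o \<Rightarrow> 'm set" where
  "Hom C X Y = {f \<in> arrs C. src C f = X \<and> tgt C f = Y}"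

subsection \<open>Additive closure\<close>

text \<open>
  A list of objects is their formal direct sum.  A morphism \<open>Xs \<rightarrow> Ys\<close> is a matrix whose entry in
  row \<open>i\<close> and column \<open>j\<close> is a morphism \<open>Xs ! j \<rightarrow> Ys ! i\<close>.  The tensor product is ordered
  lexicographically, so that it is strictly associative and given on morphisms by the
  Kronecker product.
\<close>

definition lin_sum :: "('o, 'm) lmcat \<Rightarrow> 'o \<Rightarrow> 'o \<Rightarrow> (nat \<Rightarrow> 'm) \<Rightarrow> nat \<Rightarrow> 'm" where
  "lin_sum C X Y f n = foldr (\<lambda>j. padd C (f j)) [0..<n] (nul C X Y)"

type_synonym ('o, 'm) add_arr = "'o list \<times> 'o list \<times> 'm mat"

definition additive_closure ::
  "('o, 'm) lmcat \<Rightarrow> ('o list, ('o, 'm) add_arr) lmcat" where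
  "additive_closure C =
    (let tob = (\<lambda>Xs Ys. concat (map (\<lambda>X. map (tens_ob C X) Ys) Xs)) in
     \<lparr>objs = {Xs. set Xs \<subseteq> objs C},
      arrs = {(Xs, Ys, M). set Xs \<subseteq> objs C \<and> set Ys \<subseteq> objs C \<and>
        M \<in> carrier_mat (length Ys) (length Xs) \<and>
        (\<forall>i<length Ys. \<forall>j<length Xs. M $$ (i, j) \<in> Hom C (Xs ! j) (Ys ! i))},
      src = (\<lambda>(Xs, Ys, M). Xs),
      tgt = (\<lambda>(Xs, Ys, M). Ys),
      idn = (\<lambda>Xs. (Xs, Xs, mat (length Xs) (length Xs)
        (\<lambda>(i, j). if i = j then idn C (Xs ! i) else nul C (Xs ! j) (Xs ! i)))),
      cmp = (\<lambda>(Ys', Zs, N) (Xs, Ys, M). (Xs, Zs, mat (length Zs) (length Xs)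
        (\<lambda>(i, k). lin_sum C (Xs ! k) (Zs ! i) (\<lambda>j. cmp C (N $$ (i, j)) (M $$ (j, k)))
          (length Ys)))),
      nul = (\<lambda>Xs Ys. (Xs, Ys, mat (length Ys) (length Xs) (\<lambda>(i, j). nul C (Xs ! j) (Ys ! i)))),
      padd = (\<lambda>(Xs, Ys, M) (Xs', Ys', M'). (Xs, Ys, mat (length Ys) (length Xs)
        (\<lambda>(i, j). padd C (M $$ (i, j)) (M' $$ (i, j))))),
      scal = (\<lambda>r (Xs, Ys, M). (Xs, Ys, mat (length Ys) (length Xs)
        (\<lambda>(i, j). scal C r (M $$ (i, j))))),
      unit_ob = [unit_ob C],
      tens_ob = tob,
      tens = (\<lambda>(Xs, Ys, M) (Xs', Ys', M'). (tob Xs Xs', tob Ys Ys',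
        mat (length Ys * length Ys') (length Xs * length Xs')
          (\<lambda>(i, j). tens C (M $$ (i div length Ys', j div length Xs'))
                           (M' $$ (i mod length Ys', j mod length Xs')))))\<rparr>)"

definition add_incl :: "('o, 'm) lmcat \<Rightarrow> 'm \<Rightarrow> ('o, 'm) add_arr" where
  "add_incl C f = ([src C f], [tgt C f], mat 1 1 (\<lambda>_. f))"

subsection \<open>Karoubi envelope\<close>

text \<open>Objects are pairs \<open>(X, e)\<close> with \<open>e\<close> an idempotent of \<open>X\<close>: the image of \<open>e\<close>.\<close>

type_synonym ('o, 'm) kar_arr = "('o \<times> 'm) \<times> ('o \<times> 'm) \<times> 'm"

definition karoubi :: "('o, 'm) lmcat \<Rightarrow> ('o \<times> 'm, ('o, 'm) kar_arr) lmcat" where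
  "karoubi C =
    (let obs = {(X, e). X \<in> objs C \<and> e \<in> Hom C X X \<and> cmp C e e = e};
         tob = (\<lambda>(X, e) (Y, f). (tens_ob C X Y, tens C e f)) in
     \<lparr>objs = obs,
      arrs = {((X, e), (Y, f), m). (X, e) \<in> obs \<and> (Y, f) \<in> obs \<and>
        m \<in> Hom C X Y \<and> cmp C f (cmp C m e) = m},
      src = (\<lambda>(A, B, m). A),
      tgt = (\<lambda>(A, B, m). B),
      idn = (\<lambda>(X, e). ((X, e), (X, e), e)),
      cmp = (\<lambda>(B', D, n) (A, B, m). (A, D, cmp C n m)),
      nul = (\<lambda>A B. (A, B, nul C (fst A) (fst B))),
      padd = (\<lambda>(A, B, m) (A', B', m'). (A, B, padd C m m')),
      scal = (\<lambda>r (A, B, m). (A, B, scal C r m)),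
      unit_ob = (unit_ob C, idn C (unit_ob C)),
      tens_ob = tob,
      tens = (\<lambda>(A, B, m) (A', B', m'). (tob A A', tob B B', tens C m m'))\<rparr>)"

definition kar_ob :: "('o, 'm) lmcat \<Rightarrow> 'o \<Rightarrow> 'o \<times> 'm" where
  "kar_ob C X = (X, idn C X)"

definition kar_incl :: "('o, 'm) lmcat \<Rightarrow> 'm \<Rightarrow> ('o, 'm) kar_arr" where
  "kar_incl C f = (kar_ob C (src C f), kar_ob C (tgt C f), f)"

subsection \<open>Quotient by relations between parallel morphisms\<close>

inductive lm_cong :: "('o, 'm) lmcat \<Rightarrow> ('m \<times> 'm) set \<Rightarrow> 'm \<Rightarrow> 'm \<Rightarrow> bool" for C R where
  base: "(f, g) \<in> R \<Longrightarrow> f \<in> Hom C X Y \<Longrightarrow> g \<in> Hom C X Y \<Longrightarrow> lm_cong C R f g"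
| refl: "f \<in> arrs C \<Longrightarrow> lm_cong C R f f"
| sym: "lm_cong C R f g \<Longrightarrow> lm_cong C R g f"
| trans: "lm_cong C R f g \<Longrightarrow> lm_cong C R g h \<Longrightarrow> lm_cong C R f h"
| cmp: "lm_cong C R g g' \<Longrightarrow> lm_cong C R f f' \<Longrightarrow> src C g = tgt C f \<Longrightarrow>
    lm_cong C R (cmp C g f) (cmp C g' f')"
| padd: "lm_cong C R f f' \<Longrightarrow> lm_cong C R g g' \<Longrightarrow> src C f = src C g \<Longrightarrow> tgt C f = tgt C g \<Longrightarrow>
    lm_cong C R (padd C f g) (padd C f' g')"
| scal: "lm_cong C R f f' \<Longrightarrow> lm_cong C R (scal C r f) (scal C r f')"
| tens: "lm_cong C R f f' \<Longrightarrow> lm_cong C R g g' \<Longrightarrow> lm_cong C R (tens C f g) (tens C f' g')"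

definition quotient_cat ::
  "('o, 'm) lmcat \<Rightarrow> ('m \<times> 'm) set \<Rightarrow> ('o, 'm set) lmcat" where
  "quotient_cat C R =
    (let E = {(f, g). lm_cong C R f g} in
     \<lparr>objs = objs C,
      arrs = arrs C // E,
      src = (\<lambda>F. the_elem (src C ` F)),
      tgt = (\<lambda>F. the_elem (tgt C ` F)),
      idn = (\<lambda>X. E `` {idn C X}),
      cmp = (\<lambda>G F. \<Union>g\<in>G. \<Union>f\<in>F. E `` {cmp C g f}),
      nul = (\<lambda>X Y. E `` {nul C X Y}),
      padd = (\<lambda>F G. \<Union>f\<in>F. \<Union>g\<in>G. E `` {padd C f g}),
      scal = (\<lambda>r F. \<Union>f\<in>F. E `` {scal C r f}),
      unit_ob = unit_ob C,
      tens_ob = tens_ob C,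
      tens = (\<lambda>F G. \<Union>f\<in>F. \<Union>g\<in>G. E `` {tens C f g})\<rparr>)"

subsection \<open>Grothendieck ring\<close>

text \<open>\<open>Z \<cong> X \<oplus> Y\<close>, with the direct sum described as a biproduct.\<close>

definition is_dsum :: "('o, 'm) lmcat \<Rightarrow> 'o \<Rightarrow> 'o \<Rightarrow> 'o \<Rightarrow> bool" where
  "is_dsum C Z X Y \<longleftrightarrow> Z \<in> objs C \<and> X \<in> objs C \<and> Y \<in> objs C \<and>
    (\<exists>i\<in>Hom C X Z. \<exists>j\<in>Hom C Y Z. \<exists>p\<in>Hom C Z X. \<exists>r\<in>Hom C Z Y.
      cmp C p i = idn C X \<and> cmp C r j = idn C Y \<and>
      cmp C p j = nul C Y X \<and> cmp C r i = nul C X Y \<and>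
      padd C (cmp C i p) (cmp C j r) = idn C Z)"

text \<open>
  The free abelian group on the objects, with the product extending the tensor product, modulo
  the subgroup generated by the direct sum relations.  As tensoring with an object preserves
  direct sums, this subgroup is an ideal, and \<open>[X] [Y] = [X \<otimes> Y]\<close>.
\<close>

definition object_ring :: "('o, 'm) lmcat \<Rightarrow> (int, 'o \<Rightarrow>\<^sub>0 int) module" where
  "object_ring C = monoid_algebra \<lparr>carrier = objs C, mult = tens_ob C, one = unit_ob C\<rparr>"

definition K0_relations :: "('o, 'm) lmcat \<Rightarrow> ('o \<Rightarrow>\<^sub>0 int) set" where
  "K0_relations C = generate (add_monoid (object_ring C))
     {frag_of Z - frag_of X - frag_of Y | X Y Z. is_dsum C Z X Y}"

definition K0 :: "('o, 'm) lmcat \<Rightarrow> ('o \<Rightarrow>\<^sub>0 int) set ring" where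
  "K0 C = object_ring C Quot K0_relations C"

definition K0_class :: "('o, 'm) lmcat \<Rightarrow> 'o \<Rightarrow> ('o \<Rightarrow>\<^sub>0 int) set" where
  "K0_class C X = K0_relations C +>\<^bsub>object_ring C\<^esub> frag_of X"


section \<open>The Weyl category\<close>

subsection \<open>Terms\<close>

datatype letter = Plus | Minus

type_synonym word = "letter list"

datatype tm =
    TId word
  | TCmp tm tm    (infixr \<open>\<circ>\<^sub>t\<close> 70)
  | TTens tm tm   (infixr \<open>\<otimes>\<^sub>t\<close> 75)
  | TNul word word
  | TAdd tm tm    (infixl \<open>+\<^sub>t\<close> 65)
  | TScl cq tm    (infixr \<open>*\<^sub>t\<close> 68)
  | TEta | TEps | TEta' | TEps'
  | TE
  | TB int

fun tsrc :: "tm \<Rightarrow> word" where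
  "tsrc (TId u) = u"
| "tsrc (g \<circ>\<^sub>t f) = tsrc f"
| "tsrc (f \<otimes>\<^sub>t g) = tsrc f @ tsrc g"
| "tsrc (TNul u v) = u"
| "tsrc (f +\<^sub>t g) = tsrc f"
| "tsrc (r *\<^sub>t f) = tsrc f"
| "tsrc TEta = []"
| "tsrc TEps = [Minus, Plus]"
| "tsrc TEta' = []"
| "tsrc TEps' = [Plus, Minus]"
| "tsrc TE = [Plus, Plus]"
| "tsrc (TB k) = []"

fun ttgt :: "tm \<Rightarrow> word" where
  "ttgt (TId u) = u"
| "ttgt (g \<circ>\<^sub>t f) = ttgt g"
| "ttgt (f \<otimes>\<^sub>t g) = ttgt f @ ttgt g"
| "ttgt (TNul u v) = v"
| "ttgt (f +\<^sub>t g) = ttgt f"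
| "ttgt (r *\<^sub>t f) = ttgt f"
| "ttgt TEta = [Minus, Plus]"
| "ttgt TEps = []"
| "ttgt TEta' = [Plus, Minus]"
| "ttgt TEps' = []"
| "ttgt TE = [Plus, Plus]"
| "ttgt (TB k) = []"

fun wt :: "tm \<Rightarrow> bool" where
  "wt (g \<circ>\<^sub>t f) \<longleftrightarrow> wt g \<and> wt f \<and> tsrc g = ttgt f"
| "wt (f \<otimes>\<^sub>t g) \<longleftrightarrow> wt f \<and> wt g"
| "wt (f +\<^sub>t g) \<longleftrightarrow> wt f \<and> wt g \<and> tsrc f = tsrc g \<and> ttgt f = ttgt g"
| "wt (r *\<^sub>t f) \<longleftrightarrow> wt f"
| "wt _ \<longleftrightarrow> True"

abbreviation TSub :: "tm \<Rightarrow> tm \<Rightarrow> tm"  (infixl \<open>-\<^sub>t\<close> 65) where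
  "f -\<^sub>t g \<equiv> f +\<^sub>t (-1) *\<^sub>t g"

abbreviation i0 :: tm where "i0 \<equiv> TId []"
abbreviation ip :: tm where "ip \<equiv> TId [Plus]"
abbreviation im :: tm where "im \<equiv> TId [Minus]"

definition bdag :: "int \<Rightarrow> tm" where
  "bdag k = TEps \<circ>\<^sub>t TEta -\<^sub>t TB (k - 1)"

definition TP :: tm where
  "TP = ip -\<^sub>t qint 2 *\<^sub>t (ip \<otimes>\<^sub>t TEps') \<circ>\<^sub>t (TE \<otimes>\<^sub>t im) \<circ>\<^sub>t (ip \<otimes>\<^sub>t TEta')"

fun cnat :: "nat \<Rightarrow> tm" where
  "cnat 0 = TEps \<circ>\<^sub>t (im \<otimes>\<^sub>t (TEps' \<circ>\<^sub>t (TP \<otimes>\<^sub>t im) \<circ>\<^sub>t TEta') \<otimes>\<^sub>t ip) \<circ>\<^sub>t TEta"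
| "cnat (Suc k) = TEps' \<circ>\<^sub>t (ip \<otimes>\<^sub>t TEps' \<otimes>\<^sub>t im) \<circ>\<^sub>t (TE \<otimes>\<^sub>t cnat k \<otimes>\<^sub>t im \<otimes>\<^sub>t im)
     \<circ>\<^sub>t (ip \<otimes>\<^sub>t TEta' \<otimes>\<^sub>t im) \<circ>\<^sub>t TEta'"

definition cc :: "int \<Rightarrow> tm" where
  "cc k = (if k < 0 then TNul [] [] else cnat (nat k))"

text \<open>The two mates of \<open>E\<close>, obtained by bending the strands with \<open>\<eta>'\<close>, \<open>\<epsilon>\<close> and with
  \<open>\<eta>\<close>, \<open>\<epsilon>'\<close>.\<close>

definition Emate :: tm where
  "Emate = (TEps \<otimes>\<^sub>t im \<otimes>\<^sub>t im) \<circ>\<^sub>t (im \<otimes>\<^sub>t TEps \<otimes>\<^sub>t ip \<otimes>\<^sub>t im \<otimes>\<^sub>t im)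
     \<circ>\<^sub>t (im \<otimes>\<^sub>t im \<otimes>\<^sub>t TE \<otimes>\<^sub>t im \<otimes>\<^sub>t im)
     \<circ>\<^sub>t (im \<otimes>\<^sub>t im \<otimes>\<^sub>t ip \<otimes>\<^sub>t TEta' \<otimes>\<^sub>t im) \<circ>\<^sub>t (im \<otimes>\<^sub>t im \<otimes>\<^sub>t TEta')"

definition Emate' :: tm where
  "Emate' = (im \<otimes>\<^sub>t im \<otimes>\<^sub>t TEps') \<circ>\<^sub>t (im \<otimes>\<^sub>t im \<otimes>\<^sub>t ip \<otimes>\<^sub>t TEps' \<otimes>\<^sub>t im)
     \<circ>\<^sub>t (im \<otimes>\<^sub>t im \<otimes>\<^sub>t TE \<otimes>\<^sub>t im \<otimes>\<^sub>t im)
     \<circ>\<^sub>t (im \<otimes>\<^sub>t TEta \<otimes>\<^sub>t ip \<otimes>\<^sub>t im \<otimes>\<^sub>t im) \<circ>\<^sub>t (TEta \<otimes>\<^sub>t im \<otimes>\<^sub>t im)"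

subsection \<open>Defining relations\<close>

text \<open>Axioms of a linear strict monoidal category, imposed whenever both sides are well typed.\<close>

inductive lm_axiom :: "tm \<Rightarrow> tm \<Rightarrow> bool" where
  "lm_axiom ((h \<circ>\<^sub>t g) \<circ>\<^sub>t f) (h \<circ>\<^sub>t (g \<circ>\<^sub>t f))"
| "lm_axiom (f \<circ>\<^sub>t TId u) f"
| "lm_axiom (TId u \<circ>\<^sub>t f) f"
| "lm_axiom ((f \<otimes>\<^sub>t g) \<otimes>\<^sub>t h) (f \<otimes>\<^sub>t (g \<otimes>\<^sub>t h))"
| "lm_axiom (f \<otimes>\<^sub>t i0) f"
| "lm_axiom (i0 \<otimes>\<^sub>t f) f"
| "lm_axiom (TId u \<otimes>\<^sub>t TId v) (TId (u @ v))"
| "lm_axiom ((g \<circ>\<^sub>t f) \<otimes>\<^sub>t (k \<circ>\<^sub>t h)) ((g \<otimes>\<^sub>t k) \<circ>\<^sub>t (f \<otimes>\<^sub>t h))"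
| "lm_axiom ((f +\<^sub>t g) +\<^sub>t h) (f +\<^sub>t (g +\<^sub>t h))"
| "lm_axiom (f +\<^sub>t g) (g +\<^sub>t f)"
| "lm_axiom (f +\<^sub>t TNul u v) f"
| "lm_axiom (0 *\<^sub>t f) (TNul u v)"
| "lm_axiom (1 *\<^sub>t f) f"
| "lm_axiom ((r * s) *\<^sub>t f) (r *\<^sub>t (s *\<^sub>t f))"
| "lm_axiom ((r + s) *\<^sub>t f) (r *\<^sub>t f +\<^sub>t s *\<^sub>t f)"
| "lm_axiom (r *\<^sub>t (f +\<^sub>t g)) (r *\<^sub>t f +\<^sub>t r *\<^sub>t g)"
| "lm_axiom ((g +\<^sub>t h) \<circ>\<^sub>t f) (g \<circ>\<^sub>t f +\<^sub>t h \<circ>\<^sub>t f)"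
| "lm_axiom (h \<circ>\<^sub>t (f +\<^sub>t g)) (h \<circ>\<^sub>t f +\<^sub>t h \<circ>\<^sub>t g)"
| "lm_axiom ((r *\<^sub>t g) \<circ>\<^sub>t f) (r *\<^sub>t (g \<circ>\<^sub>t f))"
| "lm_axiom (g \<circ>\<^sub>t (r *\<^sub>t f)) (r *\<^sub>t (g \<circ>\<^sub>t f))"
| "lm_axiom ((g +\<^sub>t h) \<otimes>\<^sub>t f) (g \<otimes>\<^sub>t f +\<^sub>t h \<otimes>\<^sub>t f)"
| "lm_axiom (h \<otimes>\<^sub>t (f +\<^sub>t g)) (h \<otimes>\<^sub>t f +\<^sub>t h \<otimes>\<^sub>t g)"
| "lm_axiom ((r *\<^sub>t g) \<otimes>\<^sub>t f) (r *\<^sub>t (g \<otimes>\<^sub>t f))"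
| "lm_axiom (g \<otimes>\<^sub>t (r *\<^sub>t f)) (r *\<^sub>t (g \<otimes>\<^sub>t f))"

inductive w_rel :: "tm \<Rightarrow> tm \<Rightarrow> bool" where
  iso1: "w_rel ((TEps' \<otimes>\<^sub>t ip) \<circ>\<^sub>t (ip \<otimes>\<^sub>t TEta)) ip"
| iso2: "w_rel ((ip \<otimes>\<^sub>t TEps) \<circ>\<^sub>t (TEta' \<otimes>\<^sub>t ip)) ip"
| iso3: "w_rel ((im \<otimes>\<^sub>t TEps') \<circ>\<^sub>t (TEta \<otimes>\<^sub>t im)) im"
| iso4: "w_rel ((TEps \<otimes>\<^sub>t im) \<circ>\<^sub>t (im \<otimes>\<^sub>t TEta')) im"
| mates: "w_rel Emate Emate'"
| r1: "w_rel (qint 2 ^ 3 *\<^sub>t (TE \<otimes>\<^sub>t ip) \<circ>\<^sub>t (ip \<otimes>\<^sub>t TE) \<circ>\<^sub>t (TE \<otimes>\<^sub>t ip)) (qint 2 *\<^sub>t (TE \<otimes>\<^sub>t ip))"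
| r1': "w_rel (qint 2 ^ 3 *\<^sub>t (ip \<otimes>\<^sub>t TE) \<circ>\<^sub>t (TE \<otimes>\<^sub>t ip) \<circ>\<^sub>t (ip \<otimes>\<^sub>t TE)) (qint 2 *\<^sub>t (ip \<otimes>\<^sub>t TE))"
| r2: "w_rel (qint 2 ^ 2 *\<^sub>t (TE \<otimes>\<^sub>t im) \<circ>\<^sub>t (ip \<otimes>\<^sub>t (TEta' \<circ>\<^sub>t TEps')) \<circ>\<^sub>t (TE \<otimes>\<^sub>t im))
    (qint 2 *\<^sub>t (TE \<otimes>\<^sub>t im))"
| r2': "w_rel (qint 2 ^ 2 *\<^sub>t (im \<otimes>\<^sub>t TE) \<circ>\<^sub>t ((TEta \<circ>\<^sub>t TEps) \<otimes>\<^sub>t ip) \<circ>\<^sub>t (im \<otimes>\<^sub>t TE))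
    (qint 2 *\<^sub>t (im \<otimes>\<^sub>t TE))"
| r3: "w_rel (qint 2 *\<^sub>t (TEps \<otimes>\<^sub>t ip) \<circ>\<^sub>t (im \<otimes>\<^sub>t TE) \<circ>\<^sub>t (TEta \<otimes>\<^sub>t ip)) ip"
| r3': "w_rel (qint 2 *\<^sub>t (ip \<otimes>\<^sub>t TEps') \<circ>\<^sub>t (TE \<otimes>\<^sub>t im) \<circ>\<^sub>t (ip \<otimes>\<^sub>t TEta')) ((i0 -\<^sub>t cc 0) \<otimes>\<^sub>t ip)"
| r4: "w_rel (TEps \<circ>\<^sub>t TEta) (qint 2 *\<^sub>t i0)"
| r4': "0 \<le> k \<Longrightarrow> w_rel (TEps \<circ>\<^sub>t (im \<otimes>\<^sub>t cc k \<otimes>\<^sub>t ip) \<circ>\<^sub>t TEta)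
    (TB (-2 * k + 1) \<circ>\<^sub>t cc (k - 1) +\<^sub>t bdag (-2 * k) \<circ>\<^sub>t cc k)"
| r5: "w_rel (TEps' \<circ>\<^sub>t TEta') (qint 2 *\<^sub>t i0 -\<^sub>t cc 0 \<circ>\<^sub>t bdag 0)"
| r5': "0 \<le> k \<Longrightarrow> w_rel (TEps' \<circ>\<^sub>t (ip \<otimes>\<^sub>t cc k \<otimes>\<^sub>t im) \<circ>\<^sub>t TEta')
    (TB (-2 * k - 1) \<circ>\<^sub>t cc k +\<^sub>t bdag (-2 * k - 2) \<circ>\<^sub>t cc (k + 1))"
| r6: "0 \<le> k \<Longrightarrow> w_rel (cc k \<otimes>\<^sub>t ip) (cc k \<otimes>\<^sub>t ip \<otimes>\<^sub>t (cc k +\<^sub>t cc (k - 1)))"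
| r6': "0 \<le> k \<Longrightarrow> w_rel (ip \<otimes>\<^sub>t cc k) ((cc k +\<^sub>t cc (k + 1)) \<otimes>\<^sub>t ip \<otimes>\<^sub>t cc k)"
| r7: "w_rel
    (((im \<otimes>\<^sub>t im \<otimes>\<^sub>t TE) \<circ>\<^sub>t (im \<otimes>\<^sub>t TEta \<otimes>\<^sub>t ip) \<circ>\<^sub>t TEta)
      \<circ>\<^sub>t (TEps \<circ>\<^sub>t (im \<otimes>\<^sub>t TEps \<otimes>\<^sub>t ip) \<circ>\<^sub>t (im \<otimes>\<^sub>t im \<otimes>\<^sub>t TE)))
    (Emate \<otimes>\<^sub>t TE)"
| r7': "w_rel (cc 0 \<otimes>\<^sub>t TE) (TNul [Plus, Plus] [Plus, Plus])"
| r8: "0 \<le> k \<Longrightarrow> 0 \<le> j \<Longrightarrow> w_rel (cc k \<circ>\<^sub>t cc j) (if k = j then cc k else TNul [] [])"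
| r8': "w_rel (TB k \<otimes>\<^sub>t ip) (ip \<otimes>\<^sub>t TB (k + 1))"
| r9: "0 \<le> k \<Longrightarrow> w_rel (bdag k \<circ>\<^sub>t TB k) i0"
| r10: "0 \<le> k \<Longrightarrow> w_rel (cc k \<otimes>\<^sub>t im \<otimes>\<^sub>t cc k \<otimes>\<^sub>t ip \<otimes>\<^sub>t cc k)
    ((im \<otimes>\<^sub>t cc k \<otimes>\<^sub>t ip) \<circ>\<^sub>t TEta \<circ>\<^sub>t (cc k \<circ>\<^sub>t TB (-2 * k)) \<circ>\<^sub>t TEps \<circ>\<^sub>t (im \<otimes>\<^sub>t cc k \<otimes>\<^sub>t ip))"
| r10': "0 \<le> k \<Longrightarrow> w_rel (cc (k - 1) \<otimes>\<^sub>t im \<otimes>\<^sub>t cc k \<otimes>\<^sub>t ip \<otimes>\<^sub>t cc (k - 1))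
    ((im \<otimes>\<^sub>t cc k \<otimes>\<^sub>t ip) \<circ>\<^sub>t TEta \<circ>\<^sub>t (cc (k - 1) \<circ>\<^sub>t bdag (-2 * k + 1)) \<circ>\<^sub>t TEps
      \<circ>\<^sub>t (im \<otimes>\<^sub>t cc k \<otimes>\<^sub>t ip))"
| r11: "0 \<le> k \<Longrightarrow> w_rel
    (qint 2 *\<^sub>t TE \<circ>\<^sub>t (ip \<otimes>\<^sub>t cc k \<otimes>\<^sub>t ip))
    (qint 2 *\<^sub>t (((ip \<otimes>\<^sub>t cc (k + 1) \<otimes>\<^sub>t ip) \<circ>\<^sub>t TE) \<otimes>\<^sub>t cc k)
      +\<^sub>t qint 2 *\<^sub>t (cc k \<otimes>\<^sub>t ((ip \<otimes>\<^sub>t cc (k - 1) \<otimes>\<^sub>t ip) \<circ>\<^sub>t TE))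
      +\<^sub>t cc (k + 1) \<otimes>\<^sub>t ip \<otimes>\<^sub>t cc k \<otimes>\<^sub>t ip \<otimes>\<^sub>t cc k \<otimes>\<^sub>t bdag (-2 * k)
      +\<^sub>t cc k \<otimes>\<^sub>t ip \<otimes>\<^sub>t cc k \<otimes>\<^sub>t ip \<otimes>\<^sub>t cc (k - 1) \<otimes>\<^sub>t TB (-2 * k + 1)
      -\<^sub>t cc (k + 1) \<otimes>\<^sub>t ip \<otimes>\<^sub>t cc (k + 1) \<otimes>\<^sub>t ip \<otimes>\<^sub>t cc k \<otimes>\<^sub>t TB (-2 * k - 1)
      -\<^sub>t cc k \<otimes>\<^sub>t ip \<otimes>\<^sub>t cc (k - 1) \<otimes>\<^sub>t ip \<otimes>\<^sub>t cc (k - 1) \<otimes>\<^sub>t bdag (-2 * k + 2))"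

inductive w_eq :: "tm \<Rightarrow> tm \<Rightarrow> bool" where
  refl: "w_eq f f"
| sym: "w_eq f g \<Longrightarrow> w_eq g f"
| trans: "w_eq f g \<Longrightarrow> w_eq g h \<Longrightarrow> w_eq f h"
| cmp: "w_eq g g' \<Longrightarrow> w_eq f f' \<Longrightarrow> w_eq (g \<circ>\<^sub>t f) (g' \<circ>\<^sub>t f')"
| tens: "w_eq f f' \<Longrightarrow> w_eq g g' \<Longrightarrow> w_eq (f \<otimes>\<^sub>t g) (f' \<otimes>\<^sub>t g')"
| add: "w_eq f f' \<Longrightarrow> w_eq g g' \<Longrightarrow> w_eq (f +\<^sub>t g) (f' +\<^sub>t g')"
| scl: "w_eq f f' \<Longrightarrow> w_eq (r *\<^sub>t f) (r *\<^sub>t f')"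
| axm: "lm_axiom f g \<Longrightarrow> wt f \<Longrightarrow> wt g \<Longrightarrow> tsrc f = tsrc g \<Longrightarrow> ttgt f = ttgt g \<Longrightarrow> w_eq f g"
| rel: "w_rel f g \<Longrightarrow> w_eq f g"

lemma bdag_type [simp]: "wt (bdag k)" "tsrc (bdag k) = []" "ttgt (bdag k) = []"
  by (simp_all add: bdag_def)

lemma cnat_type [simp]: "wt (cnat k) \<and> tsrc (cnat k) = [] \<and> ttgt (cnat k) = []"
  by (induction k) (simp_all add: TP_def)

lemma cc_type [simp]: "wt (cc k)" "tsrc (cc k) = []" "ttgt (cc k) = []"
  by (simp_all add: cc_def)

lemma w_rel_type:
  assumes "w_rel f g"
  shows "wt f \<and> wt g \<and> tsrc f = tsrc g \<and> ttgt f = ttgt g"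
  using assms by cases (simp_all add: Emate_def Emate'_def)

lemma w_eq_type:
  assumes "w_eq f g"
  shows "tsrc f = tsrc g \<and> ttgt f = ttgt g \<and> (wt f \<longleftrightarrow> wt g)"
  using assms
proof induction
  case (rel f g)
  then show ?case using w_rel_type by simp
qed auto

lemma equivp_w_eq: "equivp w_eq"
  by (rule equivpI) (auto intro!: reflpI sympI transpI intro: w_eq.intros)

subsection \<open>The categories\<close>

quotient_type warr = tm / w_eq
  by (rule equivp_w_eq)

lift_definition wsrc :: "warr \<Rightarrow> word" is tsrc using w_eq_type by blast
lift_definition wtgt :: "warr \<Rightarrow> word" is ttgt using w_eq_type by blast
lift_definition wwt :: "warr \<Rightarrow> bool" is wt using w_eq_type by blast
lift_definition widn :: "word \<Rightarrow> warr" is TId .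
lift_definition wcmp :: "warr \<Rightarrow> warr \<Rightarrow> warr" is TCmp by (rule w_eq.cmp)
lift_definition wnul :: "word \<Rightarrow> word \<Rightarrow> warr" is TNul .
lift_definition wadd :: "warr \<Rightarrow> warr \<Rightarrow> warr" is TAdd by (rule w_eq.add)
lift_definition wscl :: "cq \<Rightarrow> warr \<Rightarrow> warr" is TScl by (rule w_eq.scl)
lift_definition wtens :: "warr \<Rightarrow> warr \<Rightarrow> warr" is TTens by (rule w_eq.tens)

text \<open>The full subcategory of \<open>W'\<close> on the tensor words; \<open>W'\<close> is its additive closure.\<close>

definition W_words :: "(word, warr) lmcat" where
  "W_words =
     \<lparr>objs = UNIV, arrs = {f. wwt f}, src = wsrc, tgt = wtgt, idn = widn, cmp = wcmp, nul = wnul,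
      padd = wadd, scal = wscl, unit_ob = [], tens_ob = (@), tens = wtens\<rparr>"

definition W' :: "(word list, (word, warr) add_arr) lmcat" where
  "W' = additive_closure W_words"

definition in_W' :: "tm \<Rightarrow> (word, warr) add_arr" where
  "in_W' f = add_incl W_words (abs_warr f)"

type_synonym wob = "word list \<times> (word, warr) add_arr"
type_synonym wkar = "(word list, (word, warr) add_arr) kar_arr"

definition W :: "(wob, wkar) lmcat" where
  "W = karoubi W'"

definition W_inf :: "(wob, wkar set) lmcat" where
  "W_inf = quotient_cat W
     {(kar_incl W' (in_W' (bdag k \<circ>\<^sub>t TB k)), kar_incl W' (in_W' i0)) | k. True}"

definition ob_Qplus :: wob where "ob_Qplus = kar_ob W' [[Plus]]"
definition ob_Qminus :: wob where "ob_Qminus = kar_ob W' [[Minus]]"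
definition ob_C :: "nat \<Rightarrow> wob" where "ob_C k = ([[]], in_W' (cnat k))"


section \<open>The Grothendieck algebra of the asymptotic Weyl category\<close>

definition K0_W_inf :: "(cq, ((wob \<Rightarrow>\<^sub>0 int) set \<Rightarrow>\<^sub>0 cq) set) module" where
  "K0_W_inf = ext_scalars (K0 W_inf)"

definition cls :: "wob \<Rightarrow> ((wob \<Rightarrow>\<^sub>0 int) set \<Rightarrow>\<^sub>0 cq) set" where
  "cls X = ext_incl (K0 W_inf) (K0_class W_inf X)"

definition K0_W_inf' :: "(cq, ((wob \<Rightarrow>\<^sub>0 int) set \<Rightarrow>\<^sub>0 cq) set) module" where
  "K0_W_inf' = subalg_generated K0_W_inf
     ({cls ob_Qplus, cls ob_Qminus} \<union> range (\<lambda>k. cls (ob_C k)))"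

end

theory Submission
  imports Defs
begin

text \<open>
  By \<open>presented_alg_hom\<close> it suffices to verify the relations of \<open>\<K>\<close> for the classes in
  \<open>K\<^sub>0\<close>, and an equation between classes follows from morphisms that split an idempotent or
  identify the images of two. Relations 6 and 8 and the rotation of relation 6 give the
  relations for \<open>c\<^sub>k x\<close>, \<open>x c\<^sub>k\<close>, \<open>c\<^sub>k y\<close> and \<open>y c\<^sub>k\<close>. Relation 10 and its rotation by a
  quarter turn say that \<open>c\<^sub>k x c\<^sub>j\<close> and \<open>c\<^sub>j y c\<^sub>k\<close> are inverse to each other for
  \<open>j = k, k - 1\<close>. Relation 7 with traced out strands gives \<open>E\<^sup>2 = E\<close>. By relation 11 the
  diagonal entries of \<open>[2] E\<close> on
  \<open>c\<^bsub>k+1\<^esub> x x c\<^sub>k = c\<^bsub>k+1\<^esub> x c\<^sub>k x c\<^sub>k + c\<^bsub>k+1\<^esub> x c\<^bsub>k+1\<^esub> x c\<^sub>k\<close> are \<open>b\<^sup>\<dagger>\<close> and \<open>b\<close> with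
  \<open>b\<^sup>\<dagger> + b = [2]\<close>, so its off-diagonal entries compose to \<open>b\<^sup>\<dagger> b\<close>. This is invertible since
  every \<open>b\<^sub>k\<close> is invertible in the asymptotic category, hence the two summands are
  isomorphic. Finally \<open>E\<close> and its mate, bent sideways, give morphisms between \<open>Q\<^sub>- Q\<^sub>+\<close> and
  \<open>Q\<^sub>+ Q\<^sub>-\<close>; relation 7 and its rotation show that one composite is the identity and the
  other is the complement of the idempotent \<open>Q\<^sub>- c\<^sub>0 Q\<^sub>+\<close>, so that \<open>y x = x y + y c\<^sub>0 x\<close>.
  The remaining relations are formal consequences.
\<close>

section \<open>Linear monoidal categories and their closures\<close>

text \<open>The off-diagonal product in relation 11 has its value because U = [2] E satisfies U^2 =
  [2] U: if d is one diagonal entry, the two off-diagonal entries compose to [2] d - d^2 = d ([2] -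
  d). For d = b_{-2k}^dagger the other factor is b_{-2k-1}, whose index is negative, where relation
  9 says nothing; here the asymptotic relations enter. They also enter for c_k x c_j y c_k: by
  relation 8 a scalar changes its index by one when it crosses a strand, so the scalar of relation
  10, rotated and moved outside, becomes the coefficient of c_k in relation 5, and its inverse
  normalises the bubble. The obstacle is the encoding. \<open>W_inf\<close> is a quotient of a
  Karoubi envelope of an additive closure, and its objects contain an idempotent of
  \<open>W'\<close> that has to be idempotent before the asymptotic relations are imposed. Diagrams
  are therefore computed on terms, and only idempotents of single words and terms between them are
  carried over to \<open>W_inf\<close>.\<close>

lemma HomI: "f \<in> arrs C \<Longrightarrow> src C f = X \<Longrightarrow> tgt C f = Y \<Longrightarrow> f \<in> Hom C X Y"
  by (simp add: Hom_def)

lemma HomD: "f \<in> Hom C X Y \<Longrightarrow> f \<in> arrs C" "f \<in> Hom C X Y \<Longrightarrow> src C f = X"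
    "f \<in> Hom C X Y \<Longrightarrow> tgt C f = Y"
  by (simp_all add: Hom_def)

text \<open>Every axiom is relative to Hom sets, since the operations of the record are total
  functions that are meaningful only on composable or parallel arrows. Strictness appears as
  equalities of objects and of arrows. The three constructions below preserve the locale, so
  \<open>W_inf\<close> inherits its structure from the category of words.\<close>

locale lin_mon_cat =
  fixes C :: "('o, 'm) lmcat"
  assumes Hom_objs: "f \<in> Hom C X Y \<Longrightarrow> X \<in> objs C \<and> Y \<in> objs C"
    and idn: "X \<in> objs C \<Longrightarrow> idn C X \<in> Hom C X X"
    and cmp: "g \<in> Hom C Y Z \<Longrightarrow> f \<in> Hom C X Y \<Longrightarrow> cmp C g f \<in> Hom C X Z"
    and nul: "X \<in> objs C \<Longrightarrow> Y \<in> objs C \<Longrightarrow> nul C X Y \<in> Hom C X Y"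
    and padd: "f \<in> Hom C X Y \<Longrightarrow> g \<in> Hom C X Y \<Longrightarrow> padd C f g \<in> Hom C X Y"
    and scal: "f \<in> Hom C X Y \<Longrightarrow> scal C r f \<in> Hom C X Y"
    and tens: "f \<in> Hom C X Y \<Longrightarrow> g \<in> Hom C X' Y' \<Longrightarrow>
      tens C f g \<in> Hom C (tens_ob C X X') (tens_ob C Y Y')"
    and unit_ob: "unit_ob C \<in> objs C"
    and tens_ob: "X \<in> objs C \<Longrightarrow> Y \<in> objs C \<Longrightarrow> tens_ob C X Y \<in> objs C"
    and cmp_assoc: "h \<in> Hom C Z U \<Longrightarrow> g \<in> Hom C Y Z \<Longrightarrow> f \<in> Hom C X Y \<Longrightarrow>
      cmp C (cmp C h g) f = cmp C h (cmp C g f)"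
    and cmp_idn: "f \<in> Hom C X Y \<Longrightarrow> cmp C f (idn C X) = f"
      "f \<in> Hom C X Y \<Longrightarrow> cmp C (idn C Y) f = f"
    and cmp_nul: "f \<in> Hom C X Y \<Longrightarrow> Z \<in> objs C \<Longrightarrow> cmp C f (nul C Z X) = nul C Z Y"
      "f \<in> Hom C X Y \<Longrightarrow> Z \<in> objs C \<Longrightarrow> cmp C (nul C Y Z) f = nul C X Z"
    and cmp_padd: "h \<in> Hom C Y Z \<Longrightarrow> f \<in> Hom C X Y \<Longrightarrow> g \<in> Hom C X Y \<Longrightarrow>
      cmp C h (padd C f g) = padd C (cmp C h f) (cmp C h g)"
      "f \<in> Hom C Y Z \<Longrightarrow> g \<in> Hom C Y Z \<Longrightarrow> h \<in> Hom C X Y \<Longrightarrow>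
      cmp C (padd C f g) h = padd C (cmp C f h) (cmp C g h)"
    and cmp_scal: "h \<in> Hom C Y Z \<Longrightarrow> f \<in> Hom C X Y \<Longrightarrow>
        cmp C h (scal C r f) = scal C r (cmp C h f)"
      "h \<in> Hom C Y Z \<Longrightarrow> f \<in> Hom C X Y \<Longrightarrow>
        cmp C (scal C r h) f = scal C r (cmp C h f)"
    and scal_padd: "f \<in> Hom C X Y \<Longrightarrow> g \<in> Hom C X Y \<Longrightarrow>
        scal C r (padd C f g) = padd C (scal C r f) (scal C r g)"
    and scal_nul: "X \<in> objs C \<Longrightarrow> Y \<in> objs C \<Longrightarrow> scal C r (nul C X Y) = nul C X Y"
    and padd_assoc: "f \<in> Hom C X Y \<Longrightarrow> g \<in> Hom C X Y \<Longrightarrow> h \<in> Hom C X Y \<Longrightarrow>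
      padd C (padd C f g) h = padd C f (padd C g h)"
    and padd_comm: "f \<in> Hom C X Y \<Longrightarrow> g \<in> Hom C X Y \<Longrightarrow> padd C f g = padd C g f"
    and padd_nul: "f \<in> Hom C X Y \<Longrightarrow> padd C f (nul C X Y) = f"
    and tens_idn: "X \<in> objs C \<Longrightarrow> Y \<in> objs C \<Longrightarrow>
      tens C (idn C X) (idn C Y) = idn C (tens_ob C X Y)"
    and interchange: "g \<in> Hom C Y Z \<Longrightarrow> f \<in> Hom C X Y \<Longrightarrow> g' \<in> Hom C Y' Z' \<Longrightarrow> f' \<in> Hom C X' Y' \<Longrightarrow>
      tens C (cmp C g f) (cmp C g' f') = cmp C (tens C g g') (tens C f f')"
    and tens_nul: "f \<in> Hom C X Y \<Longrightarrow> X' \<in> objs C \<Longrightarrow> Y' \<in> objs C \<Longrightarrow>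
        tens C f (nul C X' Y') = nul C (tens_ob C X X') (tens_ob C Y Y')"
      "f \<in> Hom C X Y \<Longrightarrow> X' \<in> objs C \<Longrightarrow> Y' \<in> objs C \<Longrightarrow>
        tens C (nul C X' Y') f = nul C (tens_ob C X' X) (tens_ob C Y' Y)"
    and tens_padd: "h \<in> Hom C X Y \<Longrightarrow> f \<in> Hom C X' Y' \<Longrightarrow> g \<in> Hom C X' Y' \<Longrightarrow>
        tens C h (padd C f g) = padd C (tens C h f) (tens C h g)"
      "h \<in> Hom C X Y \<Longrightarrow> f \<in> Hom C X' Y' \<Longrightarrow> g \<in> Hom C X' Y' \<Longrightarrow>
        tens C (padd C f g) h = padd C (tens C f h) (tens C g h)"
    and tens_assoc: "f \<in> Hom C X Y \<Longrightarrow> g \<in> Hom C X' Y' \<Longrightarrow> h \<in> Hom C X'' Y'' \<Longrightarrow>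
      tens C (tens C f g) h = tens C f (tens C g h)"
    and tens_unit: "f \<in> Hom C X Y \<Longrightarrow> tens C f (idn C (unit_ob C)) = f"
      "f \<in> Hom C X Y \<Longrightarrow> tens C (idn C (unit_ob C)) f = f"
    and tens_ob_assoc: "X \<in> objs C \<Longrightarrow> Y \<in> objs C \<Longrightarrow> Z \<in> objs C \<Longrightarrow>
      tens_ob C (tens_ob C X Y) Z = tens_ob C X (tens_ob C Y Z)"
    and tens_ob_unit: "X \<in> objs C \<Longrightarrow> tens_ob C X (unit_ob C) = X"
      "X \<in> objs C \<Longrightarrow> tens_ob C (unit_ob C) X = X"
begin

lemma nul_padd: "f \<in> Hom C X Y \<Longrightarrow> padd C (nul C X Y) f = f"
  using padd_nul padd_comm nul Hom_objs by metis

lemma lin_sum_0: "lin_sum C X Y f 0 = nul C X Y"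
  by (simp add: lin_sum_def)

text \<open>\<open>lin_sum\<close> folds from the right, so a change of the initial value amounts to
  a new last summand. Closure is proved in the same induction because associativity applies only to
  arrows already known to be parallel.\<close>

lemma lin_sum_aux:
  assumes "\<And>j. j \<in> set js \<Longrightarrow> f j \<in> Hom C X Y" "z \<in> Hom C X Y"
  shows "foldr (\<lambda>j. padd C (f j)) js z = padd C (foldr (\<lambda>j. padd C (f j)) js (nul C X Y)) z
    \<and> foldr (\<lambda>j. padd C (f j)) js (nul C X Y) \<in> Hom C X Y"
  using assms
proof (induction js)
  case Nil
  then show ?case using nul_padd nul Hom_objs by auto
next
  case (Cons a js)
  have "f a \<in> Hom C X Y" using Cons.prems by auto
  moreover have IH: "foldr (\<lambda>j. padd C (f j)) js z = padd C (foldr (\<lambda>j. padd C (f j)) js (nul C X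
      Y)) z"
    "foldr (\<lambda>j. padd C (f j)) js (nul C X Y) \<in> Hom C X Y" using Cons by auto
  ultimately show ?case using Cons.prems padd_assoc[of "f a" X Y] padd by simp
qed

lemma lin_sum_Hom:
  assumes "X \<in> objs C" "Y \<in> objs C" "\<And>j. j < n \<Longrightarrow> f j \<in> Hom C X Y"
  shows "lin_sum C X Y f n \<in> Hom C X Y"
  using lin_sum_aux[of "[0..<n]" f X Y "nul C X Y"] assms nul by (simp add: lin_sum_def)

lemma lin_sum_Suc:
  assumes "\<And>j. j \<le> n \<Longrightarrow> f j \<in> Hom C X Y"
  shows "lin_sum C X Y f (Suc n) = padd C (lin_sum C X Y f n) (f n)"
proof -
  have "f n \<in> Hom C X Y" using assms by simp
  then have "lin_sum C X Y f (Suc n) = foldr (\<lambda>j. padd C (f j)) [0..<n] (f n)"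
    by (simp add: lin_sum_def padd_nul)
  then show ?thesis
    using lin_sum_aux[of "[0..<n]" f X Y "f n"] assms by (simp add: lin_sum_def)
qed

lemma lin_sum_cong:
  "(\<And>j. j < n \<Longrightarrow> f j = g j) \<Longrightarrow> lin_sum C X Y f n = lin_sum C X Y g n"
  unfolding lin_sum_def by (rule foldr_cong) auto

lemma lin_sum_nul:
  assumes "X \<in> objs C" "Y \<in> objs C" "\<And>j. j < n \<Longrightarrow> f j = nul C X Y"
  shows "lin_sum C X Y f n = nul C X Y"
  using assms by (induction n) (simp_all add: lin_sum_0 lin_sum_Suc less_Suc_eq_le padd_nul nul)

lemma lin_sum_single:
  assumes "X \<in> objs C" "Y \<in> objs C" "i < n" "f i \<in> Hom C X Y"
    "\<And>j. j < n \<Longrightarrow> j \<noteq> i \<Longrightarrow> f j = nul C X Y"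
  shows "lin_sum C X Y f n = f i"
  using assms(3-)
proof (induction n)
  case (Suc n)
  have ty: "\<And>j. j \<le> n \<Longrightarrow> f j \<in> Hom C X Y"
    using Suc.prems nul[OF assms(1,2)] by (metis le_imp_less_Suc)
  show ?case
  proof (cases "i = n")
    case True
    then have "lin_sum C X Y f n = nul C X Y"
      using Suc.prems(3) by (intro lin_sum_nul assms(1,2)) simp
    then show ?thesis using True ty by (simp add: lin_sum_Suc nul_padd)
  next
    case False
    then have "lin_sum C X Y f n = f i" using Suc by simp
    moreover have "f n = nul C X Y" using False Suc.prems by auto
    ultimately show ?thesis using ty Suc.prems by (simp add: lin_sum_Suc padd_nul)
  qed
qed simp

lemma padd_padd:
  assumes "a \<in> Hom C X Y" "b \<in> Hom C X Y" "c \<in> Hom C X Y" "d \<in> Hom C X Y"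
  shows "padd C (padd C a b) (padd C c d) = padd C (padd C a c) (padd C b d)"
proof -
  have "padd C (padd C a b) (padd C c d) = padd C a (padd C (padd C b c) d)"
    using assms by (simp add: padd_assoc[where X=X and Y=Y] padd)
  also have "\<dots> = padd C a (padd C (padd C c b) d)"
    using assms by (simp add: padd_comm[of b X Y c])
  also have "\<dots> = padd C (padd C a c) (padd C b d)"
    using assms by (simp add: padd_assoc[where X=X and Y=Y] padd)
  finally show ?thesis .
qed

lemma lin_sum_padd:
  assumes "X \<in> objs C" "Y \<in> objs C"
    "\<And>j. j < n \<Longrightarrow> f j \<in> Hom C X Y" "\<And>j. j < n \<Longrightarrow> g j \<in> Hom C X Y"
  shows "lin_sum C X Y (\<lambda>j. padd C (f j) (g j)) n = padd C (lin_sum C X Y f n) (lin_sum C X Y g n)"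
  using assms(3-)
  by (induction n) (simp_all add: assms(1,2) lin_sum_0 lin_sum_Suc less_Suc_eq_le padd_nul nul padd
    padd_padd[where X=X and Y=Y] lin_sum_Hom)

lemma lin_sum_scal:
  assumes "X \<in> objs C" "Y \<in> objs C" "\<And>j. j < n \<Longrightarrow> f j \<in> Hom C X Y"
  shows "lin_sum C X Y (\<lambda>j. scal C r (f j)) n = scal C r (lin_sum C X Y f n)"
  using assms(3-)
  by (induction n) (simp_all add: assms(1,2) lin_sum_0 lin_sum_Suc less_Suc_eq_le scal
    scal_nul scal_padd[where X=X and Y=Y] lin_sum_Hom)

lemma lin_sum_swap:
  assumes "X \<in> objs C" "Y \<in> objs C" "\<And>i j. i < m \<Longrightarrow> j < n \<Longrightarrow> f i j \<in> Hom C X Y"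
  shows "lin_sum C X Y (\<lambda>i. lin_sum C X Y (f i) n) m = lin_sum C X Y (\<lambda>j. lin_sum C X Y (\<lambda>i. f i
      j) m) n"
  using assms(3-)
proof (induction m)
  case 0
  then show ?case by (simp add: lin_sum_0 lin_sum_nul assms)
next
  case (Suc m)
  have "lin_sum C X Y (\<lambda>i. lin_sum C X Y (f i) n) (Suc m)
      = padd C (lin_sum C X Y (\<lambda>i. lin_sum C X Y (f i) n) m) (lin_sum C X Y (f m) n)"
    using Suc.prems by (simp add: lin_sum_Suc lin_sum_Hom assms)
  also have "\<dots> = padd C (lin_sum C X Y (\<lambda>j. lin_sum C X Y (\<lambda>i. f i j) m) n) (lin_sum C X Y (f m) n)"
    using Suc by simp
  also have "\<dots> = lin_sum C X Y (\<lambda>j. padd C (lin_sum C X Y (\<lambda>i. f i j) m) (f m j)) n"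
    using Suc.prems by (simp add: lin_sum_padd lin_sum_Hom assms)
  also have "\<dots> = lin_sum C X Y (\<lambda>j. lin_sum C X Y (\<lambda>i. f i j) (Suc m)) n"
    using Suc.prems by (intro lin_sum_cong) (simp add: lin_sum_Suc)
  finally show ?case .
qed

lemma cmp_lin_sum:
  assumes "X \<in> objs C" "h \<in> Hom C Y Z" "\<And>j. j < n \<Longrightarrow> f j \<in> Hom C X Y"
  shows "cmp C h (lin_sum C X Y f n) = lin_sum C X Z (\<lambda>j. cmp C h (f j)) n"
proof -
  note o = assms(1) Hom_objs[OF assms(2)]
  show ?thesis using assms(3)
    by (induction n) (simp_all add: lin_sum_0 lin_sum_Suc less_Suc_eq_le o cmp_nul[OF assms(2)]
      cmp_padd(1)[OF assms(2), where X=X] cmp[OF assms(2)] lin_sum_Hom)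
qed

lemma lin_sum_cmp:
  assumes "Z \<in> objs C" "h \<in> Hom C X Y" "\<And>j. j < n \<Longrightarrow> f j \<in> Hom C Y Z"
  shows "cmp C (lin_sum C Y Z f n) h = lin_sum C X Z (\<lambda>j. cmp C (f j) h) n"
proof -
  note o = assms(1) Hom_objs[OF assms(2)]
  show ?thesis using assms(3)
    by (induction n) (simp_all add: lin_sum_0 lin_sum_Suc less_Suc_eq_le o cmp_nul[OF assms(2)]
      cmp_padd(2)[where X=X and Y=Y and Z=Z, OF _ _ assms(2)] cmp[OF _ assms(2)] lin_sum_Hom)
qed

lemma tens_lin_sum:
  assumes "X \<in> objs C" "Y \<in> objs C" "h \<in> Hom C X' Y'" "\<And>j. j < n \<Longrightarrow> f j \<in> Hom C X Y"
  shows "tens C h (lin_sum C X Y f n)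
    = lin_sum C (tens_ob C X' X) (tens_ob C Y' Y) (\<lambda>j. tens C h (f j)) n"
proof -
  note o = assms(1,2) Hom_objs[OF assms(3)]
  show ?thesis using assms(4)
    by (induction n) (simp_all add: lin_sum_0 lin_sum_Suc less_Suc_eq_le o tens_nul[OF assms(3)]
      tens_padd(1)[OF assms(3), of _ X Y] tens[OF assms(3), of _ X Y] lin_sum_Hom)
qed

lemma lin_sum_tens:
  assumes "X \<in> objs C" "Y \<in> objs C" "h \<in> Hom C X' Y'" "\<And>j. j < n \<Longrightarrow> f j \<in> Hom C X Y"
  shows "tens C (lin_sum C X Y f n) h
    = lin_sum C (tens_ob C X X') (tens_ob C Y Y') (\<lambda>j. tens C (f j) h) n"
proof -
  note o = assms(1,2) Hom_objs[OF assms(3)]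
  show ?thesis using assms(4)
    by (induction n) (simp_all add: lin_sum_0 lin_sum_Suc less_Suc_eq_le o tens_nul[OF assms(3)]
      tens_padd(2)[OF assms(3), of _ X Y] tens[OF _ assms(3), of _ X Y] lin_sum_Hom)
qed

lemma lin_sum_add:
  assumes "X \<in> objs C" "Y \<in> objs C" "\<And>j. j < m + n \<Longrightarrow> f j \<in> Hom C X Y"
  shows "lin_sum C X Y f (m + n) = padd C (lin_sum C X Y f m) (lin_sum C X Y (\<lambda>j. f (m + j)) n)"
  using assms(3)
proof (induction n)
  case 0
  then show ?case by (simp add: lin_sum_0 padd_nul[OF lin_sum_Hom] assms)
next
  case (Suc n)
  then show ?case
    by (simp add: lin_sum_Suc less_Suc_eq_le padd_assoc[where X=X and Y=Y] lin_sum_Hom assms)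
qed

text \<open>The index \<open>a * n + b\<close> is the lexicographic position of the pair of
  \<open>a\<close> and \<open>b\<close>. This regrouping turns the sum in a product of Kronecker
  products into a double sum.\<close>

lemma lin_sum_mult:
  assumes "X \<in> objs C" "Y \<in> objs C" "\<And>j. j < m * n \<Longrightarrow> f j \<in> Hom C X Y"
  shows "lin_sum C X Y f (m * n) = lin_sum C X Y (\<lambda>a. lin_sum C X Y (\<lambda>b. f (a * n + b)) n) m"
  using assms(3)
proof (induction m)
  case 0
  then show ?case by (simp add: lin_sum_0)
next
  case (Suc m)
  have lt: "a * n + b < n + m * n" if "a \<le> m" "b < n" for a b
  proof -
    have "a * n \<le> m * n" using that by simp
    then show ?thesis using that by linarith
  qed
  have "lin_sum C X Y f (Suc m * n)
      = padd C (lin_sum C X Y f (m * n)) (lin_sum C X Y (\<lambda>b. f (m * n + b)) n)"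
    using lin_sum_add[of X Y "m * n" n f] assms Suc.prems by (simp add: add.commute)
  also have "\<dots> = padd C (lin_sum C X Y (\<lambda>a. lin_sum C X Y (\<lambda>b. f (a * n + b)) n) m)
      (lin_sum C X Y (\<lambda>b. f (m * n + b)) n)"
    using Suc by simp
  also have "\<dots> = lin_sum C X Y (\<lambda>a. lin_sum C X Y (\<lambda>b. f (a * n + b)) n) (Suc m)"
    using Suc.prems lt by (subst lin_sum_Suc) (simp_all add: lin_sum_Hom assms(1,2))
  finally show ?case .
qed

end

subsection \<open>Additive closure\<close>

abbreviation (input) tob :: "('o, 'm) lmcat \<Rightarrow> 'o list \<Rightarrow> 'o list \<Rightarrow> 'o list" where
  "tob C Xs Ys \<equiv> concat (map (\<lambda>X. map (tens_ob C X) Ys) Xs)"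

lemma length_tob: "length (tob C Xs Ys) = length Xs * length Ys"
  by (induction Xs) auto

lemma nth_tob:
  assumes "i < length Xs * length Ys"
  shows "tob C Xs Ys ! i = tens_ob C (Xs ! (i div length Ys)) (Ys ! (i mod length Ys))"
  using assms
proof (induction Xs arbitrary: i)
  case (Cons X Xs)
  show ?case
  proof (cases "i < length Ys")
    case True
    then show ?thesis by (simp add: nth_append)
  next
    case False
    then obtain j where j: "i = length Ys + j" using le_Suc_ex not_less by blast
    have "length Ys > 0" using Cons.prems by (cases "Ys = []") auto
    then have "i div length Ys = Suc (j div length Ys)" "i mod length Ys = j mod length Ys"
      using j by simp_all
    moreover have "j < length Xs * length Ys" using Cons.prems j by simp
    ultimately show ?thesis using Cons.IH[of j] j by (simp add: nth_append)
  qed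
qed simp

lemma additive_closure_sel:
  "objs (additive_closure C) = {Xs. set Xs \<subseteq> objs C}"
  "src (additive_closure C) = (\<lambda>(Xs, Ys, M). Xs)"
  "tgt (additive_closure C) = (\<lambda>(Xs, Ys, M). Ys)"
  "idn (additive_closure C) Xs = (Xs, Xs, mat (length Xs) (length Xs)
        (\<lambda>(i, j). if i = j then idn C (Xs ! i) else nul C (Xs ! j) (Xs ! i)))"
  "cmp (additive_closure C) (Ys', Zs, N) (Xs, Ys, M) = (Xs, Zs, mat (length Zs) (length Xs)
        (\<lambda>(i, k). lin_sum C (Xs ! k) (Zs ! i) (\<lambda>j. cmp C (N $$ (i, j)) (M $$ (j, k)))
          (length Ys)))"
  "nul (additive_closure C) Xs Ys
     = (Xs, Ys, mat (length Ys) (length Xs) (\<lambda>(i, j). nul C (Xs ! j) (Ys ! i)))"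
  "padd (additive_closure C) (Xs, Ys, M) (Xs', Ys'', M') = (Xs, Ys, mat (length Ys) (length Xs)
        (\<lambda>(i, j). padd C (M $$ (i, j)) (M' $$ (i, j))))"
  "scal (additive_closure C) r (Xs, Ys, M) = (Xs, Ys, mat (length Ys) (length Xs)
        (\<lambda>(i, j). scal C r (M $$ (i, j))))"
  "unit_ob (additive_closure C) = [unit_ob C]"
  "tens_ob (additive_closure C) Xs Ys = tob C Xs Ys"
  "tens (additive_closure C) (Xs, Ys, M) (Us, Vs, N) = (tob C Xs Us, tob C Ys Vs,
        mat (length Ys * length Vs) (length Xs * length Us)
          (\<lambda>(i, j). tens C (M $$ (i div length Vs, j div length Us))
                           (N $$ (i mod length Vs, j mod length Us))))"
  by (simp_all add: additive_closure_def Let_def)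

lemma Hom_additive_closure:
  "F \<in> Hom (additive_closure C) Xs Ys \<longleftrightarrow> set Xs \<subseteq> objs C \<and> set Ys \<subseteq> objs C \<and>
    (\<exists>M. F = (Xs, Ys, M) \<and> M \<in> carrier_mat (length Ys) (length Xs) \<and>
      (\<forall>i<length Ys. \<forall>j<length Xs. M $$ (i, j) \<in> Hom C (Xs ! j) (Ys ! i)))"
proof -
  have "arrs (additive_closure C) = {(Xs, Ys, M). set Xs \<subseteq> objs C \<and> set Ys \<subseteq> objs C \<and>
        M \<in> carrier_mat (length Ys) (length Xs) \<and>
        (\<forall>i<length Ys. \<forall>j<length Xs. M $$ (i, j) \<in> Hom C (Xs ! j) (Ys ! i))}"
    by (simp add: additive_closure_def Let_def)
  then show ?thesis
    by (cases F) (auto simp: Hom_def[of "additive_closure C"] additive_closure_sel)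
qed

lemma div_lt: "i < a * b \<Longrightarrow> i div b < (a::nat)"
  by (simp add: less_mult_imp_div_less)
lemma mod_lt: "i < a * b \<Longrightarrow> i mod b < (b::nat)"
  by (cases "b = 0") auto

lemma (in lin_mon_cat) tob_assoc:
  assumes "set Xs \<subseteq> objs C" "set Ys \<subseteq> objs C" "set Zs \<subseteq> objs C"
  shows "tob C (tob C Xs Ys) Zs = tob C Xs (tob C Ys Zs)"
proof -
  have map: "tob C (map (tens_ob C X) Us) Zs = map (tens_ob C X) (tob C Us Zs)"
    if "X \<in> objs C" "set Us \<subseteq> objs C" for X Us
    using that(2)
  proof (induction Us)
    case (Cons U Us)
    then have "map (tens_ob C (tens_ob C X U)) Zs = map (tens_ob C X) (map (tens_ob C U) Zs)"
      using that(1) assms(3) by (auto simp: tens_ob_assoc)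
    then show ?case using Cons by simp
  qed simp
  show ?thesis using assms(1)
  proof (induction Xs)
    case (Cons X Xs)
    then show ?case using map[of X Ys] assms(2) by simp
  qed simp
qed

text \<open>Matrices over a linear category multiply and tensor as they do over a ring: each axiom
  is checked entrywise and reduces to axioms of \<open>C\<close> and the laws of finite
  sums.\<close>

lemma (in lin_mon_cat) lin_mon_cat_additive_closure: "lin_mon_cat (additive_closure C)"
proof -
  let ?A = "additive_closure C"
  note sel = additive_closure_sel
  have ob: "Xs ! i \<in> objs C" if "set Xs \<subseteq> objs C" "i < length Xs" for Xs i
    using that by auto
  show ?thesis
  proof
    fix f X Y assume "f \<in> Hom ?A X Y"
    then show "X \<in> objs ?A \<and> Y \<in> objs ?A" by (simp add: Hom_additive_closure sel)
  next
    fix X assume "X \<in> objs ?A"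
    then show "idn ?A X \<in> Hom ?A X X"
      by (auto simp: Hom_additive_closure sel intro!: idn nul ob)
  next
    fix g Y Z f X assume "g \<in> Hom ?A Y Z" "f \<in> Hom ?A X Y"
    then obtain F G where d: "f = (X, Y, F)" "g = (Y, Z, G)"
      "set X \<subseteq> objs C" "set Y \<subseteq> objs C" "set Z \<subseteq> objs C"
      and t: "\<And>i j. i < length Y \<Longrightarrow> j < length X \<Longrightarrow> F $$ (i,j) \<in> Hom C (X ! j) (Y ! i)"
        "\<And>i j. i < length Z \<Longrightarrow> j < length Y \<Longrightarrow> G $$ (i,j) \<in> Hom C (Y ! j) (Z ! i)"
      by (auto simp: Hom_additive_closure)
    have "lin_sum C (X ! k) (Z ! i) (\<lambda>j. cmp C (G $$ (i, j)) (F $$ (j, k))) (length Y)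
        \<in> Hom C (X ! k) (Z ! i)" if "i < length Z" "k < length X" for i k
      using that d by (auto intro!: lin_sum_Hom cmp ob t)
    then show "cmp ?A g f \<in> Hom ?A X Z"
      unfolding Hom_additive_closure d sel using d by simp
  next
    fix X Y assume "X \<in> objs ?A" "Y \<in> objs ?A"
    then show "nul ?A X Y \<in> Hom ?A X Y"
      by (auto simp: Hom_additive_closure sel intro!: nul ob)
  next
    fix f X Y g assume "f \<in> Hom ?A X Y" "g \<in> Hom ?A X Y"
    then show "padd ?A f g \<in> Hom ?A X Y"
      by (auto simp: Hom_additive_closure sel intro!: padd)
  next
    fix f X Y r assume "f \<in> Hom ?A X Y"
    then show "scal ?A r f \<in> Hom ?A X Y"
      by (auto simp: Hom_additive_closure sel intro!: scal)
  next
    fix f X Y g X' Y' assume "f \<in> Hom ?A X Y" "g \<in> Hom ?A X' Y'"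
    then obtain F G where d: "f = (X, Y, F)" "g = (X', Y', G)"
      "set X \<subseteq> objs C" "set Y \<subseteq> objs C" "set X' \<subseteq> objs C" "set Y' \<subseteq> objs C"
      and t: "\<And>i j. i < length Y \<Longrightarrow> j < length X \<Longrightarrow> F $$ (i,j) \<in> Hom C (X ! j) (Y ! i)"
        "\<And>i j. i < length Y' \<Longrightarrow> j < length X' \<Longrightarrow> G $$ (i,j) \<in> Hom C (X' ! j) (Y' ! i)"
      by (auto simp: Hom_additive_closure)
    have "set (tob C X X') \<subseteq> objs C" "set (tob C Y Y') \<subseteq> objs C"
      using d by (auto intro!: tens_ob)
    moreover have "tens C (F $$ (i div length Y', j div length X')) (G $$ (i mod length Y', j mod
        length X'))
       \<in> Hom C (tob C X X' ! j) (tob C Y Y' ! i)"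
      if "i < length Y * length Y'" "j < length X * length X'" for i j
      using that by (simp add: nth_tob tens t div_lt mod_lt)
    ultimately show "tens ?A f g \<in> Hom ?A (tens_ob ?A X X') (tens_ob ?A Y Y')"
      unfolding Hom_additive_closure d sel by (simp add: length_tob)
  next
    show "unit_ob ?A \<in> objs ?A" by (simp add: sel unit_ob)
  next
    fix X Y assume "X \<in> objs ?A" "Y \<in> objs ?A"
    then show "tens_ob ?A X Y \<in> objs ?A" by (auto simp: sel intro!: tens_ob)
  next
    fix h Z U g Y f X assume "h \<in> Hom ?A Z U" "g \<in> Hom ?A Y Z" "f \<in> Hom ?A X Y"
    then obtain H G F where d: "h = (Z, U, H)" "g = (Y, Z, G)" "f = (X, Y, F)"
      "set X \<subseteq> objs C" "set Y \<subseteq> objs C" "set Z \<subseteq> objs C" "set U \<subseteq> objs C"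
      and t: "\<And>i j. i < length U \<Longrightarrow> j < length Z \<Longrightarrow> H $$ (i,j) \<in> Hom C (Z ! j) (U ! i)"
        "\<And>i j. i < length Z \<Longrightarrow> j < length Y \<Longrightarrow> G $$ (i,j) \<in> Hom C (Y ! j) (Z ! i)"
        "\<And>i j. i < length Y \<Longrightarrow> j < length X \<Longrightarrow> F $$ (i,j) \<in> Hom C (X ! j) (Y ! i)"
      by (auto simp: Hom_additive_closure)
    \<comment> \<open>Both sides are the same double sum over the two middle indices, taken in
      opposite order.\<close>
    have "lin_sum C (X ! k) (U ! i) (\<lambda>j. cmp C (lin_sum C (Y ! j) (U ! i)
          (\<lambda>l. cmp C (H $$ (i, l)) (G $$ (l, j))) (length Z)) (F $$ (j, k))) (length Y)
        = lin_sum C (X ! k) (U ! i) (\<lambda>l. cmp C (H $$ (i, l)) (lin_sum C (X ! k) (Z ! l)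
          (\<lambda>j. cmp C (G $$ (l, j)) (F $$ (j, k))) (length Y))) (length Z)" (is "?l = ?r")
      if ik: "i < length U" "k < length X" for i k
    proof -
      have "?l = lin_sum C (X ! k) (U ! i) (\<lambda>j. lin_sum C (X ! k) (U ! i)
          (\<lambda>l. cmp C (H $$ (i, l)) (cmp C (G $$ (l, j)) (F $$ (j, k)))) (length Z)) (length Y)"
        using d ik
        by (intro lin_sum_cong, subst lin_sum_cmp)
           (auto intro!: lin_sum_cong cmp_assoc t ob cmp)
      also have "\<dots> = lin_sum C (X ! k) (U ! i) (\<lambda>l. lin_sum C (X ! k) (U ! i)
          (\<lambda>j. cmp C (H $$ (i, l)) (cmp C (G $$ (l, j)) (F $$ (j, k)))) (length Y)) (length Z)"
        using d ik by (intro lin_sum_swap) (auto intro!: ob cmp t)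
      also have "\<dots> = ?r"
        using d ik
        by (intro lin_sum_cong, subst cmp_lin_sum) (auto intro!: t ob cmp)
      finally show ?thesis .
    qed
    then show "cmp ?A (cmp ?A h g) f = cmp ?A h (cmp ?A g f)"
      by (auto simp: d sel cong: lin_sum_cong intro!: eq_matI)
  next
    fix f X Y assume "f \<in> Hom ?A X Y"
    then obtain F where d: "f = (X, Y, F)" "set X \<subseteq> objs C" "set Y \<subseteq> objs C"
      "F \<in> carrier_mat (length Y) (length X)"
      and t: "\<And>i j. i < length Y \<Longrightarrow> j < length X \<Longrightarrow> F $$ (i,j) \<in> Hom C (X ! j) (Y ! i)"
      by (auto simp: Hom_additive_closure)
    have *: "lin_sum C (X ! k) (Y ! i) (\<lambda>j. cmp C (F $$ (i, j))
       (mat (length X) (length X) (\<lambda>(i, j). if i = j then idn C (X ! i) else nul C (X ! j) (X !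
           i)) $$ (j, k)))
       (length X) = F $$ (i, k)" if "i < length Y" "k < length X" for i k
      using that d by (subst lin_sum_single[where i=k]) (auto intro!: t simp: ob cmp_idn[OF t]
          cmp_nul(1)[OF t])
    have **: "lin_sum C (X ! k) (Y ! i) (\<lambda>j. cmp C
       (mat (length Y) (length Y) (\<lambda>(i, j). if i = j then idn C (Y ! i) else nul C (Y ! j) (Y !
           i)) $$ (i, j)) (F $$ (j, k)))
       (length Y) = F $$ (i, k)" if "i < length Y" "k < length X" for i k
      using that d by (subst lin_sum_single[where i=i]) (auto intro!: t simp: ob cmp_idn[OF t]
          cmp_nul(2)[OF t])
    show "cmp ?A f (idn ?A X) = f" using d * by (auto simp: sel intro!: eq_matI)
    show "cmp ?A (idn ?A Y) f = f" using d ** by (auto simp: sel intro!: eq_matI)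
    show "padd ?A f (nul ?A X Y) = f" using d
      by (auto simp: sel intro!: eq_matI simp: padd_nul[OF t])
    show "tens ?A f (idn ?A (unit_ob ?A)) = f" using d
      by (auto simp: sel intro!: eq_matI simp: tens_unit[OF t] concat_map_singleton
          tens_ob_unit map_idI subset_iff)
    show "tens ?A (idn ?A (unit_ob ?A)) f = f" using d
      by (auto simp: sel intro!: eq_matI simp: tens_unit[OF t] tens_ob_unit map_idI subset_iff)
    fix Z assume "Z \<in> objs ?A"
    then have Z: "set Z \<subseteq> objs C" by (simp add: sel)
    show "cmp ?A f (nul ?A Z X) = nul ?A Z Y" using d Z
      by (auto simp: sel ob cmp_nul(1)[OF t] intro!: eq_matI lin_sum_nul)
    show "cmp ?A (nul ?A Y Z) f = nul ?A X Z" using d Z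
      by (auto simp: sel ob cmp_nul(2)[OF t] intro!: eq_matI lin_sum_nul)
  next
    fix h Y Z f X g assume "h \<in> Hom ?A Y Z" "f \<in> Hom ?A X Y" "g \<in> Hom ?A X Y"
    then obtain H G F where d: "h = (Y, Z, H)" "g = (X, Y, G)" "f = (X, Y, F)"
      "set X \<subseteq> objs C" "set Y \<subseteq> objs C" "set Z \<subseteq> objs C"
      and t: "\<And>i j. i < length Z \<Longrightarrow> j < length Y \<Longrightarrow> H $$ (i,j) \<in> Hom C (Y ! j) (Z ! i)"
        "\<And>i j. i < length Y \<Longrightarrow> j < length X \<Longrightarrow> G $$ (i,j) \<in> Hom C (X ! j) (Y ! i)"
        "\<And>i j. i < length Y \<Longrightarrow> j < length X \<Longrightarrow> F $$ (i,j) \<in> Hom C (X ! j) (Y ! i)"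
      by (auto simp: Hom_additive_closure)
    have "lin_sum C (X ! k) (Z ! i) (\<lambda>j. cmp C (H $$ (i, j)) (padd C (F $$ (j, k)) (G $$ (j, k))))
        (length Y)
      = padd C (lin_sum C (X ! k) (Z ! i) (\<lambda>j. cmp C (H $$ (i, j)) (F $$ (j, k))) (length Y))
          (lin_sum C (X ! k) (Z ! i) (\<lambda>j. cmp C (H $$ (i, j)) (G $$ (j, k))) (length Y))"
      if "i < length Z" "k < length X" for i k
      using d that by (subst lin_sum_padd[symmetric])
        (auto intro!: ob cmp t lin_sum_cong cmp_padd)
    then show "cmp ?A h (padd ?A f g) = padd ?A (cmp ?A h f) (cmp ?A h g)"
      by (auto simp: d sel cong: lin_sum_cong intro!: eq_matI)
  next
    fix f Y Z g h X assume "f \<in> Hom ?A Y Z" "g \<in> Hom ?A Y Z" "h \<in> Hom ?A X Y"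
    then obtain H G F where d: "h = (X, Y, H)" "g = (Y, Z, G)" "f = (Y, Z, F)"
      "set X \<subseteq> objs C" "set Y \<subseteq> objs C" "set Z \<subseteq> objs C"
      and t: "\<And>i j. i < length Y \<Longrightarrow> j < length X \<Longrightarrow> H $$ (i,j) \<in> Hom C (X ! j) (Y ! i)"
        "\<And>i j. i < length Z \<Longrightarrow> j < length Y \<Longrightarrow> G $$ (i,j) \<in> Hom C (Y ! j) (Z ! i)"
        "\<And>i j. i < length Z \<Longrightarrow> j < length Y \<Longrightarrow> F $$ (i,j) \<in> Hom C (Y ! j) (Z ! i)"
      by (auto simp: Hom_additive_closure)
    have "lin_sum C (X ! k) (Z ! i) (\<lambda>j. cmp C (padd C (F $$ (i, j)) (G $$ (i, j))) (H $$ (j, k)))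
        (length Y)
      = padd C (lin_sum C (X ! k) (Z ! i) (\<lambda>j. cmp C (F $$ (i, j)) (H $$ (j, k))) (length Y))
          (lin_sum C (X ! k) (Z ! i) (\<lambda>j. cmp C (G $$ (i, j)) (H $$ (j, k))) (length Y))"
      if "i < length Z" "k < length X" for i k
      using d that by (subst lin_sum_padd[symmetric])
        (auto intro!: ob cmp t lin_sum_cong cmp_padd)
    then show "cmp ?A (padd ?A f g) h = padd ?A (cmp ?A f h) (cmp ?A g h)"
      by (auto simp: d sel cong: lin_sum_cong intro!: eq_matI)
  next
    fix h Y Z f X r assume "h \<in> Hom ?A Y Z" "f \<in> Hom ?A X Y"
    then obtain H F where d: "h = (Y, Z, H)" "f = (X, Y, F)"
      "set X \<subseteq> objs C" "set Y \<subseteq> objs C" "set Z \<subseteq> objs C"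
      and t: "\<And>i j. i < length Z \<Longrightarrow> j < length Y \<Longrightarrow> H $$ (i,j) \<in> Hom C (Y ! j) (Z ! i)"
        "\<And>i j. i < length Y \<Longrightarrow> j < length X \<Longrightarrow> F $$ (i,j) \<in> Hom C (X ! j) (Y ! i)"
      by (auto simp: Hom_additive_closure)
    have "lin_sum C (X ! k) (Z ! i) (\<lambda>j. cmp C (H $$ (i, j)) (scal C r (F $$ (j, k)))) (length Y)
      = scal C r (lin_sum C (X ! k) (Z ! i) (\<lambda>j. cmp C (H $$ (i, j)) (F $$ (j, k))) (length Y))"
      "lin_sum C (X ! k) (Z ! i) (\<lambda>j. cmp C (scal C r (H $$ (i, j))) (F $$ (j, k))) (length Y)
      = scal C r (lin_sum C (X ! k) (Z ! i) (\<lambda>j. cmp C (H $$ (i, j)) (F $$ (j, k))) (length Y))"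
      if "i < length Z" "k < length X" for i k
      using d that by (subst lin_sum_scal[symmetric],
        auto intro!: ob cmp t lin_sum_cong cmp_scal)+
    then show "cmp ?A h (scal ?A r f) = scal ?A r (cmp ?A h f)"
      "cmp ?A (scal ?A r h) f = scal ?A r (cmp ?A h f)"
      by (auto simp: d sel cong: lin_sum_cong intro!: eq_matI)
  next
    fix f X Y g r assume "f \<in> Hom ?A X Y" "g \<in> Hom ?A X Y"
    then show "scal ?A r (padd ?A f g) = padd ?A (scal ?A r f) (scal ?A r g)"
      by (auto simp: Hom_additive_closure sel intro!: eq_matI) (blast intro: scal_padd)
  next
    fix X Y r assume "X \<in> objs ?A" "Y \<in> objs ?A"
    then show "scal ?A r (nul ?A X Y) = nul ?A X Y"
      by (auto simp: sel intro!: eq_matI scal_nul ob)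
  next
    fix f X Y g h assume "f \<in> Hom ?A X Y" "g \<in> Hom ?A X Y" "h \<in> Hom ?A X Y"
    then show "padd ?A (padd ?A f g) h = padd ?A f (padd ?A g h)"
      by (auto simp: Hom_additive_closure sel intro!: eq_matI) (blast intro: padd_assoc)
  next
    fix f X Y g assume "f \<in> Hom ?A X Y" "g \<in> Hom ?A X Y"
    then show "padd ?A f g = padd ?A g f"
      by (auto simp: Hom_additive_closure sel intro!: eq_matI) (blast intro: padd_comm)
  next
    fix X Y assume "X \<in> objs ?A" "Y \<in> objs ?A"
    then have o: "set X \<subseteq> objs C" "set Y \<subseteq> objs C" by (simp_all add: sel)
    show "tens ?A (idn ?A X) (idn ?A Y) = idn ?A (tens_ob ?A X Y)"
    proof -
      \<comment> \<open>An entry of the Kronecker product of two identity matrices is an identity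
        only if the quotients and the remainders of its indices agree, that is, on the
        diagonal.\<close>
      have "i = j" if "i mod length Y = j mod length Y" "i div length Y = j div length Y" for i j
        using that by (metis div_mult_mod_eq)
      then show ?thesis using o
        by (auto simp: sel length_tob nth_tob div_lt mod_lt tens_idn ob
          tens_nul[OF nul] tens_nul[OF idn] intro!: eq_matI)
    qed
  next
    fix g Y Z f X g' Y' Z' f' X'
    assume "g \<in> Hom ?A Y Z" "f \<in> Hom ?A X Y" "g' \<in> Hom ?A Y' Z'" "f' \<in> Hom ?A X' Y'"
    then obtain G F G' F' where d: "g = (Y, Z, G)" "f = (X, Y, F)" "g' = (Y', Z', G')" "f' = (X',
        Y', F')"
      "set X \<subseteq> objs C" "set Y \<subseteq> objs C" "set Z \<subseteq> objs C"
      "set X' \<subseteq> objs C" "set Y' \<subseteq> objs C" "set Z' \<subseteq> objs C"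
      and t: "\<And>i j. i < length Z \<Longrightarrow> j < length Y \<Longrightarrow> G $$ (i,j) \<in> Hom C (Y ! j) (Z ! i)"
        "\<And>i j. i < length Y \<Longrightarrow> j < length X \<Longrightarrow> F $$ (i,j) \<in> Hom C (X ! j) (Y ! i)"
        "\<And>i j. i < length Z' \<Longrightarrow> j < length Y' \<Longrightarrow> G' $$ (i,j) \<in> Hom C (Y' ! j) (Z' ! i)"
        "\<And>i j. i < length Y' \<Longrightarrow> j < length X' \<Longrightarrow> F' $$ (i,j) \<in> Hom C (X' ! j) (Y' ! i)"
      by (auto simp: Hom_additive_closure)
    have dm: "(j * m + j') div m = j \<and> (j * m + j') mod m = j'" if "j' < m" for j j' m :: nat
      using that by auto
    \<comment> \<open>The mixed product rule for Kronecker products: the tensor product of two sums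
      is a double sum, which \<open>lin_sum_mult\<close> reads as one sum over the composite
      index.\<close>
    have "tens C (lin_sum C (X ! k) (Z ! i) (\<lambda>j. cmp C (G $$ (i, j)) (F $$ (j, k))) (length Y))
          (lin_sum C (X' ! k') (Z' ! i') (\<lambda>j. cmp C (G' $$ (i', j)) (F' $$ (j, k'))) (length Y'))
      = lin_sum C (tens_ob C (X ! k) (X' ! k')) (tens_ob C (Z ! i) (Z' ! i'))
         (\<lambda>j. cmp C (tens C (G $$ (i, j div length Y')) (G' $$ (i', j mod length Y')))
           (tens C (F $$ (j div length Y', k)) (F' $$ (j mod length Y', k'))))
          (length Y * length Y')" (is "?l = ?r")
      if ik: "i < length Z" "k < length X" "i' < length Z'" "k' < length X'" for i k i' k'
    proof -
      let ?X = "tens_ob C (X ! k) (X' ! k')" and ?Z = "tens_ob C (Z ! i) (Z' ! i')"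
      have "?l = lin_sum C ?X ?Z (\<lambda>j. lin_sum C ?X ?Z (\<lambda>j'.
          tens C (cmp C (G $$ (i, j)) (F $$ (j, k))) (cmp C (G' $$ (i', j')) (F' $$ (j', k'))))
              (length Y')) (length Y)"
        using d ik by (subst lin_sum_tens) (auto intro!: ob cmp t lin_sum_cong lin_sum_Hom
            tens_lin_sum)
      also have "\<dots> = lin_sum C ?X ?Z (\<lambda>j. lin_sum C ?X ?Z (\<lambda>j'.
          cmp C (tens C (G $$ (i, (j * length Y' + j') div length Y')) (G' $$ (i', (j * length Y'
              + j') mod length Y')))
           (tens C (F $$ ((j * length Y' + j') div length Y', k)) (F' $$ ((j * length Y' + j') mod
               length Y', k'))))
            (length Y')) (length Y)"
        using d ik by (intro lin_sum_cong) (simp add: dm interchange[OF t(1) t(2) t(3) t(4)])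
      also have "\<dots> = ?r"
        using d ik by (subst lin_sum_mult) (auto intro!: cmp tens t tens_ob ob div_lt mod_lt)
      finally show ?thesis .
    qed
    note eq = this
    have eq': "lin_sum C (tob C X X' ! k) (tob C Z Z' ! i)
         (\<lambda>j. cmp C (mat (length Z * length Z') (length Y * length Y')
            (\<lambda>(i, j). tens C (G $$ (i div length Z', j div length Y')) (G' $$ (i mod length Z', j
                mod length Y'))) $$ (i, j))
           (mat (length Y * length Y') (length X * length X')
            (\<lambda>(i, j). tens C (F $$ (i div length Y', j div length X')) (F' $$ (i mod length Y', j
                mod length X'))) $$ (j, k)))
          (length Y * length Y')
        = tens C (lin_sum C (X ! (k div length X')) (Z ! (i div length Z')) (\<lambda>j. cmp C (G $$ (i
            div length Z', j)) (F $$ (j, k div length X'))) (length Y))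
          (lin_sum C (X' ! (k mod length X')) (Z' ! (i mod length Z')) (\<lambda>j. cmp C (G' $$ (i mod
              length Z', j)) (F' $$ (j, k mod length X'))) (length Y'))"
      if "i < length Z * length Z'" "k < length X * length X'" for i k
      using that
      by (subst eq) (auto simp: div_lt mod_lt nth_tob intro!: lin_sum_cong)
    show "tens ?A (cmp ?A g f) (cmp ?A g' f') = cmp ?A (tens ?A g g') (tens ?A f f')"
      using eq' by (auto simp: d sel length_tob div_lt mod_lt intro!: eq_matI)
  next
    fix f X Y X' Y' assume "f \<in> Hom ?A X Y" "X' \<in> objs ?A" "Y' \<in> objs ?A"
    then obtain F where d: "f = (X, Y, F)" "set X \<subseteq> objs C" "set Y \<subseteq> objs C"
       "set X' \<subseteq> objs C" "set Y' \<subseteq> objs C"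
      and t: "\<And>i j. i < length Y \<Longrightarrow> j < length X \<Longrightarrow> F $$ (i,j) \<in> Hom C (X ! j) (Y ! i)"
      by (auto simp: Hom_additive_closure sel)
    then show "tens ?A f (nul ?A X' Y') = nul ?A (tens_ob ?A X X') (tens_ob ?A Y Y')"
      "tens ?A (nul ?A X' Y') f = nul ?A (tens_ob ?A X' X) (tens_ob ?A Y' Y)"
      by (auto simp: d sel length_tob nth_tob div_lt mod_lt ob tens_nul[OF t] intro!: eq_matI)
  next
    fix h X Y f X' Y' g assume "h \<in> Hom ?A X Y" "f \<in> Hom ?A X' Y'" "g \<in> Hom ?A X' Y'"
    then obtain H F G where d: "h = (X, Y, H)" "f = (X', Y', F)" "g = (X', Y', G)"
      and t: "\<And>i j. i < length Y \<Longrightarrow> j < length X \<Longrightarrow> H $$ (i,j) \<in> Hom C (X ! j) (Y ! i)"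
       "\<And>i j. i < length Y' \<Longrightarrow> j < length X' \<Longrightarrow> F $$ (i,j) \<in> Hom C (X' ! j) (Y' ! i)"
       "\<And>i j. i < length Y' \<Longrightarrow> j < length X' \<Longrightarrow> G $$ (i,j) \<in> Hom C (X' ! j) (Y' ! i)"
      by (auto simp: Hom_additive_closure)
    then show "tens ?A h (padd ?A f g) = padd ?A (tens ?A h f) (tens ?A h g)"
      "tens ?A (padd ?A f g) h = padd ?A (tens ?A f h) (tens ?A g h)"
      by (auto simp: d sel length_tob div_lt mod_lt intro!: eq_matI tens_padd[OF t(1) t(2) t(3)])
  next
    fix X Y Z assume "X \<in> objs ?A" "Y \<in> objs ?A" "Z \<in> objs ?A"
    then have o: "set X \<subseteq> objs C" "set Y \<subseteq> objs C" "set Z \<subseteq> objs C" by (simp_all add: sel)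
    show assoc: "tens_ob ?A (tens_ob ?A X Y) Z = tens_ob ?A X (tens_ob ?A Y Z)"
      using o by (simp add: sel tob_assoc)
  next
    fix X assume "X \<in> objs ?A"
    then have o: "set X \<subseteq> objs C" by (simp add: sel)
    show "tens_ob ?A X (unit_ob ?A) = X" "tens_ob ?A (unit_ob ?A) X = X"
      using o by (auto simp: sel concat_map_singleton tens_ob_unit map_idI subset_iff)
  next
    fix f X Y g X' Y' h X'' Y''
    assume "f \<in> Hom ?A X Y" "g \<in> Hom ?A X' Y'" "h \<in> Hom ?A X'' Y''"
    then obtain F G H where d: "f = (X, Y, F)" "g = (X', Y', G)" "h = (X'', Y'', H)"
      "set X \<subseteq> objs C" "set Y \<subseteq> objs C" "set X' \<subseteq> objs C" "set Y' \<subseteq> objs C"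
      "set X'' \<subseteq> objs C" "set Y'' \<subseteq> objs C"
      and t: "\<And>i j. i < length Y \<Longrightarrow> j < length X \<Longrightarrow> F $$ (i,j) \<in> Hom C (X ! j) (Y ! i)"
       "\<And>i j. i < length Y' \<Longrightarrow> j < length X' \<Longrightarrow> G $$ (i,j) \<in> Hom C (X' ! j) (Y' ! i)"
       "\<And>i j. i < length Y'' \<Longrightarrow> j < length X'' \<Longrightarrow> H $$ (i,j) \<in> Hom C (X'' ! j) (Y'' ! i)"
      by (auto simp: Hom_additive_closure)
    \<comment> \<open>Index arithmetic for a triple tensor product: splitting off the last factor
      first or the first factor first yields the same three digits of \<open>i\<close>.\<close>
    have *: "i div c < a * b \<and> i mod c < c \<and> i div c div b < a \<and> i div c mod b < b \<and> i mod (b * c)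
        < b * c
       \<and> i mod (b * c) div c = i div c mod b \<and> i mod (b * c) mod c = i mod c \<and> i div (b * c) = i
           div c div b"
      if "i < a * b * c" for i a b c :: nat
    proof -
      have "i < a * (b * c)" using that by (simp add: ac_simps)
      then have "i mod (b * c) < b * c" by (rule mod_lt)
      moreover have "i div (b * c) = i div c div b" by (metis div_mult2_eq mult.commute)
      moreover have "i mod (b * c) = c * (i div c mod b) + i mod c"
        by (metis mod_mult2_eq mult.commute)
      moreover have 1: "i div c < a * b" "i mod c < c" using that by (auto intro: div_lt mod_lt)
      ultimately show ?thesis using div_lt[OF 1(1)] mod_lt[OF 1(1)] by auto
    qed
    show "tens ?A (tens ?A f g) h = tens ?A f (tens ?A g h)"
    proof -
      have "mat (length Y * length Y' * length Y'') (length X * length X' * length X'')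
          (\<lambda>(i, j). tens C (mat (length Y * length Y') (length X * length X')
            (\<lambda>(i, j). tens C (F $$ (i div length Y', j div length X')) (G $$ (i mod length Y', j
                mod length X')))
              $$ (i div length Y'', j div length X'')) (H $$ (i mod length Y'', j mod length X'')))
        = mat (length Y * (length Y' * length Y'')) (length X * (length X' * length X''))
          (\<lambda>(i, j). tens C (F $$ (i div (length Y' * length Y''), j div (length X' * length X'')))
            (mat (length Y' * length Y'') (length X' * length X'')
            (\<lambda>(i, j). tens C (G $$ (i div length Y'', j div length X'')) (H $$ (i mod length Y'',
                j mod length X'')))
              $$ (i mod (length Y' * length Y''), j mod (length X' * length X''))))" (is "?l = ?r")
      proof (rule eq_matI)
        fix i j assume "i < dim_row ?r" "j < dim_col ?r"
        then have ij: "i < length Y * length Y' * length Y''" "j < length X * length X' * length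
            X''"
          by (simp_all add: ac_simps)
        have "?l $$ (i, j) = tens C (tens C (F $$ (i div length Y'' div length Y', j div length
            X'' div length X'))
           (G $$ (i div length Y'' mod length Y', j div length X'' mod length X')))
           (H $$ (i mod length Y'', j mod length X''))"
          using ij *[OF ij(1)] *[OF ij(2)] by simp
        also have "\<dots> = tens C (F $$ (i div length Y'' div length Y', j div length X'' div length
            X'))
           (tens C (G $$ (i div length Y'' mod length Y', j div length X'' mod length X'))
           (H $$ (i mod length Y'', j mod length X'')))"
          using *[OF ij(1)] *[OF ij(2)] by (intro tens_assoc[OF t(1) t(2) t(3)]) auto
        also have "\<dots> = ?r $$ (i, j)"
          using ij *[OF ij(1)] *[OF ij(2)] by (simp add: mult.assoc)
        finally show "?l $$ (i, j) = ?r $$ (i, j)" .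
      qed (simp_all add: mult.assoc)
      then show ?thesis using d by (simp add: sel length_tob tob_assoc)
    qed
  qed
qed

subsection \<open>Karoubi envelope\<close>

lemma karoubi_sel:
  "objs (karoubi C) = {(X, e). X \<in> objs C \<and> e \<in> Hom C X X \<and> cmp C e e = e}"
  "src (karoubi C) = (\<lambda>(A, B, m). A)"
  "tgt (karoubi C) = (\<lambda>(A, B, m). B)"
  "idn (karoubi C) (X, e) = ((X, e), (X, e), e)"
  "cmp (karoubi C) (B', D, n) (A, B, m) = (A, D, cmp C n m)"
  "nul (karoubi C) A B = (A, B, nul C (fst A) (fst B))"
  "padd (karoubi C) (A, B, m) (A', B'', m') = (A, B, padd C m m')"
  "scal (karoubi C) r (A, B, m) = (A, B, scal C r m)"
  "unit_ob (karoubi C) = (unit_ob C, idn C (unit_ob C))"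
  "tens_ob (karoubi C) (X, e) (Y, f) = (tens_ob C X Y, tens C e f)"
  "tens (karoubi C) (A, B, m) (A'', B''', m') =
    (tens_ob (karoubi C) A A'', tens_ob (karoubi C) B B''', tens C m m')"
  by (simp_all add: karoubi_def Let_def)

lemma Hom_karoubi:
  "F \<in> Hom (karoubi C) A B \<longleftrightarrow> A \<in> objs (karoubi C) \<and> B \<in> objs (karoubi C) \<and>
    (\<exists>m. F = (A, B, m) \<and> m \<in> Hom C (fst A) (fst B) \<and> cmp C (snd B) (cmp C m (snd A)) = m)"
proof -
  have "arrs (karoubi C) = {((X, e), (Y, f), m). (X, e) \<in> objs (karoubi C) \<and>
     (Y, f) \<in> objs (karoubi C) \<and> m \<in> Hom C X Y \<and> cmp C f (cmp C m e) = m}"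
    by (simp add: karoubi_def Let_def)
  then show ?thesis
    by (cases F; cases A; cases B) (auto simp: Hom_def[of "karoubi C"] karoubi_sel(2,3))
qed

context lin_mon_cat begin

lemma karoubi_objE:
  assumes "A \<in> objs (karoubi C)"
  obtains X e where "A = (X, e)" "X \<in> objs C" "e \<in> Hom C X X" "cmp C e e = e"
  using assms by (auto simp: karoubi_sel)

text \<open>As \<open>e\<close> and \<open>f\<close> are idempotent, the single condition on
  \<open>m\<close> in the envelope splits into the two one-sided conditions. In this form the axioms
  of the envelope follow from those of \<open>C\<close> by rewriting.\<close>

lemma karoubi_HomE:
  assumes "F \<in> Hom (karoubi C) A B"
  obtains X e Y f m where "A = (X, e)" "B = (Y, f)" "F = (A, B, m)"
    "X \<in> objs C" "e \<in> Hom C X X" "cmp C e e = e"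
    "Y \<in> objs C" "f \<in> Hom C Y Y" "cmp C f f = f"
    "m \<in> Hom C X Y" "cmp C m e = m" "cmp C f m = m"
proof -
  from assms obtain X e Y f m where d: "A = (X, e)" "B = (Y, f)" "F = (A, B, m)"
    "X \<in> objs C" "e \<in> Hom C X X" "cmp C e e = e"
    "Y \<in> objs C" "f \<in> Hom C Y Y" "cmp C f f = f"
    "m \<in> Hom C X Y" and fme: "cmp C f (cmp C m e) = m"
    by (cases A; cases B) (auto simp: Hom_karoubi karoubi_sel(1))
  have "cmp C m e = cmp C (cmp C f (cmp C m e)) e" using fme by simp
  also have "\<dots> = cmp C f (cmp C m (cmp C e e))"
    using d by (simp add: cmp_assoc[OF d(8) cmp[OF d(10,5)] d(5)] cmp_assoc[OF d(10,5,5)])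
  finally have "cmp C m e = m" using d fme by simp
  moreover have "cmp C f m = cmp C (cmp C f f) (cmp C m e)" using fme d
    by (metis cmp_assoc cmp)
  ultimately show ?thesis using that d fme by simp
qed

lemma karoubi_HomI:
  assumes "(X, e) \<in> objs (karoubi C)" "(Y, f) \<in> objs (karoubi C)"
    "m \<in> Hom C X Y" "cmp C m e = m" "cmp C f m = m"
  shows "((X, e), (Y, f), m) \<in> Hom (karoubi C) (X, e) (Y, f)"
  using assms by (simp add: Hom_karoubi)

lemma lin_mon_cat_karoubi: "lin_mon_cat (karoubi C)"
proof -
  let ?K = "karoubi C"
  note sel = karoubi_sel
  note E = karoubi_HomE
  have tob: "tens_ob ?K A B \<in> objs ?K" if AB: "A \<in> objs ?K" "B \<in> objs ?K" for A B
  proof -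
    from AB obtain X e Y f where d: "A = (X, e)" "X \<in> objs C" "e \<in> Hom C X X" "cmp C e e = e"
      "B = (Y, f)" "Y \<in> objs C" "f \<in> Hom C Y Y" "cmp C f f = f"
      by (auto elim!: karoubi_objE)
    then show ?thesis
      by (simp add: sel tens_ob tens interchange[symmetric, OF d(3,3,7,7)])
  qed
  have Hom_obj: "A \<in> objs ?K \<and> B \<in> objs ?K" if "F \<in> Hom ?K A B" for F A B
    using that by (simp add: Hom_karoubi)
  show ?thesis
  proof
    fix f X Y assume "f \<in> Hom ?K X Y"
    then show "X \<in> objs ?K \<and> Y \<in> objs ?K" by (rule Hom_obj)
  next
    fix X assume "X \<in> objs ?K"
    then show "idn ?K X \<in> Hom ?K X X" by (auto simp: sel intro!: karoubi_HomI)
  next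
    fix g Y Z f X assume g: "g \<in> Hom ?K Y Z" and f: "f \<in> Hom ?K X Y"
    then obtain m n where d: "g = (Y, Z, n)" "f = (X, Y, m)"
      and t: "m \<in> Hom C (fst X) (fst Y)" "n \<in> Hom C (fst Y) (fst Z)" 
        "snd X \<in> Hom C (fst X) (fst X)" "snd Z \<in> Hom C (fst Z) (fst Z)"
      and eq: "cmp C m (snd X) = m" "cmp C (snd Z) n = n"
      by (fastforce elim!: E)
    have "cmp C (snd Z) (cmp C (cmp C n m) (snd X)) = cmp C (cmp C (snd Z) n) (cmp C m (snd X))"
      by (simp only: cmp_assoc[OF t(2,1,3)] cmp_assoc[OF t(4,2) cmp[OF t(1,3)]])
    then show "cmp ?K g f \<in> Hom ?K X Z"
      using d t Hom_obj[OF g] Hom_obj[OF f] by (simp add: Hom_karoubi sel(5) cmp eq)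
  next
    fix X Y assume "X \<in> objs ?K" "Y \<in> objs ?K"
    then show "nul ?K X Y \<in> Hom ?K X Y"
      by (auto simp: sel nul intro!: karoubi_HomI dest: cmp_nul)
  next
    fix f X Y g assume "f \<in> Hom ?K X Y" "g \<in> Hom ?K X Y"
    then show "padd ?K f g \<in> Hom ?K X Y"
      by (elim E) (auto simp: sel intro!: karoubi_HomI padd simp: cmp_padd)
  next
    fix f X Y r assume "f \<in> Hom ?K X Y"
    then show "scal ?K r f \<in> Hom ?K X Y"
      by (elim E) (auto simp: sel intro!: karoubi_HomI scal simp: cmp_scal)
  next
    fix f X Y g X' Y' assume f: "f \<in> Hom ?K X Y" and g: "g \<in> Hom ?K X' Y'"
    from f g show "tens ?K f g \<in> Hom ?K (tens_ob ?K X X') (tens_ob ?K Y Y')"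
      using tob[of X X'] tob[of Y Y'] Hom_obj[OF f] Hom_obj[OF g]
      by (elim E) (auto simp: sel(10,11) interchange[symmetric] intro!: karoubi_HomI tens)
  next
    show "unit_ob ?K \<in> objs ?K" using idn[OF unit_ob] cmp_idn[OF idn[OF unit_ob]]
      by (simp add: sel unit_ob)
  next
    fix X Y assume "X \<in> objs ?K" "Y \<in> objs ?K"
    then show "tens_ob ?K X Y \<in> objs ?K" by (rule tob)
  next
    fix h Z U g Y f X assume "h \<in> Hom ?K Z U" "g \<in> Hom ?K Y Z" "f \<in> Hom ?K X Y"
    then show "cmp ?K (cmp ?K h g) f = cmp ?K h (cmp ?K g f)"
      by (elim E) (auto simp: sel cmp_assoc)
  next
    fix f X Y assume f: "f \<in> Hom ?K X Y"
    then show "cmp ?K f (idn ?K X) = f" "cmp ?K (idn ?K Y) f = f" "padd ?K f (nul ?K X Y) = f"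
      "tens ?K f (idn ?K (unit_ob ?K)) = f" "tens ?K (idn ?K (unit_ob ?K)) f = f"
      by (elim E; auto simp: sel padd_nul tens_unit tens_ob_unit)+
    fix Z assume Z: "Z \<in> objs ?K"
    from f Z show "cmp ?K f (nul ?K Z X) = nul ?K Z Y" "cmp ?K (nul ?K Y Z) f = nul ?K X Z"
      by (elim E karoubi_objE; auto simp: sel cmp_nul)+
  next
    fix h Y Z f X g assume "h \<in> Hom ?K Y Z" "f \<in> Hom ?K X Y" "g \<in> Hom ?K X Y"
    then show "cmp ?K h (padd ?K f g) = padd ?K (cmp ?K h f) (cmp ?K h g)"
      by (elim E) (auto simp: sel cmp_padd)
  next
    fix f Y Z g h X assume "f \<in> Hom ?K Y Z" "g \<in> Hom ?K Y Z" "h \<in> Hom ?K X Y"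
    then show "cmp ?K (padd ?K f g) h = padd ?K (cmp ?K f h) (cmp ?K g h)"
      by (elim E) (auto simp: sel cmp_padd)
  next
    fix h Y Z f X r assume "h \<in> Hom ?K Y Z" "f \<in> Hom ?K X Y"
    then show "cmp ?K h (scal ?K r f) = scal ?K r (cmp ?K h f)"
      "cmp ?K (scal ?K r h) f = scal ?K r (cmp ?K h f)"
      by (elim E; auto simp: sel cmp_scal)+
  next
    fix f X Y g r assume "f \<in> Hom ?K X Y" "g \<in> Hom ?K X Y"
    then show "scal ?K r (padd ?K f g) = padd ?K (scal ?K r f) (scal ?K r g)"
      by (elim E) (auto simp: sel scal_padd)
  next
    fix X Y r assume "X \<in> objs ?K" "Y \<in> objs ?K"
    then show "scal ?K r (nul ?K X Y) = nul ?K X Y"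
      by (auto simp: sel scal_nul)
  next
    fix f X Y g h assume "f \<in> Hom ?K X Y" "g \<in> Hom ?K X Y" "h \<in> Hom ?K X Y"
    then show "padd ?K (padd ?K f g) h = padd ?K f (padd ?K g h)"
      by (elim E) (auto simp: sel padd_assoc)
  next
    fix f X Y g assume "f \<in> Hom ?K X Y" "g \<in> Hom ?K X Y"
    then show "padd ?K f g = padd ?K g f"
      by (elim E) (auto simp: sel padd_comm)
  next
    fix X Y assume "X \<in> objs ?K" "Y \<in> objs ?K"
    then show "tens ?K (idn ?K X) (idn ?K Y) = idn ?K (tens_ob ?K X Y)"
      by (auto simp: sel)
  next
    fix g Y Z f X g' Y' Z' f' X'
    assume "g \<in> Hom ?K Y Z" "f \<in> Hom ?K X Y" "g' \<in> Hom ?K Y' Z'" "f' \<in> Hom ?K X' Y'"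
    then show "tens ?K (cmp ?K g f) (cmp ?K g' f') = cmp ?K (tens ?K g g') (tens ?K f f')"
      by (elim E) (auto simp: sel interchange)
  next
    fix f X Y X' Y' assume "f \<in> Hom ?K X Y" "X' \<in> objs ?K" "Y' \<in> objs ?K"
    then show "tens ?K f (nul ?K X' Y') = nul ?K (tens_ob ?K X X') (tens_ob ?K Y Y')"
      "tens ?K (nul ?K X' Y') f = nul ?K (tens_ob ?K X' X) (tens_ob ?K Y' Y)"
      by (elim E karoubi_objE; auto simp: sel tens_nul)+
  next
    fix h X Y f X' Y' g assume "h \<in> Hom ?K X Y" "f \<in> Hom ?K X' Y'" "g \<in> Hom ?K X' Y'"
    then show "tens ?K h (padd ?K f g) = padd ?K (tens ?K h f) (tens ?K h g)"
      "tens ?K (padd ?K f g) h = padd ?K (tens ?K f h) (tens ?K g h)"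
      by (elim E; auto simp: sel tens_padd)+
  next
    fix f X Y g X' Y' h X'' Y''
    assume "f \<in> Hom ?K X Y" "g \<in> Hom ?K X' Y'" "h \<in> Hom ?K X'' Y''"
    then show "tens ?K (tens ?K f g) h = tens ?K f (tens ?K g h)"
      by (elim E) (auto simp: sel tens_assoc tens_ob_assoc)
  next
    fix X Y Z assume "X \<in> objs ?K" "Y \<in> objs ?K" "Z \<in> objs ?K"
    then show "tens_ob ?K (tens_ob ?K X Y) Z = tens_ob ?K X (tens_ob ?K Y Z)"
      by (elim karoubi_objE) (auto simp: sel tens_assoc tens_ob_assoc)
  next
    fix X assume "X \<in> objs ?K"
    then show "tens_ob ?K X (unit_ob ?K) = X" "tens_ob ?K (unit_ob ?K) X = X"
      by (elim karoubi_objE; auto simp: sel tens_unit tens_ob_unit)+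
  qed
qed

end

subsection \<open>Quotients\<close>

context lin_mon_cat begin

text \<open>The congruence never leaves a Hom set: its generators are restricted to parallel arrows,
  and every closure rule preserves source and target.\<close>

lemma lm_cong_Hom:
  assumes "lm_cong C R f g"
  shows "f \<in> arrs C \<and> g \<in> arrs C \<and> src C f = src C g \<and> tgt C f = tgt C g"
proof -
  have ops: "f \<in> arrs C \<Longrightarrow> g \<in> arrs C \<Longrightarrow> src C g = tgt C f \<Longrightarrow> cmp C g f \<in> Hom C (src C f) (tgt C g)"
    "f \<in> arrs C \<Longrightarrow> g \<in> arrs C \<Longrightarrow> src C f = src C g \<Longrightarrow> tgt C f = tgt C g \<Longrightarrow>
      padd C f g \<in> Hom C (src C f) (tgt C f)"
    "f \<in> arrs C \<Longrightarrow> scal C r f \<in> Hom C (src C f) (tgt C f)"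
    "f \<in> arrs C \<Longrightarrow> g \<in> arrs C \<Longrightarrow>
      tens C f g \<in> Hom C (tens_ob C (src C f) (src C g)) (tens_ob C (tgt C f) (tgt C g))" for f g r
    by (auto intro!: cmp padd scal tens HomI)
  from assms show ?thesis
  proof induction
    case (cmp g g' f f')
    then show ?case using ops(1)[of f g] ops(1)[of f' g'] by (simp add: Hom_def)
  next
    case (padd f f' g g')
    then show ?case using ops(2)[of f g] ops(2)[of f' g'] by (simp add: Hom_def)
  next
    case (scal f f' r)
    then show ?case using ops(3)[of f r] ops(3)[of f' r] by (simp add: Hom_def)
  next
    case (tens f f' g g')
    then show ?case using ops(4)[of f g] ops(4)[of f' g'] by (simp add: Hom_def)
  qed (auto simp: Hom_def)
qed

definition qcls :: "('m \<times> 'm) set \<Rightarrow> 'm \<Rightarrow> 'm set" where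
  "qcls R f = {g. lm_cong C R f g}"

lemma qcls_eq_iff:
  assumes "f \<in> arrs C"
  shows "qcls R f = qcls R g \<longleftrightarrow> lm_cong C R f g"
proof
  assume "qcls R f = qcls R g"
  then have "f \<in> qcls R g" using lm_cong.refl[OF assms] by (auto simp: qcls_def)
  then show "lm_cong C R f g" by (simp add: qcls_def lm_cong.sym)
next
  assume "lm_cong C R f g"
  then have "lm_cong C R f h \<longleftrightarrow> lm_cong C R g h" for h
    using lm_cong.sym lm_cong.trans by metis
  then show "qcls R f = qcls R g" by (simp add: qcls_def)
qed

lemma qcls_cong: "lm_cong C R f g \<Longrightarrow> qcls R f = qcls R g"
  using qcls_eq_iff lm_cong_Hom by metis

lemma qcls_self: "f \<in> Hom C X Y \<Longrightarrow> f \<in> qcls R f"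
  by (simp add: qcls_def Hom_def lm_cong.refl)

lemma qcls_D:
  assumes "g \<in> qcls R f" "f \<in> Hom C X Y"
  shows "lm_cong C R g f" "g \<in> Hom C X Y"
  using assms lm_cong_Hom[of R f g] by (simp_all add: qcls_def Hom_def lm_cong.sym)

lemma quotient_sel:
  "objs (quotient_cat C R) = objs C"
  "unit_ob (quotient_cat C R) = unit_ob C"
  "tens_ob (quotient_cat C R) = tens_ob C"
  "idn (quotient_cat C R) X = qcls R (idn C X)"
  "nul (quotient_cat C R) X Y = qcls R (nul C X Y)"
  by (simp_all add: quotient_cat_def Let_def qcls_def)

lemma UN2_const:
  assumes "a \<in> A" "b \<in> B" "\<And>x y. x \<in> A \<Longrightarrow> y \<in> B \<Longrightarrow> F x y = c"
  shows "(\<Union>x\<in>A. \<Union>y\<in>B. F x y) = c"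
proof -
  have "(\<Union>x\<in>A. \<Union>y\<in>B. F x y) = (\<Union>x\<in>A. \<Union>y\<in>B. c)"
    using assms(3) by (intro SUP_cong) auto
  then show ?thesis using assms(1,2) by auto
qed

text \<open>The quotient defines an operation as a union over all representatives. By congruence all
  members of the union are the same class, and the index sets are inhabited, so the union is that
  class.\<close>

lemma quotient_cmp:
  assumes "g \<in> Hom C Y Z" "f \<in> Hom C X Y"
  shows "cmp (quotient_cat C R) (qcls R g) (qcls R f) = qcls R (cmp C g f)"
proof -
  have "qcls R (cmp C g' f') = qcls R (cmp C g f)" if "g' \<in> qcls R g" "f' \<in> qcls R f" for g' f'
    using qcls_D[OF that(1) assms(1)] qcls_D[OF that(2) assms(2)]
    by (intro qcls_cong lm_cong.cmp) (auto simp: Hom_def)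
  then have "(\<Union>g'\<in>qcls R g. \<Union>f'\<in>qcls R f. qcls R (cmp C g' f')) = qcls R (cmp C g f)"
    by (rule UN2_const[OF qcls_self[OF assms(1)] qcls_self[OF assms(2)]])
  then show ?thesis by (simp add: quotient_cat_def Let_def qcls_def)
qed

lemma quotient_padd:
  assumes "g \<in> Hom C X Y" "f \<in> Hom C X Y"
  shows "padd (quotient_cat C R) (qcls R g) (qcls R f) = qcls R (padd C g f)"
proof -
  have "qcls R (padd C g' f') = qcls R (padd C g f)" if "g' \<in> qcls R g" "f' \<in> qcls R f" for g' f'
    using qcls_D[OF that(1) assms(1)] qcls_D[OF that(2) assms(2)]
    by (intro qcls_cong lm_cong.padd) (auto simp: Hom_def)
  then have "(\<Union>g'\<in>qcls R g. \<Union>f'\<in>qcls R f. qcls R (padd C g' f')) = qcls R (padd C g f)"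
    by (rule UN2_const[OF qcls_self[OF assms(1)] qcls_self[OF assms(2)]])
  then show ?thesis by (simp add: quotient_cat_def Let_def qcls_def)
qed

lemma quotient_tens:
  assumes "g \<in> Hom C X Y" "f \<in> Hom C X' Y'"
  shows "tens (quotient_cat C R) (qcls R g) (qcls R f) = qcls R (tens C g f)"
proof -
  have "qcls R (tens C g' f') = qcls R (tens C g f)" if "g' \<in> qcls R g" "f' \<in> qcls R f" for g' f'
    using qcls_D[OF that(1) assms(1)] qcls_D[OF that(2) assms(2)]
    by (intro qcls_cong lm_cong.tens) (auto simp: Hom_def)
  then have "(\<Union>g'\<in>qcls R g. \<Union>f'\<in>qcls R f. qcls R (tens C g' f')) = qcls R (tens C g f)"
    by (rule UN2_const[OF qcls_self[OF assms(1)] qcls_self[OF assms(2)]])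
  then show ?thesis by (simp add: quotient_cat_def Let_def qcls_def)
qed

lemma quotient_scal:
  assumes "f \<in> Hom C X Y"
  shows "scal (quotient_cat C R) r (qcls R f) = qcls R (scal C r f)"
proof -
  have "qcls R (scal C r f') = qcls R (scal C r f)" if "f' \<in> qcls R f" for f'
    using qcls_D[OF that assms] by (intro qcls_cong lm_cong.scal)
  then have "(\<Union>f'\<in>qcls R f. qcls R (scal C r f')) = qcls R (scal C r f)"
    by (intro UN_constant_eq[OF qcls_self[OF assms]]) simp
  then show ?thesis by (simp add: quotient_cat_def Let_def qcls_def)
qed

lemma Hom_quotient:
  "F \<in> Hom (quotient_cat C R) X Y \<longleftrightarrow> (\<exists>f\<in>Hom C X Y. F = qcls R f)"
proof -
  have arrs: "arrs (quotient_cat C R) = qcls R ` arrs C"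
    by (auto simp: quotient_cat_def Let_def qcls_def quotient_def)
  have st: "src (quotient_cat C R) (qcls R f) = src C f \<and> tgt (quotient_cat C R) (qcls R f) = tgt
      C f"
    if "f \<in> arrs C" for f
  proof -
    have self: "f \<in> qcls R f" using that by (simp add: qcls_def lm_cong.refl)
    have st: "src C g = src C f \<and> tgt C g = tgt C f" if "g \<in> qcls R f" for g
      using that lm_cong_Hom[of R f g] by (auto simp: qcls_def)
    \<comment> \<open>All members of a class have the same source and target, so the image is a
      singleton and \<open>the_elem\<close> returns its element.\<close>
    have "src C ` qcls R f = (\<lambda>_. src C f) ` qcls R f" "tgt C ` qcls R f = (\<lambda>_. tgt C f) ` qcls R f"
      by (rule image_cong[OF HOL.refl]; simp add: st)+
    then have "src C ` qcls R f = {src C f}" "tgt C ` qcls R f = {tgt C f}"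
      using image_constant[OF self] by simp_all
    then show ?thesis by (simp add: quotient_cat_def Let_def)
  qed
  show ?thesis
  proof
    assume "F \<in> Hom (quotient_cat C R) X Y"
    then obtain f where "f \<in> arrs C" "F = qcls R f" "src (quotient_cat C R) F = X" "tgt
        (quotient_cat C R) F = Y"
      by (auto simp: Hom_def arrs)
    then have "f \<in> Hom C X Y" using st by (simp add: Hom_def)
    then show "\<exists>f\<in>Hom C X Y. F = qcls R f" using \<open>F = qcls R f\<close> by blast
  next
    assume "\<exists>f\<in>Hom C X Y. F = qcls R f"
    then obtain f where "f \<in> Hom C X Y" "F = qcls R f" by blast
    then show "F \<in> Hom (quotient_cat C R) X Y" using st by (simp add: Hom_def arrs)
  qed
qed

lemma lin_mon_cat_quotient: "lin_mon_cat (quotient_cat C R)"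
proof -
  let ?Q = "quotient_cat C R"
  note sel = quotient_sel Hom_quotient
  show ?thesis
  proof
    fix f X Y assume "f \<in> Hom ?Q X Y"
    then show "X \<in> objs ?Q \<and> Y \<in> objs ?Q" by (auto simp: sel dest: Hom_objs)
  next
    fix X assume "X \<in> objs ?Q"
    then show "idn ?Q X \<in> Hom ?Q X X" by (auto simp: sel intro: idn)
  next
    fix g Y Z f X assume "g \<in> Hom ?Q Y Z" "f \<in> Hom ?Q X Y"
    then obtain G F where d: "g = qcls R G" "f = qcls R F" and t: "G \<in> Hom C Y Z" "F \<in> Hom C X Y"
      by (auto simp: sel)
    show "cmp ?Q g f \<in> Hom ?Q X Z"
      unfolding d quotient_cmp[OF t] Hom_quotient using cmp[OF t] by blast
  next
    fix X Y assume "X \<in> objs ?Q" "Y \<in> objs ?Q"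
    then show "nul ?Q X Y \<in> Hom ?Q X Y" by (auto simp: sel intro: nul)
  next
    fix f X Y g assume "f \<in> Hom ?Q X Y" "g \<in> Hom ?Q X Y"
    then obtain G F where d: "g = qcls R G" "f = qcls R F" and t: "F \<in> Hom C X Y" "G \<in> Hom C X Y"
      by (auto simp: sel)
    show "padd ?Q f g \<in> Hom ?Q X Y"
      unfolding d quotient_padd[OF t] Hom_quotient using padd[OF t] by blast
  next
    fix f X Y r assume "f \<in> Hom ?Q X Y"
    then obtain F where d: "f = qcls R F" and t: "F \<in> Hom C X Y"
      by (auto simp: sel)
    show "scal ?Q r f \<in> Hom ?Q X Y"
      unfolding d quotient_scal[OF t] Hom_quotient using scal[OF t] by blast
  next
    fix f X Y g X' Y' assume "f \<in> Hom ?Q X Y" "g \<in> Hom ?Q X' Y'"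
    then obtain G F where d: "g = qcls R G" "f = qcls R F" and t: "F \<in> Hom C X Y" "G \<in> Hom C X' Y'"
      by (auto simp: sel)
    show "tens ?Q f g \<in> Hom ?Q (tens_ob ?Q X X') (tens_ob ?Q Y Y')"
      unfolding d quotient_tens[OF t] Hom_quotient quotient_sel using tens[OF t] by blast
  next
    show "unit_ob ?Q \<in> objs ?Q" by (simp add: sel unit_ob)
  next
    fix X Y assume "X \<in> objs ?Q" "Y \<in> objs ?Q"
    then show "tens_ob ?Q X Y \<in> objs ?Q" by (simp add: sel tens_ob)
  next
    fix h Z U g Y f X assume "h \<in> Hom ?Q Z U" "g \<in> Hom ?Q Y Z" "f \<in> Hom ?Q X Y"
    then obtain H G F where d: "h = qcls R H" "g = qcls R G" "f = qcls R F"
      and t: "H \<in> Hom C Z U" "G \<in> Hom C Y Z" "F \<in> Hom C X Y"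
      by (auto simp: sel)
    show "cmp ?Q (cmp ?Q h g) f = cmp ?Q h (cmp ?Q g f)"
      by (simp add: d quotient_cmp[OF t(1,2)] quotient_cmp[OF t(2,3)] cmp_assoc[OF t]
        quotient_cmp[OF cmp[OF t(1,2)] t(3)] quotient_cmp[OF t(1) cmp[OF t(2,3)]])
  next
    fix f X Y assume f: "f \<in> Hom ?Q X Y"
    then obtain f' where f': "f' \<in> Hom C X Y" "f = qcls R f'" by (auto simp: sel)
    have o: "X \<in> objs C" "Y \<in> objs C" using Hom_objs[OF f'(1)] by auto
    show "cmp ?Q f (idn ?Q X) = f" "cmp ?Q (idn ?Q Y) f = f" "padd ?Q f (nul ?Q X Y) = f"
      "tens ?Q f (idn ?Q (unit_ob ?Q)) = f" "tens ?Q (idn ?Q (unit_ob ?Q)) f = f"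
      using f' o by (simp_all add: sel cmp_idn padd_nul tens_unit
        quotient_cmp[OF f'(1) idn] quotient_cmp[OF idn f'(1)] quotient_padd[OF f'(1) nul]
        quotient_tens[OF f'(1) idn[OF unit_ob]] quotient_tens[OF idn[OF unit_ob] f'(1)])
    fix Z assume "Z \<in> objs ?Q"
    then have Z: "Z \<in> objs C" by (simp add: sel)
    show "cmp ?Q f (nul ?Q Z X) = nul ?Q Z Y" "cmp ?Q (nul ?Q Y Z) f = nul ?Q X Z"
      using f' o Z by (simp_all add: sel cmp_nul quotient_cmp[OF f'(1) nul] quotient_cmp[OF nul
          f'(1)])
  next
    fix h Y Z f X g assume "h \<in> Hom ?Q Y Z" "f \<in> Hom ?Q X Y" "g \<in> Hom ?Q X Y"
    then obtain H F G where d: "h = qcls R H" "f = qcls R F" "g = qcls R G"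
      and t: "H \<in> Hom C Y Z" "F \<in> Hom C X Y" "G \<in> Hom C X Y"
      by (auto simp: sel)
    show "cmp ?Q h (padd ?Q f g) = padd ?Q (cmp ?Q h f) (cmp ?Q h g)"
      by (simp add: d quotient_padd[OF t(2,3)] quotient_cmp[OF t(1) padd[OF t(2,3)]]
        quotient_cmp[OF t(1,2)] quotient_cmp[OF t(1,3)] quotient_padd[OF cmp[OF t(1,2)] cmp[OF
            t(1,3)]]
        cmp_padd(1)[OF t])
  next
    fix f Y Z g h X assume "f \<in> Hom ?Q Y Z" "g \<in> Hom ?Q Y Z" "h \<in> Hom ?Q X Y"
    then obtain H F G where d: "h = qcls R H" "f = qcls R F" "g = qcls R G"
      and t: "F \<in> Hom C Y Z" "G \<in> Hom C Y Z" "H \<in> Hom C X Y"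
      by (auto simp: sel)
    show "cmp ?Q (padd ?Q f g) h = padd ?Q (cmp ?Q f h) (cmp ?Q g h)"
      by (simp add: d quotient_padd[OF t(1,2)] quotient_cmp[OF padd[OF t(1,2)] t(3)]
        quotient_cmp[OF t(1,3)] quotient_cmp[OF t(2,3)] quotient_padd[OF cmp[OF t(1,3)] cmp[OF
            t(2,3)]]
        cmp_padd(2)[OF t])
  next
    fix h Y Z f X r assume "h \<in> Hom ?Q Y Z" "f \<in> Hom ?Q X Y"
    then obtain H F where d: "h = qcls R H" "f = qcls R F"
      and t: "H \<in> Hom C Y Z" "F \<in> Hom C X Y"
      by (auto simp: sel)
    show "cmp ?Q h (scal ?Q r f) = scal ?Q r (cmp ?Q h f)"
      "cmp ?Q (scal ?Q r h) f = scal ?Q r (cmp ?Q h f)"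
      by (simp_all add: d quotient_scal[OF t(1)] quotient_scal[OF t(2)] quotient_cmp[OF t]
        quotient_cmp[OF t(1) scal[OF t(2)]] quotient_cmp[OF scal[OF t(1)] t(2)]
        quotient_scal[OF cmp[OF t]] cmp_scal[OF t])
  next
    fix f X Y g r assume "f \<in> Hom ?Q X Y" "g \<in> Hom ?Q X Y"
    then obtain G F where d: "g = qcls R G" "f = qcls R F" and t: "F \<in> Hom C X Y" "G \<in> Hom C X Y"
      by (auto simp: sel)
    show "scal ?Q r (padd ?Q f g) = padd ?Q (scal ?Q r f) (scal ?Q r g)"
      by (simp add: d quotient_padd[OF t] quotient_scal[OF t(1)] quotient_scal[OF t(2)]
        quotient_scal[OF padd[OF t]] quotient_padd[OF scal[OF t(1)] scal[OF t(2)]] scal_padd[OF t])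
  next
    fix X Y r assume "X \<in> objs ?Q" "Y \<in> objs ?Q"
    then show "scal ?Q r (nul ?Q X Y) = nul ?Q X Y"
      by (auto simp: sel quotient_scal[OF nul] scal_nul)
  next
    fix f X Y g h assume "f \<in> Hom ?Q X Y" "g \<in> Hom ?Q X Y" "h \<in> Hom ?Q X Y"
    then obtain H F G where d: "h = qcls R H" "f = qcls R F" "g = qcls R G"
      and t: "F \<in> Hom C X Y" "G \<in> Hom C X Y" "H \<in> Hom C X Y"
      by (auto simp: sel)
    show "padd ?Q (padd ?Q f g) h = padd ?Q f (padd ?Q g h)"
      by (simp add: d quotient_padd[OF t(1,2)] quotient_padd[OF t(2,3)]
        quotient_padd[OF padd[OF t(1,2)] t(3)] quotient_padd[OF t(1) padd[OF t(2,3)]]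
            padd_assoc[OF t])
  next
    fix f X Y g assume "f \<in> Hom ?Q X Y" "g \<in> Hom ?Q X Y"
    then obtain G F where d: "g = qcls R G" "f = qcls R F" and t: "F \<in> Hom C X Y" "G \<in> Hom C X Y"
      by (auto simp: sel)
    show "padd ?Q f g = padd ?Q g f"
      by (simp add: d quotient_padd[OF t] quotient_padd[OF t(2,1)] padd_comm[OF t])
  next
    fix X Y assume "X \<in> objs ?Q" "Y \<in> objs ?Q"
    then show "tens ?Q (idn ?Q X) (idn ?Q Y) = idn ?Q (tens_ob ?Q X Y)"
      by (auto simp: sel quotient_tens[OF idn idn] tens_idn)
  next
    fix g Y Z f X g' Y' Z' f' X'
    assume "g \<in> Hom ?Q Y Z" "f \<in> Hom ?Q X Y" "g' \<in> Hom ?Q Y' Z'" "f' \<in> Hom ?Q X' Y'"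
    then obtain G F G' F' where d: "g = qcls R G" "f = qcls R F" "g' = qcls R G'" "f' = qcls R F'"
      and t: "G \<in> Hom C Y Z" "F \<in> Hom C X Y" "G' \<in> Hom C Y' Z'" "F' \<in> Hom C X' Y'"
      by (auto simp: sel)
    show "tens ?Q (cmp ?Q g f) (cmp ?Q g' f') = cmp ?Q (tens ?Q g g') (tens ?Q f f')"
      by (simp add: d quotient_cmp[OF t(1,2)] quotient_cmp[OF t(3,4)] quotient_tens[OF cmp[OF
          t(1,2)] cmp[OF t(3,4)]]
        quotient_tens[OF t(1,3)] quotient_tens[OF t(2,4)] interchange[OF t]
        quotient_cmp[OF tens[OF t(1,3)] tens[OF t(2,4)]])
  next
    fix f X Y X' Y' assume "f \<in> Hom ?Q X Y" "X' \<in> objs ?Q" "Y' \<in> objs ?Q"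
    then obtain F where d: "f = qcls R F" and t: "F \<in> Hom C X Y" and o: "X' \<in> objs C" "Y' \<in> objs C"
      by (auto simp: sel)
    show "tens ?Q f (nul ?Q X' Y') = nul ?Q (tens_ob ?Q X X') (tens_ob ?Q Y Y')"
      "tens ?Q (nul ?Q X' Y') f = nul ?Q (tens_ob ?Q X' X) (tens_ob ?Q Y' Y)"
      by (simp_all add: d sel quotient_tens[OF t nul[OF o]] quotient_tens[OF nul[OF o] t]
          tens_nul[OF t o])
  next
    fix h X Y f X' Y' g assume "h \<in> Hom ?Q X Y" "f \<in> Hom ?Q X' Y'" "g \<in> Hom ?Q X' Y'"
    then obtain H F G where d: "h = qcls R H" "f = qcls R F" "g = qcls R G"
      and t: "H \<in> Hom C X Y" "F \<in> Hom C X' Y'" "G \<in> Hom C X' Y'"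
      by (auto simp: sel)
    show "tens ?Q h (padd ?Q f g) = padd ?Q (tens ?Q h f) (tens ?Q h g)"
      "tens ?Q (padd ?Q f g) h = padd ?Q (tens ?Q f h) (tens ?Q g h)"
      by (simp_all add: d quotient_padd[OF t(2,3)] quotient_tens[OF t(1) padd[OF t(2,3)]]
        quotient_tens[OF padd[OF t(2,3)] t(1)] quotient_tens[OF t(1,2)] quotient_tens[OF t(1,3)]
        quotient_tens[OF t(2,1)] quotient_tens[OF t(3,1)] tens_padd[OF t]
        quotient_padd[OF tens[OF t(1,2)] tens[OF t(1,3)]] quotient_padd[OF tens[OF t(2,1)] tens[OF
            t(3,1)]])
  next
    fix f X Y g X' Y' h X'' Y''
    assume "f \<in> Hom ?Q X Y" "g \<in> Hom ?Q X' Y'" "h \<in> Hom ?Q X'' Y''"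
    then obtain F G H where d: "f = qcls R F" "g = qcls R G" "h = qcls R H"
      and t: "F \<in> Hom C X Y" "G \<in> Hom C X' Y'" "H \<in> Hom C X'' Y''"
      by (auto simp: sel)
    show "tens ?Q (tens ?Q f g) h = tens ?Q f (tens ?Q g h)"
      by (simp add: d quotient_tens[OF t(1,2)] quotient_tens[OF t(2,3)] tens_assoc[OF t]
        quotient_tens[OF tens[OF t(1,2)] t(3)] quotient_tens[OF t(1) tens[OF t(2,3)]])
  next
    fix X Y Z assume "X \<in> objs ?Q" "Y \<in> objs ?Q" "Z \<in> objs ?Q"
    then show "tens_ob ?Q (tens_ob ?Q X Y) Z = tens_ob ?Q X (tens_ob ?Q Y Z)"
      by (simp add: sel tens_ob_assoc)
  next
    fix X assume "X \<in> objs ?Q"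
    then show "tens_ob ?Q X (unit_ob ?Q) = X" "tens_ob ?Q (unit_ob ?Q) X = X"
      by (simp_all add: sel tens_ob_unit)
  qed
qed

end

section \<open>Algebras\<close>

locale alg = ring A for A :: "('r::comm_ring_1, 'a) module" (structure) +
  assumes smult_closed: "a \<in> carrier A \<Longrightarrow> r \<odot> a \<in> carrier A"
    and smult_add: "a \<in> carrier A \<Longrightarrow> b \<in> carrier A \<Longrightarrow> r \<odot> (a \<oplus> b) = r \<odot> a \<oplus> r \<odot> b"
    and add_smult: "a \<in> carrier A \<Longrightarrow> (r + s) \<odot> a = r \<odot> a \<oplus> s \<odot> a"
    and smult_smult: "a \<in> carrier A \<Longrightarrow> (r * s) \<odot> a = r \<odot> (s \<odot> a)"
    and one_smult: "a \<in> carrier A \<Longrightarrow> 1 \<odot> a = a"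
    and smult_mult: "a \<in> carrier A \<Longrightarrow> b \<in> carrier A \<Longrightarrow> (r \<odot> a) \<otimes> b = r \<odot> (a \<otimes> b)"
    and mult_smult: "a \<in> carrier A \<Longrightarrow> b \<in> carrier A \<Longrightarrow> a \<otimes> (r \<odot> b) = r \<odot> (a \<otimes> b)"
begin

lemma zero_smult: "a \<in> carrier A \<Longrightarrow> 0 \<odot> a = \<zero>"
  using add_smult[of a 0 0] smult_closed[of a 0] by (simp add: add.r_cancel_one')

lemma smult_zero: "r \<odot> \<zero> = \<zero>"
  using smult_add[of \<zero> \<zero> r] smult_closed[of \<zero> r] by (simp add: add.r_cancel_one')

end

subsection \<open>Monoid algebras\<close>

lemma monoid_algebra_sel:
  "carrier (monoid_algebra M) = {p. Poly_Mapping.keys p \<subseteq> carrier M}"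
  "\<one>\<^bsub>monoid_algebra M\<^esub> = Poly_Mapping.single \<one>\<^bsub>M\<^esub> 1"
  "\<zero>\<^bsub>monoid_algebra M\<^esub> = 0"
  "p \<oplus>\<^bsub>monoid_algebra M\<^esub> p' = p + p'"
  "r \<odot>\<^bsub>monoid_algebra M\<^esub> p = Poly_Mapping.map ((*) r) p"
  by (simp_all add: monoid_algebra_def)

text \<open>Enlarging the supports to finite sets adds only zero terms. With a common index set for
  \<open>p\<close>, \<open>q\<close> and \<open>p + q\<close>, bilinearity becomes additivity of
  sums.\<close>

lemma monoid_algebra_mult:
  assumes "finite A" "Poly_Mapping.keys p \<subseteq> A" "finite B" "Poly_Mapping.keys p' \<subseteq> B"
  shows "p \<otimes>\<^bsub>monoid_algebra M\<^esub> p' = (\<Sum>a\<in>A. \<Sum>b\<in>B.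
    Poly_Mapping.single (a \<otimes>\<^bsub>M\<^esub> b) (Poly_Mapping.lookup p a * Poly_Mapping.lookup p' b))"
proof -
  have "(\<Sum>b\<in>Poly_Mapping.keys p'.
      Poly_Mapping.single (a \<otimes>\<^bsub>M\<^esub> b) (Poly_Mapping.lookup p a * Poly_Mapping.lookup p' b)) =
    (\<Sum>b\<in>B. Poly_Mapping.single (a \<otimes>\<^bsub>M\<^esub> b) (Poly_Mapping.lookup p a * Poly_Mapping.lookup p' b))"
        for a
    by (rule sum.mono_neutral_left) (auto simp: assms in_keys_iff)
  moreover have "(\<Sum>a\<in>Poly_Mapping.keys p. \<Sum>b\<in>B.
      Poly_Mapping.single (a \<otimes>\<^bsub>M\<^esub> b) (Poly_Mapping.lookup p a * Poly_Mapping.lookup p' b)) =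
    (\<Sum>a\<in>A. \<Sum>b\<in>B.
      Poly_Mapping.single (a \<otimes>\<^bsub>M\<^esub> b) (Poly_Mapping.lookup p a * Poly_Mapping.lookup p' b))"
    by (rule sum.mono_neutral_left) (auto simp: assms in_keys_iff)
  ultimately show ?thesis by (simp add: monoid_algebra_def)
qed

lemma monoid_algebra_mult_add:
  fixes M :: "('a, 'b) monoid_scheme" and p q r :: "'a \<Rightarrow>\<^sub>0 'r::comm_ring_1"
  shows "(p + q) \<otimes>\<^bsub>monoid_algebra M\<^esub> r = p \<otimes>\<^bsub>monoid_algebra M\<^esub> r + q \<otimes>\<^bsub>monoid_algebra M\<^esub> r"
    "r \<otimes>\<^bsub>monoid_algebra M\<^esub> (p + q) = r \<otimes>\<^bsub>monoid_algebra M\<^esub> p + r \<otimes>\<^bsub>monoid_algebra M\<^esub> q"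
proof -
  let ?A = "Poly_Mapping.keys p \<union> Poly_Mapping.keys q" and ?B = "Poly_Mapping.keys r"
  have A: "finite ?A" "finite ?B" "?B \<subseteq> ?B" "Poly_Mapping.keys p \<subseteq> ?A" "Poly_Mapping.keys q \<subseteq> ?A"
    "Poly_Mapping.keys (p + q) \<subseteq> ?A"
    by (auto dest: Poly_Mapping.keys_add[THEN subsetD])
  show "(p + q) \<otimes>\<^bsub>monoid_algebra M\<^esub> r = p \<otimes>\<^bsub>monoid_algebra M\<^esub> r + q \<otimes>\<^bsub>monoid_algebra M\<^esub> r"
    by (simp add: monoid_algebra_mult[OF A(1) A(4) A(2) A(3)] monoid_algebra_mult[OF A(1) A(5)
        A(2) A(3)]
      monoid_algebra_mult[OF A(1) A(6) A(2) A(3)] lookup_add distrib_right single_add sum.distrib)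
  show "r \<otimes>\<^bsub>monoid_algebra M\<^esub> (p + q) = r \<otimes>\<^bsub>monoid_algebra M\<^esub> p + r \<otimes>\<^bsub>monoid_algebra M\<^esub> q"
    by (simp add: monoid_algebra_mult[OF A(2) A(3) A(1) A(4)] monoid_algebra_mult[OF A(2) A(3)
        A(1) A(5)]
      monoid_algebra_mult[OF A(2) A(3) A(1) A(6)] lookup_add distrib_left single_add sum.distrib)
qed

lemma monoid_algebra_mult_zero:
  "0 \<otimes>\<^bsub>monoid_algebra M\<^esub> p = 0" "p \<otimes>\<^bsub>monoid_algebra M\<^esub> 0 = 0"
  by (simp_all add: monoid_algebra_def)

lemma monoid_algebra_mult_single:
  "Poly_Mapping.single a r \<otimes>\<^bsub>monoid_algebra M\<^esub> Poly_Mapping.single b s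
    = Poly_Mapping.single (a \<otimes>\<^bsub>M\<^esub> b) (r * s)"
  by (subst monoid_algebra_mult[where A="{a}" and B="{b}"]) (auto simp: lookup_single)

text \<open>The supports are confined to \<open>S\<close> throughout, because the laws of a monoid
  hold only on its carrier.\<close>

lemma poly_mapping_single_induct [consumes 1, case_names zero add]:
  fixes p :: "'a \<Rightarrow>\<^sub>0 'r::comm_monoid_add"
  assumes "Poly_Mapping.keys p \<subseteq> S" "P 0"
    "\<And>a r q. a \<in> S \<Longrightarrow> Poly_Mapping.keys q \<subseteq> S \<Longrightarrow> P q \<Longrightarrow> P (Poly_Mapping.single a r + q)"
  shows "P p"
proof -
  have "P (\<Sum>a\<in>T. Poly_Mapping.single a (Poly_Mapping.lookup p a)) \<and>
     Poly_Mapping.keys (\<Sum>a\<in>T. Poly_Mapping.single a (Poly_Mapping.lookup p a)) \<subseteq> S"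
    if "finite T" "T \<subseteq> Poly_Mapping.keys p" for T
    using that
  proof induction
    case (insert a T)
    have "Poly_Mapping.keys (Poly_Mapping.single a r + q) \<subseteq> S"
      if "Poly_Mapping.keys q \<subseteq> S" "a \<in> S" for q :: "'a \<Rightarrow>\<^sub>0 'r" and r
      using that by (auto dest!: Poly_Mapping.keys_add[THEN subsetD] split: if_splits)
    then show ?case using insert assms by auto
  qed (use assms in auto)
  from this[of "Poly_Mapping.keys p"]
  have "P (\<Sum>a\<in>Poly_Mapping.keys p. Poly_Mapping.single a (Poly_Mapping.lookup p a))" by simp
  moreover have "(\<Sum>a\<in>Poly_Mapping.keys p. Poly_Mapping.single a (Poly_Mapping.lookup p a)) = p"
    by (rule poly_mapping_eqI)
      (auto simp: lookup_sum lookup_single when_def in_keys_iff sum.delta' if_distrib cong: if_cong)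
  ultimately show ?thesis by simp
qed

lemma map_times_zero: "Poly_Mapping.map ((*) (r::'r::comm_ring_1)) 0 = 0"
  by (rule poly_mapping_eqI) (simp add: Poly_Mapping.map.rep_eq)

lemma lookup_map_times: "Poly_Mapping.lookup (Poly_Mapping.map ((*) (r::'r::comm_ring_1)) p) a = r
    * Poly_Mapping.lookup p a"
  by (simp add: Poly_Mapping.map.rep_eq when_def)

lemma map_times_add:
  fixes p q :: "'a \<Rightarrow>\<^sub>0 'r::comm_ring_1"
  shows "Poly_Mapping.map ((*) r) (p + q) = Poly_Mapping.map ((*) r) p + Poly_Mapping.map ((*) r) q"
  by (rule poly_mapping_eqI) (simp add: lookup_add lookup_map_times distrib_left)

lemma map_times_single:
  "Poly_Mapping.map ((*) (r::'r::comm_ring_1)) (Poly_Mapping.single a s) = Poly_Mapping.single a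
      (r * s)"
  by (rule poly_mapping_eqI) (simp add: Poly_Mapping.map.rep_eq lookup_single when_def)

lemma keys_map_times: "Poly_Mapping.keys (Poly_Mapping.map ((*) (r::'r::comm_ring_1)) p) \<subseteq>
    Poly_Mapping.keys p"
  by (auto simp: in_keys_iff Poly_Mapping.map.rep_eq)

lemma (in Group.monoid) monoid_algebra_closed:
  assumes "Poly_Mapping.keys p \<subseteq> carrier G" "Poly_Mapping.keys q \<subseteq> carrier G"
  shows "Poly_Mapping.keys (p \<otimes>\<^bsub>monoid_algebra G\<^esub> q) \<subseteq> carrier G"
  using assms(1)
proof (induction rule: poly_mapping_single_induct)
  case (add a r p)
  have "Poly_Mapping.keys (Poly_Mapping.single a r \<otimes>\<^bsub>monoid_algebra G\<^esub> q) \<subseteq> carrier G"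
    using assms(2)
  proof (induction rule: poly_mapping_single_induct)
    case (add b s q)
    then show ?case using \<open>a \<in> carrier G\<close>
      by (auto simp: monoid_algebra_mult_add monoid_algebra_mult_single
        dest!: Poly_Mapping.keys_add[THEN subsetD] split: if_splits)
  qed (simp add: monoid_algebra_mult_zero)
  then show ?case using add
    by (auto simp: monoid_algebra_mult_add dest!: Poly_Mapping.keys_add[THEN subsetD])
qed (simp add: monoid_algebra_mult_zero)

lemma (in Group.monoid) monoid_algebra_assoc:
  assumes "Poly_Mapping.keys p \<subseteq> carrier G" "Poly_Mapping.keys q \<subseteq> carrier G" "Poly_Mapping.keys t
      \<subseteq> carrier G"
  shows "(p \<otimes>\<^bsub>monoid_algebra G\<^esub> q) \<otimes>\<^bsub>monoid_algebra G\<^esub> t = p \<otimes>\<^bsub>monoid_algebra G\<^esub> (q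
      \<otimes>\<^bsub>monoid_algebra G\<^esub> t)"
  using assms(1)
proof (induction rule: poly_mapping_single_induct)
  case (add a r p)
  have "(Poly_Mapping.single a r \<otimes>\<^bsub>monoid_algebra G\<^esub> q) \<otimes>\<^bsub>monoid_algebra G\<^esub> t
      = Poly_Mapping.single a r \<otimes>\<^bsub>monoid_algebra G\<^esub> (q \<otimes>\<^bsub>monoid_algebra G\<^esub> t)"
    using assms(2)
  proof (induction rule: poly_mapping_single_induct)
    case (add b s q)
    have "(Poly_Mapping.single a r \<otimes>\<^bsub>monoid_algebra G\<^esub> Poly_Mapping.single b s) \<otimes>\<^bsub>monoid_algebra
        G\<^esub> t
      = Poly_Mapping.single a r \<otimes>\<^bsub>monoid_algebra G\<^esub> (Poly_Mapping.single b s \<otimes>\<^bsub>monoid_algebra G\<^esub> t)"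
      using assms(3)
    proof (induction rule: poly_mapping_single_induct)
      case (add c u t)
      then show ?case using \<open>a \<in> carrier G\<close> \<open>b \<in> carrier G\<close>
        by (simp add: monoid_algebra_mult_add monoid_algebra_mult_single m_assoc mult.assoc)
    qed (simp add: monoid_algebra_mult_zero)
    then show ?case using add by (simp add: monoid_algebra_mult_add)
  qed (simp add: monoid_algebra_mult_zero)
  then show ?case using add by (simp add: monoid_algebra_mult_add)
qed (simp add: monoid_algebra_mult_zero)

lemma (in Group.monoid) monoid_algebra_one:
  assumes "Poly_Mapping.keys p \<subseteq> carrier G"
  shows "Poly_Mapping.single \<one> 1 \<otimes>\<^bsub>monoid_algebra G\<^esub> p = p"
    "p \<otimes>\<^bsub>monoid_algebra G\<^esub> Poly_Mapping.single \<one> 1 = p"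
  using assms
  by (induction rule: poly_mapping_single_induct)
    (simp_all add: monoid_algebra_mult_zero monoid_algebra_mult_add monoid_algebra_mult_single)

lemma (in Group.monoid) monoid_algebra_smult_mult:
  assumes "Poly_Mapping.keys p \<subseteq> carrier G" "Poly_Mapping.keys q \<subseteq> carrier G"
  shows "Poly_Mapping.map ((*) r) p \<otimes>\<^bsub>monoid_algebra G\<^esub> q = Poly_Mapping.map ((*) r) (p
      \<otimes>\<^bsub>monoid_algebra G\<^esub> q)"
    "p \<otimes>\<^bsub>monoid_algebra G\<^esub> Poly_Mapping.map ((*) r) q = Poly_Mapping.map ((*) r) (p
        \<otimes>\<^bsub>monoid_algebra G\<^esub> q)"
proof -
  have "Poly_Mapping.map ((*) r) p \<otimes>\<^bsub>monoid_algebra G\<^esub> q = Poly_Mapping.map ((*) r) (p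
      \<otimes>\<^bsub>monoid_algebra G\<^esub> q)
    \<and> p \<otimes>\<^bsub>monoid_algebra G\<^esub> Poly_Mapping.map ((*) r) q = Poly_Mapping.map ((*) r) (p
        \<otimes>\<^bsub>monoid_algebra G\<^esub> q)"
    using assms(1)
  proof (induction rule: poly_mapping_single_induct)
    case (add a s p)
    have "Poly_Mapping.map ((*) r) (Poly_Mapping.single a s) \<otimes>\<^bsub>monoid_algebra G\<^esub> q =
        Poly_Mapping.map ((*) r) (Poly_Mapping.single a s \<otimes>\<^bsub>monoid_algebra G\<^esub> q)
      \<and> Poly_Mapping.single a s \<otimes>\<^bsub>monoid_algebra G\<^esub> Poly_Mapping.map ((*) r) q = Poly_Mapping.map
          ((*) r) (Poly_Mapping.single a s \<otimes>\<^bsub>monoid_algebra G\<^esub> q)"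
      using assms(2)
      by (induction rule: poly_mapping_single_induct)
        (simp_all add: monoid_algebra_mult_zero monoid_algebra_mult_add monoid_algebra_mult_single
          map_times_zero map_times_add map_times_single mult.assoc mult.left_commute)
    then show ?case using add by (simp add: monoid_algebra_mult_add map_times_add)
  qed (simp add: monoid_algebra_mult_zero map_times_zero)
  then show "Poly_Mapping.map ((*) r) p \<otimes>\<^bsub>monoid_algebra G\<^esub> q = Poly_Mapping.map ((*) r) (p
      \<otimes>\<^bsub>monoid_algebra G\<^esub> q)"
    "p \<otimes>\<^bsub>monoid_algebra G\<^esub> Poly_Mapping.map ((*) r) q = Poly_Mapping.map ((*) r) (p
        \<otimes>\<^bsub>monoid_algebra G\<^esub> q)"
    by auto
qed

lemma (in Group.monoid) alg_monoid_algebra: "alg (monoid_algebra G :: ('r::comm_ring_1, 'a \<Rightarrow>\<^sub>0 'r)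
    module)"
proof -
  let ?A = "monoid_algebra G :: ('r, 'a \<Rightarrow>\<^sub>0 'r) module"
  note sel = monoid_algebra_sel
  have "abelian_group ?A"
  proof (rule abelian_groupI)
    fix p assume "p \<in> carrier ?A"
    then have "- p \<in> carrier ?A \<and> - p \<oplus>\<^bsub>?A\<^esub> p = \<zero>\<^bsub>?A\<^esub>" by (auto simp: sel in_keys_iff)
    then show "\<exists>q\<in>carrier ?A. q \<oplus>\<^bsub>?A\<^esub> p = \<zero>\<^bsub>?A\<^esub>" by blast
  qed (auto simp: sel algebra_simps dest!: Poly_Mapping.keys_add[THEN subsetD])
  moreover have "Group.monoid ?A"
    by (rule Group.monoid.intro)
      (auto simp: sel monoid_algebra_closed[THEN subsetD] monoid_algebra_assoc monoid_algebra_one)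
  ultimately have "ring ?A"
    by (rule ringI) (simp_all add: sel monoid_algebra_mult_add)
  then show ?thesis
  proof (rule alg.intro, unfold_locales)
    fix a b and r s :: 'r
    assume a: "a \<in> carrier ?A"
    show "r \<odot>\<^bsub>?A\<^esub> a \<in> carrier ?A" using a keys_map_times by (force simp: sel)
    show "(r + s) \<odot>\<^bsub>?A\<^esub> a = r \<odot>\<^bsub>?A\<^esub> a \<oplus>\<^bsub>?A\<^esub> s \<odot>\<^bsub>?A\<^esub> a"
      "(r * s) \<odot>\<^bsub>?A\<^esub> a = r \<odot>\<^bsub>?A\<^esub> (s \<odot>\<^bsub>?A\<^esub> a)" "1 \<odot>\<^bsub>?A\<^esub> a = a"
      by (rule poly_mapping_eqI; simp add: sel lookup_map_times lookup_add algebra_simps)+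
    assume b: "b \<in> carrier ?A"
    show "r \<odot>\<^bsub>?A\<^esub> (a \<oplus>\<^bsub>?A\<^esub> b) = r \<odot>\<^bsub>?A\<^esub> a \<oplus>\<^bsub>?A\<^esub> r \<odot>\<^bsub>?A\<^esub> b" by (simp add: sel map_times_add)
    show "(r \<odot>\<^bsub>?A\<^esub> a) \<otimes>\<^bsub>?A\<^esub> b = r \<odot>\<^bsub>?A\<^esub> (a \<otimes>\<^bsub>?A\<^esub> b)" "a \<otimes>\<^bsub>?A\<^esub> (r \<odot>\<^bsub>?A\<^esub> b) = r \<odot>\<^bsub>?A\<^esub> (a \<otimes>\<^bsub>?A\<^esub> b)"
      using a b by (simp_all add: sel monoid_algebra_smult_mult)
  qed
qed

lemma (in Group.monoid) monoid_algebra_minus: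
  assumes "p \<in> carrier (monoid_algebra G)" "q \<in> carrier (monoid_algebra G)"
  shows "\<ominus>\<^bsub>monoid_algebra G\<^esub> p = - p" "p \<ominus>\<^bsub>monoid_algebra G\<^esub> q = p - q"
proof -
  interpret A: alg "monoid_algebra G" by (rule alg_monoid_algebra)
  have *: "\<ominus>\<^bsub>monoid_algebra G\<^esub> p = - p" if "p \<in> carrier (monoid_algebra G)" for p
    using that by (intro A.minus_equality) (auto simp: monoid_algebra_sel in_keys_iff)
  show "\<ominus>\<^bsub>monoid_algebra G\<^esub> p = - p" "p \<ominus>\<^bsub>monoid_algebra G\<^esub> q = p - q"
    using assms * by (simp_all add: a_minus_def monoid_algebra_sel(4))
qed

text \<open>Products of generators with multiples of basis vectors are enough, since every element
  is a sum of such multiples and the additive subgroup is closed under sums and negatives.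
  \<open>ext_relations\<close> and \<open>K0_relations\<close> are given as additive subgroups; this
  is how they become ideals.\<close>

lemma (in Group.monoid) ideal_generate_monoid_algebra:
  fixes S :: "('a \<Rightarrow>\<^sub>0 'r::comm_ring_1) set"
  defines "A \<equiv> monoid_algebra G"
  defines "I \<equiv> generate (add_monoid A) S"
  assumes S: "S \<subseteq> carrier A"
    and single: "\<And>a r s. a \<in> carrier G \<Longrightarrow> s \<in> S \<Longrightarrow>
      Poly_Mapping.single a r \<otimes>\<^bsub>A\<^esub> s \<in> I \<and> s \<otimes>\<^bsub>A\<^esub> Poly_Mapping.single a r \<in> I"
  shows "ideal I A"
proof -
  interpret A: alg A unfolding A_def by (rule alg_monoid_algebra)
  have sub: "subgroup I (add_monoid A)"
    unfolding I_def using S by (intro A.add.generate_is_subgroup) simp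
  have add: "p + q \<in> I" if "p \<in> I" "q \<in> I" for p q
    using subgroup.m_closed[OF sub that] by (simp add: A_def monoid_algebra_sel)
  have zero: "0 \<in> I"
    using subgroup.one_closed[OF sub] by (simp add: A_def monoid_algebra_sel)
  have minus: "\<ominus>\<^bsub>A\<^esub> p \<in> I" if "p \<in> I" for p
    using subgroup.m_inv_closed[OF sub that] by (simp add: a_inv_def)
  have gen: "p \<otimes>\<^bsub>A\<^esub> s \<in> I \<and> s \<otimes>\<^bsub>A\<^esub> p \<in> I" if "s \<in> S" "p \<in> carrier A" for p s
  proof -
    have "Poly_Mapping.keys p \<subseteq> carrier G" using that(2) by (simp add: A_def monoid_algebra_sel)
    then show ?thesis
      by (induction rule: poly_mapping_single_induct)
        (use zero add single[OF _ that(1)] in \<open>auto simp: A_def monoid_algebra_mult_add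
            monoid_algebra_mult_zero\<close>)
  qed
  have ideal: "p \<otimes>\<^bsub>A\<^esub> s \<in> I \<and> s \<otimes>\<^bsub>A\<^esub> p \<in> I" if "s \<in> I" "p \<in> carrier A" for p s
    using that(1) unfolding I_def
  proof (induction rule: generate.induct)
    case one
    have "p \<otimes>\<^bsub>A\<^esub> 0 = 0" "0 \<otimes>\<^bsub>A\<^esub> p = 0" "\<one>\<^bsub>add_monoid A\<^esub> = 0"
      by (simp_all add: A_def monoid_algebra_sel monoid_algebra_mult_zero)
    then show ?case using zero unfolding I_def by metis
  next
    case (incl h)
    then show ?case using gen that(2) by (simp add: I_def[symmetric])
  next
    case (inv h)
    then have "h \<in> carrier A" using S by auto
    then have "p \<otimes>\<^bsub>A\<^esub> (\<ominus>\<^bsub>A\<^esub> h) = \<ominus>\<^bsub>A\<^esub> (p \<otimes>\<^bsub>A\<^esub> h)" "(\<ominus>\<^bsub>A\<^esub> h) \<otimes>\<^bsub>A\<^esub> p = \<ominus>\<^bsub>A\<^esub> (h \<otimes>\<^bsub>A\<^esub> p)"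
      using that(2) by (simp_all add: A.r_minus A.l_minus)
    then show ?case using gen[OF inv that(2)] minus by (simp add: I_def[symmetric] a_inv_def)
  next
    case (eng h1 h2)
    have "h1 \<in> carrier A" "h2 \<in> carrier A"
      using eng subgroup.mem_carrier[OF sub] by (auto simp: I_def)
    then have "p \<otimes>\<^bsub>A\<^esub> (h1 \<oplus>\<^bsub>A\<^esub> h2) = p \<otimes>\<^bsub>A\<^esub> h1 + p \<otimes>\<^bsub>A\<^esub> h2"
      "(h1 \<oplus>\<^bsub>A\<^esub> h2) \<otimes>\<^bsub>A\<^esub> p = h1 \<otimes>\<^bsub>A\<^esub> p + h2 \<otimes>\<^bsub>A\<^esub> p"
      by (simp_all add: A_def monoid_algebra_sel monoid_algebra_mult_add)
    then show ?case using eng(3,4) add unfolding I_def by (simp add: I_def[symmetric])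
  qed
  show ?thesis
    by (rule idealI[OF A.ring_axioms sub]) (use ideal in auto)
qed

subsection \<open>Quotient algebras\<close>

context alg begin

context
  fixes I assumes I: "ideal I A"
begin

interpretation I: ideal I A by (rule I)

lemma alg_quot_sel:
  "carrier (alg_quot A I) = (\<lambda>a. I +> a) ` carrier A"
  "\<one>\<^bsub>alg_quot A I\<^esub> = I +> \<one>"
  "\<zero>\<^bsub>alg_quot A I\<^esub> = I +> \<zero>"
  by (auto simp: alg_quot_def FactRing_def A_RCOSETS_def' I.a_rcos_const)

lemma alg_quot_ops:
  assumes "a \<in> carrier A" "b \<in> carrier A"
  shows "(I +> a) \<otimes>\<^bsub>alg_quot A I\<^esub> (I +> b) = I +> (a \<otimes> b)"
    "(I +> a) \<oplus>\<^bsub>alg_quot A I\<^esub> (I +> b) = I +> (a \<oplus> b)"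
    "r \<odot>\<^bsub>alg_quot A I\<^esub> (I +> a) = I +> (r \<odot> a)"
proof -
  show "(I +> a) \<otimes>\<^bsub>alg_quot A I\<^esub> (I +> b) = I +> (a \<otimes> b)"
    using assms by (simp add: alg_quot_def FactRing_def I.rcoset_mult_add)
  show "(I +> a) \<oplus>\<^bsub>alg_quot A I\<^esub> (I +> b) = I +> (a \<oplus> b)"
    using assms by (simp add: alg_quot_def FactRing_def I.a_rcos_sum)
  have "I +> (r \<odot> x) = I +> (r \<odot> a)" if x: "x \<in> I +> a" for x
  proof -
    have xc: "x \<in> carrier A" using x assms(1) I.a_Hcarr I.a_subset a_r_coset_subset_G by blast
    have "x \<ominus> a \<in> I" using x assms(1) xc
      using I.a_repr_independence'[OF x assms(1)] quotient_eq_iff_same_a_r_cos[OF I xc assms(1)]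
          by simp
    \<comment> \<open>A two-sided ideal of a unital algebra absorbs scalars, since r x = (r 1)
      x.\<close>
    then have "(r \<odot> \<one>) \<otimes> (x \<ominus> a) \<in> I" by (intro I.I_l_closed smult_closed) auto
    moreover have "r \<odot> (x \<ominus> a) = r \<odot> x \<ominus> r \<odot> a"
    proof -
      have "r \<odot> (x \<ominus> a) \<oplus> r \<odot> a = r \<odot> x"
        using xc assms(1) by (simp add: smult_add[symmetric] a_minus_def a_assoc l_neg)
      then show ?thesis using xc assms(1) smult_closed
        by (metis a_minus_def add.inv_solve_right minus_closed)
    qed
    ultimately have "r \<odot> x \<ominus> r \<odot> a \<in> I"
      using xc assms(1) by (simp add: smult_mult)
    then show ?thesis
      using quotient_eq_iff_same_a_r_cos[OF I] smult_closed xc assms(1) by simp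
  qed
  moreover have "a \<in> I +> a" using assms(1) I.a_rcos_self by simp
  ultimately have "(\<Union>x\<in>I +> a. I +> (r \<odot> x)) = I +> (r \<odot> a)" by blast
  then show "r \<odot>\<^bsub>alg_quot A I\<^esub> (I +> a) = I +> (r \<odot> a)"
    by (simp add: alg_quot_def)
qed

lemma alg_alg_quot: "alg (alg_quot A I)"
proof -
  let ?Q = "alg_quot A I"
  have "ring ?Q"
  proof (rule ringI)
    show "abelian_group ?Q"
    proof (rule abelian_groupI)
      fix X assume "X \<in> carrier ?Q"
      then obtain a where a: "a \<in> carrier A" "X = I +> a" by (auto simp: alg_quot_sel)
      then have "(I +> (\<ominus> a)) \<in> carrier ?Q" "(I +> (\<ominus> a)) \<oplus>\<^bsub>?Q\<^esub> X = \<zero>\<^bsub>?Q\<^esub>"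
        by (simp_all add: alg_quot_sel alg_quot_ops l_neg)
      then show "\<exists>Y\<in>carrier ?Q. Y \<oplus>\<^bsub>?Q\<^esub> X = \<zero>\<^bsub>?Q\<^esub>" by blast
    qed (auto simp: alg_quot_sel alg_quot_ops a_ac)
    show "Group.monoid ?Q"
      by (rule Group.monoid.intro) (auto simp: alg_quot_sel alg_quot_ops m_assoc)
  qed (auto simp: alg_quot_sel alg_quot_ops l_distr r_distr)
  then show ?thesis
    by (rule alg.intro, unfold_locales)
      (auto simp: alg_quot_sel(1) alg_quot_ops smult_closed smult_add add_smult smult_smult
          one_smult
        smult_mult mult_smult)
qed

end

end

subsection \<open>Extension of scalars\<close>

text \<open>A basis vector c times the additivity relation for a and b is the additivity relation
  for c a and c b, with the coefficients multiplied.\<close>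

lemma ideal_ext_relations:
  fixes R :: "'a ring" (structure)
  assumes "ring R"
  shows "ideal (ext_relations R) (monoid_algebra R)"
proof -
  interpret ring R by fact
  let ?A = "monoid_algebra R :: (cq, 'a \<Rightarrow>\<^sub>0 cq) module"
  let ?S = "{Poly_Mapping.single (a \<oplus> b) r - Poly_Mapping.single a r - Poly_Mapping.single b r
      | a b r. a \<in> carrier R \<and> b \<in> carrier R} :: ('a \<Rightarrow>\<^sub>0 cq) set"
  have minus: "p \<otimes>\<^bsub>?A\<^esub> (q - t) = p \<otimes>\<^bsub>?A\<^esub> q - p \<otimes>\<^bsub>?A\<^esub> t" "(q - t) \<otimes>\<^bsub>?A\<^esub> p = q \<otimes>\<^bsub>?A\<^esub> p - t \<otimes>\<^bsub>?A\<^esub> p"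
      for p q t
    using monoid_algebra_mult_add(1)[of R "q - t" t p] monoid_algebra_mult_add(2)[of R p "q - t" t]
    by simp_all
  show ?thesis
    unfolding ext_relations_def
  proof (rule ideal_generate_monoid_algebra)
    show "?S \<subseteq> carrier ?A"
      by (auto simp: monoid_algebra_sel in_keys_iff lookup_minus lookup_single when_def split:
          if_splits)
    fix c r s assume c: "c \<in> carrier R" and "s \<in> ?S"
    then obtain a b t where s: "s = Poly_Mapping.single (a \<oplus> b) t - Poly_Mapping.single a t -
        Poly_Mapping.single b t"
      and ab: "a \<in> carrier R" "b \<in> carrier R" by blast
    have "Poly_Mapping.single c r \<otimes>\<^bsub>?A\<^esub> s = Poly_Mapping.single (c \<otimes> a \<oplus> c \<otimes> b) (r * t)
        - Poly_Mapping.single (c \<otimes> a) (r * t) - Poly_Mapping.single (c \<otimes> b) (r * t)"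
      using c ab by (simp add: s minus monoid_algebra_mult_single r_distr)
    moreover have "s \<otimes>\<^bsub>?A\<^esub> Poly_Mapping.single c r = Poly_Mapping.single (a \<otimes> c \<oplus> b \<otimes> c) (t * r)
        - Poly_Mapping.single (a \<otimes> c) (t * r) - Poly_Mapping.single (b \<otimes> c) (t * r)"
      using c ab by (simp add: s minus monoid_algebra_mult_single l_distr)
    ultimately show "Poly_Mapping.single c r \<otimes>\<^bsub>?A\<^esub> s \<in> generate (add_monoid ?A) ?S
        \<and> s \<otimes>\<^bsub>?A\<^esub> Poly_Mapping.single c r \<in> generate (add_monoid ?A) ?S"
      using c ab by (auto intro!: generate.incl)
  qed
qed

lemma ext_scalars:
  fixes R :: "'a ring" (structure)
  assumes "ring R"
  shows alg_ext_scalars: "alg (ext_scalars R)"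
    and ext_incl_hom: "ext_incl R \<in> Ring.ring_hom R (ext_scalars R)"
proof -
  interpret ring R by fact
  let ?A = "monoid_algebra R :: (cq, 'a \<Rightarrow>\<^sub>0 cq) module"
  interpret A: alg ?A by (rule alg_monoid_algebra)
  have I: "ideal (ext_relations R) ?A" by (rule ideal_ext_relations[OF assms])
  note ops = A.alg_quot_ops[OF I] and sel = A.alg_quot_sel[OF I]
  show "alg (ext_scalars R)"
    unfolding ext_scalars_def by (rule A.alg_alg_quot[OF I])
  have c: "Poly_Mapping.single a r \<in> carrier ?A" if "a \<in> carrier R" for a r
    using that by (simp add: monoid_algebra_sel)
  show "ext_incl R \<in> Ring.ring_hom R (ext_scalars R)"
  proof (rule ring_hom_memI)
    fix a b assume ab: "a \<in> carrier R" "b \<in> carrier R"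
    show "ext_incl R a \<in> carrier (ext_scalars R)"
      using c[OF ab(1)] by (simp add: ext_incl_def ext_scalars_def sel)
    show "ext_incl R (a \<otimes> b) = ext_incl R a \<otimes>\<^bsub>ext_scalars R\<^esub> ext_incl R b"
      using c[OF ab(1)] c[OF ab(2)]
      by (simp add: ext_incl_def ext_scalars_def ops monoid_algebra_mult_single)
    have p: "Poly_Mapping.single a 1 + Poly_Mapping.single b 1 \<in> carrier ?A"
      using A.a_closed[OF c[OF ab(1), of 1] c[OF ab(2), of 1]] by (simp add: monoid_algebra_sel(4))
    have "Poly_Mapping.single (a \<oplus> b) 1 - (Poly_Mapping.single a 1 + Poly_Mapping.single b 1) \<in>
        ext_relations R"
      unfolding ext_relations_def using ab by (intro generate.incl) (auto simp: algebra_simps)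
    then have "ext_relations R +>\<^bsub>?A\<^esub> Poly_Mapping.single (a \<oplus> b) 1
        = ext_relations R +>\<^bsub>?A\<^esub> (Poly_Mapping.single a 1 + Poly_Mapping.single b 1)"
      using A.quotient_eq_iff_same_a_r_cos[OF I c[of "a \<oplus> b"] p] monoid_algebra_minus(2)[OF c[of
          "a \<oplus> b"] p] ab
      by simp
    then show "ext_incl R (a \<oplus> b) = ext_incl R a \<oplus>\<^bsub>ext_scalars R\<^esub> ext_incl R b"
      using c[OF ab(1), of 1] c[OF ab(2), of 1]
      by (simp add: ext_incl_def ext_scalars_def ops monoid_algebra_sel(4))
  next
    show "ext_incl R \<one> = \<one>\<^bsub>ext_scalars R\<^esub>"
      by (simp add: ext_incl_def ext_scalars_def sel monoid_algebra_sel(2))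
  qed
qed

subsection \<open>Presented algebras\<close>

interpretation word: Group.monoid "\<lparr>carrier = UNIV, mult = (@), one = []\<rparr>"
  by (rule Group.monoid.intro) auto

lemma alg_free_alg: "alg free_alg"
  unfolding free_alg_def by (rule word.alg_monoid_algebra)

lemma free_alg_sel:
  "carrier free_alg = UNIV" "\<one>\<^bsub>free_alg\<^esub> = Poly_Mapping.single [] 1" "\<zero>\<^bsub>free_alg\<^esub> = 0"
  "p \<oplus>\<^bsub>free_alg\<^esub> q = p + q" "p \<ominus>\<^bsub>free_alg\<^esub> q = p - q"
  "r \<odot>\<^bsub>free_alg\<^esub> Poly_Mapping.single a s = Poly_Mapping.single a (r * s)"
  "Poly_Mapping.single a r \<otimes>\<^bsub>free_alg\<^esub> Poly_Mapping.single b s = Poly_Mapping.single (a @ b) (r *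
      s)"
  by (simp_all add: free_alg_def monoid_algebra_sel word.monoid_algebra_minus map_times_single
    monoid_algebra_mult_single)

definition word_prod :: "('r, 'a) module \<Rightarrow> ('g \<Rightarrow> 'a) \<Rightarrow> 'g list \<Rightarrow> 'a" where
  "word_prod B g w = foldr (\<lambda>x a. g x \<otimes>\<^bsub>B\<^esub> a) w \<one>\<^bsub>B\<^esub>"

definition free_ext :: "(cq, 'a) module \<Rightarrow> ('g \<Rightarrow> 'a) \<Rightarrow> ('g list \<Rightarrow>\<^sub>0 cq) \<Rightarrow> 'a" where
  "free_ext B g p = (\<Oplus>\<^bsub>B\<^esub>w\<in>Poly_Mapping.keys p. Poly_Mapping.lookup p w \<odot>\<^bsub>B\<^esub> word_prod B g w)"

context
  fixes B :: "(cq, 'a) module" (structure) and g :: "'g \<Rightarrow> 'a"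
  assumes B: "alg B" and g: "\<And>x. g x \<in> carrier B"
begin

interpretation alg B by (rule B)

lemma word_prod_closed: "word_prod B g w \<in> carrier B"
  by (induction w) (auto simp: word_prod_def g)

lemma word_prod_append: "word_prod B g (u @ v) = word_prod B g u \<otimes> word_prod B g v"
proof (induction u)
  case Nil
  then show ?case using word_prod_closed by (simp add: word_prod_def)
next
  case (Cons a u)
  then show ?case using word_prod_closed g by (simp add: word_prod_def m_assoc)
qed

lemma free_ext_superset:
  assumes "finite S" "Poly_Mapping.keys p \<subseteq> S"
  shows "free_ext B g p = (\<Oplus>w\<in>S. Poly_Mapping.lookup p w \<odot> word_prod B g w)"
  unfolding free_ext_def
  by (rule add.finprod_mono_neutral_cong_left[simplified])
    (use assms in \<open>auto simp: smult_closed word_prod_closed zero_smult in_keys_iff\<close>)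

lemma free_ext_zero: "free_ext B g 0 = \<zero>"
  by (simp add: free_ext_def)

lemma free_ext_single: "free_ext B g (Poly_Mapping.single w r) = r \<odot> word_prod B g w"
  by (subst free_ext_superset[where S="{w}"]) (auto simp: smult_closed word_prod_closed)

lemma free_ext_add: "free_ext B g (p + q) = free_ext B g p \<oplus> free_ext B g q"
proof -
  let ?S = "Poly_Mapping.keys p \<union> Poly_Mapping.keys q"
  have "free_ext B g (p + q) = (\<Oplus>w\<in>?S. Poly_Mapping.lookup (p + q) w \<odot> word_prod B g w)"
    using Poly_Mapping.keys_add[of p q] by (intro free_ext_superset) auto
  moreover have "free_ext B g p = (\<Oplus>w\<in>?S. Poly_Mapping.lookup p w \<odot> word_prod B g w)"
    "free_ext B g q = (\<Oplus>w\<in>?S. Poly_Mapping.lookup q w \<odot> word_prod B g w)"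
    by (auto intro!: free_ext_superset)
  ultimately show ?thesis
    by (simp add: lookup_add add_smult word_prod_closed smult_closed finsum_addf)
qed

lemma free_ext_closed: "free_ext B g p \<in> carrier B"
  unfolding free_ext_def by (intro finsum_closed) (auto simp: smult_closed word_prod_closed)

lemma free_ext_mult: "free_ext B g (p \<otimes>\<^bsub>free_alg\<^esub> q) = free_ext B g p \<otimes> free_ext B g q"
proof -
  have add: "(p + q) \<otimes>\<^bsub>free_alg\<^esub> t = p \<otimes>\<^bsub>free_alg\<^esub> t + q \<otimes>\<^bsub>free_alg\<^esub> t"
    "t \<otimes>\<^bsub>free_alg\<^esub> (p + q) = t \<otimes>\<^bsub>free_alg\<^esub> p + t \<otimes>\<^bsub>free_alg\<^esub> q"
    "0 \<otimes>\<^bsub>free_alg\<^esub> p = 0" "p \<otimes>\<^bsub>free_alg\<^esub> 0 = 0" for p q t :: "'g list \<Rightarrow>\<^sub>0 cq"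
    by (simp_all add: free_alg_def monoid_algebra_mult_add monoid_algebra_mult_zero)
  note mult = free_alg_sel add
  have "Poly_Mapping.keys p \<subseteq> UNIV" by simp
  then show ?thesis
  proof (induction rule: poly_mapping_single_induct)
    case (add a r p)
    have "Poly_Mapping.keys q \<subseteq> UNIV" by simp
    then have "free_ext B g (Poly_Mapping.single a r \<otimes>\<^bsub>free_alg\<^esub> q) = free_ext B g
        (Poly_Mapping.single a r) \<otimes> free_ext B g q"
      by (induction rule: poly_mapping_single_induct)
        (simp_all add: mult free_ext_add free_ext_zero free_ext_single word_prod_append r_distr
          free_ext_closed smult_closed word_prod_closed smult_mult mult_smult
              smult_smult[symmetric] mult.commute)
    then show ?case using add by (simp add: mult free_ext_add l_distr free_ext_closed)
  qed (simp add: mult free_ext_zero free_ext_closed)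
qed

lemma free_ext_smult: "free_ext B g (r \<odot>\<^bsub>free_alg\<^esub> p) = r \<odot> free_ext B g p"
proof -
  have "Poly_Mapping.keys p \<subseteq> UNIV" by simp
  then show ?thesis
    by (induction rule: poly_mapping_single_induct)
      (simp_all add: free_alg_def monoid_algebra_sel map_times_zero map_times_add map_times_single
          free_ext_add free_ext_zero
        free_ext_single smult_zero smult_add free_ext_closed smult_closed word_prod_closed
            smult_smult)
qed

lemma free_ext_one: "free_ext B g \<one>\<^bsub>free_alg\<^esub> = \<one>"
  by (simp add: free_alg_sel free_ext_single word_prod_def one_smult)

lemma free_ext_span: "free_ext B g p \<in> alg_span B (range g)"
proof -
  have w: "word_prod B g w \<in> alg_span B (range g)" for w
    by (induction w) (auto simp: word_prod_def intro: alg_span.intros)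
  have "Poly_Mapping.keys p \<subseteq> UNIV" by simp
  then show ?thesis
    by (induction rule: poly_mapping_single_induct)
      (auto simp: free_ext_zero free_ext_add free_ext_single intro: alg_span.intros w)
qed

text \<open>The universal property of an algebra given by generators and relations. Functions in HOL
  are total, so uniqueness can hold only among functions that are fixed outside the carrier, which
  is what \<open>extensional\<close> provides.\<close>

lemma presented_alg_hom:
  assumes rel: "\<And>p. p \<in> S \<Longrightarrow> free_ext B g p = \<zero>"
  defines "I \<equiv> Idl\<^bsub>free_alg\<^esub> S"
  shows "\<exists>!\<phi>. \<phi> \<in> alg_hom (alg_quot free_alg I) (subalg_generated B (range g)) \<and>
    \<phi> \<in> extensional (carrier (alg_quot free_alg I)) \<and>
    (\<forall>x. \<phi> (I +>\<^bsub>free_alg\<^esub> Poly_Mapping.single [x] 1) = g x)"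
proof -
  interpret F: alg "free_alg :: (cq, 'g list \<Rightarrow>\<^sub>0 cq) module" by (rule alg_free_alg)
  have I: "ideal I free_alg" unfolding I_def by (rule F.genideal_ideal) (simp add: free_alg_sel)
  note sel = F.alg_quot_sel[OF I] and ops = F.alg_quot_ops[OF I, simplified free_alg_sel,
      simplified]
  have hom: "free_ext B g \<in> Ring.ring_hom free_alg B"
    by (rule ring_hom_memI) (auto simp: free_ext_closed free_ext_mult free_ext_add free_ext_one
        free_alg_sel(4))
  note hom_ring = ring_hom_ringI2[OF F.ring_axioms ring_axioms hom]
  have "I \<subseteq> a_kernel free_alg B (free_ext B g)"
    unfolding I_def by (rule F.genideal_minimal[OF ring_hom_ring.kernel_is_ideal[OF hom_ring]])
      (auto simp: a_kernel_def' free_alg_sel rel)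
  then have ker: "free_ext B g p = \<zero>" if "p \<in> I" for p using that by (auto simp: a_kernel_def')
  have cong: "free_ext B g p = free_ext B g q" if "I +>\<^bsub>free_alg\<^esub> p = I +>\<^bsub>free_alg\<^esub> q" for p q
  proof -
    have "p - q \<in> I"
      using that F.quotient_eq_iff_same_a_r_cos[OF I, of p q] by (simp add: free_alg_sel)
    then show ?thesis using free_ext_add[of "p - q" q] ker free_ext_closed by simp
  qed
  \<comment> \<open>A coset is evaluated at an arbitrary representative; \<open>cong\<close> makes
    the choice irrelevant.\<close>
  define \<phi> where "\<phi> = (\<lambda>X\<in>carrier (alg_quot free_alg I). free_ext B g (SOME p. X = I +>\<^bsub>free_alg\<^esub>
      p))"
  have \<phi>: "\<phi> (I +>\<^bsub>free_alg\<^esub> p) = free_ext B g p" for p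
  proof -
    have "\<phi> (I +>\<^bsub>free_alg\<^esub> p)
        = free_ext B g (SOME q. I +>\<^bsub>free_alg\<^esub> p = I +>\<^bsub>free_alg\<^esub> q)"
      unfolding \<phi>_def by (rule restrict_apply') (simp add: sel free_alg_sel)
    also have "\<dots> = free_ext B g p"
      by (rule cong[symmetric], rule someI) (rule HOL.refl)
    finally show ?thesis .
  qed
  have \<phi>_ext: "\<phi> \<in> extensional (carrier (alg_quot free_alg I))" by (simp add: \<phi>_def)
  have sub: "carrier (subalg_generated B (range g)) = alg_span B (range g)"
    "x \<otimes>\<^bsub>subalg_generated B (range g)\<^esub> y = x \<otimes> y" "x \<oplus>\<^bsub>subalg_generated B (range g)\<^esub> y = x \<oplus> y"
    "\<one>\<^bsub>subalg_generated B (range g)\<^esub> = \<one>" "r \<odot>\<^bsub>subalg_generated B (range g)\<^esub> x = r \<odot> x" for x y r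
    by (simp_all add: subalg_generated_def)
  have carr: "carrier (alg_quot free_alg I) = range (\<lambda>p. I +>\<^bsub>free_alg\<^esub> p)"
    by (simp add: sel free_alg_sel)
  show ?thesis
  proof (rule ex1I[of _ \<phi>], intro conjI allI)
    have "\<phi> \<in> Ring.ring_hom (alg_quot free_alg I) (subalg_generated B (range g))"
      by (rule ring_hom_memI)
        (auto simp: carr sub ops \<phi> sel(2) free_ext_span free_ext_mult free_ext_add free_ext_one)
    then show "\<phi> \<in> alg_hom (alg_quot free_alg I) (subalg_generated B (range g))"
      by (auto simp: alg_hom_def carr ops \<phi> free_ext_smult sub)
    show "\<phi> \<in> extensional (carrier (alg_quot free_alg I))" by (rule \<phi>_ext)
    show "\<phi> (I +>\<^bsub>free_alg\<^esub> Poly_Mapping.single [x] 1) = g x" for x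
      using g by (simp add: \<phi> free_ext_single word_prod_def one_smult)
  next
    fix \<psi> assume \<psi>: "\<psi> \<in> alg_hom (alg_quot free_alg I) (subalg_generated B (range g)) \<and>
      \<psi> \<in> extensional (carrier (alg_quot free_alg I)) \<and>
      (\<forall>x. \<psi> (I +>\<^bsub>free_alg\<^esub> Poly_Mapping.single [x] 1) = g x)"
    let ?c = "\<lambda>p. I +>\<^bsub>free_alg\<^esub> p"
    have 1: "\<psi> (?c (p \<otimes>\<^bsub>free_alg\<^esub> q)) = \<psi> (?c p) \<otimes> \<psi> (?c q)" "\<psi> (?c (p + q)) = \<psi> (?c p) \<oplus> \<psi> (?c q)"
      "\<psi> (?c (r \<odot>\<^bsub>free_alg\<^esub> p)) = r \<odot> \<psi> (?c p)" "\<psi> (?c \<one>\<^bsub>free_alg\<^esub>) = \<one>" for p q r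
      using \<psi> ring_hom_mult[of \<psi> "alg_quot free_alg I" "subalg_generated B (range g)" "?c p" "?c q"]
        ring_hom_add[of \<psi> "alg_quot free_alg I" "subalg_generated B (range g)" "?c p" "?c q"]
        ring_hom_one[of \<psi> "alg_quot free_alg I" "subalg_generated B (range g)"]
      by (auto simp: alg_hom_def carr ops sub sel(2) simp flip: ops(3))
    \<comment> \<open>A homomorphism is determined by its values on generators: first on words, then
      on scalar multiples of words, then on sums.\<close>
    have w: "\<psi> (?c (Poly_Mapping.single w 1)) = word_prod B g w" for w
    proof (induction w)
      case Nil
      then show ?case using 1(4) by (simp add: word_prod_def free_alg_sel)
    next
      case (Cons x w)
      then show ?case
        using 1(1)[of "Poly_Mapping.single [x] 1" "Poly_Mapping.single w 1"] \<psi>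
        by (simp add: word_prod_def free_alg_sel)
    qed
    have "\<psi> (?c p) = free_ext B g p" for p
    proof -
      have s: "\<psi> (?c (Poly_Mapping.single w r)) = r \<odot> word_prod B g w" for w r
        using 1(3)[of r "Poly_Mapping.single w 1"] w by (simp add: free_alg_sel)
      have "Poly_Mapping.keys p \<subseteq> UNIV" by simp
      then show ?thesis
      proof (induction rule: poly_mapping_single_induct)
        case zero
        then show ?case using s[of "[]" 0] by (simp add: zero_smult word_prod_closed free_ext_zero)
      qed (simp add: 1 s free_ext_add free_ext_single)
    qed
    then show "\<psi> = \<phi>"
      using \<psi> \<phi>_ext by (intro extensionalityI[of _ "carrier (alg_quot free_alg I)"]) (auto simp:
          carr \<phi>)
  qed
qed

end

section \<open>Grothendieck rings\<close>

context lin_mon_cat begin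

text \<open>Tensoring with an object is an additive functor, so it carries the four structure maps
  of a biproduct to those of another one.\<close>

lemma is_dsum_tens:
  assumes "is_dsum C Z X Y" "A \<in> objs C"
  shows "is_dsum C (tens_ob C A Z) (tens_ob C A X) (tens_ob C A Y)"
    "is_dsum C (tens_ob C Z A) (tens_ob C X A) (tens_ob C Y A)"
proof -
  from assms(1) obtain i j p r where o: "Z \<in> objs C" "X \<in> objs C" "Y \<in> objs C"
    and t: "i \<in> Hom C X Z" "j \<in> Hom C Y Z" "p \<in> Hom C Z X" "r \<in> Hom C Z Y"
    and eq: "cmp C p i = idn C X" "cmp C r j = idn C Y" "cmp C p j = nul C Y X" "cmp C r i = nul C
        X Y"
      "padd C (cmp C i p) (cmp C j r) = idn C Z"
    unfolding is_dsum_def by blast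
  note a = idn[OF assms(2)]
  note aa = cmp_idn(1)[OF a]
  have il: "cmp C (tens C (idn C A) g) (tens C (idn C A) f) = tens C (idn C A) (cmp C g f)"
    "cmp C (tens C g (idn C A)) (tens C f (idn C A)) = tens C (cmp C g f) (idn C A)"
    if "g \<in> Hom C V U" "f \<in> Hom C T V" for f g T U V
    using interchange[OF a a that] interchange[OF that a a] aa by simp_all
  note ip = cmp[OF t(1,3)] and jr = cmp[OF t(2,4)]
  show "is_dsum C (tens_ob C A Z) (tens_ob C A X) (tens_ob C A Y)"
    unfolding is_dsum_def
    by (intro conjI tens_ob assms(2) o bexI[of _ "tens C (idn C A) i"] bexI[of _ "tens C (idn C A)
        j"]
        bexI[of _ "tens C (idn C A) p"] bexI[of _ "tens C (idn C A) r"] tens a t)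
      (simp_all add: il[OF t(3,1)] il[OF t(4,2)] il[OF t(3,2)] il[OF t(4,1)] il[OF t(1,3)] il[OF
          t(2,4)]
        eq tens_idn assms(2) o tens_nul[OF a] flip: tens_padd(1)[OF a ip jr])
  show "is_dsum C (tens_ob C Z A) (tens_ob C X A) (tens_ob C Y A)"
    unfolding is_dsum_def
    by (intro conjI tens_ob assms(2) o bexI[of _ "tens C i (idn C A)"] bexI[of _ "tens C j (idn C
        A)"]
        bexI[of _ "tens C p (idn C A)"] bexI[of _ "tens C r (idn C A)"] tens a t)
      (simp_all add: il[OF t(3,1)] il[OF t(4,2)] il[OF t(3,2)] il[OF t(4,1)] il[OF t(1,3)] il[OF
          t(2,4)]
        eq tens_idn assms(2) o tens_nul[OF a] flip: tens_padd(2)[OF a ip jr])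
qed

lemma monoid_objs: "Group.monoid \<lparr>carrier = objs C, mult = tens_ob C, one = unit_ob C\<rparr>"
  by (rule Group.monoid.intro) (simp_all add: tens_ob unit_ob tens_ob_assoc tens_ob_unit)

lemma alg_object_ring: "alg (object_ring C)"
  unfolding object_ring_def by (rule monoid.alg_monoid_algebra[OF monoid_objs])

lemma ideal_K0_relations: "ideal (K0_relations C) (object_ring C)"
proof -
  interpret M: Group.monoid "\<lparr>carrier = objs C, mult = tens_ob C, one = unit_ob C\<rparr>"
    by (rule monoid_objs)
  interpret A: alg "object_ring C" by (rule alg_object_ring)
  let ?S = "{frag_of Z - frag_of X - frag_of Y | X Y Z. is_dsum C Z X Y}"
  let ?I = "generate (add_monoid (object_ring C)) ?S"
  have S: "?S \<subseteq> carrier (object_ring C)"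
    by (auto simp: object_ring_def monoid_algebra_sel is_dsum_def in_keys_iff lookup_minus
        lookup_single
        when_def split: if_splits)
  have sub: "subgroup ?I (add_monoid (object_ring C))"
    using S by (intro A.add.generate_is_subgroup) simp
  have add: "p + q \<in> ?I" if "p \<in> ?I" "q \<in> ?I" for p q
    using subgroup.m_closed[OF sub that] by (simp add: object_ring_def monoid_algebra_sel)
  have zero: "0 \<in> ?I"
    using subgroup.one_closed[OF sub] by (simp add: object_ring_def monoid_algebra_sel)
  have neg: "- p \<in> ?I" if "p \<in> ?I" for p
  proof -
    have "p \<in> carrier (object_ring C)" using subgroup.mem_carrier[OF sub that] by simp
    then have "\<ominus>\<^bsub>object_ring C\<^esub> p = - p"
      using M.monoid_algebra_minus(1)[of p p] by (simp add: object_ring_def)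
    then show ?thesis using subgroup.m_inv_closed[OF sub that] by (simp add: a_inv_def)
  qed
  \<comment> \<open>The generating relations have coefficient \<open>1\<close>, but a product with
    \<open>Poly_Mapping.single a r\<close> has coefficient \<open>r\<close>. Integer multiples are
    reached by induction in both directions.\<close>
  have multiple: "Poly_Mapping.single Z r - Poly_Mapping.single X r - Poly_Mapping.single Y r \<in> ?I"
    if d: "is_dsum C Z X Y" for X Y Z r
  proof -
    let ?g = "\<lambda>r. Poly_Mapping.single Z r - Poly_Mapping.single X r - Poly_Mapping.single Y r"
    have one: "?g 1 \<in> ?I" using d by (intro generate.incl) blast
    show ?thesis
    proof (induction r rule: int_induct[where k=0])
      case base
      then show ?case using zero by simp
    next
      case (step1 r)
      have "?g (r + 1) = ?g r + ?g 1" by (simp add: single_add)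
      then show ?case using add step1 one by simp
    next
      case (step2 r)
      have "?g (r - 1) = ?g r + - ?g 1" by (simp add: single_diff)
      then show ?case using add[OF step2(2) neg[OF one]] by simp
    qed
  qed
  have minus: "p \<otimes>\<^bsub>object_ring C\<^esub> (q - t) = p \<otimes>\<^bsub>object_ring C\<^esub> q - p \<otimes>\<^bsub>object_ring C\<^esub> t"
    "(q - t) \<otimes>\<^bsub>object_ring C\<^esub> p = q \<otimes>\<^bsub>object_ring C\<^esub> p - t \<otimes>\<^bsub>object_ring C\<^esub> p" for p q t
    unfolding object_ring_def
    using monoid_algebra_mult_add(1)[of _ "q - t" t p] monoid_algebra_mult_add(2)[of _ p "q - t" t]
    by (metis add_diff_cancel_right' diff_add_cancel)+
  show ?thesis
    unfolding K0_relations_def object_ring_def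
  proof (rule M.ideal_generate_monoid_algebra, fold object_ring_def)
    show "?S \<subseteq> carrier (object_ring C)" by (rule S)
    fix a r s assume a: "a \<in> carrier \<lparr>carrier = objs C, mult = tens_ob C, one = unit_ob C\<rparr>" and "s
        \<in> ?S"
    then obtain X Y Z where s: "s = frag_of Z - frag_of X - frag_of Y" and d: "is_dsum C Z X Y" by
        blast
    have single: "Poly_Mapping.single a r \<otimes>\<^bsub>object_ring C\<^esub> Poly_Mapping.single b t =
        Poly_Mapping.single (tens_ob C a b) (r * t)"
      for a b r t
      by (simp add: object_ring_def monoid_algebra_mult_single)
    show "Poly_Mapping.single a r \<otimes>\<^bsub>object_ring C\<^esub> s \<in> ?I \<and> s \<otimes>\<^bsub>object_ring C\<^esub> Poly_Mapping.single
        a r \<in> ?I"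
      using multiple[OF is_dsum_tens(1)[OF d, of a]] multiple[OF is_dsum_tens(2)[OF d, of a]] a
      by (simp add: s minus single)
  qed
qed

lemma ring_K0: "ring (K0 C)"
  unfolding K0_def by (rule ideal.quotient_is_ring[OF ideal_K0_relations])

lemma K0_class_carrier: "X \<in> objs C \<Longrightarrow> K0_class C X \<in> carrier (K0 C)"
  by (auto simp: K0_class_def K0_def FactRing_def A_RCOSETS_def' object_ring_def monoid_algebra_sel
      intro!: exI[of _ "frag_of X"])

lemma K0_class_mult:
  assumes "X \<in> objs C" "Y \<in> objs C"
  shows "K0_class C X \<otimes>\<^bsub>K0 C\<^esub> K0_class C Y = K0_class C (tens_ob C X Y)"
proof -
  have "frag_of X \<in> carrier (object_ring C)" "frag_of Y \<in> carrier (object_ring C)"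
    using assms by (simp_all add: object_ring_def monoid_algebra_sel)
  then show ?thesis
    using ideal.rcoset_mult_add[OF ideal_K0_relations]
    by (simp add: K0_class_def K0_def FactRing_def)
      (simp add: object_ring_def monoid_algebra_mult_single)
qed

lemma K0_class_dsum:
  assumes "is_dsum C Z X Y"
  shows "K0_class C Z = K0_class C X \<oplus>\<^bsub>K0 C\<^esub> K0_class C Y"
proof -
  interpret M: Group.monoid "\<lparr>carrier = objs C, mult = tens_ob C, one = unit_ob C\<rparr>"
    by (rule monoid_objs)
  interpret A: alg "object_ring C" by (rule alg_object_ring)
  interpret I: ideal "K0_relations C" "object_ring C" by (rule ideal_K0_relations)
  have o: "Z \<in> objs C" "X \<in> objs C" "Y \<in> objs C" using assms by (auto simp: is_dsum_def)
  have c: "frag_of Z \<in> carrier (object_ring C)" "frag_of X \<in> carrier (object_ring C)"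
    "frag_of Y \<in> carrier (object_ring C)"
    using o by (simp_all add: object_ring_def monoid_algebra_sel)
  have plus: "p \<oplus>\<^bsub>object_ring C\<^esub> q = p + q" for p q by (simp add: object_ring_def
      monoid_algebra_sel)
  have c': "frag_of X + frag_of Y \<in> carrier (object_ring C)"
    using A.a_closed[OF c(2,3)] by (simp add: plus)
  have "frag_of Z - frag_of X - frag_of Y \<in> K0_relations C"
    unfolding K0_relations_def using assms by (intro generate.incl) blast
  then have "frag_of Z \<ominus>\<^bsub>object_ring C\<^esub> (frag_of X + frag_of Y) \<in> K0_relations C"
    using M.monoid_algebra_minus(2)[of "frag_of Z" "frag_of X + frag_of Y"] c(1) c'
    by (simp only: object_ring_def[symmetric] diff_diff_eq)
  then have "K0_class C Z = K0_relations C +>\<^bsub>object_ring C\<^esub> (frag_of X + frag_of Y)"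
    using A.quotient_eq_iff_same_a_r_cos[OF ideal_K0_relations c(1) c'] by (simp add: K0_class_def)
  also have "\<dots> = K0_class C X \<oplus>\<^bsub>K0 C\<^esub> K0_class C Y"
    using c by (simp add: K0_class_def K0_def FactRing_def I.a_rcos_sum plus)
  finally show ?thesis .
qed

subsection \<open>Single objects in the additive closure\<close>

lemma add_incl_Hom: "f \<in> Hom C X Y \<Longrightarrow> add_incl C f \<in> Hom (additive_closure C) [X] [Y]"
  using Hom_objs[of f X Y] by (auto simp: Hom_additive_closure add_incl_def HomD)

lemma add_incl_cmp:
  assumes "g \<in> Hom C Y Z" "f \<in> Hom C X Y"
  shows "cmp (additive_closure C) (add_incl C g) (add_incl C f) = add_incl C (cmp C g f)"
  using assms cmp[OF assms] padd_nul[OF cmp[OF assms]]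
  by (auto simp: add_incl_def additive_closure_sel HomD lin_sum_def intro!: eq_matI)

lemma add_incl_idn: "X \<in> objs C \<Longrightarrow> idn (additive_closure C) [X] = add_incl C (idn C X)"
  using idn[of X] by (auto simp: add_incl_def additive_closure_sel HomD intro!: eq_matI)

lemma add_incl_nul: "X \<in> objs C \<Longrightarrow> Y \<in> objs C \<Longrightarrow> nul (additive_closure C) [X] [Y] = add_incl C (nul
    C X Y)"
  using nul[of X Y] by (auto simp: add_incl_def additive_closure_sel HomD intro!: eq_matI)

lemma add_incl_padd:
  assumes "f \<in> Hom C X Y" "g \<in> Hom C X Y"
  shows "padd (additive_closure C) (add_incl C f) (add_incl C g) = add_incl C (padd C f g)"
  using assms padd[OF assms]
  by (auto simp: add_incl_def additive_closure_sel HomD intro!: eq_matI)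

lemma add_incl_scal:
  assumes "f \<in> Hom C X Y"
  shows "scal (additive_closure C) r (add_incl C f) = add_incl C (scal C r f)"
  using assms scal[OF assms, of r]
  by (auto simp: add_incl_def additive_closure_sel HomD intro!: eq_matI)

lemma add_incl_tens:
  assumes "f \<in> Hom C X Y" "g \<in> Hom C X' Y'"
  shows "tens (additive_closure C) (add_incl C f) (add_incl C g) = add_incl C (tens C f g)"
  using assms tens[OF assms]
  by (auto simp: add_incl_def additive_closure_sel HomD intro!: eq_matI)

end

subsection \<open>The Weyl categories\<close>

context
  notes axm = w_eq.axm
begin

lemma w_type [simp]:
  "wsrc (widn u) = u" "wtgt (widn u) = u" "wwt (widn u)"
  "wsrc (wcmp g f) = wsrc f" "wtgt (wcmp g f) = wtgt g"
  "wwt (wcmp g f) \<longleftrightarrow> wwt g \<and> wwt f \<and> wsrc g = wtgt f"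
  "wsrc (wtens f g) = wsrc f @ wsrc g" "wtgt (wtens f g) = wtgt f @ wtgt g"
  "wwt (wtens f g) \<longleftrightarrow> wwt f \<and> wwt g"
  "wsrc (wnul u v) = u" "wtgt (wnul u v) = v" "wwt (wnul u v)"
  "wsrc (wadd f g) = wsrc f" "wtgt (wadd f g) = wtgt f"
  "wwt (wadd f g) \<longleftrightarrow> wwt f \<and> wwt g \<and> wsrc f = wsrc g \<and> wtgt f = wtgt g"
  "wsrc (wscl r f) = wsrc f" "wtgt (wscl r f) = wtgt f" "wwt (wscl r f) \<longleftrightarrow> wwt f"
  by (transfer; simp)+

lemma wscl_0: "wwt f \<Longrightarrow> wscl 0 f = wnul (wsrc f) (wtgt f)"
  by transfer (rule axm, rule lm_axiom.intros; auto)

lemma wscl_wscl: "wwt f \<Longrightarrow> wscl (r * s) f = wscl r (wscl s f)"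
  by transfer (rule axm, rule lm_axiom.intros; auto)

lemma wcmp_wscl:
  "wwt h \<Longrightarrow> wwt f \<Longrightarrow> wsrc h = wtgt f \<Longrightarrow> wcmp h (wscl r f) = wscl r (wcmp h f)"
  "wwt h \<Longrightarrow> wwt f \<Longrightarrow> wsrc h = wtgt f \<Longrightarrow> wcmp (wscl r h) f = wscl r (wcmp h f)"
  by (transfer, rule axm, rule lm_axiom.intros; auto)+

lemma wtens_wscl:
  "wwt h \<Longrightarrow> wwt f \<Longrightarrow> wtens h (wscl r f) = wscl r (wtens h f)"
  "wwt h \<Longrightarrow> wwt f \<Longrightarrow> wtens (wscl r h) f = wscl r (wtens h f)"
  by (transfer, rule axm, rule lm_axiom.intros; auto)+

text \<open>No term axiom composes or tensors a zero morphism. A zero morphism is \<open>0\<close>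
  times itself, and scalars pass through both operations, so absorption follows.\<close>

lemma wnul: "wcmp f (wnul u (wsrc f)) = wnul u (wtgt f)" "wcmp (wnul (wtgt f) u) f = wnul (wsrc f)
    u"
  "wtens f (wnul u v) = wnul (wsrc f @ u) (wtgt f @ v)" "wtens (wnul u v) f = wnul (u @ wsrc f) (v
      @ wtgt f)"
  if "wwt f"
  using that wcmp_wscl(1)[of f "wnul u (wsrc f)" 0] wcmp_wscl(2)[of "wnul (wtgt f) u" f 0]
    wtens_wscl(1)[of f "wnul u v" 0] wtens_wscl(2)[of "wnul u v" f 0]
  by (simp_all add: wscl_0)

lemma wscl_wnul: "wscl r (wnul u v) = wnul u v"
  using wscl_wscl[of "wnul u v" r 0] by (simp add: wscl_0)

lemma W_words_sel:
  "objs W_words = UNIV" "src W_words = wsrc" "tgt W_words = wtgt" "idn W_words = widn"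
  "cmp W_words = wcmp" "nul W_words = wnul" "padd W_words = wadd" "scal W_words = wscl"
  "unit_ob W_words = []" "tens_ob W_words = (@)" "tens W_words = wtens"
  "f \<in> Hom W_words u v \<longleftrightarrow> wwt f \<and> wsrc f = u \<and> wtgt f = v"
  by (simp_all add: W_words_def Hom_def)

lemma w_axioms:
  "wwt h \<Longrightarrow> wwt g \<Longrightarrow> wwt f \<Longrightarrow> wsrc h = wtgt g \<Longrightarrow> wsrc g = wtgt f \<Longrightarrow>
    wcmp (wcmp h g) f = wcmp h (wcmp g f)"
  "wwt f \<Longrightarrow> wcmp f (widn (wsrc f)) = f" "wwt f \<Longrightarrow> wcmp (widn (wtgt f)) f = f"
  "wwt h \<Longrightarrow> wwt f \<Longrightarrow> wwt g \<Longrightarrow> wsrc h = wtgt f \<Longrightarrow> wsrc g = wsrc f \<Longrightarrow> wtgt g = wtgt f \<Longrightarrow>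
    wcmp h (wadd f g) = wadd (wcmp h f) (wcmp h g)"
  "wwt h \<Longrightarrow> wwt f \<Longrightarrow> wwt g \<Longrightarrow> wsrc f = wtgt h \<Longrightarrow> wsrc g = wsrc f \<Longrightarrow> wtgt g = wtgt f \<Longrightarrow>
    wcmp (wadd f g) h = wadd (wcmp f h) (wcmp g h)"
  "wwt f \<Longrightarrow> wwt g \<Longrightarrow> wsrc g = wsrc f \<Longrightarrow> wtgt g = wtgt f \<Longrightarrow>
    wscl r (wadd f g) = wadd (wscl r f) (wscl r g)"
  "wwt f \<Longrightarrow> wwt g \<Longrightarrow> wwt h \<Longrightarrow> wsrc g = wsrc f \<Longrightarrow> wtgt g = wtgt f \<Longrightarrow> wsrc h = wsrc f \<Longrightarrow> wtgt h = wtgt f \<Longrightarrow>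
    wadd (wadd f g) h = wadd f (wadd g h)"
  "wwt f \<Longrightarrow> wadd f (wnul (wsrc f) (wtgt f)) = f"
  "wtens (widn u) (widn v) = widn (u @ v)"
  "wwt g \<Longrightarrow> wwt f \<Longrightarrow> wwt k \<Longrightarrow> wwt h \<Longrightarrow> wsrc g = wtgt f \<Longrightarrow> wsrc k = wtgt h \<Longrightarrow>
    wtens (wcmp g f) (wcmp k h) = wcmp (wtens g k) (wtens f h)"
  "wwt h \<Longrightarrow> wwt f \<Longrightarrow> wwt g \<Longrightarrow> wsrc g = wsrc f \<Longrightarrow> wtgt g = wtgt f \<Longrightarrow>
    wtens h (wadd f g) = wadd (wtens h f) (wtens h g)"
  "wwt h \<Longrightarrow> wwt f \<Longrightarrow> wwt g \<Longrightarrow> wsrc g = wsrc f \<Longrightarrow> wtgt g = wtgt f \<Longrightarrow>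
    wtens (wadd f g) h = wadd (wtens f h) (wtens g h)"
  "wwt f \<Longrightarrow> wwt g \<Longrightarrow> wwt h \<Longrightarrow> wtens (wtens f g) h = wtens f (wtens g h)"
  "wwt f \<Longrightarrow> wtens f (widn []) = f" "wwt f \<Longrightarrow> wtens (widn []) f = f"
  by (transfer, rule axm, rule lm_axiom.intros; auto)+

lemma wadd_comm:
  "wwt f \<Longrightarrow> wwt g \<Longrightarrow> wsrc g = wsrc f \<Longrightarrow> wtgt g = wtgt f \<Longrightarrow> wadd f g = wadd g f"
  by transfer (rule axm, rule lm_axiom.intros; auto)

lemma lin_mon_cat_W_words: "lin_mon_cat W_words"
  by unfold_locales (simp_all add: W_words_sel, (auto simp: wnul wscl_wnul wcmp_wscl w_axioms
      intro: wadd_comm))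

end

section \<open>Diagrams in the asymptotic Weyl category\<close>

text \<open>
  Terms modulo \<open>d_eq\<close> are the morphisms between tensor words in the asymptotic category.
  Source, target and composition are total functions on them, so that typing conditions are
  decided by rewriting.
\<close>

inductive d_eq :: "tm \<Rightarrow> tm \<Rightarrow> bool" where
  weq: "w_eq f g \<Longrightarrow> d_eq f g"
| asym: "d_eq (bdag k \<circ>\<^sub>t TB k) i0"
| sym: "d_eq f g \<Longrightarrow> d_eq g f"
| trans: "d_eq f g \<Longrightarrow> d_eq g h \<Longrightarrow> d_eq f h"
| cmp: "d_eq g g' \<Longrightarrow> d_eq f f' \<Longrightarrow> d_eq (g \<circ>\<^sub>t f) (g' \<circ>\<^sub>t f')"
| tens: "d_eq f f' \<Longrightarrow> d_eq g g' \<Longrightarrow> d_eq (f \<otimes>\<^sub>t g) (f' \<otimes>\<^sub>t g')"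
| add: "d_eq f f' \<Longrightarrow> d_eq g g' \<Longrightarrow> d_eq (f +\<^sub>t g) (f' +\<^sub>t g')"
| scl: "d_eq f f' \<Longrightarrow> d_eq (r *\<^sub>t f) (r *\<^sub>t f')"

lemma d_eq_type:
  assumes "d_eq f g"
  shows "tsrc f = tsrc g \<and> ttgt f = ttgt g \<and> (wt f \<longleftrightarrow> wt g)"
  using assms by induction (auto dest: w_eq_type)

lemma equivp_d_eq: "equivp d_eq"
  by (rule equivpI) (auto intro!: reflpI sympI transpI intro: d_eq.intros w_eq.refl)

quotient_type darr = tm / d_eq
  by (rule equivp_d_eq)

lift_definition dsrc :: "darr \<Rightarrow> word" is tsrc using d_eq_type by blast
lift_definition dtgt :: "darr \<Rightarrow> word" is ttgt using d_eq_type by blast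
lift_definition dwt :: "darr \<Rightarrow> bool" is wt using d_eq_type by blast
lift_definition idd :: "word \<Rightarrow> darr" is TId .
lift_definition dcmp :: "darr \<Rightarrow> darr \<Rightarrow> darr"  (infixr \<open>\<star>\<close> 70) is TCmp by (rule d_eq.cmp)
lift_definition dtens :: "darr \<Rightarrow> darr \<Rightarrow> darr"  (infixr \<open>\<diamondop>\<close> 75) is TTens by (rule d_eq.tens)
lift_definition Nul :: "word \<Rightarrow> word \<Rightarrow> darr" is TNul .
lift_definition dadd :: "darr \<Rightarrow> darr \<Rightarrow> darr"  (infixl \<open>+\<^sub>d\<close> 65) is TAdd by (rule d_eq.add)
lift_definition dscl :: "cq \<Rightarrow> darr \<Rightarrow> darr"  (infixr \<open>*\<^sub>d\<close> 68) is TScl by (rule d_eq.scl)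

abbreviation dsub :: "darr \<Rightarrow> darr \<Rightarrow> darr"  (infixl \<open>-\<^sub>d\<close> 65) where
  "f -\<^sub>d g \<equiv> f +\<^sub>d (-1) *\<^sub>d g"

abbreviation D :: "tm \<Rightarrow> darr" where "D \<equiv> abs_darr"

lemmas D_simps [simp] = dcmp.abs_eq[symmetric] dtens.abs_eq[symmetric] dadd.abs_eq[symmetric]
  dscl.abs_eq[symmetric] idd.abs_eq[symmetric] Nul.abs_eq[symmetric]

lemma D_eq_iff: "D f = D g \<longleftrightarrow> d_eq f g"
  using Quotient_rel[OF Quotient_darr] by (metis equivp_d_eq equivp_reflp)

lemma D_rel: "w_rel f g \<Longrightarrow> D f = D g"
  by (simp add: D_eq_iff d_eq.weq w_eq.rel)

lemma D_type: "dsrc (D f) = tsrc f" "dtgt (D f) = ttgt f" "dwt (D f) = wt f"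
  by (simp_all add: dsrc.abs_eq dtgt.abs_eq dwt.abs_eq)

lemma d_type [simp]:
  "dsrc (idd u) = u" "dtgt (idd u) = u" "dwt (idd u)"
  "dsrc (g \<star> f) = dsrc f" "dtgt (g \<star> f) = dtgt g"
  "dwt (g \<star> f) \<longleftrightarrow> dwt g \<and> dwt f \<and> dsrc g = dtgt f"
  "dsrc (f \<diamondop> g) = dsrc f @ dsrc g" "dtgt (f \<diamondop> g) = dtgt f @ dtgt g"
  "dwt (f \<diamondop> g) \<longleftrightarrow> dwt f \<and> dwt g"
  "dsrc (Nul u v) = u" "dtgt (Nul u v) = v" "dwt (Nul u v)"
  "dsrc (f +\<^sub>d g) = dsrc f" "dtgt (f +\<^sub>d g) = dtgt f"
  "dwt (f +\<^sub>d g) \<longleftrightarrow> dwt f \<and> dwt g \<and> dsrc f = dsrc g \<and> dtgt f = dtgt g"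
  "dsrc (r *\<^sub>d f) = dsrc f" "dtgt (r *\<^sub>d f) = dtgt f" "dwt (r *\<^sub>d f) \<longleftrightarrow> dwt f"
  by (transfer; simp)+

context
  notes axm = d_eq.weq[OF w_eq.axm]
begin

lemma dcmp_assoc:
  "dwt h \<Longrightarrow> dwt g \<Longrightarrow> dwt f \<Longrightarrow> dsrc h = dtgt g \<Longrightarrow> dsrc g = dtgt f \<Longrightarrow> (h \<star> g) \<star> f = h \<star> g \<star> f"
  by transfer (rule axm, rule lm_axiom.intros; auto)

lemma dcmp_Id [simp]:
  "dwt f \<Longrightarrow> dsrc f = u \<Longrightarrow> f \<star> idd u = f" "dwt f \<Longrightarrow> dtgt f = u \<Longrightarrow> idd u \<star> f = f"
  by (transfer, rule axm, rule lm_axiom.intros; auto)+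

lemma dtens_assoc: "dwt f \<Longrightarrow> dwt g \<Longrightarrow> dwt h \<Longrightarrow> (f \<diamondop> g) \<diamondop> h = f \<diamondop> g \<diamondop> h"
  by transfer (rule axm, rule lm_axiom.intros; auto)

lemma dtens_unit [simp]: "dwt f \<Longrightarrow> f \<diamondop> idd [] = f" "dwt f \<Longrightarrow> idd [] \<diamondop> f = f"
  by (transfer, rule axm, rule lm_axiom.intros; auto)+

lemma Id_dtens [simp]: "idd u \<diamondop> idd v = idd (u @ v)"
  by transfer (rule axm, rule lm_axiom.intros; auto)

lemma d_interchange:
  "dwt (g \<star> f) \<Longrightarrow> dwt (k \<star> h) \<Longrightarrow> (g \<star> f) \<diamondop> (k \<star> h) = (g \<diamondop> k) \<star> (f \<diamondop> h)"
  by transfer (rule axm, rule lm_axiom.intros; auto)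

lemma dadd_assoc: "dwt ((f +\<^sub>d g) +\<^sub>d h) \<Longrightarrow> (f +\<^sub>d g) +\<^sub>d h = f +\<^sub>d (g +\<^sub>d h)"
  by transfer (rule axm, rule lm_axiom.intros; auto)

lemma dadd_comm: "dwt (f +\<^sub>d g) \<Longrightarrow> f +\<^sub>d g = g +\<^sub>d f"
  by transfer (rule axm, rule lm_axiom.intros; auto)

lemma dadd_Nul [simp]: "dwt f \<Longrightarrow> dsrc f = u \<Longrightarrow> dtgt f = v \<Longrightarrow> f +\<^sub>d Nul u v = f"
  by transfer (rule axm, rule lm_axiom.intros; auto)

lemma Nul_dadd [simp]: "dwt f \<Longrightarrow> dsrc f = u \<Longrightarrow> dtgt f = v \<Longrightarrow> Nul u v +\<^sub>d f = f"
  using dadd_comm[of "Nul u v" f] by simp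

lemma dscl_0 [simp]: "dwt f \<Longrightarrow> 0 *\<^sub>d f = Nul (dsrc f) (dtgt f)"
  by transfer (rule axm, rule lm_axiom.intros; auto)

lemma dscl_1 [simp]: "dwt f \<Longrightarrow> 1 *\<^sub>d f = f"
  by transfer (rule axm, rule lm_axiom.intros; auto)

lemma dscl_dscl: "dwt f \<Longrightarrow> r *\<^sub>d (s *\<^sub>d f) = (r * s) *\<^sub>d f"
  by (rule HOL.sym, transfer) (rule axm, rule lm_axiom.intros; auto)

lemma dscl_add: "dwt f \<Longrightarrow> (r + s) *\<^sub>d f = r *\<^sub>d f +\<^sub>d s *\<^sub>d f"
  by transfer (rule axm, rule lm_axiom.intros; auto)

lemma dcmp_dadd:
  "dwt (g +\<^sub>d h) \<Longrightarrow> dwt f \<Longrightarrow> dsrc g = dtgt f \<Longrightarrow> (g +\<^sub>d h) \<star> f = g \<star> f +\<^sub>d h \<star> f"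
  "dwt (f +\<^sub>d g) \<Longrightarrow> dwt k \<Longrightarrow> dsrc k = dtgt f \<Longrightarrow> k \<star> (f +\<^sub>d g) = k \<star> f +\<^sub>d k \<star> g"
  by (transfer, rule axm, rule lm_axiom.intros; auto)+

lemma dcmp_dscl:
  "dwt g \<Longrightarrow> dwt f \<Longrightarrow> dsrc g = dtgt f \<Longrightarrow> (r *\<^sub>d g) \<star> f = r *\<^sub>d (g \<star> f)"
  "dwt g \<Longrightarrow> dwt f \<Longrightarrow> dsrc g = dtgt f \<Longrightarrow> g \<star> (r *\<^sub>d f) = r *\<^sub>d (g \<star> f)"
  by (transfer, rule axm, rule lm_axiom.intros; auto)+

lemma dtens_dadd:
  "dwt (g +\<^sub>d h) \<Longrightarrow> dwt f \<Longrightarrow> (g +\<^sub>d h) \<diamondop> f = g \<diamondop> f +\<^sub>d h \<diamondop> f"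
  "dwt (g +\<^sub>d h) \<Longrightarrow> dwt f \<Longrightarrow> f \<diamondop> (g +\<^sub>d h) = f \<diamondop> g +\<^sub>d f \<diamondop> h"
  by (transfer, rule axm, rule lm_axiom.intros; auto)+

lemma dtens_dscl:
  "dwt g \<Longrightarrow> dwt f \<Longrightarrow> (r *\<^sub>d g) \<diamondop> f = r *\<^sub>d (g \<diamondop> f)"
  "dwt g \<Longrightarrow> dwt f \<Longrightarrow> f \<diamondop> (r *\<^sub>d g) = r *\<^sub>d (f \<diamondop> g)"
  by (transfer, rule axm, rule lm_axiom.intros; auto)+

end

lemma dscl_Nul [simp]: "r *\<^sub>d Nul u v = Nul u v"
  using dscl_dscl[of "Nul u v" r 0] by simp

lemma dcmp_Nul [simp]:
  "dwt f \<Longrightarrow> dtgt f = u \<Longrightarrow> Nul u v \<star> f = Nul (dsrc f) v"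
  "dwt f \<Longrightarrow> dsrc f = v \<Longrightarrow> f \<star> Nul u v = Nul u (dtgt f)"
  using dcmp_dscl(1)[of "Nul u v" f 0] dcmp_dscl(2)[of f "Nul u v" 0] by auto

lemma dtens_Nul [simp]:
  "dwt f \<Longrightarrow> Nul u v \<diamondop> f = Nul (u @ dsrc f) (v @ dtgt f)"
  "dwt f \<Longrightarrow> f \<diamondop> Nul u v = Nul (dsrc f @ u) (dtgt f @ v)"
  using dtens_dscl[of "Nul u v" f 0] by auto

subsection \<open>Slices\<close>

text \<open>The whiskering of \<open>f\<close> by identity strands. Diagrams are brought into the
  form of vertical composites of whiskered generators, on which the rewrite rules below
  operate.\<close>

definition sl :: "word \<Rightarrow> darr \<Rightarrow> word \<Rightarrow> darr" where
  "sl u f v = idd u \<diamondop> f \<diamondop> idd v"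

lemma sl_type [simp]:
  "dsrc (sl u f v) = u @ dsrc f @ v" "dtgt (sl u f v) = u @ dtgt f @ v" "dwt (sl u f v) = dwt f"
  by (simp_all add: sl_def)

lemma sl_cmp: "dwt (g \<star> f) \<Longrightarrow> sl u (g \<star> f) v = sl u g v \<star> sl u f v"
  using d_interchange[of "idd u" "idd u" "g \<diamondop> idd v" "f \<diamondop> idd v"] d_interchange[of g f "idd v"
      "idd v"]
  by (simp add: sl_def)

lemma sl_sl: "dwt f \<Longrightarrow> sl u (sl u' f v') v = sl (u @ u') f (v' @ v)"
  by (simp add: sl_def dtens_assoc flip: Id_dtens)

lemma sl_Id: "sl u (idd w) v = idd (u @ w @ v)"
  by (simp add: sl_def)

lemma sl_nil: "dwt f \<Longrightarrow> sl [] f [] = f"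
  by (simp add: sl_def)

lemma sl_Nul: "sl u (Nul w w') v = Nul (u @ w @ v) (u @ w' @ v)"
  by (simp add: sl_def)

lemma sl_dadd: "dwt (f +\<^sub>d g) \<Longrightarrow> sl u (f +\<^sub>d g) v = sl u f v +\<^sub>d sl u g v"
  by (simp add: sl_def dtens_dadd)

lemma sl_dscl: "dwt f \<Longrightarrow> sl u (r *\<^sub>d f) v = r *\<^sub>d sl u f v"
  by (simp add: sl_def dtens_dscl)

lemma dtens_sl: "dwt f \<Longrightarrow> dwt g \<Longrightarrow> f \<diamondop> g = sl [] f (dtgt g) \<star> sl (dsrc f) g []"
  using d_interchange[of f "idd (dsrc f)" "idd (dtgt g)" g] by (simp add: sl_def)

lemma Id_append_dtens: "dwt g \<Longrightarrow> idd (u @ v) \<diamondop> g = idd u \<diamondop> idd v \<diamondop> g"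
  using dtens_assoc[of "idd u" "idd v" g] by simp

text \<open>The morphisms act on disjoint strands, separated by \<open>m\<close>. Both orders of
  composition equal the tensor product of \<open>f\<close>, the identity of \<open>m\<close> and
  \<open>g\<close>.\<close>

lemma exchange:
  assumes "dwt f" "dwt g"
  shows "sl u f (m @ dtgt g @ v) \<star> sl (u @ dsrc f @ m) g v
    = sl (u @ dtgt f @ m) g v \<star> sl u f (m @ dsrc g @ v)"
proof -
  have 1: "f \<diamondop> idd m \<diamondop> g = sl [] f (m @ dtgt g) \<star> sl (dsrc f @ m) g []"
    using d_interchange[of f "idd (dsrc f)" "idd (m @ dtgt g)" "idd m \<diamondop> g"] assms
    by (simp add: sl_def Id_append_dtens)
  have 2: "f \<diamondop> idd m \<diamondop> g = sl (dtgt f @ m) g [] \<star> sl [] f (m @ dsrc g)"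
    using d_interchange[of "idd (dtgt f)" f "idd m \<diamondop> g" "idd (m @ dsrc g)"] assms
    by (simp add: sl_def Id_append_dtens)
  have "sl u (sl [] f (m @ dtgt g) \<star> sl (dsrc f @ m) g []) v
      = sl u (sl (dtgt f @ m) g [] \<star> sl [] f (m @ dsrc g)) v"
    using 1 2 by simp
  then show ?thesis using assms by (simp add: sl_cmp sl_sl)
qed

text \<open>This is \<open>exchange\<close> with the separating word computed by
  \<open>drop\<close>, so that it can rewrite diagrams on concrete words. The length condition says
  that the lower slice ends to the left of the upper one. Scalars are excluded on both sides, as
  nothing would orient their exchange.\<close>

lemma swap:
  assumes "length u' + length (dtgt g) \<le> length u" "dwt f" "dwt g"
    "u @ dsrc f @ v = u' @ dtgt g @ v'" "dsrc f \<noteq> [] \<or> dtgt f \<noteq> []" "dsrc g \<noteq> [] \<or> dtgt g \<noteq> []"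
  shows "sl u f v \<star> sl u' g v'
    = sl u' g (drop (length u' + length (dtgt g)) u @ dtgt f @ v)
      \<star> sl (u' @ dsrc g @ drop (length u' + length (dtgt g)) u) f v"
proof -
  define m where "m = drop (length u' + length (dtgt g)) u"
  have "take (length u' + length (dtgt g)) (u @ dsrc f @ v) = u' @ dtgt g"
    using assms(4) by simp
  then have u: "u = u' @ dtgt g @ m"
    using assms(1) append_take_drop_id[of "length u' + length (dtgt g)" u] by (simp add: m_def)
  then have "v' = m @ dsrc f @ v" using assms(4) by simp
  then show ?thesis
    using exchange[OF assms(3,2), of u' m v] u by (simp flip: m_def)
qed

text \<open>Composites are kept nested to the right, so a rule for two adjacent factors has to be
  repeated with an arbitrary remainder \<open>x\<close>.\<close>

lemma cmp_reassoc:
  assumes "a \<star> b = c \<star> d" "dwt (a \<star> b)" "dwt x" "dtgt x = dsrc b"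
  shows "a \<star> b \<star> x = c \<star> d \<star> x"
proof -
  have bd: "dsrc b = dsrc d" using assms(1) by (metis d_type(4))
  have "dwt (c \<star> d)" using assms(1,2) by metis
  then have "(a \<star> b) \<star> x = a \<star> b \<star> x" "(c \<star> d) \<star> x = c \<star> d \<star> x"
    using assms(2-) \<open>dwt (c \<star> d)\<close> bd by (auto intro!: dcmp_assoc)
  then show ?thesis using assms(1) by simp
qed

lemma swap_chain:
  assumes "length u' + length (dtgt g) \<le> length u" "dwt f" "dwt g"
    "u @ dsrc f @ v = u' @ dtgt g @ v'" "dsrc f \<noteq> [] \<or> dtgt f \<noteq> []" "dsrc g \<noteq> [] \<or> dtgt g \<noteq> []"
    "dwt x" "dtgt x = u' @ dsrc g @ v'"
  shows "sl u f v \<star> sl u' g v' \<star> x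
    = sl u' g (drop (length u' + length (dtgt g)) u @ dtgt f @ v)
      \<star> sl (u' @ dsrc g @ drop (length u' + length (dtgt g)) u) f v \<star> x"
  by (rule cmp_reassoc[OF swap[OF assms(1-6)]]) (use assms in simp_all)

text \<open>
  The next rules move morphisms that are not written as slices. The marker \<open>bare\<close> is only
  established for generators, so that the simplifier does not apply them to slices.
\<close>

definition bare :: "darr \<Rightarrow> bool" where "bare f \<longleftrightarrow> True"

lemma swap_bare:
  "bare f \<Longrightarrow> dtgt g = [] \<Longrightarrow> dsrc f = v \<Longrightarrow> dwt f \<Longrightarrow> dwt g \<Longrightarrow>
      dsrc f \<noteq> [] \<or> dtgt f \<noteq> [] \<Longrightarrow> dsrc g \<noteq> [] \<or> dtgt g \<noteq> [] \<Longrightarrow> f \<star> sl [] g v = sl [] g (dtgt f) \<star>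
          sl (dsrc g) f []"
  "bare g \<Longrightarrow> dsrc f = [] \<Longrightarrow> dtgt g = u \<Longrightarrow> dwt f \<Longrightarrow> dwt g \<Longrightarrow>
      dsrc f \<noteq> [] \<or> dtgt f \<noteq> [] \<Longrightarrow> dsrc g \<noteq> [] \<or> dtgt g \<noteq> [] \<Longrightarrow> sl u f [] \<star> g = sl [] g (dtgt f) \<star>
          sl (dsrc g) f []"
  "bare f \<Longrightarrow> bare g \<Longrightarrow> dsrc f = [] \<Longrightarrow> dtgt g = [] \<Longrightarrow> dwt f \<Longrightarrow> dwt g \<Longrightarrow>
      dsrc f \<noteq> [] \<or> dtgt f \<noteq> [] \<Longrightarrow> dsrc g \<noteq> [] \<or> dtgt g \<noteq> [] \<Longrightarrow> f \<star> g = sl [] g (dtgt f) \<star> sl (dsrc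
          g) f []"
  using exchange[of g f "[]" "[]" "[]"] by (simp_all add: sl_nil)

lemma swap_bare_chain:
  "bare f \<Longrightarrow> dtgt g = [] \<Longrightarrow> dsrc f = v \<Longrightarrow> dtgt x = dsrc g @ v \<Longrightarrow> dwt f \<Longrightarrow> dwt g \<Longrightarrow>
      dsrc f \<noteq> [] \<or> dtgt f \<noteq> [] \<Longrightarrow> dsrc g \<noteq> [] \<or> dtgt g \<noteq> [] \<Longrightarrow> dwt x \<Longrightarrow>
    f \<star> sl [] g v \<star> x = sl [] g (dtgt f) \<star> sl (dsrc g) f [] \<star> x"
  "bare g \<Longrightarrow> dsrc f = [] \<Longrightarrow> dtgt g = u \<Longrightarrow> dtgt x = dsrc g \<Longrightarrow> dwt f \<Longrightarrow> dwt g \<Longrightarrow>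
      dsrc f \<noteq> [] \<or> dtgt f \<noteq> [] \<Longrightarrow> dsrc g \<noteq> [] \<or> dtgt g \<noteq> [] \<Longrightarrow> dwt x \<Longrightarrow>
    sl u f [] \<star> g \<star> x = sl [] g (dtgt f) \<star> sl (dsrc g) f [] \<star> x"
  "bare f \<Longrightarrow> bare g \<Longrightarrow> dsrc f = [] \<Longrightarrow> dtgt g = [] \<Longrightarrow> dtgt x = dsrc g \<Longrightarrow> dwt f \<Longrightarrow> dwt g \<Longrightarrow>
      dsrc f \<noteq> [] \<or> dtgt f \<noteq> [] \<Longrightarrow> dsrc g \<noteq> [] \<or> dtgt g \<noteq> [] \<Longrightarrow> dwt x \<Longrightarrow>
    f \<star> g \<star> x = sl [] g (dtgt f) \<star> sl (dsrc g) f [] \<star> x"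
  using cmp_reassoc[OF swap_bare(1)[of f g v], of x] cmp_reassoc[OF swap_bare(2)[of g f u], of x]
    cmp_reassoc[OF swap_bare(3)[of f g], of x] by (simp_all add: bare_def)

text \<open>The scalar lies to the left of \<open>f\<close> in the first case and to its right in
  the second. If \<open>f\<close> is a cap and the scalar stands exactly where it closes, both would
  apply; the side condition of the second case then sends the scalar to the left.\<close>

lemma scalar_swap:
  assumes "dwt z" "dsrc z = []" "dtgt z = []" "dwt f" "u @ v = u' @ dtgt f @ v'"
    "dsrc f \<noteq> [] \<or> dtgt f \<noteq> []"
  shows "length u \<le> length u' \<Longrightarrow>
      sl u z v \<star> sl u' f v' = sl u' f v' \<star> sl u z (drop (length u) u' @ dsrc f @ v')"
    "length u' + length (dtgt f) \<le> length u \<Longrightarrow> dtgt f \<noteq> [] \<or> u \<noteq> u' \<Longrightarrow>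
      sl u z v \<star> sl u' f v' = sl u' f v' \<star> sl (u' @ dsrc f @ drop (length u' + length (dtgt f)) u)
          z v"
proof -
  assume le: "length u \<le> length u'"
  define m where "m = drop (length u) u'"
  have "take (length u) (u @ v) = take (length u) (u' @ dtgt f @ v')" using assms(5) by simp
  then have "u' = u @ m" using le append_take_drop_id[of "length u" u'] by (simp add: m_def)
  moreover then have "v = m @ dtgt f @ v'" using assms(5) by simp
  ultimately show "sl u z v \<star> sl u' f v' = sl u' f v' \<star> sl u z (drop (length u) u' @ dsrc f @ v')"
    using exchange[OF assms(1,4), of u m v'] assms by simp
next
  assume le: "length u' + length (dtgt f) \<le> length u"
  define m where "m = drop (length u' + length (dtgt f)) u"
  have "take (length u' + length (dtgt f)) (u @ v) = u' @ dtgt f"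
    using assms(5) by simp
  then have u: "u = u' @ dtgt f @ m"
    using le append_take_drop_id[of "length u' + length (dtgt f)" u] by (simp add: m_def)
  then have "v' = m @ v" using assms(5) by simp
  then show "sl u z v \<star> sl u' f v' = sl u' f v' \<star> sl (u' @ dsrc f @ drop (length u' + length (dtgt
      f)) u) z v"
    using exchange[OF assms(4,1), of u' m v] u assms by simp
qed

lemma scalar_swap_chain:
  assumes "dwt z" "dsrc z = []" "dtgt z = []" "dwt f" "u @ v = u' @ dtgt f @ v'"
    "dsrc f \<noteq> [] \<or> dtgt f \<noteq> []" "dwt x" "dtgt x = u' @ dsrc f @ v'"
  shows "length u \<le> length u' \<Longrightarrow>
      sl u z v \<star> sl u' f v' \<star> x = sl u' f v' \<star> sl u z (drop (length u) u' @ dsrc f @ v') \<star> x"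
    "length u' + length (dtgt f) \<le> length u \<Longrightarrow> dtgt f \<noteq> [] \<or> u \<noteq> u' \<Longrightarrow>
      sl u z v \<star> sl u' f v' \<star> x
        = sl u' f v' \<star> sl (u' @ dsrc f @ drop (length u' + length (dtgt f)) u) z v \<star> x"
  by (rule cmp_reassoc[OF scalar_swap(1)[OF assms(1-6)]]; use assms in simp)
    (rule cmp_reassoc[OF scalar_swap(2)[OF assms(1-6)]]; use assms in simp)

text \<open>Endomorphisms of the unit commute at any two positions: whichever stands further left,
  \<open>exchange\<close> applies with the strands between them.\<close>

lemma scalar_comm:
  assumes "dwt z" "dsrc z = []" "dtgt z = []" "dwt w" "dsrc w = []" "dtgt w = []" "u @ v = u' @ v'"
  shows "sl u z v \<star> sl u' w v' = sl u' w v' \<star> sl u z v"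
  using assms(7)
proof (elim append_eq_append_conv2[THEN iffD1, THEN exE])
  fix m assume "u = u' @ m \<and> m @ v = v' \<or> u @ m = u' \<and> v = m @ v'"
  then show ?thesis
    using exchange[OF assms(1,4), of u m v'] exchange[OF assms(4,1), of u' m v] assms by auto
qed

lemma scalar_comm_chain:
  assumes "dwt z" "dsrc z = []" "dtgt z = []" "dwt w" "dsrc w = []" "dtgt w = []" "u @ v = u' @ v'"
    "dwt x" "dtgt x = u' @ v'"
  shows "sl u z v \<star> sl u' w v' \<star> x = sl u' w v' \<star> sl u z v \<star> x"
  by (rule cmp_reassoc[OF scalar_comm[OF assms(1-7)]]) (use assms in simp_all)

text \<open>
  Of two independent slices, \<open>nf\<close> moves the left one up (composes it later), and it moves
  scalars down. Two diagrams that agree up to isotopy not involving zigzags are mostly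
  identified by \<open>simp add: nf\<close>; the exceptions are scalars enclosed by a cup below, which
  cannot be moved down.
\<close>

lemmas norm = dcmp_assoc sl_cmp sl_sl sl_Id sl_nil sl_Nul sl_dadd sl_dscl dtens_sl
lemmas nf = norm swap swap_chain swap_bare swap_bare_chain scalar_swap scalar_swap_chain

subsection \<open>Generators\<close>

definition "\<eta> = D TEta"
definition "\<epsilon> = D TEps"
definition "\<eta>' = D TEta'"
definition "\<epsilon>' = D TEps'"
definition "EE = D TE"
definition "Es = D Emate"
definition "\<beta> k = D (TB k)"
definition "\<beta>d k = D (bdag k)"
definition "\<gamma> k = D (cc k)"

abbreviation Idp :: darr where "Idp \<equiv> idd [Plus]"
abbreviation Idm :: darr where "Idm \<equiv> idd [Minus]"

lemma gen_type [simp]: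
  "dsrc \<eta> = []" "dtgt \<eta> = [Minus, Plus]" "dwt \<eta>"
  "dsrc \<epsilon> = [Minus, Plus]" "dtgt \<epsilon> = []" "dwt \<epsilon>"
  "dsrc \<eta>' = []" "dtgt \<eta>' = [Plus, Minus]" "dwt \<eta>'"
  "dsrc \<epsilon>' = [Plus, Minus]" "dtgt \<epsilon>' = []" "dwt \<epsilon>'"
  "dsrc EE = [Plus, Plus]" "dtgt EE = [Plus, Plus]" "dwt EE"
  "dsrc Es = [Minus, Minus]" "dtgt Es = [Minus, Minus]" "dwt Es"
  "dsrc (\<beta> k) = []" "dtgt (\<beta> k) = []" "dwt (\<beta> k)"
  "dsrc (\<beta>d k) = []" "dtgt (\<beta>d k) = []" "dwt (\<beta>d k)"
  "dsrc (\<gamma> k) = []" "dtgt (\<gamma> k) = []" "dwt (\<gamma> k)"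
  by (simp_all add: \<eta>_def \<epsilon>_def \<eta>'_def \<epsilon>'_def EE_def Es_def \<beta>_def \<beta>d_def \<gamma>_def D_type Emate_def
    del: D_simps)

lemma bare_gen [simp]: "bare \<eta>" "bare \<epsilon>" "bare \<eta>'" "bare \<epsilon>'" "bare EE" "bare Es"
  by (simp_all add: bare_def)

lemmas gen_defs = \<eta>_def[symmetric] \<epsilon>_def[symmetric] \<eta>'_def[symmetric] \<epsilon>'_def[symmetric]
  EE_def[symmetric] \<beta>_def[symmetric] \<beta>d_def[symmetric] \<gamma>_def[symmetric] Es_def[symmetric]

definition q2 :: cq where "q2 = qint 2"

text \<open>Division by zero yields \<open>0\<close>, so both the numerator and the denominator of
  \<open>qint 2\<close> have to be nonzero. Powers of \<open>qq\<close> are monomials, hence q^4 and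
  q^2 differ from 1.\<close>

lemma q2_nonzero: "q2 \<noteq> 0"
proof -
  have pow: "qq ^ n = Fract (monom 1 n) 1" for n
    by (induction n) (simp_all add: qq_def One_fract_def mult_monom)
  have ne: "qq ^ n \<noteq> 1" if "n > 0" for n
  proof
    assume "qq ^ n = 1"
    then have "monom (1::complex) n = 1" by (simp add: pow One_fract_def eq_fract)
    then have "degree (monom (1::complex) n) = 0" by simp
    then show False using that by (simp add: degree_monom_eq)
  qed
  have q0: "qq \<noteq> 0" by (simp add: qq_def Zero_fract_def eq_fract monom_eq_0_iff)
  have "qq \<noteq> inverse qq"
  proof
    assume "qq = inverse qq"
    then have "qq * qq = 1" using q0 by (metis right_inverse)
    then show False using ne[of 2] by (simp add: power2_eq_square)
  qed
  moreover have "qq powi 2 \<noteq> qq powi - 2"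
  proof
    assume "qq powi 2 = qq powi - 2"
    then have "qq ^ 2 = inverse (qq ^ 2)" by (simp add: power_int_def power_inverse)
    then have "qq ^ 2 * qq ^ 2 = 1" using q0 by (metis power_not_zero right_inverse)
    then show False using ne[of 4] by (simp flip: power_add)
  qed
  ultimately show ?thesis by (simp add: q2_def qint_def)
qed

lemma iso:
  "(\<epsilon>' \<diamondop> Idp) \<star> (Idp \<diamondop> \<eta>) = Idp"
  "(Idp \<diamondop> \<epsilon>) \<star> (\<eta>' \<diamondop> Idp) = Idp"
  "(Idm \<diamondop> \<epsilon>') \<star> (\<eta> \<diamondop> Idm) = Idm"
  "(\<epsilon> \<diamondop> Idm) \<star> (Idm \<diamondop> \<eta>') = Idm"
  using D_rel[OF iso1] D_rel[OF iso2] D_rel[OF iso3] D_rel[OF iso4] by (simp_all add: gen_defs)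

lemma W_relations:
  "q2 *\<^sub>d (\<epsilon> \<diamondop> Idp) \<star> (Idm \<diamondop> EE) \<star> (\<eta> \<diamondop> Idp) = Idp"
  "q2 *\<^sub>d (Idp \<diamondop> \<epsilon>') \<star> (EE \<diamondop> Idm) \<star> (Idp \<diamondop> \<eta>') = (idd [] -\<^sub>d \<gamma> 0) \<diamondop> Idp"
  "\<epsilon> \<star> \<eta> = q2 *\<^sub>d idd []"
  "((Idm \<diamondop> Idm \<diamondop> EE) \<star> (Idm \<diamondop> \<eta> \<diamondop> Idp) \<star> \<eta>) \<star> (\<epsilon> \<star> (Idm \<diamondop> \<epsilon> \<diamondop> Idp) \<star> (Idm \<diamondop> Idm \<diamondop> EE)) = Es \<diamondop> EE"
  "\<beta>d k = q2 *\<^sub>d idd [] -\<^sub>d \<beta> (k - 1)"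
  "\<beta>d k \<star> \<beta> k = idd []"
  "\<beta> k \<diamondop> Idp = Idp \<diamondop> \<beta> (k + 1)"
proof -
  show 4: "\<epsilon> \<star> \<eta> = q2 *\<^sub>d idd []" using D_rel[OF r4] by (simp add: gen_defs q2_def)
  show "\<beta>d k = q2 *\<^sub>d idd [] -\<^sub>d \<beta> (k - 1)" using 4 by (simp add: \<beta>d_def bdag_def) (simp add:
      gen_defs)
  have "D (bdag k \<circ>\<^sub>t TB k) = D i0" by (simp only: D_eq_iff d_eq.asym)
  then show "\<beta>d k \<star> \<beta> k = idd []" by (simp add: gen_defs)
qed (use D_rel[OF r3] D_rel[OF r3'] D_rel[OF r7] D_rel[OF r8'] in \<open>simp_all add: gen_defs q2_def\<close>)

lemma mate:
  "Es = (\<epsilon> \<diamondop> Idm \<diamondop> Idm) \<star> (Idm \<diamondop> \<epsilon> \<diamondop> Idp \<diamondop> Idm \<diamondop> Idm)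
     \<star> (Idm \<diamondop> Idm \<diamondop> EE \<diamondop> Idm \<diamondop> Idm) \<star> (Idm \<diamondop> Idm \<diamondop> Idp \<diamondop> \<eta>' \<diamondop> Idm) \<star> (Idm \<diamondop> Idm \<diamondop> \<eta>')"
  "Es = (Idm \<diamondop> Idm \<diamondop> \<epsilon>') \<star> (Idm \<diamondop> Idm \<diamondop> Idp \<diamondop> \<epsilon>' \<diamondop> Idm)
     \<star> (Idm \<diamondop> Idm \<diamondop> EE \<diamondop> Idm \<diamondop> Idm) \<star> (Idm \<diamondop> \<eta> \<diamondop> Idp \<diamondop> Idm \<diamondop> Idm) \<star> (\<eta> \<diamondop> Idm \<diamondop> Idm)"
proof -
  show "Es = (\<epsilon> \<diamondop> Idm \<diamondop> Idm) \<star> (Idm \<diamondop> \<epsilon> \<diamondop> Idp \<diamondop> Idm \<diamondop> Idm)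
     \<star> (Idm \<diamondop> Idm \<diamondop> EE \<diamondop> Idm \<diamondop> Idm) \<star> (Idm \<diamondop> Idm \<diamondop> Idp \<diamondop> \<eta>' \<diamondop> Idm) \<star> (Idm \<diamondop> Idm \<diamondop> \<eta>')"
    unfolding Es_def Emate_def by (simp add: gen_defs del: Id_dtens)
  have "Es = D Emate'" using D_rel[OF mates] by (simp add: Es_def)
  then show "Es = (Idm \<diamondop> Idm \<diamondop> \<epsilon>') \<star> (Idm \<diamondop> Idm \<diamondop> Idp \<diamondop> \<epsilon>' \<diamondop> Idm)
     \<star> (Idm \<diamondop> Idm \<diamondop> EE \<diamondop> Idm \<diamondop> Idm) \<star> (Idm \<diamondop> \<eta> \<diamondop> Idp \<diamondop> Idm \<diamondop> Idm) \<star> (\<eta> \<diamondop> Idm \<diamondop> Idm)"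
    unfolding Emate'_def by (simp add: gen_defs del: Id_dtens)
qed

section \<open>Nested cups and caps, the idempotent \<open>EE\<close> and its sideways
  versions\<close>

definition "cap2 = \<epsilon> \<star> (Idm \<diamondop> \<epsilon> \<diamondop> Idp)"
definition "cup2 = (Idm \<diamondop> \<eta> \<diamondop> Idp) \<star> \<eta>"
definition "cap2' = \<epsilon>' \<star> (Idp \<diamondop> \<epsilon>' \<diamondop> Idm)"
definition "cup2' = (Idp \<diamondop> \<eta>' \<diamondop> Idm) \<star> \<eta>'"

lemma zigzag2: "(Idp \<diamondop> Idp \<diamondop> cap2) \<star> (cup2' \<diamondop> Idp \<diamondop> Idp) = idd [Plus, Plus]"
proof -
  have "(Idp \<diamondop> Idp \<diamondop> cap2) \<star> (cup2' \<diamondop> Idp \<diamondop> Idp)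
    = (Idp \<diamondop> ((Idp \<diamondop> \<epsilon>) \<star> (\<eta>' \<diamondop> Idp))) \<star> (((Idp \<diamondop> \<epsilon>) \<star> (\<eta>' \<diamondop> Idp)) \<diamondop> Idp)"
    by (simp add: nf cap2_def cup2'_def)
  then show ?thesis by (simp add: iso)
qed

lemma zigzag2': "(cap2' \<diamondop> Idp \<diamondop> Idp) \<star> (Idp \<diamondop> Idp \<diamondop> cup2) = idd [Plus, Plus]"
proof -
  have "(cap2' \<diamondop> Idp \<diamondop> Idp) \<star> (Idp \<diamondop> Idp \<diamondop> cup2)
    = (((\<epsilon>' \<diamondop> Idp) \<star> (Idp \<diamondop> \<eta>)) \<diamondop> Idp) \<star> (Idp \<diamondop> ((\<epsilon>' \<diamondop> Idp) \<star> (Idp \<diamondop> \<eta>)))"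
    by (simp add: nf cap2'_def cup2_def)
  then show ?thesis by (simp add: iso)
qed

lemma cap2_type [simp]:
  "dsrc cap2 = [Minus, Minus, Plus, Plus]" "dtgt cap2 = []" "dwt cap2"
  "dsrc cap2' = [Plus, Plus, Minus, Minus]" "dtgt cap2' = []" "dwt cap2'"
  "dsrc cup2 = []" "dtgt cup2 = [Minus, Minus, Plus, Plus]" "dwt cup2"
  "dsrc cup2' = []" "dtgt cup2' = [Plus, Plus, Minus, Minus]" "dwt cup2'"
  by (simp_all add: cap2_def cap2'_def cup2_def cup2'_def)

lemma bare_cap2 [simp]: "bare cap2" "bare cap2'" "bare cup2" "bare cup2'"
  by (simp_all add: bare_def)

text \<open>\<open>Es\<close> is \<open>EE\<close> bent by a nested cap and a nested cup, and under
  a further cap the resulting zigzag straightens. The form \<open>mate(1)\<close> serves here and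
  \<open>mate(2)\<close> serves in \<open>cap2'_Es\<close>; that both describe the same
  \<open>Es\<close> is the coincidence of the two mates.\<close>

lemma cap2_Es: "cap2 \<star> (Es \<diamondop> Idp \<diamondop> Idp) = cap2 \<star> (Idm \<diamondop> Idm \<diamondop> EE)"
proof -
  have "cap2 \<star> (Es \<diamondop> Idp \<diamondop> Idp)
      = cap2 \<star> (Idm \<diamondop> Idm \<diamondop> EE) \<star> (Idm \<diamondop> Idm \<diamondop> ((Idp \<diamondop> Idp \<diamondop> cap2) \<star> (cup2' \<diamondop> Idp \<diamondop> Idp)))"
    by (simp add: nf cap2_def cup2'_def mate(1))
  then show ?thesis by (simp add: zigzag2[simplified])
qed

lemma cap2'_Es: "cap2' \<star> (Idp \<diamondop> Idp \<diamondop> Es) = cap2' \<star> (EE \<diamondop> Idm \<diamondop> Idm)"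
proof -
  have "cap2' \<star> (Idp \<diamondop> Idp \<diamondop> Es)
      = cap2' \<star> (EE \<diamondop> Idm \<diamondop> Idm) \<star> (((cap2' \<diamondop> Idp \<diamondop> Idp) \<star> (Idp \<diamondop> Idp \<diamondop> cup2)) \<diamondop> Idm \<diamondop> Idm)"
    by (simp add: nf cap2'_def cup2_def mate(2))
  then show ?thesis by (simp add: zigzag2'[simplified])
qed

text \<open>Relation 3 solved for the two partial traces of \<open>EE\<close>. Their asymmetry, 1 on
  the left against 1 - c_0 on the right, reappears in \<open>FF_GG\<close> and
  \<open>GG_FF\<close>.\<close>

lemma ptr_left: "(\<epsilon> \<diamondop> Idp) \<star> (Idm \<diamondop> EE) \<star> (\<eta> \<diamondop> Idp) = (1 / q2) *\<^sub>d Idp"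
  and ptr_right: "(Idp \<diamondop> \<epsilon>') \<star> (EE \<diamondop> Idm) \<star> (Idp \<diamondop> \<eta>') = (1 / q2) *\<^sub>d ((idd [] -\<^sub>d \<gamma> 0) \<diamondop> Idp)"
proof -
  have *: "f = (1 / q2) *\<^sub>d g" if "q2 *\<^sub>d f = g" "dwt f" for f g
    using that dscl_dscl[of f "1 / q2" q2] q2_nonzero by auto
  show "(\<epsilon> \<diamondop> Idp) \<star> (Idm \<diamondop> EE) \<star> (\<eta> \<diamondop> Idp) = (1 / q2) *\<^sub>d Idp"
    by (rule *[OF W_relations(1)]) simp
  show "(Idp \<diamondop> \<epsilon>') \<star> (EE \<diamondop> Idm) \<star> (Idp \<diamondop> \<eta>') = (1 / q2) *\<^sub>d ((idd [] -\<^sub>d \<gamma> 0) \<diamondop> Idp)"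
    by (rule *[OF W_relations(2)]) simp
qed

lemma Es_EE: "Es \<diamondop> EE = ((Idm \<diamondop> Idm \<diamondop> EE) \<star> cup2) \<star> (cap2 \<star> (Idm \<diamondop> Idm \<diamondop> EE))"
  using W_relations(4) by (simp add: cup2_def cap2_def dcmp_assoc)

text \<open>The inner loop is the left partial trace 1 / [2], and the remaining loop contributes [2]
  by relation 4.\<close>

lemma trace_EE: "cap2 \<star> (Idm \<diamondop> Idm \<diamondop> EE) \<star> cup2 = idd []"
proof -
  have "cap2 \<star> (Idm \<diamondop> Idm \<diamondop> EE) \<star> cup2
      = \<epsilon> \<star> (Idm \<diamondop> ((\<epsilon> \<diamondop> Idp) \<star> (Idm \<diamondop> EE) \<star> (\<eta> \<diamondop> Idp))) \<star> \<eta>"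
    by (simp add: nf cap2_def cup2_def)
  also have "\<dots> = idd []"
    by (simp add: ptr_left dtens_dscl dcmp_dscl W_relations(3) dscl_dscl q2_nonzero)
  finally show ?thesis .
qed

text \<open>Under the cap one factor of \<open>EE \<star> EE\<close> turns into \<open>Es\<close>
  and moves beside the other. Relation 7 factors the resulting tensor product through the unit,
  which leaves one capped \<open>EE\<close> multiplied by the full trace 1.\<close>

lemma EE_idem: "EE \<star> EE = EE"
proof -
  let ?m = "\<lambda>f. Idm \<diamondop> Idm \<diamondop> f"
  \<comment> \<open>Capping off loses no information: \<open>cup2'\<close> bends the strands back
    and recovers \<open>f\<close>.\<close>
  have bend: "(Idp \<diamondop> Idp \<diamondop> (cap2 \<star> ?m f)) \<star> (cup2' \<diamondop> Idp \<diamondop> Idp) = f"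
    if f: "dwt f" "dsrc f = [Plus, Plus]" "dtgt f = [Plus, Plus]" for f
  proof -
    have "(Idp \<diamondop> Idp \<diamondop> (cap2 \<star> ?m f)) \<star> (cup2' \<diamondop> Idp \<diamondop> Idp)
        = ((Idp \<diamondop> Idp \<diamondop> cap2) \<star> (cup2' \<diamondop> Idp \<diamondop> Idp)) \<star> f"
      using f by (simp add: nf)
    then show ?thesis using f by (simp add: zigzag2[simplified])
  qed
  have "cap2 \<star> ?m (EE \<star> EE) = (cap2 \<star> ?m EE) \<star> ?m EE" by (simp add: norm)
  also have "\<dots> = (cap2 \<star> (Es \<diamondop> Idp \<diamondop> Idp)) \<star> ?m EE" by (simp only: cap2_Es)
  also have "\<dots> = cap2 \<star> (Es \<diamondop> EE)" by (simp add: norm)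
  also have "\<dots> = (cap2 \<star> ?m EE \<star> cup2) \<star> (cap2 \<star> ?m EE)" by (simp add: Es_EE dcmp_assoc)
  also have "\<dots> = cap2 \<star> ?m EE" by (simp add: trace_EE)
  finally show ?thesis using bend[of "EE \<star> EE"] bend[of EE] by simp
qed

text \<open>The rotation \<open>?rot\<close> attaches \<open>cap2'\<close> on the left and
  \<open>cup2'\<close> on the right. It turns the tensor product in relation 7 into a composite
  through the unit and the composite through the unit into a tensor product, so the two sides
  exchange their shapes.\<close>

lemma EE_Es: "EE \<diamondop> Es = ((EE \<diamondop> Idm \<diamondop> Idm) \<star> cup2') \<star> (cap2' \<star> (EE \<diamondop> Idm \<diamondop> Idm))"
proof -
  let ?rot = "\<lambda>X. (cap2' \<diamondop> Idp \<diamondop> Idp \<diamondop> Idm \<diamondop> Idm) \<star> (Idp \<diamondop> Idp \<diamondop> X \<diamondop> Idm \<diamondop> Idm) \<star> (Idp \<diamondop> Idp \<diamondop> Idm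
      \<diamondop> Idm \<diamondop> cup2')"
  have "?rot (Es \<diamondop> EE) = ((EE \<diamondop> Idm \<diamondop> Idm) \<star> cup2') \<star> (cap2' \<star> (Idp \<diamondop> Idp \<diamondop> Es))"
    by (simp add: nf)
  moreover have "?rot (((Idm \<diamondop> Idm \<diamondop> EE) \<star> cup2) \<star> (cap2 \<star> (Idm \<diamondop> Idm \<diamondop> EE)))
      = (EE \<star> ((cap2' \<diamondop> Idp \<diamondop> Idp) \<star> (Idp \<diamondop> Idp \<diamondop> cup2))) \<diamondop> Es"
    by (simp add: nf mate(1) cap2_def cup2'_def)
  ultimately show ?thesis by (simp add: Es_EE zigzag2'[simplified] cap2'_Es)
qed

text \<open>One leg of \<open>EE\<close>, respectively of its mate, is bent at each end to obtain a
  morphism between the mixed words. The factors [2] compensate the values 1 / [2] of two partial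
  traces.\<close>

definition "FF = q2 *\<^sub>d (\<epsilon> \<diamondop> Idp \<diamondop> Idm) \<star> (Idm \<diamondop> EE \<diamondop> Idm) \<star> (Idm \<diamondop> Idp \<diamondop> \<eta>')"
definition "GG = q2 *\<^sub>d (\<epsilon>' \<diamondop> Idm \<diamondop> Idp) \<star> (Idp \<diamondop> Es \<diamondop> Idp) \<star> (Idp \<diamondop> Idm \<diamondop> \<eta>)"

text \<open>In the composite, \<open>Es\<close> and \<open>EE\<close> stand side by side, and
  relation 7 cuts the diagram along a horizontal line. Each half straightens to strands of which one
  carries a left partial trace (\<open>K\<close> above the cut, \<open>J\<close> below), and the two
  factors 1 / [2] cancel.\<close>

lemma FF_GG: "FF \<star> GG = idd [Plus, Minus]"
proof -
  let ?tr = "(\<epsilon> \<diamondop> Idp) \<star> (Idm \<diamondop> EE) \<star> (\<eta> \<diamondop> Idp)"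
  have K: "(\<epsilon>' \<diamondop> \<epsilon> \<diamondop> Idp \<diamondop> Idm) \<star> (Idp \<diamondop> ((Idm \<diamondop> Idm \<diamondop> EE) \<star> cup2) \<diamondop> Idm)
      = (?tr \<star> ((\<epsilon>' \<diamondop> Idp) \<star> (Idp \<diamondop> \<eta>))) \<diamondop> Idm"
    by (simp add: nf cup2_def)
  have J: "(Idp \<diamondop> (cap2 \<star> (Idm \<diamondop> Idm \<diamondop> EE)) \<diamondop> Idm) \<star> (Idp \<diamondop> Idm \<diamondop> \<eta> \<diamondop> \<eta>')
      = Idp \<diamondop> ((\<epsilon> \<diamondop> Idm) \<star> (Idm \<diamondop> ?tr \<diamondop> Idm) \<star> (Idm \<diamondop> \<eta>'))"
    by (simp add: nf cap2_def)
  have "FF \<star> GG = (q2 * q2) *\<^sub>d ((\<epsilon>' \<diamondop> \<epsilon> \<diamondop> Idp \<diamondop> Idm) \<star> (Idp \<diamondop> (Es \<diamondop> EE) \<diamondop> Idm) \<star> (Idp \<diamondop> Idm \<diamondop> \<eta> \<diamondop>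
      \<eta>'))"
    by (simp add: FF_def GG_def dcmp_dscl dscl_dscl) (simp add: nf)
  also have "\<dots> = (q2 * q2) *\<^sub>d (((\<epsilon>' \<diamondop> \<epsilon> \<diamondop> Idp \<diamondop> Idm) \<star> (Idp \<diamondop> ((Idm \<diamondop> Idm \<diamondop> EE) \<star> cup2) \<diamondop> Idm))
      \<star> ((Idp \<diamondop> (cap2 \<star> (Idm \<diamondop> Idm \<diamondop> EE)) \<diamondop> Idm) \<star> (Idp \<diamondop> Idm \<diamondop> \<eta> \<diamondop> \<eta>')))"
    unfolding Es_EE by (simp add: norm)
  also have "\<dots> = idd [Plus, Minus]"
    unfolding K J by (simp add: ptr_left iso dcmp_dscl dtens_dscl dscl_dscl q2_nonzero)
  finally show ?thesis .
qed

section \<open>Relations with the scalars c_k\<close>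

lemma \<gamma>_neg: "k < 0 \<Longrightarrow> \<gamma> k = Nul [] []"
  by (simp add: \<gamma>_def cc_def)

lemma \<gamma>_mult: "\<gamma> k \<star> \<gamma> j = (if k = j then \<gamma> k else Nul [] [])"
proof (cases "k < 0 \<or> j < 0")
  case True
  then show ?thesis by (auto simp: \<gamma>_neg)
next
  case False
  then show ?thesis using D_rel[OF r8, of k j] by (auto simp: gen_defs)
qed

lemma W_relations_\<gamma>:
  assumes "0 \<le> k"
  shows "\<epsilon> \<star> (Idm \<diamondop> \<gamma> k \<diamondop> Idp) \<star> \<eta> = \<beta> (-2 * k + 1) \<star> \<gamma> (k - 1) +\<^sub>d \<beta>d (-2 * k) \<star> \<gamma> k"
    "\<epsilon>' \<star> (Idp \<diamondop> \<gamma> k \<diamondop> Idm) \<star> \<eta>' = \<beta> (-2 * k - 1) \<star> \<gamma> k +\<^sub>d \<beta>d (-2 * k - 2) \<star> \<gamma> (k + 1)"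
    "\<gamma> k \<diamondop> Idp = \<gamma> k \<diamondop> Idp \<diamondop> (\<gamma> k +\<^sub>d \<gamma> (k - 1))"
    "Idp \<diamondop> \<gamma> k = (\<gamma> k +\<^sub>d \<gamma> (k + 1)) \<diamondop> Idp \<diamondop> \<gamma> k"
    "\<gamma> k \<diamondop> Idm \<diamondop> \<gamma> k \<diamondop> Idp \<diamondop> \<gamma> k = (Idm \<diamondop> \<gamma> k \<diamondop> Idp) \<star> \<eta> \<star> (\<gamma> k \<star> \<beta> (-2 * k)) \<star> \<epsilon> \<star> (Idm \<diamondop> \<gamma> k \<diamondop>
        Idp)"
    "\<gamma> (k - 1) \<diamondop> Idm \<diamondop> \<gamma> k \<diamondop> Idp \<diamondop> \<gamma> (k - 1)
      = (Idm \<diamondop> \<gamma> k \<diamondop> Idp) \<star> \<eta> \<star> (\<gamma> (k - 1) \<star> \<beta>d (-2 * k + 1)) \<star> \<epsilon> \<star> (Idm \<diamondop> \<gamma> k \<diamondop> Idp)"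
    "q2 *\<^sub>d EE \<star> (Idp \<diamondop> \<gamma> k \<diamondop> Idp) = q2 *\<^sub>d (((Idp \<diamondop> \<gamma> (k + 1) \<diamondop> Idp) \<star> EE) \<diamondop> \<gamma> k)
      +\<^sub>d q2 *\<^sub>d (\<gamma> k \<diamondop> ((Idp \<diamondop> \<gamma> (k - 1) \<diamondop> Idp) \<star> EE))
      +\<^sub>d \<gamma> (k + 1) \<diamondop> Idp \<diamondop> \<gamma> k \<diamondop> Idp \<diamondop> \<gamma> k \<diamondop> \<beta>d (-2 * k)
      +\<^sub>d \<gamma> k \<diamondop> Idp \<diamondop> \<gamma> k \<diamondop> Idp \<diamondop> \<gamma> (k - 1) \<diamondop> \<beta> (-2 * k + 1)
      -\<^sub>d \<gamma> (k + 1) \<diamondop> Idp \<diamondop> \<gamma> (k + 1) \<diamondop> Idp \<diamondop> \<gamma> k \<diamondop> \<beta> (-2 * k - 1)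
      -\<^sub>d \<gamma> k \<diamondop> Idp \<diamondop> \<gamma> (k - 1) \<diamondop> Idp \<diamondop> \<gamma> (k - 1) \<diamondop> \<beta>d (-2 * k + 2)"
  using D_rel[OF r4'[OF assms]] D_rel[OF r5'[OF assms]] D_rel[OF r6[OF assms]] D_rel[OF r6'[OF
      assms]]
    D_rel[OF r10[OF assms]] D_rel[OF r10'[OF assms]] D_rel[OF r11[OF assms]]
  by (simp_all add: gen_defs q2_def)

text \<open>The computation of \<open>FF_GG\<close> with the rotated relation 7 leaves a right
  partial trace in each half. Each contributes a factor 1 - c_0 between the two strands, and this
  scalar is idempotent.\<close>

lemma GG_FF: "GG \<star> FF = Idm \<diamondop> (idd [] -\<^sub>d \<gamma> 0) \<diamondop> Idp"
proof -
  define d where "d = idd [] -\<^sub>d \<gamma> 0"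
  have d [simp]: "dwt d" "dsrc d = []" "dtgt d = []" by (simp_all add: d_def)
  let ?tr = "(Idp \<diamondop> \<epsilon>') \<star> (EE \<diamondop> Idm) \<star> (Idp \<diamondop> \<eta>')"
  have K: "(\<epsilon> \<diamondop> \<epsilon>' \<diamondop> Idm \<diamondop> Idp) \<star> (Idm \<diamondop> ((EE \<diamondop> Idm \<diamondop> Idm) \<star> cup2') \<diamondop> Idp)
      = ((\<epsilon> \<diamondop> Idm) \<star> (Idm \<diamondop> ?tr \<diamondop> Idm) \<star> (Idm \<diamondop> \<eta>')) \<diamondop> Idp"
    by (simp add: nf cup2'_def)
  have J: "(Idm \<diamondop> (cap2' \<star> (EE \<diamondop> Idm \<diamondop> Idm)) \<diamondop> Idp) \<star> (Idm \<diamondop> Idp \<diamondop> \<eta>' \<diamondop> \<eta>)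
      = Idm \<diamondop> ((\<epsilon>' \<diamondop> Idp) \<star> (?tr \<diamondop> Idm \<diamondop> Idp) \<star> (Idp \<diamondop> \<eta>))"
    by (simp add: nf cap2'_def)
  have K': "(\<epsilon> \<diamondop> Idm) \<star> (Idm \<diamondop> (d \<diamondop> Idp) \<diamondop> Idm) \<star> (Idm \<diamondop> \<eta>') = ((\<epsilon> \<diamondop> Idm) \<star> (Idm \<diamondop> \<eta>')) \<diamondop> d"
    by (simp add: nf)
  have J': "(\<epsilon>' \<diamondop> Idp) \<star> ((d \<diamondop> Idp) \<diamondop> Idm \<diamondop> Idp) \<star> (Idp \<diamondop> \<eta>) = d \<diamondop> ((\<epsilon>' \<diamondop> Idp) \<star> (Idp \<diamondop> \<eta>))"
    by (simp add: nf)
  have "GG \<star> FF = (q2 * q2) *\<^sub>d ((\<epsilon> \<diamondop> \<epsilon>' \<diamondop> Idm \<diamondop> Idp) \<star> (Idm \<diamondop> (EE \<diamondop> Es) \<diamondop> Idp) \<star> (Idm \<diamondop> Idp \<diamondop> \<eta>'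
      \<diamondop> \<eta>))"
    by (simp add: FF_def GG_def dcmp_dscl dscl_dscl) (simp add: nf)
  also have "\<dots> = (q2 * q2) *\<^sub>d (((\<epsilon> \<diamondop> \<epsilon>' \<diamondop> Idm \<diamondop> Idp) \<star> (Idm \<diamondop> ((EE \<diamondop> Idm \<diamondop> Idm) \<star> cup2') \<diamondop> Idp))
      \<star> ((Idm \<diamondop> (cap2' \<star> (EE \<diamondop> Idm \<diamondop> Idm)) \<diamondop> Idp) \<star> (Idm \<diamondop> Idp \<diamondop> \<eta>' \<diamondop> \<eta>)))"
    unfolding EE_Es by (simp add: norm)
  also have "\<dots> = ((Idm \<diamondop> d) \<diamondop> Idp) \<star> (Idm \<diamondop> (d \<diamondop> Idp))"
    unfolding K J by (simp add: ptr_right dcmp_dscl dtens_dscl dscl_dscl q2_nonzero K'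
        J'[simplified] iso flip: d_def)
  also have "\<dots> = Idm \<diamondop> (d \<star> d) \<diamondop> Idp"
    by (simp add: norm)
  also have "d \<star> d = d"
  proof -
    have "d \<star> \<gamma> 0 = 1 *\<^sub>d \<gamma> 0 -\<^sub>d \<gamma> 0"
      by (simp add: d_def dcmp_dadd dcmp_dscl \<gamma>_mult)
    also have "\<dots> = Nul [] []" by (simp flip: dscl_add del: dscl_1)
    finally have 0: "d \<star> \<gamma> 0 = Nul [] []" .
    have "d \<star> d = d \<star> (idd [] -\<^sub>d \<gamma> 0)" by (simp only: d_def)
    also have "\<dots> = d" by (simp add: dcmp_dadd dcmp_dscl 0)
    finally show ?thesis .
  qed
  finally show ?thesis by (simp add: d_def)
qed

section \<open>Rotation of strands and bubbles\<close>

lemma rotate_scalars: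
  assumes "dwt a" "dsrc a = []" "dtgt a = []" "dwt b" "dsrc b = []" "dtgt b = []"
  shows "(Idm \<diamondop> \<epsilon>') \<star> (Idm \<diamondop> (a \<diamondop> Idp \<diamondop> b) \<diamondop> Idm) \<star> (\<eta> \<diamondop> Idm) = b \<diamondop> Idm \<diamondop> a"
proof -
  \<comment> \<open>The scalar \<open>a\<close> is enclosed by the cup and cannot be moved down, so
    it leaves upwards past the cap; \<open>b\<close>, which lies under the cap, leaves downwards
    past the cup.\<close>
  have 1: "(Idm \<diamondop> \<epsilon>') \<star> (Idm \<diamondop> a \<diamondop> Idp \<diamondop> Idm) = (Idm \<diamondop> a) \<star> (Idm \<diamondop> \<epsilon>')"
    and 2: "(Idm \<diamondop> Idp \<diamondop> b \<diamondop> Idm) \<star> (\<eta> \<diamondop> Idm) = (\<eta> \<diamondop> Idm) \<star> (b \<diamondop> Idm)"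
    using assms by (simp_all add: nf)
  have "(Idm \<diamondop> \<epsilon>') \<star> (Idm \<diamondop> (a \<diamondop> Idp \<diamondop> b) \<diamondop> Idm) \<star> (\<eta> \<diamondop> Idm)
    = ((Idm \<diamondop> \<epsilon>') \<star> (Idm \<diamondop> a \<diamondop> Idp \<diamondop> Idm)) \<star> ((Idm \<diamondop> Idp \<diamondop> b \<diamondop> Idm) \<star> (\<eta> \<diamondop> Idm))"
    using assms by (simp add: norm)
  also have "\<dots> = (Idm \<diamondop> a) \<star> ((Idm \<diamondop> \<epsilon>') \<star> (\<eta> \<diamondop> Idm)) \<star> (b \<diamondop> Idm)"
    unfolding 1 2 using assms by (simp add: dcmp_assoc)
  also have "\<dots> = b \<diamondop> Idm \<diamondop> a"
    using assms by (simp add: iso) (simp add: nf scalar_comm)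
  finally show ?thesis .
qed

lemma cap_slide:
  "dwt v \<Longrightarrow> dtgt v = [] \<Longrightarrow> dwt f \<Longrightarrow>
    (v \<diamondop> idd (dtgt f)) \<star> (idd (dsrc v) \<diamondop> f) = f \<star> (v \<diamondop> idd (dsrc f))"
  using d_interchange[of v "idd (dsrc v)" "idd (dtgt f)" f] d_interchange[of "idd []" v f "idd
      (dsrc f)"]
  by simp

text \<open>A cap, a scalar and a cup meet only in the unit object, so placing them side by side is
  the same as stacking them. Together with \<open>cup_scalar_cap\<close> the cap may be put on
  either side.\<close>

lemma cap_scalar_cup:
  assumes "dwt v" "dtgt v = []" "dwt w" "dsrc w = []" "dwt m" "dsrc m = []" "dtgt m = []"
  shows "v \<diamondop> m \<diamondop> w = w \<star> m \<star> v"
proof -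
  have "m \<diamondop> w = w \<star> m"
    using d_interchange[of "idd []" m w "idd []"] assms by simp
  moreover have "v \<diamondop> (w \<star> m) = (w \<star> m) \<star> v"
    using d_interchange[of "idd []" v "w \<star> m" "idd []"] assms by simp
  ultimately show ?thesis using assms by (simp add: dcmp_assoc)
qed

lemma cup_scalar_cap:
  assumes "dwt v" "dtgt v = []" "dwt w" "dsrc w = []" "dwt m" "dsrc m = []" "dtgt m = []"
  shows "w \<star> m \<star> v = w \<diamondop> m \<diamondop> v"
proof -
  have "m \<diamondop> v = m \<star> v"
    using d_interchange[of m "idd []" "idd []" v] assms by simp
  moreover have "w \<diamondop> (m \<star> v) = w \<star> (m \<star> v)"
    using d_interchange[of w "idd []" "idd []" "m \<star> v"] assms by simp
  ultimately show ?thesis by simp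
qed

text \<open>A quarter turn exchanges the two ways of joining four endpoints in pairs. The strands
  with \<open>m\<close> between them become a cup and a cap joined through \<open>m\<close>, while
  the old cup and cap become strands with the scalar \<open>z\<close> between them.\<close>

lemma rotate_bubble:
  assumes s: "dwt a" "dsrc a = []" "dtgt a = []" "dwt m" "dsrc m = []" "dtgt m = []"
    "dwt z" "dsrc z = []" "dtgt z = []"
    and eq: "a \<diamondop> Idm \<diamondop> m \<diamondop> Idp \<diamondop> a = (Idm \<diamondop> m \<diamondop> Idp) \<star> \<eta> \<star> z \<star> \<epsilon> \<star> (Idm \<diamondop> m \<diamondop> Idp)"
  shows "(Idp \<diamondop> a \<diamondop> Idm) \<star> \<eta>' \<star> m \<star> \<epsilon>' \<star> (Idp \<diamondop> a \<diamondop> Idm) = m \<diamondop> Idp \<diamondop> z \<diamondop> Idm \<diamondop> m"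
proof -
  note [simp] = s
  let ?rot = "\<lambda>X. (\<epsilon>' \<diamondop> Idp \<diamondop> Idm) \<star> (Idp \<diamondop> X \<diamondop> Idm) \<star> (Idp \<diamondop> Idm \<diamondop> \<eta>')"
  define Y where "Y = Idp \<diamondop> a \<diamondop> Idm"
  define Z where "Z = Idm \<diamondop> m \<diamondop> Idp"
  have Y [simp]: "dwt Y" "dsrc Y = [Plus, Minus]" "dtgt Y = [Plus, Minus]"
    and Z [simp]: "dwt Z" "dsrc Z = [Minus, Plus]" "dtgt Z = [Minus, Plus]" by (simp_all add:
        Y_def Z_def)
  \<comment> \<open>The rotated tensor product splits at its middle region \<open>m\<close> into a
    cap on the left and a cup on the right.\<close>
  have "?rot (a \<diamondop> Idm \<diamondop> m \<diamondop> Idp \<diamondop> a)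
      = (\<epsilon>' \<diamondop> idd [] \<diamondop> idd [Plus, Minus]) \<star> (Y \<diamondop> m \<diamondop> Y) \<star> (idd [Plus, Minus] \<diamondop> idd [] \<diamondop> \<eta>')"
    using Id_append_dtens[of \<eta>' "[Plus]" "[Minus]"] by (simp add: Y_def dtens_assoc)
  also have "\<dots> = (\<epsilon>' \<star> Y) \<diamondop> m \<diamondop> (Y \<star> \<eta>')"
    by (simp flip: d_interchange del: dtens_unit)
  also have "\<dots> = (Y \<star> \<eta>') \<star> m \<star> (\<epsilon>' \<star> Y)"
    by (rule cap_scalar_cup) simp_all
  finally have 1: "?rot (a \<diamondop> Idm \<diamondop> m \<diamondop> Idp \<diamondop> a) = (Y \<star> \<eta>') \<star> m \<star> (\<epsilon>' \<star> Y)" .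
  \<comment> \<open>The cup and the cap are first placed side by side, so that the zigzag in each
    half can be straightened separately.\<close>
  have "?rot (Z \<star> \<eta> \<star> z \<star> \<epsilon> \<star> Z) = ?rot ((Z \<star> \<eta>) \<star> z \<star> (\<epsilon> \<star> Z))"
    by (simp add: dcmp_assoc)
  also have "\<dots> = ?rot ((Z \<star> \<eta>) \<diamondop> z \<diamondop> (\<epsilon> \<star> Z))"
    by (subst cup_scalar_cap) simp_all
  also have "\<dots> = ((\<epsilon>' \<diamondop> Idp) \<diamondop> idd [] \<diamondop> Idm) \<star> ((Idp \<diamondop> (Z \<star> \<eta>)) \<diamondop> z \<diamondop> ((\<epsilon> \<star> Z) \<diamondop> Idm)) \<star> (Idp \<diamondop>
      idd [] \<diamondop> (Idm \<diamondop> \<eta>'))"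
    by (simp add: dtens_assoc)
  also have "\<dots> = ((\<epsilon>' \<diamondop> Idp) \<star> (Idp \<diamondop> (Z \<star> \<eta>))) \<diamondop> z \<diamondop> (((\<epsilon> \<star> Z) \<diamondop> Idm) \<star> (Idm \<diamondop> \<eta>'))"
    by (simp flip: d_interchange del: dtens_unit)
  also have "(\<epsilon>' \<diamondop> Idp) \<star> (Idp \<diamondop> (Z \<star> \<eta>)) = (m \<diamondop> Idp) \<star> (\<epsilon>' \<diamondop> Idp) \<star> (Idp \<diamondop> \<eta>)"
  proof -
    have "(\<epsilon>' \<diamondop> Idp) \<star> (Idp \<diamondop> (Z \<star> \<eta>)) = ((\<epsilon>' \<diamondop> Idp) \<star> (idd [Plus, Minus] \<diamondop> (m \<diamondop> Idp))) \<star> (Idp \<diamondop> \<eta>)"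
      by (simp add: norm Z_def)
    also have "(\<epsilon>' \<diamondop> Idp) \<star> (idd [Plus, Minus] \<diamondop> (m \<diamondop> Idp)) = (m \<diamondop> Idp) \<star> (\<epsilon>' \<diamondop> Idp)"
      using cap_slide[of \<epsilon>' "m \<diamondop> Idp"] by simp
    finally show ?thesis by (simp add: dcmp_assoc)
  qed
  also have "((\<epsilon> \<star> Z) \<diamondop> Idm) \<star> (Idm \<diamondop> \<eta>') = ((\<epsilon> \<diamondop> Idm) \<star> (Idm \<diamondop> \<eta>')) \<star> (Idm \<diamondop> m)"
    by (simp add: nf Z_def)
  finally have "?rot (Z \<star> \<eta> \<star> z \<star> \<epsilon> \<star> Z) = (m \<diamondop> Idp) \<diamondop> z \<diamondop> (Idm \<diamondop> m)"
    by (simp add: iso)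
  then show ?thesis using 1 eq by (simp add: Y_def Z_def dcmp_assoc dtens_assoc)
qed

definition scalar :: "darr \<Rightarrow> bool" where
  "scalar z \<longleftrightarrow> dwt z \<and> dsrc z = [] \<and> dtgt z = []"

lemma scalar_simps [simp]:
  "scalar (\<gamma> k)" "scalar (\<beta> k)" "scalar (\<beta>d k)" "scalar (idd [])"
  "scalar a \<Longrightarrow> scalar b \<Longrightarrow> scalar (a \<star> b)" "scalar a \<Longrightarrow> scalar b \<Longrightarrow> scalar (a +\<^sub>d b)"
  "scalar a \<Longrightarrow> scalar (r *\<^sub>d a)"
  by (simp_all add: scalar_def)

lemma scalar_commute: "scalar a \<Longrightarrow> scalar b \<Longrightarrow> a \<star> b = b \<star> a"
  using scalar_comm[of a b "[]" "[]" "[]" "[]"] by (simp add: scalar_def sl_nil)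

lemma scalar_dtens: "scalar a \<Longrightarrow> scalar b \<Longrightarrow> a \<diamondop> b = a \<star> b"
  by (simp add: scalar_def norm)

lemma \<beta>_inverse: "\<beta>d k \<star> \<beta> k = idd []" "\<beta> k \<star> \<beta>d k = idd []"
  using W_relations(6) scalar_commute[of "\<beta> k" "\<beta>d k"] by simp_all

lemma \<beta>d_slide: "\<beta>d k \<diamondop> Idp = Idp \<diamondop> \<beta>d (k + 1)"
  using W_relations(7)[of "k - 1"] by (simp add: W_relations(5) dtens_dadd dtens_dscl)

text \<open>If the identity of \<open>a x m y a\<close> factors through \<open>a\<close>, then its image is isomorphic to that of
    \<open>a\<close>.\<close>

lemma bubble:
  assumes s: "scalar a" "scalar m" "scalar z" and aa: "a \<star> a = a" and mm: "m \<star> m = m"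
    and ct: "dwt cup" "dsrc cup = []" "dtgt cup = [x, y]" "dwt cap" "dsrc cap = [x, y]" "dtgt cap
        = []"
    and bare [simp]: "bare cup" "bare cap"
    and e: "e = a \<diamondop> idd [x] \<diamondop> m \<diamondop> idd [y] \<diamondop> a"
    and eq: "e = (idd [x] \<diamondop> m \<diamondop> idd [y]) \<star> cup \<star> z \<star> cap \<star> (idd [x] \<diamondop> m \<diamondop> idd [y])"
    and az: "a \<star> z = z"
    and tr: "z \<star> (cap \<star> (idd [x] \<diamondop> m \<diamondop> idd [y]) \<star> cup) = a"
  shows "e \<star> cup \<star> a \<star> (z \<star> cap) \<star> e = e" "a \<star> (z \<star> cap) \<star> e \<star> cup \<star> a = a"
proof -
  note t [simp] = s[unfolded scalar_def] ct
  \<comment> \<open>\<open>e\<close> is the product of \<open>A\<close>, which carries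
    \<open>a\<close> in the outer regions, and \<open>M\<close>, which carries \<open>m\<close>
    between the strands; the two factors commute.\<close>
  define A where "A = a \<diamondop> idd [x, y] \<diamondop> a"
  define M where "M = idd [x] \<diamondop> m \<diamondop> idd [y]"
  have ty [simp]: "dwt A" "dsrc A = [x, y]" "dtgt A = [x, y]" "dwt M" "dsrc M = [x, y]" "dtgt M =
      [x, y]"
    by (simp_all add: A_def M_def)
  have AM: "e = A \<star> M" "e = M \<star> A"
    by (simp_all add: e A_def M_def nf scalar_comm scalar_comm_chain)
  have AA: "A \<star> A = A"
  proof -
    have "A \<star> A = (a \<star> a) \<diamondop> idd [x, y] \<diamondop> (a \<star> a)"
      unfolding A_def by (simp flip: d_interchange)
    then show ?thesis by (simp add: aa A_def)
  qed
  have Ae: "A \<star> e = e"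
    using AA by (simp add: AM(1) flip: dcmp_assoc)
  have "e \<star> cup \<star> a \<star> (z \<star> cap) \<star> e = A \<star> (M \<star> cup \<star> (a \<star> z) \<star> cap \<star> M) \<star> A"
    using AM(1) by (simp add: AM(2)[symmetric] dcmp_assoc)
  also have "\<dots> = A \<star> e \<star> A" using eq by (simp add: az M_def)
  also have "\<dots> = (A \<star> e) \<star> A" by (simp add: AM(1) dcmp_assoc)
  also have "\<dots> = M \<star> A \<star> A" unfolding Ae by (simp add: AM(2) dcmp_assoc)
  also have "\<dots> = e" by (simp add: AA flip: AM(2))
  finally show "e \<star> cup \<star> a \<star> (z \<star> cap) \<star> e = e" .
  \<comment> \<open>Past the cap the two outer regions are one, so the two copies of
    \<open>a\<close> multiply there.\<close>
  have "cap \<star> A = a \<diamondop> cap \<diamondop> a"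
    using d_interchange[of "idd []" a cap "idd [x, y] \<diamondop> a"] d_interchange[of cap "idd [x, y]" "idd
        []" a]
    by (simp add: A_def)
  also have "cap \<diamondop> a = a \<star> cap"
    using d_interchange[of "idd []" cap a "idd []"] by simp
  also have "a \<diamondop> (a \<star> cap) = (a \<star> a) \<star> cap"
    using d_interchange[of a "idd []" "idd []" "a \<star> cap"] by (simp add: dcmp_assoc)
  finally have "cap \<star> A = (a \<star> a) \<star> cap" .
  then have 1: "cap \<star> e = a \<star> cap \<star> M" by (simp add: AM(1) aa flip: dcmp_assoc)
  have "a \<star> (z \<star> cap) \<star> e \<star> cup \<star> a = (a \<star> z) \<star> ((cap \<star> e) \<star> cup \<star> a)"
    by (simp add: dcmp_assoc e)
  also have "\<dots> = (z \<star> a) \<star> (cap \<star> M \<star> cup) \<star> a"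
    by (simp add: 1 az dcmp_assoc)
  also have "z \<star> a = z" using az scalar_commute s by metis
  also have "z \<star> (cap \<star> M \<star> cup) \<star> a = (z \<star> cap \<star> M \<star> cup) \<star> a"
    by (simp add: dcmp_assoc)
  also have "\<dots> = a" using tr by (simp add: M_def aa)
  finally show "a \<star> (z \<star> cap) \<star> e \<star> cup \<star> a = a" .
qed

section \<open>Two upward strands with scalars in their three regions, and relation 11\<close>

definition tri :: "darr \<Rightarrow> darr \<Rightarrow> darr \<Rightarrow> darr" where
  "tri a b c = a \<diamondop> Idp \<diamondop> b \<diamondop> Idp \<diamondop> c"

lemma tri_type [simp]:
  assumes "scalar a" "scalar b" "scalar c"
  shows "dwt (tri a b c)" "dsrc (tri a b c) = [Plus, Plus]" "dtgt (tri a b c) = [Plus, Plus]"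
  using assms by (simp_all add: tri_def scalar_def)

lemma tri_mult:
  assumes "scalar a" "scalar b" "scalar c" "scalar a'" "scalar b'" "scalar c'"
  shows "tri a b c \<star> tri a' b' c' = tri (a \<star> a') (b \<star> b') (c \<star> c')"
proof -
  have "tri (a \<star> a') (b \<star> b') (c \<star> c') = tri a b c \<star> tri a' b' c'"
    using assms d_interchange[of Idp Idp] d_interchange[of a a'] d_interchange[of b b']
    by (simp add: tri_def scalar_def)
  then show ?thesis by simp
qed

lemma tri_Nul [simp]:
  assumes "scalar a" "scalar b"
  shows "tri (Nul [] []) a b = Nul [Plus, Plus] [Plus, Plus]" "tri a (Nul [] []) b = Nul [Plus,
      Plus] [Plus, Plus]"
    "tri a b (Nul [] []) = Nul [Plus, Plus] [Plus, Plus]"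
  using assms by (simp_all add: tri_def scalar_def)

lemma tri_dadd:
  assumes "scalar a" "scalar b" "scalar c" "scalar d"
  shows "tri a (b +\<^sub>d c) d = tri a b d +\<^sub>d tri a c d" "tri a b (c +\<^sub>d d) = tri a b c +\<^sub>d tri a b d"
  using assms by (simp_all add: tri_def scalar_def dtens_dadd)

lemma tri_dscl:
  assumes "scalar a" "scalar b" "scalar c"
  shows "tri a b (r *\<^sub>d c) = r *\<^sub>d tri a b c"
  using assms by (simp add: tri_def scalar_def dtens_dscl)

lemma scalar_EE:
  assumes "scalar a"
  shows "sl [] a [Plus, Plus] \<star> EE = EE \<star> sl [] a [Plus, Plus]"
    "sl [Plus, Plus] a [] \<star> EE = EE \<star> sl [Plus, Plus] a []"
    "dwt x \<Longrightarrow> dtgt x = [Plus, Plus] \<Longrightarrow> sl [] a [Plus, Plus] \<star> EE \<star> x = EE \<star> sl [] a [Plus, Plus] \<star> x"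
    "dwt x \<Longrightarrow> dtgt x = [Plus, Plus] \<Longrightarrow> sl [Plus, Plus] a [] \<star> EE \<star> x = EE \<star> sl [Plus, Plus] a [] \<star> x"
proof -
  show 1: "sl [] a [Plus, Plus] \<star> EE = EE \<star> sl [] a [Plus, Plus]"
    using exchange[of a EE "[]" "[]" "[]"] assms by (simp add: scalar_def sl_nil)
  show 2: "sl [Plus, Plus] a [] \<star> EE = EE \<star> sl [Plus, Plus] a []"
    using exchange[of EE a "[]" "[]" "[]"] assms by (simp add: scalar_def sl_nil)
  show "sl [] a [Plus, Plus] \<star> EE \<star> x = EE \<star> sl [] a [Plus, Plus] \<star> x"
    "sl [Plus, Plus] a [] \<star> EE \<star> x = EE \<star> sl [Plus, Plus] a [] \<star> x"
    if "dwt x" "dtgt x = [Plus, Plus]"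
    using that assms by (auto intro!: cmp_reassoc 1 2 simp: scalar_def)
qed

text \<open>\<open>EE\<close> does not touch the outer regions, so scalars slide past it there; for
  the middle region relation 11 takes the place of this commutation.\<close>

lemma tri_EE:
  assumes "scalar a" "scalar c"
  shows "tri a (idd []) c \<star> EE = EE \<star> tri a (idd []) c"
  using assms scalar_EE[of a] scalar_EE[of c] by (simp add: tri_def scalar_def norm)

text \<open>Negatives exist only as multiples by -1, so cancellation has to be derived from the laws
  of scalars.\<close>

lemma dadd_cancel:
  assumes "dwt f" "dwt g" "dsrc g = dsrc f" "dtgt g = dtgt f" "f -\<^sub>d g = Nul u v"
  shows "f = g"
proof -
  have uv: "u = dsrc f" "v = dtgt f" using arg_cong[OF assms(5), of dsrc] arg_cong[OF assms(5), of
      dtgt] by simp_all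
  have "f = f +\<^sub>d Nul u v" using assms uv by simp
  also have "\<dots> = f +\<^sub>d ((-1) *\<^sub>d g +\<^sub>d 1 *\<^sub>d g)"
    using assms uv by (simp flip: dscl_add del: dscl_1)
  also have "\<dots> = (f -\<^sub>d g) +\<^sub>d g" using assms(1-4) dadd_assoc[of f "(-1) *\<^sub>d g" g] by simp
  also have "\<dots> = g" using assms uv by simp
  finally show ?thesis .
qed

context
  fixes k :: int assumes k: "0 \<le> k"
begin

text \<open>The block decomposition of \<open>UU\<close> on the image of \<open>po\<close>:
  \<open>p1\<close> and \<open>p2\<close> project onto the two summands, and \<open>pd\<close> and
  \<open>pb\<close> are going to be the corresponding diagonal entries.\<close>

definition "p1 = tri (\<gamma> (k + 1)) (\<gamma> k) (\<gamma> k)"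
definition "p2 = tri (\<gamma> (k + 1)) (\<gamma> (k + 1)) (\<gamma> k)"
definition "po = tri (\<gamma> (k + 1)) (idd []) (\<gamma> k)"
definition "pd = tri (idd []) (idd []) (\<beta>d (-2 * k))"
definition "pb = tri (idd []) (idd []) (\<beta> (-2 * k - 1))"
definition "UU = q2 *\<^sub>d EE"

lemma p_type [simp]:
  "dwt p1" "dsrc p1 = [Plus, Plus]" "dtgt p1 = [Plus, Plus]"
  "dwt p2" "dsrc p2 = [Plus, Plus]" "dtgt p2 = [Plus, Plus]"
  "dwt po" "dsrc po = [Plus, Plus]" "dtgt po = [Plus, Plus]"
  "dwt pd" "dsrc pd = [Plus, Plus]" "dtgt pd = [Plus, Plus]"
  "dwt pb" "dsrc pb = [Plus, Plus]" "dtgt pb = [Plus, Plus]"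
  "dwt UU" "dsrc UU = [Plus, Plus]" "dtgt UU = [Plus, Plus]"
  by (simp_all add: p1_def p2_def po_def pd_def pb_def UU_def)

lemma p_mult:
  "p1 \<star> p1 = p1" "p2 \<star> p2 = p2" "p1 \<star> p2 = Nul [Plus, Plus] [Plus, Plus]" "p2 \<star> p1 = Nul [Plus,
      Plus] [Plus, Plus]"
  "po \<star> p1 = p1" "po \<star> p2 = p2" "p1 \<star> po = p1" "p2 \<star> po = p2"
  "pd \<star> p1 = p1 \<star> pd" "pd \<star> p2 = p2 \<star> pd" "pb \<star> p1 = p1 \<star> pb" "pb \<star> p2 = p2 \<star> pb"
  by (simp_all add: p1_def p2_def po_def pd_def pb_def tri_mult \<gamma>_mult scalar_commute[of _ "\<gamma> _"])

text \<open>Relation 6 for c_{k+1} admits only c_{k+1} and c_k in the region between the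
  strands.\<close>

lemma p_sum: "po = p1 +\<^sub>d p2"
proof -
  have k1: "0 \<le> k + 1" using k by simp
  have "po = (\<gamma> (k + 1) \<diamondop> Idp) \<diamondop> Idp \<diamondop> \<gamma> k" by (simp add: po_def tri_def dtens_assoc)
  also have "\<dots> = tri (\<gamma> (k + 1)) (\<gamma> (k + 1) +\<^sub>d \<gamma> k) (\<gamma> k)"
    using W_relations_\<gamma>(3)[OF k1] by (simp add: tri_def dtens_assoc)
  also have "\<dots> = p2 +\<^sub>d p1" by (simp add: tri_dadd p1_def p2_def)
  also have "\<dots> = p1 +\<^sub>d p2" by (rule dadd_comm) simp
  finally show ?thesis .
qed

text \<open>b_{-2k}^dagger is [2] - b_{-2k-1}; this is the reason for the shift by one between the
  indices in \<open>pd\<close> and \<open>pb\<close>.\<close>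

lemma pd_pb: "pd +\<^sub>d pb = q2 *\<^sub>d idd [Plus, Plus]"
proof -
  have "pd = q2 *\<^sub>d idd [Plus, Plus] -\<^sub>d pb"
    by (simp add: pd_def pb_def W_relations(5) tri_dadd tri_dscl) (simp add: tri_def)
  then have "pd +\<^sub>d pb = q2 *\<^sub>d idd [Plus, Plus] +\<^sub>d ((-1) *\<^sub>d pb +\<^sub>d 1 *\<^sub>d pb)"
    by (simp add: dadd_assoc)
  then show ?thesis by (simp flip: dscl_add del: dscl_1)
qed

lemma UU_mult: "UU \<star> UU = q2 *\<^sub>d UU" "po \<star> UU = UU \<star> po"
  by (simp_all add: UU_def dcmp_dscl EE_idem po_def tri_EE)

text \<open>Relation 11 multiplied by \<open>po\<close>: of its six terms, the three whose leftmost
  scalar is c_k vanish against the c_{k+1} of \<open>po\<close>.\<close>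

lemma UU_p1: "UU \<star> p1 = p2 \<star> UU +\<^sub>d p1 \<star> pd -\<^sub>d p2 \<star> pb"
proof -
  have 0: "UU \<star> p1 = po \<star> (q2 *\<^sub>d EE \<star> (Idp \<diamondop> \<gamma> k \<diamondop> Idp))"
  proof -
    have "p1 = po \<star> tri (idd []) (\<gamma> k) (idd [])" by (simp add: p1_def po_def tri_mult)
    then have "UU \<star> p1 = (UU \<star> po) \<star> tri (idd []) (\<gamma> k) (idd [])" by (simp add: dcmp_assoc)
    also have "\<dots> = po \<star> UU \<star> tri (idd []) (\<gamma> k) (idd [])" by (simp add: dcmp_assoc flip: UU_mult(2))
    finally show ?thesis by (simp add: UU_def dcmp_dscl tri_def)
  qed
  have 1: "((Idp \<diamondop> \<gamma> (k + 1) \<diamondop> Idp) \<star> EE) \<diamondop> \<gamma> k = tri (idd []) (\<gamma> (k + 1)) (\<gamma> k) \<star> EE"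
    "\<gamma> k \<diamondop> ((Idp \<diamondop> \<gamma> (k - 1) \<diamondop> Idp) \<star> EE) = tri (\<gamma> k) (\<gamma> (k - 1)) (idd []) \<star> EE"
    by (simp_all add: tri_def norm scalar_EE)
  have 2: "po \<star> (tri (idd []) (\<gamma> (k + 1)) (\<gamma> k) \<star> EE) = p2 \<star> EE"
    "po \<star> (tri (\<gamma> k) (\<gamma> (k - 1)) (idd []) \<star> EE) = Nul [Plus, Plus] [Plus, Plus]"
    "po \<star> tri (\<gamma> (k + 1)) (\<gamma> k) (\<gamma> k \<star> \<beta>d (-2 * k)) = p1 \<star> pd"
    "po \<star> tri (\<gamma> k) (\<gamma> k) (\<gamma> (k - 1) \<star> \<beta> (-2 * k + 1)) = Nul [Plus, Plus] [Plus, Plus]"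
    "po \<star> tri (\<gamma> (k + 1)) (\<gamma> (k + 1)) (\<gamma> k \<star> \<beta> (-2 * k - 1)) = p2 \<star> pb"
    "po \<star> tri (\<gamma> k) (\<gamma> (k - 1)) (\<gamma> (k - 1) \<star> \<beta>d (-2 * k + 2)) = Nul [Plus, Plus] [Plus, Plus]"
    by (simp_all add: po_def p1_def p2_def pd_def pb_def tri_mult \<gamma>_mult flip: dcmp_assoc)
      (simp_all add: scalar_def \<gamma>_mult flip: dcmp_assoc)
  have 3: "\<gamma> i \<diamondop> Idp \<diamondop> \<gamma> j \<diamondop> Idp \<diamondop> \<gamma> l \<diamondop> z = tri (\<gamma> i) (\<gamma> j) (\<gamma> l \<star> z)" if "scalar z" for i j l z
    using that by (simp add: tri_def scalar_dtens)
  show ?thesis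
    unfolding 0 W_relations_\<gamma>(7)[OF k] 1 by (simp add: 3 dcmp_dadd dcmp_dscl 2[simplified]) (simp
        add: UU_def dcmp_dscl)
qed

lemma p1_UU_p1: "p1 \<star> UU \<star> p1 = p1 \<star> pd"
proof -
  have "p1 \<star> UU \<star> p1 = (p1 \<star> p2) \<star> UU +\<^sub>d (p1 \<star> p1) \<star> pd -\<^sub>d (p1 \<star> p2) \<star> pb"
    unfolding UU_p1 by (simp add: dcmp_dadd dcmp_dscl dcmp_assoc)
  then show ?thesis by (simp add: p_mult)
qed

text \<open>Multiplication by \<open>p2\<close> on the right annihilates the left side of
  \<open>UU_p1\<close>, so the second diagonal entry comes out of the same formula as the
  first.\<close>

lemma p2_UU_p2: "p2 \<star> UU \<star> p2 = p2 \<star> pb"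
proof -
  have "p1 \<star> pd \<star> p2 = Nul [Plus, Plus] [Plus, Plus]"
    by (simp add: p_mult) (simp add: p_mult flip: dcmp_assoc)
  moreover have "p2 \<star> pb \<star> p2 = p2 \<star> pb"
    by (simp add: p_mult) (simp add: p_mult flip: dcmp_assoc)
  moreover have "(UU \<star> p1) \<star> p2 = Nul [Plus, Plus] [Plus, Plus]"
    by (simp add: dcmp_assoc p_mult)
  ultimately have "p2 \<star> UU \<star> p2 -\<^sub>d p2 \<star> pb = Nul [Plus, Plus] [Plus, Plus]"
    unfolding UU_p1 by (simp add: dcmp_dadd dcmp_dscl dcmp_assoc)
  then show ?thesis by (rule dadd_cancel[rotated 4]) simp_all
qed

text \<open>Since \<open>UU\<close> commutes with \<open>po\<close> and squares to [2] times itself,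
  inserting \<open>po\<close> in the middle gives [2] z; subtracting the part through
  \<open>e\<close>, which is z z, leaves z ([2] - z). The pair is kept general because it is needed
  with \<open>p1\<close> and \<open>p2\<close> in both orders.\<close>

lemma UU_squeeze:
  assumes ty [simp]: "dwt e" "dsrc e = [Plus, Plus]" "dtgt e = [Plus, Plus]" "dwt e'" "dsrc e' =
      [Plus, Plus]" "dtgt e' = [Plus, Plus]"
    "dwt z" "dsrc z = [Plus, Plus]" "dtgt z = [Plus, Plus]" "dwt z'" "dsrc z' = [Plus, Plus]"
        "dtgt z' = [Plus, Plus]"
    and sum: "po = e +\<^sub>d e'" and o: "e \<star> po = e" "po \<star> e = e" and e: "e \<star> e = e" "e \<star> UU \<star> e = e \<star>
        z"
    and z: "z \<star> e = e \<star> z" and zz': "z +\<^sub>d z' = q2 *\<^sub>d idd [Plus, Plus]"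
  shows "e \<star> UU \<star> e' \<star> UU \<star> e = e \<star> z \<star> z'"
proof (rule dadd_cancel)
  have "e \<star> UU \<star> po \<star> UU \<star> e = e \<star> (UU \<star> po) \<star> UU \<star> e" by (simp add: dcmp_assoc)
  also have "\<dots> = (e \<star> po) \<star> (UU \<star> UU) \<star> e"
    unfolding UU_mult(2)[symmetric] by (simp add: dcmp_assoc)
  also have "\<dots> = q2 *\<^sub>d (e \<star> UU \<star> e)" by (simp add: o UU_mult(1) dcmp_dscl)
  also have "\<dots> = q2 *\<^sub>d (e \<star> z)" by (simp add: e)
  finally have 1: "e \<star> UU \<star> po \<star> UU \<star> e = q2 *\<^sub>d (e \<star> z)" .
  have "e \<star> UU \<star> e \<star> UU \<star> e = e \<star> UU \<star> e \<star> z" by (simp only: e(2))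
  also have "\<dots> = (e \<star> UU \<star> e) \<star> z" by (simp add: dcmp_assoc)
  also have "\<dots> = e \<star> z \<star> z" by (simp add: e dcmp_assoc)
  finally have 2: "e \<star> UU \<star> e \<star> UU \<star> e = e \<star> z \<star> z" .
  have 3: "q2 *\<^sub>d (e \<star> z) = e \<star> z \<star> z +\<^sub>d e \<star> z \<star> z'"
  proof -
    have "q2 *\<^sub>d (e \<star> z) = e \<star> z \<star> (q2 *\<^sub>d idd [Plus, Plus])" by (simp add: dcmp_dscl)
    then show ?thesis by (simp add: dcmp_dadd flip: zz')
  qed
  have "e \<star> UU \<star> po \<star> UU \<star> e = e \<star> z \<star> z +\<^sub>d e \<star> UU \<star> e' \<star> UU \<star> e"
    unfolding sum by (simp add: dcmp_dadd 2)
  then have 4: "e \<star> z \<star> z +\<^sub>d e \<star> UU \<star> e' \<star> UU \<star> e = e \<star> z \<star> z +\<^sub>d e \<star> z \<star> z'"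
    using 1 3 by simp
  have neg: "(-1) *\<^sub>d f +\<^sub>d f = Nul [Plus, Plus] [Plus, Plus]" if "dwt f" "dsrc f = [Plus, Plus]"
      "dtgt f = [Plus, Plus]" for f
    using that dscl_add[of f "-1" 1] by simp
  have canc: "g = h" if "f +\<^sub>d g = f +\<^sub>d h" "dwt f" "dsrc f = [Plus, Plus]" "dtgt f = [Plus, Plus]"
    "dwt g" "dsrc g = [Plus, Plus]" "dtgt g = [Plus, Plus]" "dwt h" "dsrc h = [Plus, Plus]" "dtgt
        h = [Plus, Plus]" for f g h
  proof -
    have "((-1) *\<^sub>d f +\<^sub>d f) +\<^sub>d g = ((-1) *\<^sub>d f +\<^sub>d f) +\<^sub>d h"
      using that by (simp add: dadd_assoc)
    then show ?thesis using that by (simp add: neg)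
  qed
  have "e \<star> UU \<star> e' \<star> UU \<star> e = e \<star> z \<star> z'"
    by (rule canc[OF 4]) simp_all
  then show "e \<star> UU \<star> e' \<star> UU \<star> e -\<^sub>d e \<star> z \<star> z' = Nul [Plus, Plus] [Plus, Plus]"
    using neg[of "e \<star> z \<star> z'"] dadd_comm by simp
qed simp_all

text \<open>The inverse of \<open>pd \<star> pb\<close>, which the asymptotic relations supply, as
  the index -2k - 1 is negative.\<close>

definition "pt = tri (idd []) (idd []) (\<beta> (-2 * k) \<star> \<beta>d (-2 * k - 1))"

text \<open>The off-diagonal blocks of \<open>UU\<close> are inverse to each other up to the factor
  \<open>pd \<star> pb\<close>. Its inverse \<open>pt\<close> commutes with \<open>p1\<close>,
  \<open>p2\<close> and \<open>UU\<close>, so it can be collected at the end and cancelled.\<close>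

lemma UU_iso:
  "p1 \<star> (UU \<star> pt) \<star> p2 \<star> UU \<star> p1 = p1" "p2 \<star> UU \<star> p1 \<star> (UU \<star> pt) \<star> p2 = p2"
proof -
  have ty [simp]: "dwt pt" "dsrc pt = [Plus, Plus]" "dtgt pt = [Plus, Plus]" by (simp_all add:
      pt_def)
  have inv: "\<beta>d i \<star> \<beta> j \<star> \<beta> i \<star> \<beta>d j = idd []" for i j
  proof -
    have "\<beta>d i \<star> \<beta> j \<star> \<beta> i \<star> \<beta>d j = \<beta>d i \<star> (\<beta> j \<star> \<beta> i) \<star> \<beta>d j" by (simp add: dcmp_assoc)
    also have "\<beta> j \<star> \<beta> i = \<beta> i \<star> \<beta> j" by (rule scalar_commute) simp_all
    also have "\<beta>d i \<star> (\<beta> i \<star> \<beta> j) \<star> \<beta>d j = (\<beta>d i \<star> \<beta> i) \<star> \<beta> j \<star> \<beta>d j" by (simp add: dcmp_assoc)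
    finally show ?thesis by (simp add: \<beta>_inverse)
  qed
  have comm: "pt \<star> p1 = p1 \<star> pt" "pt \<star> p2 = p2 \<star> pt" "pt \<star> UU = UU \<star> pt" "pd \<star> pb = pb \<star> pd"
    by (simp_all add: pt_def p1_def p2_def pd_def pb_def tri_mult tri_EE UU_def dcmp_dscl
        scalar_commute[of "\<gamma> _"]
      scalar_commute[of "\<beta> _" "\<beta>d _"])
  have pdbt: "pd \<star> pb \<star> pt = idd [Plus, Plus]"
    by (simp add: pd_def pb_def pt_def tri_mult inv) (simp add: tri_def)
  have sum2: "po = p2 +\<^sub>d p1" using p_sum dadd_comm[of p1 p2] by simp
  have pb_pd: "pb +\<^sub>d pd = q2 *\<^sub>d idd [Plus, Plus]" using pd_pb dadd_comm[of pb pd] by simp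
  have sq1: "p1 \<star> UU \<star> p2 \<star> UU \<star> p1 = p1 \<star> pd \<star> pb"
    by (rule UU_squeeze) (simp_all add: p_mult p1_UU_p1 pd_pb flip: p_sum)
  have sq2: "p2 \<star> UU \<star> p1 \<star> UU \<star> p2 = p2 \<star> pb \<star> pd"
    by (rule UU_squeeze) (simp_all add: p_mult p2_UU_p2 pb_pd flip: sum2)
  have "p1 \<star> (UU \<star> pt) \<star> p2 \<star> UU \<star> p1 = p1 \<star> UU \<star> (pt \<star> p2) \<star> UU \<star> p1" by (simp add: dcmp_assoc)
  also have "\<dots> = p1 \<star> UU \<star> p2 \<star> (pt \<star> UU) \<star> p1" unfolding comm(2) by (simp add: dcmp_assoc)
  also have "\<dots> = p1 \<star> UU \<star> p2 \<star> UU \<star> (pt \<star> p1)" unfolding comm(3) by (simp add: dcmp_assoc)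
  also have "\<dots> = (p1 \<star> UU \<star> p2 \<star> UU \<star> p1) \<star> pt" unfolding comm(1) by (simp add: dcmp_assoc)
  also have "\<dots> = p1 \<star> (pd \<star> pb \<star> pt)" unfolding sq1 by (simp add: dcmp_assoc)
  finally show "p1 \<star> (UU \<star> pt) \<star> p2 \<star> UU \<star> p1 = p1" by (simp add: pdbt)
  have "p2 \<star> UU \<star> p1 \<star> (UU \<star> pt) \<star> p2 = p2 \<star> UU \<star> p1 \<star> UU \<star> (pt \<star> p2)" by (simp add: dcmp_assoc)
  also have "\<dots> = (p2 \<star> UU \<star> p1 \<star> UU \<star> p2) \<star> pt" unfolding comm(2) by (simp add: dcmp_assoc)
  also have "\<dots> = p2 \<star> (pb \<star> pd) \<star> pt" unfolding sq2 by (simp add: dcmp_assoc)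
  also have "\<dots> = p2 \<star> (pd \<star> pb \<star> pt)" unfolding comm(4)[symmetric] by (simp add: dcmp_assoc)
  finally show "p2 \<star> UU \<star> p1 \<star> (UU \<star> pt) \<star> p2 = p2" by (simp add: pdbt)
qed

end

section \<open>The relations in the Grothendieck ring\<close>

interpretation WW: lin_mon_cat W_words by (rule lin_mon_cat_W_words)
interpretation W1: lin_mon_cat W' unfolding W'_def by (rule WW.lin_mon_cat_additive_closure)
interpretation W2: lin_mon_cat W unfolding W_def by (rule W1.lin_mon_cat_karoubi)

definition W_rel :: "(wkar \<times> wkar) set" where
  "W_rel = {(kar_incl W' (in_W' (bdag k \<circ>\<^sub>t TB k)), kar_incl W' (in_W' i0)) | k. True}"

lemma W_inf_eq: "W_inf = quotient_cat W W_rel"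
  by (simp add: W_inf_def W_rel_def)

interpretation WI: lin_mon_cat W_inf unfolding W_inf_eq by (rule W2.lin_mon_cat_quotient)

lemmas W_sel = karoubi_sel[of W', folded W_def]
lemmas Hom_W = Hom_karoubi[of _ W', folded W_def]

lemma tens_ob_W': "tens_ob W' [u] [v] = [u @ v]"
  by (simp add: W'_def additive_closure_sel W_words_sel)

lemma abs_warr_Hom: "wt f \<Longrightarrow> abs_warr f \<in> Hom W_words (tsrc f) (ttgt f)"
  by (simp add: W_words_sel wwt.abs_eq wsrc.abs_eq wtgt.abs_eq)

lemma abs_warr_eq_iff: "abs_warr f = abs_warr g \<longleftrightarrow> w_eq f g"
  using Quotient_rel[OF Quotient_warr] by (metis equivp_w_eq equivp_reflp)

lemma in_W'_Hom: "wt f \<Longrightarrow> in_W' f \<in> Hom W' [tsrc f] [ttgt f]"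
  unfolding in_W'_def W'_def by (rule WW.add_incl_Hom[OF abs_warr_Hom])

lemma in_W'_cong: "w_eq f g \<Longrightarrow> in_W' f = in_W' g"
  by (simp add: in_W'_def abs_warr_eq_iff[THEN iffD2])

lemma in_W'_ops:
  "wt (g \<circ>\<^sub>t f) \<Longrightarrow> in_W' (g \<circ>\<^sub>t f) = cmp W' (in_W' g) (in_W' f)"
  "wt (f +\<^sub>t g) \<Longrightarrow> in_W' (f +\<^sub>t g) = padd W' (in_W' f) (in_W' g)"
  "wt f \<Longrightarrow> in_W' (r *\<^sub>t f) = scal W' r (in_W' f)"
  "wt f \<Longrightarrow> wt g \<Longrightarrow> in_W' (f \<otimes>\<^sub>t g) = tens W' (in_W' f) (in_W' g)"
  "in_W' (TId u) = idn W' [u]"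
  "in_W' (TNul u v) = nul W' [u] [v]"
proof -
  show "in_W' (g \<circ>\<^sub>t f) = cmp W' (in_W' g) (in_W' f)" if "wt (g \<circ>\<^sub>t f)"
    using that WW.add_incl_cmp[of "abs_warr g" "tsrc g" "ttgt g" "abs_warr f" "tsrc f"]
        abs_warr_Hom[of g] abs_warr_Hom[of f]
    by (simp add: in_W'_def W'_def W_words_sel(5) wcmp.abs_eq)
  show "in_W' (f +\<^sub>t g) = padd W' (in_W' f) (in_W' g)" if "wt (f +\<^sub>t g)"
    using that WW.add_incl_padd[of "abs_warr f" "tsrc f" "ttgt f" "abs_warr g"] abs_warr_Hom[of g]
        abs_warr_Hom[of f]
    by (simp add: in_W'_def W'_def W_words_sel(7) wadd.abs_eq)
  show "in_W' (r *\<^sub>t f) = scal W' r (in_W' f)" if "wt f"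
    using that WW.add_incl_scal[OF abs_warr_Hom[of f], of r]
    by (simp add: in_W'_def W'_def W_words_sel(8) wscl.abs_eq)
  show "in_W' (f \<otimes>\<^sub>t g) = tens W' (in_W' f) (in_W' g)" if "wt f" "wt g"
    using that WW.add_incl_tens[OF abs_warr_Hom[of f] abs_warr_Hom[of g]]
    by (simp add: in_W'_def W'_def W_words_sel(11) wtens.abs_eq)
  show "in_W' (TId u) = idn W' [u]"
    using WW.add_incl_idn[of u] by (simp add: in_W'_def W'_def W_words_sel(1,4) widn.abs_eq)
  show "in_W' (TNul u v) = nul W' [u] [v]"
    using WW.add_incl_nul[of u v] by (simp add: in_W'_def W'_def W_words_sel(1,6) wnul.abs_eq)
qed

section \<open>Terms as objects and arrows of the Karoubi envelope\<close>

definition KO :: "word \<Rightarrow> tm \<Rightarrow> wob" where "KO w e = ([w], in_W' e)"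

text \<open>Idempotence is required modulo \<open>w_eq\<close> and not modulo \<open>d_eq\<close>,
  because objects of the envelope are formed before the asymptotic relations are imposed.\<close>

definition good :: "word \<Rightarrow> tm \<Rightarrow> bool" where
  "good w e \<longleftrightarrow> wt e \<and> tsrc e = w \<and> ttgt e = w \<and> w_eq (e \<circ>\<^sub>t e) e"

lemma kar_ob_KO: "kar_ob W' [w] = KO w (TId w)"
  by (simp add: kar_ob_def KO_def in_W'_ops)

lemma kar_incl_KO: "wt f \<Longrightarrow> kar_incl W' (in_W' f) = (KO (tsrc f) (TId (tsrc f)), KO (ttgt f) (TId
    (ttgt f)), in_W' f)"
  using HomD[OF in_W'_Hom[of f]] by (simp add: kar_incl_def kar_ob_KO)

lemma w_eq_TId: "wt f \<Longrightarrow> tsrc f = u \<Longrightarrow> w_eq (f \<circ>\<^sub>t TId u) f" "wt f \<Longrightarrow> ttgt f = u \<Longrightarrow> w_eq (TId u \<circ>\<^sub>t f)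
    f"
  by (auto intro!: w_eq.axm lm_axiom.intros)

lemma good_TId: "good w (TId w)"
  by (simp add: good_def w_eq_TId)

lemma good_TNul: "good w (TNul w w)"
proof -
  have "abs_warr (TNul w w \<circ>\<^sub>t TNul w w) = abs_warr (TNul w w)"
    using wnul(1)[of "wnul w w" w] by (simp flip: wcmp.abs_eq wnul.abs_eq)
  then show ?thesis by (simp add: good_def abs_warr_eq_iff)
qed

lemma good_tens: "good u e \<Longrightarrow> good v f \<Longrightarrow> good (u @ v) (e \<otimes>\<^sub>t f)"
  unfolding good_def
  by (auto intro: w_eq.trans[OF w_eq.sym[OF w_eq.axm[OF lm_axiom.intros(8)]] w_eq.tens])

lemma KO_objs: "good w e \<Longrightarrow> KO w e \<in> objs W"
  using in_W'_Hom[of e] W1.Hom_objs[OF in_W'_Hom[of e]] in_W'_cong[of "e \<circ>\<^sub>t e" e]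
  by (simp add: W_sel KO_def good_def flip: in_W'_ops(1))

lemma KO_objs_inf: "good w e \<Longrightarrow> KO w e \<in> objs W_inf"
  by (simp add: W_inf_eq W2.quotient_sel KO_objs)

lemma KO_tens: "wt e \<Longrightarrow> wt f \<Longrightarrow> tens_ob W_inf (KO u e) (KO v f) = KO (u @ v) (e \<otimes>\<^sub>t f)"
  by (simp add: W_inf_eq W2.quotient_sel KO_def W_sel in_W'_ops tens_ob_W')

lemma KO_cong: "w_eq e f \<Longrightarrow> KO w e = KO w f"
  by (simp add: KO_def in_W'_cong)

text \<open>Cutting down by the idempotents on both sides makes a morphism of images out of any term
  between the underlying words.\<close>

definition karr :: "word \<Rightarrow> tm \<Rightarrow> word \<Rightarrow> tm \<Rightarrow> tm \<Rightarrow> wkar" where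
  "karr u a v b f = (KO u a, KO v b, in_W' (b \<circ>\<^sub>t f \<circ>\<^sub>t a))"

lemma karr_Hom:
  assumes "good u a" "good v b" "wt f" "tsrc f = u" "ttgt f = v"
  shows "karr u a v b f \<in> Hom W (KO u a) (KO v b)"
proof -
  note ab = assms(1,2)[unfolded good_def]
  have wa: "wcmp (abs_warr a) (abs_warr a) = abs_warr a" "wcmp (abs_warr b) (abs_warr b) =
      abs_warr b"
    using ab by (simp_all add: wcmp.abs_eq abs_warr_eq_iff)
  have ty: "wwt (abs_warr a)" "wsrc (abs_warr a) = u" "wtgt (abs_warr a) = u" "wwt (abs_warr b)"
      "wsrc (abs_warr b) = v"
    "wtgt (abs_warr b) = v" "wwt (abs_warr f)" "wsrc (abs_warr f) = u" "wtgt (abs_warr f) = v"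
    using ab assms by (simp_all add: wwt.abs_eq wsrc.abs_eq wtgt.abs_eq)
  have "abs_warr (b \<circ>\<^sub>t (b \<circ>\<^sub>t f \<circ>\<^sub>t a) \<circ>\<^sub>t a) = abs_warr (b \<circ>\<^sub>t f \<circ>\<^sub>t a)"
  proof -
    have "wcmp (abs_warr b) (wcmp (wcmp (abs_warr b) (wcmp (abs_warr f) (abs_warr a))) (abs_warr a))
        = wcmp (wcmp (abs_warr b) (abs_warr b)) (wcmp (abs_warr f) (wcmp (abs_warr a) (abs_warr
            a)))"
      using ty by (simp add: w_axioms(1))
    then show ?thesis by (simp add: wa flip: wcmp.abs_eq)
  qed
  then have "in_W' (b \<circ>\<^sub>t (b \<circ>\<^sub>t f \<circ>\<^sub>t a) \<circ>\<^sub>t a) = in_W' (b \<circ>\<^sub>t f \<circ>\<^sub>t a)" by (simp add: in_W'_def)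
  moreover have "in_W' (b \<circ>\<^sub>t (b \<circ>\<^sub>t f \<circ>\<^sub>t a) \<circ>\<^sub>t a) = cmp W' (in_W' b) (cmp W' (in_W' (b \<circ>\<^sub>t f
      \<circ>\<^sub>t a)) (in_W' a))"
    using ab assms by (simp add: in_W'_ops(1)[of b] in_W'_ops(1)[of _ a])
  moreover have "in_W' (b \<circ>\<^sub>t f \<circ>\<^sub>t a) \<in> Hom W' [u] [v]"
    using in_W'_Hom[of "b \<circ>\<^sub>t f \<circ>\<^sub>t a"] ab assms by simp
  ultimately show ?thesis
    using KO_objs[OF assms(1)] KO_objs[OF assms(2)] by (simp add: Hom_W karr_def) (simp add: KO_def)
qed

lemma karr_cmp:
  assumes "good u a" "good v b" "good w c" "wt f" "tsrc f = u" "ttgt f = v" "wt g" "tsrc g = v"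
      "ttgt g = w"
  shows "cmp W (karr v b w c g) (karr u a v b f) = karr u a w c (g \<circ>\<^sub>t b \<circ>\<^sub>t f)"
proof -
  note abc = assms(1-3)[unfolded good_def]
  have b: "wcmp (abs_warr b) (abs_warr b) = abs_warr b"
    using abc by (simp_all add: wcmp.abs_eq abs_warr_eq_iff)
  have ty: "wwt (abs_warr a)" "wsrc (abs_warr a) = u" "wtgt (abs_warr a) = u" "wwt (abs_warr b)"
      "wsrc (abs_warr b) = v"
    "wtgt (abs_warr b) = v" "wwt (abs_warr f)" "wsrc (abs_warr f) = u" "wtgt (abs_warr f) = v"
    "wwt (abs_warr c)" "wsrc (abs_warr c) = w" "wtgt (abs_warr c) = w" "wwt (abs_warr g)" "wsrc
        (abs_warr g) = v" "wtgt (abs_warr g) = w"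
    using abc assms by (simp_all add: wwt.abs_eq wsrc.abs_eq wtgt.abs_eq)
  have "wcmp (wcmp (abs_warr c) (wcmp (abs_warr g) (abs_warr b))) (wcmp (abs_warr b) (wcmp
      (abs_warr f) (abs_warr a)))
      = wcmp (abs_warr c) (wcmp (wcmp (abs_warr g) (wcmp (wcmp (abs_warr b) (abs_warr b))
          (abs_warr f))) (abs_warr a))"
    using ty by (simp add: w_axioms(1))
  then have "abs_warr ((c \<circ>\<^sub>t g \<circ>\<^sub>t b) \<circ>\<^sub>t (b \<circ>\<^sub>t f \<circ>\<^sub>t a)) = abs_warr (c \<circ>\<^sub>t (g \<circ>\<^sub>t b \<circ>\<^sub>t f) \<circ>\<^sub>t
      a)"
    by (simp add: b flip: wcmp.abs_eq)
  then have "in_W' ((c \<circ>\<^sub>t g \<circ>\<^sub>t b) \<circ>\<^sub>t (b \<circ>\<^sub>t f \<circ>\<^sub>t a)) = in_W' (c \<circ>\<^sub>t (g \<circ>\<^sub>t b \<circ>\<^sub>t f) \<circ>\<^sub>t a)"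
    by (simp add: in_W'_def)
  then show ?thesis
    using abc assms by (simp add: karr_def W_sel flip: in_W'_ops(1))
qed

text \<open>The passage from the calculus of diagrams to \<open>W_inf\<close>: each rule of
  \<open>d_eq\<close> is matched by a rule of the congruence, and the asymptotic relation is one of
  its generators. Typing is assumed because \<open>d_eq\<close> also relates ill-typed terms to
  themselves, while the congruence is reflexive only on arrows.\<close>

lemma d_eq_lm_cong:
  assumes "d_eq f g" "wt f"
  shows "lm_cong W W_rel (kar_incl W' (in_W' f)) (kar_incl W' (in_W' g))"
proof -
  have H: "kar_incl W' (in_W' f) \<in> Hom W (KO (tsrc f) (TId (tsrc f))) (KO (ttgt f) (TId (ttgt f)))"
    if "wt f" for f
  proof -
    have "w_eq (TId (ttgt f) \<circ>\<^sub>t f \<circ>\<^sub>t TId (tsrc f)) f"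
      using that by (meson w_eq.trans w_eq_TId wt.simps(1) w_eq.cmp w_eq.refl)
    then show ?thesis
      using karr_Hom[OF good_TId good_TId that HOL.refl HOL.refl] in_W'_cong
      by (simp add: karr_def kar_incl_KO[OF that])
  qed
  have op: "kar_incl W' (in_W' (g \<circ>\<^sub>t f)) = cmp W (kar_incl W' (in_W' g)) (kar_incl W' (in_W' f))"
    if "wt (g \<circ>\<^sub>t f)" for f g
    using that kar_incl_KO[of "g \<circ>\<^sub>t f"] kar_incl_KO[of g] kar_incl_KO[of f] in_W'_ops(1)[of g f]
    by (simp add: W_sel)
  have op2: "kar_incl W' (in_W' (f +\<^sub>t g)) = padd W (kar_incl W' (in_W' f)) (kar_incl W' (in_W' g))"
    if "wt (f +\<^sub>t g)" for f g
    using that kar_incl_KO[of "f +\<^sub>t g"] kar_incl_KO[of g] kar_incl_KO[of f] in_W'_ops(2)[of f g]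
    by (simp add: W_sel)
  have op3: "kar_incl W' (in_W' (r *\<^sub>t f)) = scal W r (kar_incl W' (in_W' f))"
    if "wt f" for f r
    using that kar_incl_KO[of "r *\<^sub>t f"] kar_incl_KO[of f] in_W'_ops(3)[of f r]
    by (simp add: W_sel)
  have op4: "kar_incl W' (in_W' (f \<otimes>\<^sub>t g)) = tens W (kar_incl W' (in_W' f)) (kar_incl W' (in_W' g))"
    if "wt f" "wt g" for f g
  proof -
    have "KO (u @ v) (TId (u @ v)) = tens_ob W (KO u (TId u)) (KO v (TId v))" for u v
      using KO_tens[of "TId u" "TId v" u v] KO_cong[OF w_eq.axm[OF lm_axiom.intros(7)[of u v]]]
      by (simp add: W_inf_eq W2.quotient_sel)
    then show ?thesis
      using that kar_incl_KO[of "f \<otimes>\<^sub>t g"] kar_incl_KO[of g] kar_incl_KO[of f] in_W'_ops(4)[of f g]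
      by (simp add: W_sel)
  qed
  show ?thesis using assms
  proof induction
    case (weq f g)
    then show ?case using in_W'_cong[of f g] H[of f] by (simp add: lm_cong.refl HomD)
  next
    case (asym k)
    show ?case
      by (rule lm_cong.base[of _ _ _ _ "KO [] i0" "KO [] i0"])
        (use H[of "bdag k \<circ>\<^sub>t TB k"] H[of i0] in \<open>auto simp: W_rel_def\<close>)
  next
    case (sym f g)
    then show ?case using d_eq_type[OF sym(1)] by (blast intro: lm_cong.sym)
  next
    case (trans f g h)
    then show ?case using d_eq_type[OF trans(1)] by (blast intro: lm_cong.trans)
  next
    case (cmp g g' f f')
    then have "wt (g' \<circ>\<^sub>t f')" using d_eq_type[OF cmp(1)] d_eq_type[OF cmp(2)] by simp
    then show ?case
      using cmp HomD[OF H[of g]] HomD[OF H[of f]] by (simp add: op lm_cong.cmp)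
  next
    case (tens f f' g g')
    then have "wt f'" "wt g'" using d_eq_type[OF tens(1)] d_eq_type[OF tens(2)] by simp_all
    then show ?case using tens by (simp add: op4 lm_cong.tens)
  next
    case (add f f' g g')
    then have "wt (f' +\<^sub>t g')" using d_eq_type[OF add(1)] d_eq_type[OF add(2)] by simp
    then show ?case
      using add HomD[OF H[of g]] HomD[OF H[of f]] by (simp add: op2 lm_cong.padd)
  next
    case (scl f f' r)
    then have "wt f'" using d_eq_type[OF scl(1)] by simp
    then show ?case using scl by (simp add: op3 lm_cong.scal)
  qed
qed

text \<open>The congruence was transferred for arrows between full words. \<open>L\<close> recovers
  an arrow between images from one between words, by composing with the inclusion of the image of
  \<open>a\<close> and the projection onto the image of \<open>b\<close>, and composition respects
  the congruence.\<close>

lemma karr_cong: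
  assumes "good u a" "good v b" "wt f" "tsrc f = u" "ttgt f = v"
    and "D (b \<circ>\<^sub>t f \<circ>\<^sub>t a) = D (b \<circ>\<^sub>t g \<circ>\<^sub>t a)"
  shows "lm_cong W W_rel (karr u a v b f) (karr u a v b g)"
proof -
  note ab = assms(1,2)[unfolded good_def]
  have d: "d_eq (b \<circ>\<^sub>t f \<circ>\<^sub>t a) (b \<circ>\<^sub>t g \<circ>\<^sub>t a)" using assms(6) by (simp only: D_eq_iff)
  have g: "wt g" "tsrc g = u" "ttgt g = v" using d_eq_type[OF d] assms ab by auto
  define L where "L = (\<lambda>h. cmp W (karr v (TId v) v b b) (cmp W (kar_incl W' (in_W' h)) (karr u a u
      (TId u) a)))"
  have L: "L (b \<circ>\<^sub>t h \<circ>\<^sub>t a) = karr u a v b h" if h: "wt h" "tsrc h = u" "ttgt h = v" for h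
  proof -
    have eq: "wcmp (abs_warr a) (abs_warr a) = abs_warr a" "wcmp (abs_warr b) (abs_warr b) =
        abs_warr b"
      using ab by (simp_all add: wcmp.abs_eq abs_warr_eq_iff)
    have ty: "wwt (abs_warr a)" "wsrc (abs_warr a) = u" "wtgt (abs_warr a) = u" "wwt (abs_warr b)"
        "wsrc (abs_warr b) = v"
      "wtgt (abs_warr b) = v" "wwt (abs_warr h)" "wsrc (abs_warr h) = u" "wtgt (abs_warr h) = v"
      using ab h by (simp_all add: wwt.abs_eq wsrc.abs_eq wtgt.abs_eq)
    have bb: "wcmp (abs_warr b) (wcmp (abs_warr b) x) = wcmp (abs_warr b) x" if "wwt x" "wtgt x =
        v" for x
      using that ty w_axioms(1)[of "abs_warr b" "abs_warr b" x] by (simp add: eq)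
    have "wcmp (wcmp (abs_warr b) (wcmp (abs_warr b) (widn v))) (wcmp (wcmp (abs_warr b) (wcmp
        (abs_warr h) (abs_warr a))) (wcmp (widn u) (wcmp (abs_warr a) (abs_warr a))))
        = wcmp (abs_warr b) (wcmp (abs_warr h) (abs_warr a))"
      using ty w_axioms(2)[of "abs_warr b"] w_axioms(3)[of "abs_warr a"] by (simp add: w_axioms(1)
          eq bb)
    then have "abs_warr ((b \<circ>\<^sub>t b \<circ>\<^sub>t TId v) \<circ>\<^sub>t (b \<circ>\<^sub>t h \<circ>\<^sub>t a) \<circ>\<^sub>t (TId u \<circ>\<^sub>t a \<circ>\<^sub>t a)) =
        abs_warr (b \<circ>\<^sub>t h \<circ>\<^sub>t a)"
      by (simp add: eq flip: wcmp.abs_eq widn.abs_eq)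
    then have "in_W' ((b \<circ>\<^sub>t b \<circ>\<^sub>t TId v) \<circ>\<^sub>t (b \<circ>\<^sub>t h \<circ>\<^sub>t a) \<circ>\<^sub>t (TId u \<circ>\<^sub>t a \<circ>\<^sub>t a)) = in_W' (b
        \<circ>\<^sub>t h \<circ>\<^sub>t a)"
      by (simp add: in_W'_def)
    then show ?thesis
      using ab h by (simp add: L_def karr_def kar_incl_KO W_sel flip: in_W'_ops(1))
  qed
  have Ha: "karr u a u (TId u) a \<in> Hom W (KO u a) (KO u (TId u))"
    using ab assms(1) by (intro karr_Hom good_TId) auto
  have Hb: "karr v (TId v) v b b \<in> Hom W (KO v (TId v)) (KO v b)"
    using ab assms(2) by (intro karr_Hom good_TId) auto
  have wt: "wt (b \<circ>\<^sub>t f \<circ>\<^sub>t a)" using ab assms by simp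
  have c: "lm_cong W W_rel (kar_incl W' (in_W' (b \<circ>\<^sub>t f \<circ>\<^sub>t a))) (kar_incl W' (in_W' (b \<circ>\<^sub>t g \<circ>\<^sub>t
      a)))"
    by (rule d_eq_lm_cong[OF d wt])
  have st: "src W (kar_incl W' (in_W' (b \<circ>\<^sub>t f \<circ>\<^sub>t a))) = KO u (TId u)" "tgt W (kar_incl W' (in_W'
      (b \<circ>\<^sub>t f \<circ>\<^sub>t a))) = KO v (TId v)"
    using ab assms by (simp_all add: kar_incl_KO W_sel)
  have m: "kar_incl W' (in_W' (b \<circ>\<^sub>t f \<circ>\<^sub>t a)) \<in> Hom W (KO u (TId u)) (KO v (TId v))"
    using W2.lm_cong_Hom[OF c] st by (simp add: Hom_def)
  have "lm_cong W W_rel (L (b \<circ>\<^sub>t f \<circ>\<^sub>t a)) (L (b \<circ>\<^sub>t g \<circ>\<^sub>t a))"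
    unfolding L_def
    using HomD[OF Ha] HomD[OF Hb] HomD[OF W2.cmp[OF m Ha]] st
    by (intro lm_cong.cmp c lm_cong.refl) auto
  then show ?thesis using L g assms by simp
qed

text \<open>A biproduct in \<open>W_inf\<close> is read off from equations between diagrams. The
  structure maps may be arbitrary terms, since the idempotents inserted between them do the cutting
  down.\<close>

lemma is_dsum_W_inf:
  assumes g: "good w e" "good u a" "good v b"
    and i: "wt i" "tsrc i = u" "ttgt i = w" and j: "wt j" "tsrc j = v" "ttgt j = w"
    and p: "wt p" "tsrc p = w" "ttgt p = u" and r: "wt r" "tsrc r = w" "ttgt r = v"
    and eq: "D a \<star> D p \<star> D e \<star> D i \<star> D a = D a" "D b \<star> D r \<star> D e \<star> D j \<star> D b = D b"
      "D a \<star> D p \<star> D e \<star> D j \<star> D b = Nul v u" "D b \<star> D r \<star> D e \<star> D i \<star> D a = Nul u v"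
      "D e \<star> D i \<star> D a \<star> D p \<star> D e +\<^sub>d D e \<star> D j \<star> D b \<star> D r \<star> D e = D e"
  shows "is_dsum W_inf (KO w e) (KO u a) (KO v b)"
proof -
  note gg = g[unfolded good_def]
  have idem: "D e \<star> D e = D e" "D a \<star> D a = D a" "D b \<star> D b = D b"
    using gg d_eq.weq D_eq_iff by (metis dcmp.abs_eq)+
  have ty [simp]: "dwt (D e)" "dsrc (D e) = w" "dtgt (D e) = w" "dwt (D a)" "dsrc (D a) = u" "dtgt
      (D a) = u"
    "dwt (D b)" "dsrc (D b) = v" "dtgt (D b) = v" "dwt (D i)" "dsrc (D i) = u" "dtgt (D i) = w"
    "dwt (D j)" "dsrc (D j) = v" "dtgt (D j) = w" "dwt (D p)" "dsrc (D p) = w" "dtgt (D p) = u"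
    "dwt (D r)" "dsrc (D r) = w" "dtgt (D r) = v"
    using gg i j p r by (simp_all add: D_type)
  let ?q = "lin_mon_cat.qcls W W_rel"
  let ?Q = "quotient_cat W W_rel"
  have H: "karr u a w e i \<in> Hom W (KO u a) (KO w e)" "karr v b w e j \<in> Hom W (KO v b) (KO w e)"
    "karr w e u a p \<in> Hom W (KO w e) (KO u a)" "karr w e v b r \<in> Hom W (KO w e) (KO v b)"
    by (intro karr_Hom g i j p r)+
  have idn: "idn W (KO x c) = karr x c x c (TId x)" if "good x c" for x c
  proof -
    have "abs_warr (c \<circ>\<^sub>t TId x \<circ>\<^sub>t c) = abs_warr c"
      using that w_axioms(3)[of "abs_warr c"] abs_warr_eq_iff[of "c \<circ>\<^sub>t c" c]
      by (simp add: good_def wwt.abs_eq wtgt.abs_eq flip: wcmp.abs_eq widn.abs_eq)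
    then show ?thesis by (simp add: karr_def W_sel KO_def in_W'_def)
  qed
  have nul: "nul W (KO x c) (KO y d) = karr x c y d (TNul x y)" if "good x c" "good y d" for x c y d
  proof -
    have "abs_warr (d \<circ>\<^sub>t TNul x y \<circ>\<^sub>t c) = abs_warr (TNul x y)"
      using that wnul(1)[of "abs_warr d" x] wnul(2)[of "abs_warr c" y]
      by (simp add: good_def wwt.abs_eq wtgt.abs_eq wsrc.abs_eq flip: wcmp.abs_eq wnul.abs_eq)
    then show ?thesis by (simp add: karr_def W_sel KO_def in_W'_def flip: in_W'_ops(6))
  qed
  \<comment> \<open>A composite of cut-down arrows is again a cut-down arrow, so each biproduct
    identity becomes a single equation between diagrams.\<close>
  have cl: "?q (cmp W (karr v' b' w' c' h) (karr u' a' v' b' f)) = ?q (karr u' a' w' c' k)"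
    if "good u' a'" "good v' b'" "good w' c'" "wt f" "tsrc f = u'" "ttgt f = v'" "wt h" "tsrc h =
        v'" "ttgt h = w'"
      "D c' \<star> (D h \<star> D b' \<star> D f) \<star> D a' = D c' \<star> D k \<star> D a'" for u' a' v' b' w' c' f h k
  proof -
    have "wt (h \<circ>\<^sub>t b' \<circ>\<^sub>t f)" using that by (simp add: good_def)
    then show ?thesis
      using that by (simp add: karr_cmp) (intro W2.qcls_cong karr_cong, simp_all)
  qed
  have "cmp ?Q (?q (karr w e u a p)) (?q (karr u a w e i)) = idn ?Q (KO u a)"
    by (subst W2.quotient_cmp[OF H(3,1)])
      (simp add: W2.quotient_sel idn[OF g(2)], rule cl, simp_all add: g p i eq idem dcmp_assoc)
  moreover have "cmp ?Q (?q (karr w e v b r)) (?q (karr v b w e j)) = idn ?Q (KO v b)"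
    by (subst W2.quotient_cmp[OF H(4,2)])
      (simp add: W2.quotient_sel idn[OF g(3)], rule cl, simp_all add: g r j eq idem dcmp_assoc)
  moreover have "cmp ?Q (?q (karr w e u a p)) (?q (karr v b w e j)) = nul ?Q (KO v b) (KO u a)"
    by (subst W2.quotient_cmp[OF H(3,2)])
      (simp add: W2.quotient_sel nul[OF g(3,2)], rule cl, simp_all add: g p j eq idem dcmp_assoc)
  moreover have "cmp ?Q (?q (karr w e v b r)) (?q (karr u a w e i)) = nul ?Q (KO u a) (KO v b)"
    by (subst W2.quotient_cmp[OF H(4,1)])
      (simp add: W2.quotient_sel nul[OF g(2,3)], rule cl, simp_all add: g r i eq idem dcmp_assoc)
  moreover have "padd ?Q (cmp ?Q (?q (karr u a w e i)) (?q (karr w e u a p))) (cmp ?Q (?q (karr v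
      b w e j)) (?q (karr w e v b r)))
      = idn ?Q (KO w e)"
  proof -
    let ?s = "i \<circ>\<^sub>t a \<circ>\<^sub>t p" and ?t = "j \<circ>\<^sub>t b \<circ>\<^sub>t r"
    have c: "cmp W (karr u a w e i) (karr w e u a p) = karr w e w e ?s"
      "cmp W (karr v b w e j) (karr w e v b r) = karr w e w e ?t"
      by (intro karr_cmp g i j p r)+
    have ty': "wt ?s" "tsrc ?s = w" "ttgt ?s = w" "wt ?t" "tsrc ?t = w" "ttgt ?t = w"
      using gg i j p r by simp_all
    have "padd W (karr w e w e ?s) (karr w e w e ?t) = karr w e w e (?s +\<^sub>t ?t)"
    proof -
      have a: "abs_warr (e \<circ>\<^sub>t (?s +\<^sub>t ?t) \<circ>\<^sub>t e) = abs_warr ((e \<circ>\<^sub>t ?s \<circ>\<^sub>t e) +\<^sub>t (e \<circ>\<^sub>t ?t \<circ>\<^sub>t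
          e))"
      proof -
        have "abs_warr ((?s +\<^sub>t ?t) \<circ>\<^sub>t e) = abs_warr (?s \<circ>\<^sub>t e +\<^sub>t ?t \<circ>\<^sub>t e)"
          using ty' gg by (simp only: abs_warr_eq_iff) (intro w_eq.axm lm_axiom.intros; simp)
        moreover have "abs_warr (e \<circ>\<^sub>t (?s \<circ>\<^sub>t e +\<^sub>t ?t \<circ>\<^sub>t e)) = abs_warr ((e \<circ>\<^sub>t ?s \<circ>\<^sub>t e) +\<^sub>t
            (e \<circ>\<^sub>t ?t \<circ>\<^sub>t e))"
          using ty' gg by (simp only: abs_warr_eq_iff) (intro w_eq.axm lm_axiom.intros; simp)
        ultimately show ?thesis by (metis wcmp.abs_eq)
      qed
      show ?thesis
        using ty' gg in_W'_ops(2)[of "e \<circ>\<^sub>t ?s \<circ>\<^sub>t e" "e \<circ>\<^sub>t ?t \<circ>\<^sub>t e"]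
        by (simp add: karr_def W_sel in_W'_def[of "e \<circ>\<^sub>t (?s +\<^sub>t ?t) \<circ>\<^sub>t e"] a)
          (simp add: in_W'_def)
    qed
    moreover have "?q (karr w e w e (?s +\<^sub>t ?t)) = ?q (karr w e w e (TId w))"
      using ty' by (intro W2.qcls_cong karr_cong g)
        (simp_all add: dcmp_dadd idem dcmp_assoc, simp add: eq)
    ultimately show ?thesis
      using karr_Hom[OF g(1) g(1) ty'(1-3)] karr_Hom[OF g(1) g(1) ty'(4-6)]
      by (simp add: W2.quotient_cmp[OF H(1,3)] W2.quotient_cmp[OF H(2,4)] c W2.quotient_padd
          W2.quotient_sel idn[OF g(1)])
  qed
  moreover have "?q (karr u a w e i) \<in> Hom ?Q (KO u a) (KO w e)" "?q (karr v b w e j) \<in> Hom ?Q (KO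
      v b) (KO w e)"
    "?q (karr w e u a p) \<in> Hom ?Q (KO w e) (KO u a)" "?q (karr w e v b r) \<in> Hom ?Q (KO w e) (KO v
        b)"
    using H by (auto simp: W2.Hom_quotient)
  ultimately show ?thesis
    unfolding is_dsum_def W_inf_eq using KO_objs[OF g(1)] KO_objs[OF g(2)] KO_objs[OF g(3)]
    by (auto simp: W2.quotient_sel)
qed

subsection \<open>Classes in the Grothendieck ring\<close>

interpretation K: ring "K0 W_inf" by (rule WI.ring_K0)

definition kc :: "word \<Rightarrow> tm \<Rightarrow> (wob \<Rightarrow>\<^sub>0 int) set" where
  "kc w e = K0_class W_inf (KO w e)"

lemma kc_closed [simp]: "good w e \<Longrightarrow> kc w e \<in> carrier (K0 W_inf)"
  unfolding kc_def by (intro WI.K0_class_carrier KO_objs_inf)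

lemma kc_mult: "good u e \<Longrightarrow> good v f \<Longrightarrow> kc u e \<otimes>\<^bsub>K0 W_inf\<^esub> kc v f = kc (u @ v) (e \<otimes>\<^sub>t f)"
  by (simp add: kc_def WI.K0_class_mult KO_objs_inf KO_tens good_def)

lemma good_D: "good w e \<Longrightarrow> dwt (D e)" "good w e \<Longrightarrow> dsrc (D e) = w" "good w e \<Longrightarrow> dtgt (D e) = w"
    "good w e \<Longrightarrow> D e \<star> D e = D e"
  using D_eq_iff[of "e \<circ>\<^sub>t e" e] by (simp_all add: good_def D_type d_eq.weq)

text \<open>For orthogonal idempotents of one word all four structure maps are the identity of that
  word, cut down.\<close>

lemma kc_sum:
  assumes "good w e" "good w e1" "good w e2" "D e = D e1 +\<^sub>d D e2"
    "D e1 \<star> D e2 = Nul w w" "D e2 \<star> D e1 = Nul w w"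
  shows "kc w e = kc w e1 \<oplus>\<^bsub>K0 W_inf\<^esub> kc w e2"
proof -
  note g = good_D[OF assms(1)] good_D[OF assms(2)] good_D[OF assms(3)]
  have "D e1 \<star> D e = D e1" "D e2 \<star> D e = D e2" "D e \<star> D e1 = D e1" "D e \<star> D e2 = D e2"
    using g assms(5,6) by (simp_all add: assms(4) dcmp_dadd)
  then have "is_dsum W_inf (KO w e) (KO w e1) (KO w e2)"
    using g assms(4-6)
    by (intro is_dsum_W_inf[where i="TId w" and j="TId w" and p="TId w" and r="TId w"] assms(1-3))
        simp_all
  then show ?thesis unfolding kc_def by (rule WI.K0_class_dsum)
qed

text \<open>A zero object is the direct sum of two copies of itself, so its class cancels.\<close>

lemma kc_zero:
  assumes "good w e" "D e = Nul w w"
  shows "kc w e = \<zero>\<^bsub>K0 W_inf\<^esub>"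
  using kc_sum[OF assms(1) assms(1) assms(1)] assms kc_closed[OF assms(1)] by (simp add:
      K.add.l_cancel_one')

text \<open>\<open>K0\<close> knows only direct sums, so an isomorphism is presented as a direct sum
  whose second summand is the zero object on the empty word. Representatives of \<open>f\<close> and
  \<open>g\<close> are chosen because the criterion for direct sums asks for terms.\<close>

lemma kc_iso:
  assumes "good u a" "good v b" "dwt f" "dsrc f = u" "dtgt f = v" "dwt g" "dsrc g = v" "dtgt g = u"
    "D a \<star> g \<star> D b \<star> f \<star> D a = D a" "D b \<star> f \<star> D a \<star> g \<star> D b = D b"
  shows "kc u a = kc v b"
proof -
  have rep: "D (rep_darr h) = h" for h by (rule Quotient_abs_rep[OF Quotient_darr])
  have ty: "wt (rep_darr h) = dwt h" "tsrc (rep_darr h) = dsrc h" "ttgt (rep_darr h) = dtgt h" for h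
    using D_type[of "rep_darr h"] by (simp_all add: rep)
  have "is_dsum W_inf (KO u a) (KO v b) (KO [] (TNul [] []))"
    using assms good_D[OF assms(1)] good_D[OF assms(2)]
    by (intro is_dsum_W_inf[where i="rep_darr g" and j="TNul [] u" and p="rep_darr f" and r="TNul
        u []"]
        assms(1,2) good_TNul) (simp_all add: ty rep)
  then have "kc u a = kc v b \<oplus>\<^bsub>K0 W_inf\<^esub> kc [] (TNul [] [])"
    unfolding kc_def by (rule WI.K0_class_dsum)
  then show ?thesis using kc_zero[OF good_TNul, of "[]"] assms by simp
qed

text \<open>Idempotents that agree only modulo the asymptotic relations may be different objects of
  \<open>W_inf\<close>, but these objects are isomorphic.\<close>

lemma kc_cong:
  assumes "good w a" "good w b" "D a = D b"
  shows "kc w a = kc w b"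
  using assms good_D[OF assms(2)] by (intro kc_iso[where f="idd w" and g="idd w"]) simp_all

lemma good_cc [simp]: "good [] (cc k)"
proof (cases "k < 0")
  case True
  then show ?thesis using good_TNul[of "[]"] by (simp add: cc_def)
next
  case False
  then have "w_eq (cc k \<circ>\<^sub>t cc k) (cc k)" using w_eq.rel[OF r8, of k k] by simp
  then show ?thesis by (simp add: good_def)
qed

lemma good_gen [simp]: "good [Plus] ip" "good [Minus] im" by (rule good_TId)+

abbreviation "kx \<equiv> kc [Plus] ip"
abbreviation "ky \<equiv> kc [Minus] im"
abbreviation "kcc k \<equiv> kc [] (cc k)"
abbreviation kmult (infixl \<open>\<odot>\<odot>\<close> 70) where "a \<odot>\<odot> b \<equiv> a \<otimes>\<^bsub>K0 W_inf\<^esub> b"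

section \<open>Relations between the classes of Q_+, Q_- and C_k\<close>

lemma D_gen: "D (cc k) = \<gamma> k" "D ip = Idp" "D im = Idm"
  by (simp_all add: \<gamma>_def)

lemma strand_mult:
  assumes "scalar a" "scalar b" "scalar a'" "scalar b'"
  shows "(a \<diamondop> idd [l] \<diamondop> b) \<star> (a' \<diamondop> idd [l] \<diamondop> b') = (a \<star> a') \<diamondop> idd [l] \<diamondop> (b \<star> b')"
  using assms d_interchange[of "idd [l]" "idd [l]" b b'] d_interchange[of a a' "idd [l] \<diamondop> b" "idd
      [l] \<diamondop> b'"]
  by (simp add: scalar_def)

lemma kcc_mult: "kcc k \<odot>\<odot> kcc j = (if k = j then kcc k else \<zero>\<^bsub>K0 W_inf\<^esub>)"
proof -
  have g: "good [] (cc k \<otimes>\<^sub>t cc j)" using good_tens[OF good_cc good_cc] by simp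
  have "D (cc k \<otimes>\<^sub>t cc j) = (if k = j then \<gamma> k else Nul [] [])"
    by (simp add: D_gen scalar_dtens \<gamma>_mult)
  then show ?thesis
    using kc_cong[OF g good_cc[of k]] kc_zero[OF g] by (auto simp: kc_mult D_gen)
qed

lemma kcc_neg: "k < 0 \<Longrightarrow> kcc k = \<zero>\<^bsub>K0 W_inf\<^esub>"
  by (intro kc_zero) (simp_all add: D_gen \<gamma>_neg)

text \<open>The two decorated strands are orthogonal, because their scalars have different indices
  in at least one of the two regions.\<close>

lemma kc_strand_sum:
  assumes "good [l] e" "l = Plus \<and> t = ip \<or> l = Minus \<and> t = im"
    "D e = \<gamma> i \<diamondop> idd [l] \<diamondop> \<gamma> j +\<^sub>d \<gamma> i' \<diamondop> idd [l] \<diamondop> \<gamma> j'" "i \<noteq> i' \<or> j \<noteq> j'"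
  shows "kc [l] e = kcc i \<odot>\<odot> kc [l] t \<odot>\<odot> kcc j \<oplus>\<^bsub>K0 W_inf\<^esub> kcc i' \<odot>\<odot> kc [l] t \<odot>\<odot> kcc j'"
proof -
  have t [simp]: "good [l] t" "D t = idd [l]" using assms(2) by auto
  have g: "good [l] (cc i \<otimes>\<^sub>t t)" "good [l] (cc i' \<otimes>\<^sub>t t)" "good [l] ((cc i \<otimes>\<^sub>t t) \<otimes>\<^sub>t cc j)"
      "good [l] ((cc i' \<otimes>\<^sub>t t) \<otimes>\<^sub>t cc j')"
    using good_tens[OF good_cc t(1)] good_tens[OF good_tens[OF good_cc t(1)] good_cc] by simp_all
  have "kc [l] e = kc [l] ((cc i \<otimes>\<^sub>t t) \<otimes>\<^sub>t cc j) \<oplus>\<^bsub>K0 W_inf\<^esub> kc [l] ((cc i' \<otimes>\<^sub>t t) \<otimes>\<^sub>t cc j')"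
    using assms(3,4)
    by (intro kc_sum assms(1) g) (auto simp: D_gen dtens_assoc strand_mult \<gamma>_mult scalar_def)
  then show ?thesis using g by (simp add: kc_mult)
qed

text \<open>\<open>?rot\<close> turns an upward strand into a downward one and interchanges left and
  right. Hence the relation for x c_k yields the one for c_k y, and the relation for c_k x yields
  the one for y c_k.\<close>

lemma strand_minus:
  assumes "0 \<le> k"
  shows "\<gamma> k \<diamondop> Idm = \<gamma> k \<diamondop> Idm \<diamondop> \<gamma> k +\<^sub>d \<gamma> k \<diamondop> Idm \<diamondop> \<gamma> (k + 1)"
    "Idm \<diamondop> \<gamma> k = \<gamma> k \<diamondop> Idm \<diamondop> \<gamma> k +\<^sub>d \<gamma> (k - 1) \<diamondop> Idm \<diamondop> \<gamma> k"
proof -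
  let ?rot = "\<lambda>f. (Idm \<diamondop> \<epsilon>') \<star> (Idm \<diamondop> f \<diamondop> Idm) \<star> (\<eta> \<diamondop> Idm)"
  have r: "?rot (a \<diamondop> Idp \<diamondop> b) = b \<diamondop> Idm \<diamondop> a" if "scalar a" "scalar b" for a b
    using rotate_scalars[of a b] that by (simp add: scalar_def)
  have radd: "?rot (f +\<^sub>d g) = ?rot f +\<^sub>d ?rot g"
    if "dwt f" "dsrc f = [Plus]" "dtgt f = [Plus]" "dwt g" "dsrc g = [Plus]" "dtgt g = [Plus]" for
        f g
    using that by (simp add: dtens_dadd dcmp_dadd)
  have "?rot (idd [] \<diamondop> Idp \<diamondop> \<gamma> k) = ?rot (\<gamma> k \<diamondop> Idp \<diamondop> \<gamma> k +\<^sub>d \<gamma> (k + 1) \<diamondop> Idp \<diamondop> \<gamma> k)"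
    using W_relations_\<gamma>(4)[OF assms] by (simp add: dtens_dadd)
  then show "\<gamma> k \<diamondop> Idm = \<gamma> k \<diamondop> Idm \<diamondop> \<gamma> k +\<^sub>d \<gamma> k \<diamondop> Idm \<diamondop> \<gamma> (k + 1)"
    by (simp only: radd r d_type gen_type scalar_simps append.simps simp_thms) simp
  have "?rot (\<gamma> k \<diamondop> Idp \<diamondop> idd []) = ?rot (\<gamma> k \<diamondop> Idp \<diamondop> \<gamma> k +\<^sub>d \<gamma> k \<diamondop> Idp \<diamondop> \<gamma> (k - 1))"
    using W_relations_\<gamma>(3)[OF assms] by (simp add: dtens_dadd)
  then show "Idm \<diamondop> \<gamma> k = \<gamma> k \<diamondop> Idm \<diamondop> \<gamma> k +\<^sub>d \<gamma> (k - 1) \<diamondop> Idm \<diamondop> \<gamma> k"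
    by (simp only: radd r d_type gen_type scalar_simps append.simps simp_thms) simp
qed

lemma k_strand:
  assumes "0 \<le> k"
  shows "kcc k \<odot>\<odot> kx = kcc k \<odot>\<odot> kx \<odot>\<odot> kcc k \<oplus>\<^bsub>K0 W_inf\<^esub> kcc k \<odot>\<odot> kx \<odot>\<odot> kcc (k - 1)"
    "kx \<odot>\<odot> kcc k = kcc k \<odot>\<odot> kx \<odot>\<odot> kcc k \<oplus>\<^bsub>K0 W_inf\<^esub> kcc (k + 1) \<odot>\<odot> kx \<odot>\<odot> kcc k"
    "kcc k \<odot>\<odot> ky = kcc k \<odot>\<odot> ky \<odot>\<odot> kcc k \<oplus>\<^bsub>K0 W_inf\<^esub> kcc k \<odot>\<odot> ky \<odot>\<odot> kcc (k + 1)"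
    "ky \<odot>\<odot> kcc k = kcc k \<odot>\<odot> ky \<odot>\<odot> kcc k \<oplus>\<^bsub>K0 W_inf\<^esub> kcc (k - 1) \<odot>\<odot> ky \<odot>\<odot> kcc k"
proof -
  have g: "good [Plus] (cc k \<otimes>\<^sub>t ip)" "good [Plus] (ip \<otimes>\<^sub>t cc k)" "good [Minus] (cc k \<otimes>\<^sub>t im)"
      "good [Minus] (im \<otimes>\<^sub>t cc k)"
    using good_tens[OF good_cc good_gen(1)] good_tens[OF good_gen(1) good_cc]
      good_tens[OF good_cc good_gen(2)] good_tens[OF good_gen(2) good_cc] by simp_all
  have p: "D (cc k \<otimes>\<^sub>t ip) = \<gamma> k \<diamondop> Idp \<diamondop> \<gamma> k +\<^sub>d \<gamma> k \<diamondop> Idp \<diamondop> \<gamma> (k - 1)"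
    "D (ip \<otimes>\<^sub>t cc k) = \<gamma> k \<diamondop> Idp \<diamondop> \<gamma> k +\<^sub>d \<gamma> (k + 1) \<diamondop> Idp \<diamondop> \<gamma> k"
    using W_relations_\<gamma>(3,4)[OF assms] by (simp_all add: D_gen dtens_dadd)
  have m: "D (cc k \<otimes>\<^sub>t im) = \<gamma> k \<diamondop> Idm \<diamondop> \<gamma> k +\<^sub>d \<gamma> k \<diamondop> Idm \<diamondop> \<gamma> (k + 1)"
    "D (im \<otimes>\<^sub>t cc k) = \<gamma> k \<diamondop> Idm \<diamondop> \<gamma> k +\<^sub>d \<gamma> (k - 1) \<diamondop> Idm \<diamondop> \<gamma> k"
    using strand_minus[OF assms] by (simp_all add: D_gen)
  show "kcc k \<odot>\<odot> kx = kcc k \<odot>\<odot> kx \<odot>\<odot> kcc k \<oplus>\<^bsub>K0 W_inf\<^esub> kcc k \<odot>\<odot> kx \<odot>\<odot> kcc (k - 1)"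
    using kc_strand_sum[OF g(1) _ p(1), of ip] by (simp add: kc_mult[of "[]" _ "[Plus]" ip])
  show "kx \<odot>\<odot> kcc k = kcc k \<odot>\<odot> kx \<odot>\<odot> kcc k \<oplus>\<^bsub>K0 W_inf\<^esub> kcc (k + 1) \<odot>\<odot> kx \<odot>\<odot> kcc k"
    using kc_strand_sum[OF g(2) _ p(2), of ip] by (simp add: kc_mult[of "[Plus]" ip "[]"])
  show "kcc k \<odot>\<odot> ky = kcc k \<odot>\<odot> ky \<odot>\<odot> kcc k \<oplus>\<^bsub>K0 W_inf\<^esub> kcc k \<odot>\<odot> ky \<odot>\<odot> kcc (k + 1)"
    using kc_strand_sum[OF g(3) _ m(1), of im] by (simp add: kc_mult[of "[]" _ "[Minus]" im])
  show "ky \<odot>\<odot> kcc k = kcc k \<odot>\<odot> ky \<odot>\<odot> kcc k \<oplus>\<^bsub>K0 W_inf\<^esub> kcc (k - 1) \<odot>\<odot> ky \<odot>\<odot> kcc k"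
    using kc_strand_sum[OF g(4) _ m(2), of im] by (simp add: kc_mult[of "[Minus]" im "[]"])
qed

lemma kc_word:
  assumes "good [l] s" "good [l'] t"
  shows "kcc i \<odot>\<odot> kc [l] s \<odot>\<odot> kcc j \<odot>\<odot> kc [l'] t \<odot>\<odot> kcc m = kc [l, l'] ((((cc i \<otimes>\<^sub>t s) \<otimes>\<^sub>t cc j)
      \<otimes>\<^sub>t t) \<otimes>\<^sub>t cc m)"
    "good [l, l'] ((((cc i \<otimes>\<^sub>t s) \<otimes>\<^sub>t cc j) \<otimes>\<^sub>t t) \<otimes>\<^sub>t cc m)"
proof -
  note g1 = good_tens[OF good_cc[of i] assms(1)]
  note g2 = good_tens[OF g1 good_cc[of j]]
  note g3 = good_tens[OF g2 assms(2)]
  note g4 = good_tens[OF g3 good_cc[of m]]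
  show "kcc i \<odot>\<odot> kc [l] s \<odot>\<odot> kcc j \<odot>\<odot> kc [l'] t \<odot>\<odot> kcc m = kc [l, l'] ((((cc i \<otimes>\<^sub>t s) \<otimes>\<^sub>t cc j)
      \<otimes>\<^sub>t t) \<otimes>\<^sub>t cc m)"
    by (simp only: kc_mult[OF good_cc assms(1)] kc_mult[OF g1 good_cc] kc_mult[OF g2 assms(2)]
        kc_mult[OF g3 good_cc]) simp
  show "good [l, l'] ((((cc i \<otimes>\<^sub>t s) \<otimes>\<^sub>t cc j) \<otimes>\<^sub>t t) \<otimes>\<^sub>t cc m)" using g4 by simp
qed

lemma k_xx:
  assumes "0 \<le> k"
  shows "kcc (k + 1) \<odot>\<odot> kx \<odot>\<odot> kcc k \<odot>\<odot> kx \<odot>\<odot> kcc k = kcc (k + 1) \<odot>\<odot> kx \<odot>\<odot> kcc (k + 1) \<odot>\<odot> kx \<odot>\<odot> kcc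
      k"
proof -
  note w = kc_word[OF good_gen(1) good_gen(1)]
  have d: "D ((((cc (k + 1) \<otimes>\<^sub>t ip) \<otimes>\<^sub>t cc k) \<otimes>\<^sub>t ip) \<otimes>\<^sub>t cc k) = p1 k"
    "D ((((cc (k + 1) \<otimes>\<^sub>t ip) \<otimes>\<^sub>t cc (k + 1)) \<otimes>\<^sub>t ip) \<otimes>\<^sub>t cc k) = p2 k"
    using assms by (simp_all add: D_gen dtens_assoc p1_def p2_def tri_def)
  have pt: "dwt (pt k)" "dsrc (pt k) = [Plus, Plus]" "dtgt (pt k) = [Plus, Plus]"
    by (simp_all add: pt_def[OF assms])
  have UU: "dwt UU" "dsrc UU = [Plus, Plus]" "dtgt UU = [Plus, Plus]"
    using p_type[OF assms] by simp_all
  show ?thesis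
    unfolding w(1) using UU_iso[OF assms] UU pt
    by (intro kc_iso[where f=UU and g="UU \<star> pt k"] w(2)) (simp_all only: d d_type append.simps
        simp_thms)
qed

text \<open>In the product of a scalar of relation 10 with the value of a bubble, this brings each b
  next to its inverse and each c_k next to another c.\<close>

lemma scalar4:
  assumes "scalar a" "scalar b" "scalar c" "scalar d"
  shows "(a \<star> b) \<star> (c \<star> d) = (b \<star> c) \<star> (a \<star> d)"
proof -
  have "(a \<star> b) \<star> (c \<star> d) = (b \<star> a) \<star> (c \<star> d)" using scalar_commute assms by metis
  also have "\<dots> = b \<star> (a \<star> c) \<star> d" using assms by (simp add: scalar_def dcmp_assoc)
  also have "a \<star> c = c \<star> a" using scalar_commute assms by metis
  finally show ?thesis using assms by (simp add: scalar_def dcmp_assoc)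
qed

text \<open>The isomorphism of \<open>bubble\<close> for a cup and a cap of either kind. The
  hypothesis \<open>tr\<close> says that on c_i the scalar \<open>b\<close> is inverse to the closed
  bubble containing c_j.\<close>

lemma k_bubble:
  assumes lt: "good [l] s" "D s = idd [l]" "good [l'] t" "D t = idd [l']"
    and b: "scalar b" and ct: "dwt cup" "dsrc cup = []" "dtgt cup = [l, l']" "dwt cap" "dsrc cap =
        [l, l']" "dtgt cap = []"
    "bare cup" "bare cap"
    and eq: "\<gamma> i \<diamondop> idd [l] \<diamondop> \<gamma> j \<diamondop> idd [l'] \<diamondop> \<gamma> i
      = (idd [l] \<diamondop> \<gamma> j \<diamondop> idd [l']) \<star> cup \<star> (\<gamma> i \<star> b) \<star> cap \<star> (idd [l] \<diamondop> \<gamma> j \<diamondop> idd [l'])"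
    and tr: "(\<gamma> i \<star> b) \<star> (cap \<star> (idd [l] \<diamondop> \<gamma> j \<diamondop> idd [l']) \<star> cup) = \<gamma> i"
  shows "kcc i \<odot>\<odot> kc [l] s \<odot>\<odot> kcc j \<odot>\<odot> kc [l'] t \<odot>\<odot> kcc i = kcc i"
proof -
  note w = kc_word[OF lt(1,3)]
  have d: "D ((((cc i \<otimes>\<^sub>t s) \<otimes>\<^sub>t cc j) \<otimes>\<^sub>t t) \<otimes>\<^sub>t cc i) = \<gamma> i \<diamondop> idd [l] \<diamondop> \<gamma> j \<diamondop> idd [l'] \<diamondop> \<gamma> i"
    using lt by (simp add: D_gen dtens_assoc)
  have az: "\<gamma> i \<star> \<gamma> i \<star> b = \<gamma> i \<star> b"
    using b by (simp add: scalar_def \<gamma>_mult flip: dcmp_assoc)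
  have sz: "scalar (\<gamma> i \<star> b)" using b by simp
  have \<gamma>\<gamma>: "\<gamma> i \<star> \<gamma> i = \<gamma> i" for i by (simp add: \<gamma>_mult)
  note bb = bubble[OF scalar_simps(1) scalar_simps(1) sz \<gamma>\<gamma> \<gamma>\<gamma> ct HOL.refl eq az tr]
  show ?thesis
    unfolding w(1) using ct b bb
    by (intro kc_iso[where f="(\<gamma> i \<star> b) \<star> cap" and g=cup] w(2) good_cc)
      (simp_all only: d D_gen d_type append.simps simp_thms gen_type scalar_def \<gamma>_mult)
qed

lemma k_bubble_minus:
  assumes "0 \<le> k"
  shows "kcc k \<odot>\<odot> ky \<odot>\<odot> kcc k \<odot>\<odot> kx \<odot>\<odot> kcc k = kcc k"
    "kcc (k - 1) \<odot>\<odot> ky \<odot>\<odot> kcc k \<odot>\<odot> kx \<odot>\<odot> kcc (k - 1) = kcc (k - 1)"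
proof -
  \<comment> \<open>Relation 4 evaluates the bubble: the summand with c_{k-1} is annihilated by c_k,
    and the other one has the coefficient b_{-2k}^dagger, inverse to b_{-2k}.\<close>
  have tr: "(\<gamma> k \<star> \<beta> (-2 * k)) \<star> (\<epsilon> \<star> (Idm \<diamondop> \<gamma> k \<diamondop> Idp) \<star> \<eta>) = \<gamma> k"
    unfolding W_relations_\<gamma>(1)[OF assms] by (simp add: dcmp_dadd scalar4[of "\<gamma> _" _ _ "\<gamma> _"]
        \<gamma>_mult \<beta>_inverse)
  show "kcc k \<odot>\<odot> ky \<odot>\<odot> kcc k \<odot>\<odot> kx \<odot>\<odot> kcc k = kcc k"
    by (rule k_bubble[OF _ _ _ _ _ _ _ _ _ _ _ _ _ W_relations_\<gamma>(5)[OF assms] tr]) (simp_all add: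
        D_gen)
  have tr: "(\<gamma> (k - 1) \<star> \<beta>d (-2 * k + 1)) \<star> (\<epsilon> \<star> (Idm \<diamondop> \<gamma> k \<diamondop> Idp) \<star> \<eta>) = \<gamma> (k - 1)"
    unfolding W_relations_\<gamma>(1)[OF assms] by (simp add: dcmp_dadd scalar4[of "\<gamma> _" _ _ "\<gamma> _"]
        \<gamma>_mult \<beta>_inverse)
  show "kcc (k - 1) \<odot>\<odot> ky \<odot>\<odot> kcc k \<odot>\<odot> kx \<odot>\<odot> kcc (k - 1) = kcc (k - 1)"
    by (rule k_bubble[OF _ _ _ _ _ _ _ _ _ _ _ _ _ W_relations_\<gamma>(6)[OF assms] tr]) (simp_all add:
        D_gen)
qed

text \<open>After the quarter turn the scalar \<open>z\<close> is trapped between the strands. It is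
  moved across the upward strand to the left region, where it becomes \<open>z'\<close>, and its
  inverse \<open>w\<close> takes it to the other side of the equation.\<close>

lemma bubble_shift:
  assumes s: "scalar a" "scalar m" "scalar z" "scalar z'" "scalar w"
    and slide: "z' \<diamondop> Idp = Idp \<diamondop> z" and inv: "w \<star> z' = idd []"
    and eq: "(Idp \<diamondop> a \<diamondop> Idm) \<star> \<eta>' \<star> m \<star> \<epsilon>' \<star> (Idp \<diamondop> a \<diamondop> Idm) = m \<diamondop> Idp \<diamondop> (a \<star> z) \<diamondop> Idm \<diamondop> m"
  shows "m \<diamondop> Idp \<diamondop> a \<diamondop> Idm \<diamondop> m = (Idp \<diamondop> a \<diamondop> Idm) \<star> \<eta>' \<star> (m \<star> w) \<star> \<epsilon>' \<star> (Idp \<diamondop> a \<diamondop> Idm)"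
proof -
  note t [simp] = s[unfolded scalar_def]
  let ?Y = "Idp \<diamondop> a \<diamondop> Idm \<diamondop> m"
  have "m \<diamondop> Idp \<diamondop> (a \<star> z) \<diamondop> Idm \<diamondop> m = m \<diamondop> (Idp \<diamondop> z) \<diamondop> a \<diamondop> Idm \<diamondop> m"
    using scalar_commute[OF s(1,3)] scalar_dtens[OF s(3,1)] by (simp add: dtens_assoc) (simp flip:
        dtens_assoc)
  also have "\<dots> = (m \<diamondop> z') \<diamondop> ?Y" by (simp add: dtens_assoc flip: slide)
  also have "m \<diamondop> z' = z' \<star> m" using scalar_dtens[OF s(2,4)] scalar_commute[OF s(2,4)] by simp
  also have "(z' \<star> m) \<diamondop> ?Y = (z' \<diamondop> idd [Plus, Minus]) \<star> (m \<diamondop> ?Y)"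
    using d_interchange[of z' m "idd [Plus, Minus]" ?Y] by simp
  finally have 1: "m \<diamondop> Idp \<diamondop> (a \<star> z) \<diamondop> Idm \<diamondop> m = (z' \<diamondop> idd [Plus, Minus]) \<star> (m \<diamondop> ?Y)" .
  have "m \<diamondop> ?Y = (w \<diamondop> idd [Plus, Minus]) \<star> (z' \<diamondop> idd [Plus, Minus]) \<star> (m \<diamondop> ?Y)"
    using d_interchange[of w z' "idd [Plus, Minus]" "idd [Plus, Minus]"] by (simp add: inv flip:
        dcmp_assoc)
  also have "\<dots> = (w \<diamondop> idd [Plus, Minus]) \<star> ((Idp \<diamondop> a \<diamondop> Idm) \<star> \<eta>' \<star> m \<star> \<epsilon>' \<star> (Idp \<diamondop> a \<diamondop> Idm))"
    unfolding eq 1 ..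
  also have "\<dots> = ((w \<diamondop> idd [Plus, Minus]) \<star> (Idp \<diamondop> a \<diamondop> Idm) \<star> \<eta>') \<star> m \<star> \<epsilon>' \<star> (Idp \<diamondop> a \<diamondop> Idm)"
    by (simp add: dcmp_assoc)
  also have "(w \<diamondop> idd [Plus, Minus]) \<star> (Idp \<diamondop> a \<diamondop> Idm) \<star> \<eta>' = ((Idp \<diamondop> a \<diamondop> Idm) \<star> \<eta>') \<star> w"
    using d_interchange[of w "idd []" "idd [Plus, Minus]" "(Idp \<diamondop> a \<diamondop> Idm) \<star> \<eta>'"]
      d_interchange[of "idd []" w "(Idp \<diamondop> a \<diamondop> Idm) \<star> \<eta>'" "idd []"] by simp
  also have "(((Idp \<diamondop> a \<diamondop> Idm) \<star> \<eta>') \<star> w) \<star> m \<star> \<epsilon>' \<star> (Idp \<diamondop> a \<diamondop> Idm)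
      = (Idp \<diamondop> a \<diamondop> Idm) \<star> \<eta>' \<star> (w \<star> m) \<star> \<epsilon>' \<star> (Idp \<diamondop> a \<diamondop> Idm)"
    by (simp add: dcmp_assoc)
  finally show ?thesis using scalar_commute[OF s(2,5)] by simp
qed

lemma k_bubble_plus:
  assumes "0 \<le> k"
  shows "kcc k \<odot>\<odot> kx \<odot>\<odot> kcc k \<odot>\<odot> ky \<odot>\<odot> kcc k = kcc k"
    "1 \<le> k \<Longrightarrow> kcc k \<odot>\<odot> kx \<odot>\<odot> kcc (k - 1) \<odot>\<odot> ky \<odot>\<odot> kcc k = kcc k"
proof -
  have rot: "(Idp \<diamondop> \<gamma> i \<diamondop> Idm) \<star> \<eta>' \<star> \<gamma> k \<star> \<epsilon>' \<star> (Idp \<diamondop> \<gamma> i \<diamondop> Idm) = \<gamma> k \<diamondop> Idp \<diamondop> (\<gamma> i \<star> b) \<diamondop> Idm \<diamondop>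
      \<gamma> k"
    if "\<gamma> i \<diamondop> Idm \<diamondop> \<gamma> k \<diamondop> Idp \<diamondop> \<gamma> i = (Idm \<diamondop> \<gamma> k \<diamondop> Idp) \<star> \<eta> \<star> (\<gamma> i \<star> b) \<star> \<epsilon> \<star> (Idm \<diamondop> \<gamma> k \<diamondop> Idp)"
        "scalar b" for i b
    by (rule rotate_bubble[OF _ _ _ _ _ _ _ _ _ that(1)]) (use that(2) in \<open>simp_all add:
        scalar_def\<close>)
  \<comment> \<open>The scalar b_{-2k} of relation 10 leaves the strands as b_{-2k-1}, which is the
    coefficient of c_k in relation 5, so its inverse appears here.\<close>
  have eq: "\<gamma> k \<diamondop> Idp \<diamondop> \<gamma> k \<diamondop> Idm \<diamondop> \<gamma> k
      = (Idp \<diamondop> \<gamma> k \<diamondop> Idm) \<star> \<eta>' \<star> (\<gamma> k \<star> \<beta>d (-2 * k - 1)) \<star> \<epsilon>' \<star> (Idp \<diamondop> \<gamma> k \<diamondop> Idm)"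
    using W_relations(7)[of "-2 * k - 1"]
    by (intro bubble_shift[OF _ _ _ _ _ _ _ rot[OF W_relations_\<gamma>(5)[OF assms]], where z'="\<beta> (-2 *
        k - 1)"]) (simp_all add: \<beta>_inverse)
  have tr: "(\<gamma> k \<star> \<beta>d (-2 * k - 1)) \<star> (\<epsilon>' \<star> (Idp \<diamondop> \<gamma> k \<diamondop> Idm) \<star> \<eta>') = \<gamma> k"
    unfolding W_relations_\<gamma>(2)[OF assms] by (simp add: dcmp_dadd scalar4[of "\<gamma> _" _ _ "\<gamma> _"]
        \<gamma>_mult \<beta>_inverse)
  show "kcc k \<odot>\<odot> kx \<odot>\<odot> kcc k \<odot>\<odot> ky \<odot>\<odot> kcc k = kcc k"
    by (rule k_bubble[OF _ _ _ _ _ _ _ _ _ _ _ _ _ eq tr]) (simp_all add: D_gen)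
  assume k1: "1 \<le> k"
  \<comment> \<open>Here b_{-2k+1}^dagger leaves the strands as b_{-2k}^dagger. This is the
    coefficient of c_k in relation 5 for k - 1, an instance that requires k >= 1.\<close>
  have eq: "\<gamma> k \<diamondop> Idp \<diamondop> \<gamma> (k - 1) \<diamondop> Idm \<diamondop> \<gamma> k
      = (Idp \<diamondop> \<gamma> (k - 1) \<diamondop> Idm) \<star> \<eta>' \<star> (\<gamma> k \<star> \<beta> (-2 * k)) \<star> \<epsilon>' \<star> (Idp \<diamondop> \<gamma> (k - 1) \<diamondop> Idm)"
    using \<beta>d_slide[of "-2 * k"]
    by (intro bubble_shift[OF _ _ _ _ _ _ _ rot[OF W_relations_\<gamma>(6)[OF assms]], where z'="\<beta>d (-2 *
        k)"]) (simp_all add: \<beta>_inverse)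
  have tr: "(\<gamma> k \<star> \<beta> (-2 * k)) \<star> (\<epsilon>' \<star> (Idp \<diamondop> \<gamma> (k - 1) \<diamondop> Idm) \<star> \<eta>') = \<gamma> k"
    using W_relations_\<gamma>(2)[of "k - 1"] k1 by (simp add: dcmp_dadd scalar4[of "\<gamma> _" _ _ "\<gamma> _"]
        \<gamma>_mult \<beta>_inverse)
  show "kcc k \<odot>\<odot> kx \<odot>\<odot> kcc (k - 1) \<odot>\<odot> ky \<odot>\<odot> kcc k = kcc k"
    by (rule k_bubble[OF _ _ _ _ _ _ _ _ _ _ _ _ _ eq tr]) (simp_all add: D_gen)
qed

lemma k_yx: "ky \<odot>\<odot> kx = kx \<odot>\<odot> ky \<oplus>\<^bsub>K0 W_inf\<^esub> ky \<odot>\<odot> kcc 0 \<odot>\<odot> kx"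
proof -
  note g1 = good_tens[OF good_gen(2) good_gen(1), simplified] and g2 = good_tens[OF good_gen(1)
      good_gen(2), simplified]
  note g3 = good_tens[OF good_gen(2) good_cc[of 0]]
  note g4 = good_tens[OF g3 good_gen(1), simplified]
  define e0 where "e0 = Idm \<diamondop> \<gamma> 0 \<diamondop> Idp"
  have e0 [simp]: "dwt e0" "dsrc e0 = [Minus, Plus]" "dtgt e0 = [Minus, Plus]" by (simp_all add:
      e0_def)
  have F [simp]: "dwt FF" "dsrc FF = [Minus, Plus]" "dtgt FF = [Plus, Minus]" "dwt GG" "dsrc GG =
      [Plus, Minus]" "dtgt GG = [Minus, Plus]"
    by (simp_all add: FF_def GG_def)
  have GF: "GG \<star> FF = idd [Minus, Plus] -\<^sub>d e0"
    using GG_FF by (simp add: dtens_dadd dtens_dscl e0_def)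
  have e00: "e0 \<star> e0 = e0"
  proof -
    have "(Idm \<diamondop> \<gamma> 0) \<star> (Idm \<diamondop> \<gamma> 0) = Idm \<diamondop> \<gamma> 0"
      using d_interchange[of Idm Idm "\<gamma> 0" "\<gamma> 0"] by (simp add: \<gamma>_mult)
    then show ?thesis using d_interchange[of "Idm \<diamondop> \<gamma> 0" "Idm \<diamondop> \<gamma> 0" Idp Idp] by (simp add: e0_def
        dtens_assoc)
  qed
  have canc: "f = Nul u v" if "g = g -\<^sub>d f" "dwt f" "dsrc f = u" "dtgt f = v" "dwt g" "dsrc g = u"
      "dtgt g = v" for f g u v
  proof -
    have "Nul u v = (-1) *\<^sub>d g +\<^sub>d 1 *\<^sub>d g" using that by (simp flip: dscl_add del: dscl_1)
    also have "\<dots> = (-1) *\<^sub>d g +\<^sub>d (g -\<^sub>d f)" using that by simp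
    also have "\<dots> = ((-1) *\<^sub>d g +\<^sub>d 1 *\<^sub>d g) -\<^sub>d f" using that by (simp add: dadd_assoc)
    also have "(-1) *\<^sub>d g +\<^sub>d 1 *\<^sub>d g = Nul u v" using that by (simp flip: dscl_add del: dscl_1)
    finally have "(-1) *\<^sub>d f = Nul u v" using that by simp
    then have "(-1) *\<^sub>d (-1) *\<^sub>d f = Nul u v" by simp
    then show ?thesis using that by (simp add: dscl_dscl)
  qed
  \<comment> \<open>Orthogonality is formal: FF = FF GG FF = FF (1 - e0) forces FF e0 = 0, and
    \<open>eG\<close> follows in the same way from the other side.\<close>
  have Fe: "FF \<star> e0 = Nul [Minus, Plus] [Plus, Minus]"
  proof (rule canc)
    have "FF = (FF \<star> GG) \<star> FF" by (simp add: FF_GG)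
    also have "\<dots> = FF \<star> (GG \<star> FF)" by (simp add: dcmp_assoc)
    finally show "FF = FF -\<^sub>d FF \<star> e0" by (simp add: GF dcmp_dadd dcmp_dscl)
  qed simp_all
  have eG: "e0 \<star> GG = Nul [Plus, Minus] [Minus, Plus]"
  proof (rule canc)
    have "GG = GG \<star> (FF \<star> GG)" by (simp add: FF_GG)
    also have "\<dots> = (GG \<star> FF) \<star> GG" by (simp add: dcmp_assoc)
    finally show "GG = GG -\<^sub>d e0 \<star> GG" by (simp add: GF dcmp_dadd dcmp_dscl)
  qed simp_all
  have sum: "GG \<star> FF +\<^sub>d e0 = idd [Minus, Plus]"
  proof -
    have "GG \<star> FF +\<^sub>d e0 = idd [Minus, Plus] +\<^sub>d ((-1) *\<^sub>d e0 +\<^sub>d 1 *\<^sub>d e0)" by (simp add: GF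
        dadd_assoc)
    then show ?thesis by (simp flip: dscl_add del: dscl_1)
  qed
  have d: "D (im \<otimes>\<^sub>t ip) = idd [Minus, Plus]" "D (ip \<otimes>\<^sub>t im) = idd [Plus, Minus]" "D ((im \<otimes>\<^sub>t cc
      0) \<otimes>\<^sub>t ip) = e0"
    by (simp_all add: D_gen e0_def dtens_assoc)
  have rep: "D (rep_darr h) = h" for h by (rule Quotient_abs_rep[OF Quotient_darr])
  have ty: "wt (rep_darr h) = dwt h" "tsrc (rep_darr h) = dsrc h" "ttgt (rep_darr h) = dtgt h" for h
    using D_type[of "rep_darr h"] by (simp_all add: rep)
  have "is_dsum W_inf (KO [Minus, Plus] (im \<otimes>\<^sub>t ip)) (KO [Plus, Minus] (ip \<otimes>\<^sub>t im)) (KO [Minus,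
      Plus] ((im \<otimes>\<^sub>t cc 0) \<otimes>\<^sub>t ip))"
    by (rule is_dsum_W_inf[where i="rep_darr GG" and p="rep_darr FF" and j="rep_darr e0" and
        r="rep_darr e0"])
      (simp_all only: g1 g2 g4 ty d rep, simp_all add: FF_GG e00 Fe eG sum)
  then have "kc [Minus, Plus] (im \<otimes>\<^sub>t ip) = kc [Plus, Minus] (ip \<otimes>\<^sub>t im) \<oplus>\<^bsub>K0 W_inf\<^esub> kc [Minus,
      Plus] ((im \<otimes>\<^sub>t cc 0) \<otimes>\<^sub>t ip)"
    unfolding kc_def by (rule WI.K0_class_dsum)
  then show ?thesis
    using kc_mult[OF good_gen(2,1)] kc_mult[OF good_gen(1,2)] kc_mult[OF good_gen(2) good_cc]
        kc_mult[OF g3 good_gen(1)]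
    by simp
qed

subsection \<open>Consequences of the strand and bubble relations\<close>

text \<open>The relations obtained from diagrams, in an arbitrary ring; the remaining relations
  follow from them by algebra. The term y c_0 x is kept in \<open>yx\<close> because its equality
  with c_0 is itself one of these consequences.\<close>

locale strand_ring = ring R for R :: "('a, 'b) ring_scheme" (structure) +
  fixes x y :: 'a and c :: "int \<Rightarrow> 'a"
  assumes closed [simp]: "x \<in> carrier R" "y \<in> carrier R" "c k \<in> carrier R"
    and c_mult: "c k \<otimes> c j = (if k = j then c k else \<zero>)"
    and c_neg: "k < 0 \<Longrightarrow> c k = \<zero>"
    and cx: "0 \<le> k \<Longrightarrow> c k \<otimes> x = c k \<otimes> x \<otimes> c k \<oplus> c k \<otimes> x \<otimes> c (k - 1)"
    and xc: "0 \<le> k \<Longrightarrow> x \<otimes> c k = c k \<otimes> x \<otimes> c k \<oplus> c (k + 1) \<otimes> x \<otimes> c k"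
    and cy: "0 \<le> k \<Longrightarrow> c k \<otimes> y = c k \<otimes> y \<otimes> c k \<oplus> c k \<otimes> y \<otimes> c (k + 1)"
    and yc: "0 \<le> k \<Longrightarrow> y \<otimes> c k = c k \<otimes> y \<otimes> c k \<oplus> c (k - 1) \<otimes> y \<otimes> c k"
    and cxcxc: "0 \<le> k \<Longrightarrow> c (k + 1) \<otimes> x \<otimes> c k \<otimes> x \<otimes> c k = c (k + 1) \<otimes> x \<otimes> c (k + 1) \<otimes> x \<otimes> c k"
    and cycxc: "0 \<le> k \<Longrightarrow> c k \<otimes> y \<otimes> c k \<otimes> x \<otimes> c k = c k"
      "0 \<le> k \<Longrightarrow> c (k - 1) \<otimes> y \<otimes> c k \<otimes> x \<otimes> c (k - 1) = c (k - 1)"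
    and cxcyc: "0 \<le> k \<Longrightarrow> c k \<otimes> x \<otimes> c k \<otimes> y \<otimes> c k = c k"
      "1 \<le> k \<Longrightarrow> c k \<otimes> x \<otimes> c (k - 1) \<otimes> y \<otimes> c k = c k"
    and yx: "y \<otimes> x = x \<otimes> y \<oplus> y \<otimes> c 0 \<otimes> x"
begin

lemma c_chain: "z \<in> carrier R \<Longrightarrow> c k \<otimes> (c j \<otimes> z) = (if k = j then c k \<otimes> z else \<zero>)"
  using c_mult[of k j] by (simp flip: m_assoc)

text \<open>\<open>cx\<close> resolves c_k x into terms ending in c_k and c_{k-1}, and these
  annihilate every other c_j.\<close>

lemma cx_zero:
  assumes "j \<noteq> k" "j \<noteq> k - 1" "z \<in> carrier R"
  shows "c k \<otimes> (x \<otimes> (c j \<otimes> z)) = \<zero>"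
proof (cases "k < 0")
  case False
  have "c k \<otimes> (x \<otimes> (c j \<otimes> z)) = (c k \<otimes> x) \<otimes> (c j \<otimes> z)" using assms by (simp add: m_assoc)
  also have "\<dots> = (c k \<otimes> x \<otimes> c k \<oplus> c k \<otimes> x \<otimes> c (k - 1)) \<otimes> (c j \<otimes> z)" using cx[of k] False by simp
  also have "\<dots> = \<zero>" using assms by (simp add: l_distr m_assoc c_chain)
  finally show ?thesis .
qed (use assms in \<open>simp add: c_neg\<close>)

lemma cy_zero:
  assumes "j \<noteq> k" "j \<noteq> k - 1" "z \<in> carrier R"
  shows "c j \<otimes> (y \<otimes> (c k \<otimes> z)) = \<zero>"
proof (cases "k < 0")
  case False
  have "c j \<otimes> (y \<otimes> (c k \<otimes> z)) = c j \<otimes> (y \<otimes> c k) \<otimes> z" using assms by (simp add: m_assoc)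
  also have "\<dots> = c j \<otimes> (c k \<otimes> y \<otimes> c k \<oplus> c (k - 1) \<otimes> y \<otimes> c k) \<otimes> z" using yc[of k] False by simp
  also have "\<dots> = \<zero>" using assms by (simp add: r_distr l_distr m_assoc c_chain)
  finally show ?thesis .
qed (use assms in \<open>simp add: c_neg\<close>)

text \<open>Products are normalised to nest to the right, so the relations are needed with an
  arbitrary right factor \<open>z\<close>.\<close>

lemma chain:
  assumes "z \<in> carrier R"
  shows "0 \<le> k \<Longrightarrow> c k \<otimes> (y \<otimes> (c k \<otimes> (x \<otimes> (c k \<otimes> z)))) = c k \<otimes> z"
    "0 \<le> k \<Longrightarrow> c (k - 1) \<otimes> (y \<otimes> (c k \<otimes> (x \<otimes> (c (k - 1) \<otimes> z)))) = c (k - 1) \<otimes> z"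
    "0 \<le> k \<Longrightarrow> c k \<otimes> (x \<otimes> (c k \<otimes> (y \<otimes> (c k \<otimes> z)))) = c k \<otimes> z"
    "1 \<le> k \<Longrightarrow> c k \<otimes> (x \<otimes> (c (k - 1) \<otimes> (y \<otimes> (c k \<otimes> z)))) = c k \<otimes> z"
    "0 \<le> k \<Longrightarrow> c (k + 1) \<otimes> (x \<otimes> (c k \<otimes> (x \<otimes> (c k \<otimes> z)))) = c (k + 1) \<otimes> (x \<otimes> (c (k + 1) \<otimes> (x \<otimes> (c k \<otimes>
        z))))"
  using assms cycxc[of k] cxcyc[of k] cxcxc[of k] by (simp_all flip: m_assoc)

text \<open>The idempotent between x and y is forced: of the two indices that one outer factor
  admits there, the other outer factor annihilates one.\<close>

lemma cxyc:
  assumes "0 \<le> k"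
  shows "c k \<otimes> x \<otimes> y \<otimes> c (k + 1) = c k \<otimes> x \<otimes> c k \<otimes> y \<otimes> c (k + 1)"
    "c (k + 1) \<otimes> x \<otimes> y \<otimes> c k = c (k + 1) \<otimes> x \<otimes> c k \<otimes> y \<otimes> c k"
proof -
  have "c k \<otimes> x \<otimes> y \<otimes> c (k + 1) = (c k \<otimes> x) \<otimes> (y \<otimes> c (k + 1))" by (simp add: m_assoc)
  also have "\<dots> = (c k \<otimes> x \<otimes> c k \<oplus> c k \<otimes> x \<otimes> c (k - 1)) \<otimes> (y \<otimes> c (k + 1))" using cx[OF assms] by simp
  also have "\<dots> = c k \<otimes> x \<otimes> c k \<otimes> y \<otimes> c (k + 1)"
    using cy_zero[of "k - 1" "k + 1" "\<one>"] by (simp add: l_distr m_assoc)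
  finally show "c k \<otimes> x \<otimes> y \<otimes> c (k + 1) = c k \<otimes> x \<otimes> c k \<otimes> y \<otimes> c (k + 1)" .
  have "c (k + 1) \<otimes> x \<otimes> y \<otimes> c k = (c (k + 1) \<otimes> x) \<otimes> (y \<otimes> c k)" by (simp add: m_assoc)
  also have "\<dots> = (c (k + 1) \<otimes> x) \<otimes> (c k \<otimes> y \<otimes> c k \<oplus> c (k - 1) \<otimes> y \<otimes> c k)" using yc[OF assms] by simp
  also have "\<dots> = c (k + 1) \<otimes> x \<otimes> c k \<otimes> y \<otimes> c k"
    using cx_zero[of "k - 1" "k + 1"] by (simp add: r_distr m_assoc)
  finally show "c (k + 1) \<otimes> x \<otimes> y \<otimes> c k = c (k + 1) \<otimes> x \<otimes> c k \<otimes> y \<otimes> c k" .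
qed

text \<open>Both sides are inverse to \<open>c\<^bsub>k+1\<^esub> x c\<^sub>k x c\<^sub>k = c\<^bsub>k+1\<^esub> x c\<^bsub>k+1\<^esub> x c\<^sub>k\<close>.\<close>

lemma cycyc:
  assumes "0 \<le> k"
  shows "c k \<otimes> y \<otimes> c (k + 1) \<otimes> y \<otimes> c (k + 1) = c k \<otimes> y \<otimes> c k \<otimes> y \<otimes> c (k + 1)" (is "?L = ?L'")
proof -
  let ?A = "c (k + 1) \<otimes> x \<otimes> c (k + 1) \<otimes> x \<otimes> c k"
  have k1: "0 \<le> k + 1" "1 \<le> k + 1" using assms by simp_all
  have "?L \<otimes> ?A = c k"
    using chain(1)[OF _ k1(1)] chain(2)[OF _ k1(1), of "\<one>"] by (simp add: m_assoc c_chain)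
  moreover have "?A \<otimes> ?L' = c (k + 1)"
  proof -
    have "?A \<otimes> ?L' = (c (k + 1) \<otimes> x \<otimes> c k \<otimes> x \<otimes> c k) \<otimes> ?L'" using cxcxc[OF assms] by simp
    also have "\<dots> = c (k + 1)"
      using chain(3)[OF _ assms] chain(4)[OF _ k1(2), of "\<one>"] by (simp add: m_assoc c_chain)
    finally show ?thesis .
  qed
  moreover have "?L = ?L \<otimes> c (k + 1)" "?L' = c k \<otimes> ?L'" by (simp_all add: m_assoc c_chain c_mult)
  moreover have "?L \<otimes> (?A \<otimes> ?L') = (?L \<otimes> ?A) \<otimes> ?L'" by (simp add: m_assoc)
  ultimately show ?thesis by metis
qed

text \<open>Resolving both sides of y c_k x gives four terms. Two of them are bubbles and reduce to
  c_k and c_{k-1}; in the other two the order of y and x has to be reversed. For k = 0 these two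
  vanish together with c_{-1}.\<close>

lemma ycx:
  assumes "0 \<le> k"
  shows "y \<otimes> c k \<otimes> x = c k \<oplus> c (k - 1) \<oplus> c k \<otimes> x \<otimes> y \<otimes> c (k - 1) \<oplus> c (k - 1) \<otimes> x \<otimes> y \<otimes> c k"
proof -
  have "y \<otimes> c k \<otimes> x = y \<otimes> c k \<otimes> (c k \<otimes> x)" by (simp add: m_assoc c_chain)
  also have "\<dots> = (c k \<otimes> y \<otimes> c k \<oplus> c (k - 1) \<otimes> y \<otimes> c k) \<otimes> (c k \<otimes> x \<otimes> c k \<oplus> c k \<otimes> x \<otimes> c (k - 1))"
    using yc[OF assms] cx[OF assms] by simp
  also have "\<dots> = c k \<otimes> y \<otimes> c k \<otimes> x \<otimes> c k \<oplus> c (k - 1) \<otimes> y \<otimes> c k \<otimes> x \<otimes> c (k - 1)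
      \<oplus> c k \<otimes> y \<otimes> c k \<otimes> x \<otimes> c (k - 1) \<oplus> c (k - 1) \<otimes> y \<otimes> c k \<otimes> x \<otimes> c k"
    by (simp add: l_distr r_distr m_assoc c_chain a_ac)
  also have "c k \<otimes> y \<otimes> c k \<otimes> x \<otimes> c (k - 1) = c k \<otimes> x \<otimes> y \<otimes> c (k - 1)"
  proof (cases "k = 0")
    case False
    then have k1: "0 \<le> k - 1" using assms by simp
    \<comment> \<open>A bubble is created to the right of c_{k-1}, \<open>cxcxc\<close> changes the
      middle index between the two letters x from k - 1 to k, and the bubble thus completed on the
      left is cancelled.\<close>
    have "c k \<otimes> y \<otimes> c k \<otimes> x \<otimes> c (k - 1) = c k \<otimes> y \<otimes> c k \<otimes> x \<otimes> (c (k - 1) \<otimes> x \<otimes> c (k - 1) \<otimes> y \<otimes> c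
        (k - 1))"
      using cxcyc(1)[OF k1] by simp
    also have "\<dots> = c k \<otimes> y \<otimes> (c k \<otimes> x \<otimes> c (k - 1) \<otimes> x \<otimes> c (k - 1)) \<otimes> y \<otimes> c (k - 1)" by (simp add:
        m_assoc)
    also have "\<dots> = c k \<otimes> y \<otimes> (c k \<otimes> x \<otimes> c k \<otimes> x \<otimes> c (k - 1)) \<otimes> y \<otimes> c (k - 1)" using cxcxc[OF k1]
        by simp
    also have "\<dots> = (c k \<otimes> y \<otimes> c k \<otimes> x \<otimes> c k) \<otimes> x \<otimes> c (k - 1) \<otimes> y \<otimes> c (k - 1)" by (simp add: m_assoc)
    also have "\<dots> = c k \<otimes> x \<otimes> y \<otimes> c (k - 1)" using cycxc(1)[OF assms] cxyc(2)[OF k1] by simp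
    finally show ?thesis .
  qed (simp add: c_neg)
  also have "c (k - 1) \<otimes> y \<otimes> c k \<otimes> x \<otimes> c k = c (k - 1) \<otimes> x \<otimes> y \<otimes> c k"
  proof (cases "k = 0")
    case False
    then have k1: "0 \<le> k - 1" "1 \<le> k" using assms by simp_all
    \<comment> \<open>The bubble is now created from c_k, and the index between the two letters x
      changes from k to k - 1.\<close>
    have "c (k - 1) \<otimes> y \<otimes> c k \<otimes> x \<otimes> c k = c (k - 1) \<otimes> y \<otimes> c k \<otimes> x \<otimes> (c k \<otimes> x \<otimes> c (k - 1) \<otimes> y \<otimes> c k)"
      using cxcyc(2)[OF k1(2)] by simp
    also have "\<dots> = c (k - 1) \<otimes> y \<otimes> (c k \<otimes> x \<otimes> c k \<otimes> x \<otimes> c (k - 1)) \<otimes> y \<otimes> c k" by (simp add: m_assoc)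
    also have "\<dots> = c (k - 1) \<otimes> y \<otimes> (c k \<otimes> x \<otimes> c (k - 1) \<otimes> x \<otimes> c (k - 1)) \<otimes> y \<otimes> c k" using cxcxc[OF
        k1(1)] by simp
    also have "\<dots> = (c (k - 1) \<otimes> y \<otimes> c k \<otimes> x \<otimes> c (k - 1)) \<otimes> x \<otimes> c (k - 1) \<otimes> y \<otimes> c k" by (simp add:
        m_assoc)
    also have "\<dots> = c (k - 1) \<otimes> x \<otimes> y \<otimes> c k" using cycxc(2)[OF assms] cxyc(1)[OF k1(1)] by simp
    finally show ?thesis .
  qed (simp add: c_neg)
  finally show ?thesis using cycxc[OF assms] by simp
qed

lemma xcy:
  assumes "0 \<le> k"
  shows "x \<otimes> c k \<otimes> y = c k \<oplus> c (k + 1) \<oplus> c k \<otimes> x \<otimes> y \<otimes> c (k + 1) \<oplus> c (k + 1) \<otimes> x \<otimes> y \<otimes> c k"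
proof -
  have k1: "1 \<le> k + 1" using assms by simp
  have "x \<otimes> c k \<otimes> y = x \<otimes> c k \<otimes> (c k \<otimes> y)" by (simp add: m_assoc c_chain)
  also have "\<dots> = (c k \<otimes> x \<otimes> c k \<oplus> c (k + 1) \<otimes> x \<otimes> c k) \<otimes> (c k \<otimes> y \<otimes> c k \<oplus> c k \<otimes> y \<otimes> c (k + 1))"
    using xc[OF assms] cy[OF assms] by simp
  also have "\<dots> = c k \<otimes> x \<otimes> c k \<otimes> y \<otimes> c k \<oplus> c (k + 1) \<otimes> x \<otimes> c k \<otimes> y \<otimes> c (k + 1)
      \<oplus> c k \<otimes> x \<otimes> c k \<otimes> y \<otimes> c (k + 1) \<oplus> c (k + 1) \<otimes> x \<otimes> c k \<otimes> y \<otimes> c k"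
    by (simp add: l_distr r_distr m_assoc c_chain a_ac)
  finally show ?thesis using cxcyc(1)[OF assms] cxcyc(2)[OF k1] cxyc[OF assms] by simp
qed

lemma ycx0: "y \<otimes> c 0 \<otimes> x = c 0"
  using ycx[of 0] by (simp add: c_neg)

end

interpretation S: strand_ring "K0 W_inf" kx ky kcc
proof
  show "kcc k \<odot>\<odot> kcc j = (if k = j then kcc k else \<zero>\<^bsub>K0 W_inf\<^esub>)" for k j by (rule kcc_mult)
qed (assumption | rule kc_closed good_gen good_cc kcc_neg k_strand k_xx k_bubble_minus
    k_bubble_plus k_yx | linarith)+

subsection \<open>The homomorphism\<close>

lemma kar_ob_word: "ob_Qplus = KO [Plus] ip" "ob_Qminus = KO [Minus] im" "ob_C k = KO [] (cc (int
    k))"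
  by (simp_all add: ob_Qplus_def ob_Qminus_def kar_ob_KO ob_C_def cc_def) (simp add: KO_def)

fun k_image :: "kgen \<Rightarrow> ((wob \<Rightarrow>\<^sub>0 int) set \<Rightarrow>\<^sub>0 cq) set" where
  "k_image GX = cls ob_Qplus"
| "k_image GY = cls ob_Qminus"
| "k_image (GC k) = cls (ob_C k)"

lemma cls_eq: "cls ob_Qplus = ext_incl (K0 W_inf) kx" "cls ob_Qminus = ext_incl (K0 W_inf) ky"
    "cls (ob_C k) = ext_incl (K0 W_inf) (kcc (int k))"
  by (simp_all add: cls_def kar_ob_word kc_def)

lemma alg_K0_W_inf: "alg K0_W_inf"
  unfolding K0_W_inf_def by (rule alg_ext_scalars[OF WI.ring_K0])

lemma k_image_closed: "k_image g \<in> carrier K0_W_inf"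
  using ring_hom_closed[OF ext_incl_hom[OF WI.ring_K0]]
  by (cases g) (simp_all add: cls_eq K0_W_inf_def)

lemma k_rel_image:
  assumes "k_rel a b"
  shows "free_ext K0_W_inf k_image a = free_ext K0_W_inf k_image b"
proof -
  let ?h = "free_ext K0_W_inf k_image" and ?i = "ext_incl (K0 W_inf)"
  interpret B: alg K0_W_inf by (rule alg_K0_W_inf)
  note i = ext_incl_hom[OF WI.ring_K0, folded K0_W_inf_def]
  note BA = alg_K0_W_inf k_image_closed
  have gen: "?h fx = ?i kx" "?h fy = ?i ky"
    by (simp_all add: fx_def fy_def free_ext_single[OF BA] word_prod_def B.one_smult B.r_one
        k_image_closed
        cls_eq[symmetric] del: k_image.simps) (simp_all)
  have i0: "?i \<zero>\<^bsub>K0 W_inf\<^esub> = \<zero>\<^bsub>K0_W_inf\<^esub>"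
    using ring_hom_zero[OF i WI.ring_K0 B.ring_axioms] .
  have genc: "?h (fc k) = ?i (kcc k)" for k
    using k_image_closed[of "GC (nat k)"]
    by (auto simp: fc_def free_ext_single[OF BA] word_prod_def B.one_smult B.r_one
        free_ext_zero[OF BA]
        cls_eq kcc_neg i0)
  have ops: "?h (p \<cdot> q) = ?h p \<otimes>\<^bsub>K0_W_inf\<^esub> ?h q" "?h (p + q) = ?h p \<oplus>\<^bsub>K0_W_inf\<^esub> ?h q" "?h 0 =
      \<zero>\<^bsub>K0_W_inf\<^esub>" for p q
    by (simp_all add: free_ext_mult[OF BA] free_ext_add[OF BA] free_ext_zero[OF BA])
  have iops: "a \<in> carrier (K0 W_inf) \<Longrightarrow> b \<in> carrier (K0 W_inf) \<Longrightarrow> ?i a \<otimes>\<^bsub>K0_W_inf\<^esub> ?i b = ?i (a \<odot>\<odot> b)"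
    "a \<in> carrier (K0 W_inf) \<Longrightarrow> b \<in> carrier (K0 W_inf) \<Longrightarrow> ?i a \<oplus>\<^bsub>K0_W_inf\<^esub> ?i b = ?i (a \<oplus>\<^bsub>K0 W_inf\<^esub>
        b)" for a b
    using ring_hom_mult[OF i] ring_hom_add[OF i] by simp_all
  \<comment> \<open>All generators are images under the inclusion of the integral ring, and
    \<open>iops\<close> collects sums and products inside it, so each case becomes an identity in
    \<open>K0 W_inf\<close>.\<close>
  note ev = ops gen genc iops i0[symmetric] S.closed K.m_closed K.a_closed K.zero_closed
  show ?thesis using assms
  proof cases
    case 1
    then show ?thesis by (simp add: ev S.yx[unfolded S.ycx0])
  next
    case (2 k l)
    then show ?thesis by (auto simp: ev S.c_mult)
  next
    case (3 k)
    then show ?thesis using S.cx[of k] by (simp add: ev K.r_distr)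
  next
    case (4 k)
    then show ?thesis using S.xc[of k] by (simp add: ev K.l_distr)
  next
    case (5 k)
    then show ?thesis using S.cy[of k] by (simp add: ev K.r_distr)
  next
    case (6 k)
    then show ?thesis using S.yc[of k] by (simp add: ev K.l_distr)
  next
    case (7 k)
    then show ?thesis using S.cxcxc[of k] by (simp add: ev)
  next
    case (8 k)
    then show ?thesis using S.cycyc[of k] by (simp add: ev)
  next
    case (9 k)
    then show ?thesis using S.cycxc(1)[of k] by (simp add: ev)
  next
    case (10 k)
    then show ?thesis using S.cycxc(2)[of k] by (simp add: ev)
  next
    case (11 k)
    then show ?thesis using S.cxcyc(1)[of k] by (simp add: ev)
  next
    case (12 k)
    then show ?thesis using S.cxcyc(2)[of k] by (simp add: ev)
  next
    case (13 k)
    then show ?thesis using S.ycx[of k] by (simp add: ev)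
  next
    case (14 k)
    then show ?thesis using S.xcy[of k] by (simp add: ev)
  next
    case 15
    then show ?thesis using S.ycx0 by (simp add: ev)
  qed
qed

theorem proposition8p4:
  shows "\<exists>!\<phi>. \<phi> \<in> alg_hom K_alg K0_W_inf' \<and> \<phi> \<in> extensional (carrier K_alg) \<and>
    \<phi> K_x = cls ob_Qplus \<and> \<phi> K_y = cls ob_Qminus \<and> (\<forall>k. \<phi> (K_c k) = cls (ob_C k))"
proof -
  interpret B: alg K0_W_inf by (rule alg_K0_W_inf)
  note BA = alg_K0_W_inf k_image_closed
  have rel: "free_ext K0_W_inf k_image p = \<zero>\<^bsub>K0_W_inf\<^esub>" if "p \<in> {a - b | a b. k_rel a b}" for p
  proof -
    from that obtain a b where p: "p = a - b" "k_rel a b" by blast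
    have "free_ext K0_W_inf k_image b = free_ext K0_W_inf k_image p \<oplus>\<^bsub>K0_W_inf\<^esub> free_ext K0_W_inf
        k_image b"
      using free_ext_add[where g=k_image, OF BA, of p b] k_rel_image[OF p(2)] p(1) by simp
    then show ?thesis
      using free_ext_closed[where g=k_image, OF BA, of p] free_ext_closed[where g=k_image, OF BA,
          of b] by (simp add: B.add.r_cancel_one')
  qed
  have gens: "{cls ob_Qplus, cls ob_Qminus} \<union> range (\<lambda>k. cls (ob_C k)) = range k_image"
  proof (intro equalityI subsetI)
    fix z assume "z \<in> {cls ob_Qplus, cls ob_Qminus} \<union> range (\<lambda>k. cls (ob_C k))"
    then consider "z = k_image GX" | "z = k_image GY" | k where "z = k_image (GC k)" by auto
    then show "z \<in> range k_image" by cases blast+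
  next
    fix z assume "z \<in> range k_image"
    then obtain g where "z = k_image g" by blast
    then show "z \<in> {cls ob_Qplus, cls ob_Qminus} \<union> range (\<lambda>k. cls (ob_C k))" by (cases g) auto
  qed
  have all: "(\<forall>g. \<phi> (k_ideal +>\<^bsub>free_alg\<^esub> Poly_Mapping.single [g] 1) = k_image g) \<longleftrightarrow>
      \<phi> K_x = cls ob_Qplus \<and> \<phi> K_y = cls ob_Qminus \<and> (\<forall>k. \<phi> (K_c k) = cls (ob_C k))" for \<phi>
  proof -
    have "(\<forall>g. P g) \<longleftrightarrow> P GX \<and> P GY \<and> (\<forall>k. P (GC k))" for P
      by (metis kgen.exhaust)
    then show ?thesis by (simp add: K_x_def K_y_def K_c_def fx_def fy_def fc_def)
  qed
  have "\<exists>!\<phi>. \<phi> \<in> alg_hom (alg_quot free_alg k_ideal) (subalg_generated K0_W_inf (range k_image)) \<and>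
      \<phi> \<in> extensional (carrier (alg_quot free_alg k_ideal)) \<and>
      (\<forall>g. \<phi> (k_ideal +>\<^bsub>free_alg\<^esub> Poly_Mapping.single [g] 1) = k_image g)"
    unfolding k_ideal_def by (rule presented_alg_hom[OF BA rel])
  then show ?thesis
    unfolding K_alg_def K0_W_inf'_def gens all .
qed

end
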